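(* Let $k$ be a field of characteristic $p\ge3$, $r\ge1$ an integer, and let $A=A_{\bar0}$ be a purely even commutative $k$-algebra. Below, "the canonical quotient maps induce identifications" means that precomposition with them gives bijections between the displayed sets of homomorphisms. (1) Let $t\ge1$. The canonical quotient maps $\mathbb M_r\to\mathbb M_{r;t}\to\mathbb M_{r;1}$ induce identifications $$\mathbf{Hom}(\mathbb M_{r;1},\mathbb M_{r;1})(A)=\mathbf{Hom}(\mathbb M_{r;t},\mathbb M_{r;1})(A)=\mathbf{Hom}(\mathbb M_r,\mathbb M_{r;1})(A)=\{(\mu,a_0,\dots,a_{r-1})\in A^{r+1}\}.$$ Given $(\mu,a_0,\dots,a_{r-1})\in A^{r+1}$, the corresponding comorphism $\phi:A[\mathbb M_{r;1}]\to A[\mathbb M_r]$ is completely specified by $\phi(\tau)=\mu\cdot\tau$ and $\phi(\theta)=\sum_{i=0}^{r-1}a_i\cdot\theta^{p^i}$. (2) Let $2\le s\le t$, and suppose $A$ is reduced. The canonical quotient maps $\mathbb M_r\to\mathbb M_{r;t}\to\mathbb M_{r;s}$ induce identifications $$\mathbf{Hom}(\mathbb M_{r;s},\mathbb M_{r;s})(A)=\mathbf{Hom}(\mathbb M_{r;t},\mathbb M_{r;s})(A)=\mathbf{Hom}(\mathbb M_r,\mathbb M_{r;s})(A)=\{(\mu,a_0,\dots,a_{r-1},b_s)\in A^{r+2}:\mu^2=a_0^{p^r}\}.$$ Given such a tuple, the corresponding comorphism $\phi:A[\mathbb M_{r;s}]\to A[\mathbb M_r]$ is completely specified by $\phi(\tau)=\mu\cdot\tau$,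 $\phi(\theta)=\sum_{i=0}^{r-1}a_i\cdot\theta^{p^i}$, $\phi(\sigma_i)=a_0^{ip^{r-1}}\cdot\sigma_i$ for $0\le i<p^{s-1}$, and $\phi(\sigma_{p^{s-1}})=a_0^{p^{r+s-2}}\cdot\sigma_{p^{s-1}}+b_s\cdot\sigma_1$. (3) Suppose $r\ge2$, let $1\le s<t$, and let $0\ne\eta\in k$. Suppose $A$ is reduced. The canonical quotient maps $\mathbb M_r\to\mathbb M_{r;t}\to\mathbb M_{r;s+1}$ induce identifications $$\mathbf{Hom}(\mathbb M_{r;s+1},\mathbb M_{r;s,\eta})(A)=\mathbf{Hom}(\mathbb M_{r;t},\mathbb M_{r;s,\eta})(A)=\mathbf{Hom}(\mathbb M_r,\mathbb M_{r;s,\eta})(A)=\{(\mu,a_0,\dots,a_{r-1})\in A^{r+1}:\mu^2=a_0^{p^r}\}.$$ Given such a tuple, the corresponding comorphism $\phi:A[\mathbb M_{r;s,\eta}]\to A[\mathbb M_r]$ is completely specified by $\phi(\tau)=\mu\cdot\tau$, $\phi(\theta)=\left(\sum_{i=0}^{r-1}a_i\cdot\theta^{p^i}\right)-\eta\cdot\left(a_0^{p^{r+s-1}}\sigma_{p^s}\right)$, and $\phi(\sigma_i)=a_0^{ip^{r-1}}\cdot\sigma_i$ for $0\le i<p^s$. (4) Let $t\ge1$. The canonical quotient maps $\mathbb M_r\to\mathbb M_{r;t}\to\mathbb G_{a(r)}$ induce identifications $$\mathbf{Hom}(\mathbb G_{a(r)},\mathbb G_{a(r)})(A)=\mathbf{Hom}(\mathbb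 M_{r;t},\mathbb G_{a(r)})(A)=\mathbf{Hom}(\mathbb M_r,\mathbb G_{a(r)})(A)=A^r.$$ Given $(a_0,\dots,a_{r-1})\in A^r$, the corresponding comorphism $\phi:A[\mathbb G_{a(r)}]\to A[\mathbb M_r]$ is completely specified by $\phi(\theta)=\sum_{i=0}^{r-1}a_i\cdot\theta^{p^i}$. (5) Let $t\ge1$. The canonical quotient maps $\mathbb M_r\to\mathbb M_{r;t}\to\mathbb G_a^-$ induce identifications $$\mathbf{Hom}(\mathbb G_a^-,\mathbb G_a^-)(A)=\mathbf{Hom}(\mathbb M_{r;t},\mathbb G_a^-)(A)=\mathbf{Hom}(\mathbb M_r,\mathbb G_a^-)(A)=A.$$ Given $\mu\in A$, the corresponding comorphism $\phi:A[\mathbb G_a^-]\to A[\mathbb M_r]$ is specified by $\phi(\tau)=\mu\cdot\tau$.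
   Context: "Super" means $\mathbb Z_2$-graded; $\mathbb N=\{0,1,\dots\}$. An affine $k$-supergroup scheme $G$ is a representable functor from commutative $k$-superalgebras (odd elements square to $0$) to groups, represented by the Hopf superalgebra $k[G]$; $G\otimes_kA$ is its base change, with coordinate Hopf superalgebra $A[G]=k[G]\otimes_kA$. $\mathbf{Hom}(G,G')(A)$ is the set of $A$-supergroup scheme homomorphisms $G\otimes_kA\to G'\otimes_kA$, equivalently of $A$-Hopf superalgebra homomorphisms (comorphisms) $A[G']\to A[G]$. $k[\mathbb M_r]$ is the commutative superalgebra generated by odd $\tau$ and even $\theta,\sigma_i$ ($i\in\mathbb N$) with $\tau^2=0$, $\sigma_0=1$, $\theta^{p^{r-1}}=\sigma_1$, $\sigma_i\sigma_j=\binom{i+j}{i}\sigma_{i+j}$; coproduct: $\tau,\theta$ primitive, $\Delta(\sigma_i)=\sum_{u+v=i}\sigma_u\otimes\sigma_v+\sum_{u+v+p=i}\sigma_u\tau\otimes\sigma_v\tau$; antipode $S(\tau)=-\tau$, $S(\theta)=-\theta$, $S(\sigma_i)=(-1)^i\sigma_i$. For $s\ge1$, $k[\mathbb M_{r;s}]$ is the Hopf subsuperalgebra of $k[\mathbb M_r]$ generated by $\tau,\theta,\sigma_i$ ($1\le i<p^s$). $\mathbb M_{r;s,\eta}$ ($\eta\in k$) is the finite supergroup scheme whose group algebra $k[\mathbb M_{r;s,\eta}]^\#$ is $P_r/\langle u_{r-1}^{p^s}+\eta u_0\rangle$, where $P_r=k[u_0,\dots,u_{r-1},v]/\langle u_0^p,\dots,u_{r-2}^p,u_{r-1}^p+v^2\rangle$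 ($v$ odd, $u_i$ even) is the graded dual Hopf superalgebra of $k[\mathbb M_r]$, with $u_i$ dual to $\theta^{p^i}$ and $v$ dual to $\tau$ with respect to the basis $\{\theta^i\sigma_j,\tau\theta^i\sigma_j:0\le i<p^{r-1},j\ge0\}$. For $r\ge2$, $k[\mathbb M_{r;s,\eta}]$ is identified as a superalgebra with $k[\mathbb M_{r;s}]$ (the span of the monomials $u_0^{i_0}\cdots u_{r-2}^{i_{r-2}}u_{r-1}^jv^\epsilon$, $0\le i_\ell<p$, $0\le j<p^s$, $\epsilon\in\{0,1\}$, is a subcoalgebra of $P_r$ mapping isomorphically onto both group algebras); under this identification the coproduct of $k[\mathbb M_{r;s,\eta}]$ is given by the same formulas for $\tau$ and $\sigma_\ell$, and $\Delta(\theta)=\theta\otimes1+1\otimes\theta-\eta\left(\sum_{i=1}^{p^s-1}\sigma_i\otimes\sigma_{p^s-i}+\sum_{i+j+p=p^s}\sigma_i\tau\otimes\sigma_j\tau\right)$. $k[\mathbb G_{a(r)}]=k[\theta]/\langle\theta^{p^r}\rangle$ with $\theta$ primitive; $k[\mathbb G_a^-]=\Lambda(\tau)$ with $\tau$ odd primitive. The canonical quotient maps among $\mathbb M_r$, $\mathbb M_{r;t}$, $\mathbb M_{r;s}$ ($s\le t$), $\mathbb G_{a(r)}$, $\mathbb G_a^-$ are those whose comorphisms are the evident subalgebra inclusions inside $k[\mathbb M_r]$. *)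

theory Defs
  imports "HOL-Computational_Algebra.Primes" "HOL-Library.Poly_Mapping" "HOL-Library.FuncSet"
begin

section \<open>Free superalgebras and Hopf superalgebras with a chosen homogeneous basis\<close>

text \<open>
  A superalgebra over a commutative ring \<open>R\<close> that is free as a module is described by a
  homogeneous basis and its structure constants; its elements are the finitely supported
  functions \<open>'b \<Rightarrow>\<^sub>0 'a\<close> whose support lies in the basis.  Structure constants at arguments
  outside the basis are irrelevant.  Over a field every superalgebra is of this shape, and so
  is each of its base changes.

  The sort \<open>{comm_ring, comm_monoid_mult}\<close> is that of all commutative unital rings, including
  the zero ring (which \<open>comm_ring_1\<close> excludes).
\<close>

record (overloaded) ('b, 'a::zero) superalgebra =
  basis :: "'b set"
  parity :: "'b \<Rightarrow> nat"
  unit_el :: "'b \<Rightarrow>\<^sub>0 'a"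
  mult_tab :: "'b \<Rightarrow> 'b \<Rightarrow> ('b \<Rightarrow>\<^sub>0 'a)"

record (overloaded) ('b, 'a::zero) hopf_superalgebra = "('b, 'a) superalgebra" +
  comult_tab :: "'b \<Rightarrow> ('b \<times> 'b \<Rightarrow>\<^sub>0 'a)"
  counit_tab :: "'b \<Rightarrow> 'a"
  antipode_tab :: "'b \<Rightarrow> ('b \<Rightarrow>\<^sub>0 'a)"

definition scal :: "'a::comm_ring \<Rightarrow> ('b \<Rightarrow>\<^sub>0 'a) \<Rightarrow> ('b \<Rightarrow>\<^sub>0 'a)" where
  "scal c x = Poly_Mapping.map ((*) c) x"

definition lin_ext :: "('b \<Rightarrow> ('c \<Rightarrow>\<^sub>0 'a)) \<Rightarrow> ('b \<Rightarrow>\<^sub>0 'a) \<Rightarrow> ('c \<Rightarrow>\<^sub>0 'a::comm_ring)" where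
  "lin_ext f x = (\<Sum>b\<in>Poly_Mapping.keys x. scal (Poly_Mapping.lookup x b) (f b))"

definition tensor :: "('b \<Rightarrow>\<^sub>0 'a) \<Rightarrow> ('c \<Rightarrow>\<^sub>0 'a) \<Rightarrow> ('b \<times> 'c \<Rightarrow>\<^sub>0 'a::comm_ring)" where
  "tensor x y = (\<Sum>b\<in>Poly_Mapping.keys x. \<Sum>c\<in>Poly_Mapping.keys y.
     Poly_Mapping.single (b, c) (Poly_Mapping.lookup x b * Poly_Mapping.lookup y c))"

definition carrier_of :: "('b, 'a::zero, 'z) superalgebra_scheme \<Rightarrow> ('b \<Rightarrow>\<^sub>0 'a) set" where
  "carrier_of H = {x. Poly_Mapping.keys x \<subseteq> basis H}"

definition homogeneous :: "('b, 'a::zero, 'z) superalgebra_scheme \<Rightarrow> nat \<Rightarrow> ('b \<Rightarrow>\<^sub>0 'a) \<Rightarrow> bool" where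
  "homogeneous H e x \<longleftrightarrow> (\<forall>b\<in>Poly_Mapping.keys x. parity H b = e)"

definition mul :: "('b, 'a::comm_ring, 'z) superalgebra_scheme
    \<Rightarrow> ('b \<Rightarrow>\<^sub>0 'a) \<Rightarrow> ('b \<Rightarrow>\<^sub>0 'a) \<Rightarrow> ('b \<Rightarrow>\<^sub>0 'a)" where
  "mul H x y = lin_ext (\<lambda>b. lin_ext (mult_tab H b) y) x"

definition pow :: "('b, 'a::comm_ring, 'z) superalgebra_scheme
    \<Rightarrow> ('b \<Rightarrow>\<^sub>0 'a) \<Rightarrow> nat \<Rightarrow> ('b \<Rightarrow>\<^sub>0 'a)" where
  "pow H x n = ((mul H x) ^^ n) (unit_el H)"

text \<open>Product on \<open>H \<otimes> H\<close>: \<open>(b \<otimes> c)(b' \<otimes> c') = (-1)^(|c||b'|) bb' \<otimes> cc'\<close>.\<close>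

definition tensor_square :: "('b, 'a::{comm_ring,comm_monoid_mult}, 'z) superalgebra_scheme
    \<Rightarrow> ('b \<times> 'b, 'a) superalgebra" where
  "tensor_square H =
    \<lparr> basis = basis H \<times> basis H,
      parity = (\<lambda>(b, c). (parity H b + parity H c) mod 2),
      unit_el = tensor (unit_el H) (unit_el H),
      mult_tab = (\<lambda>(b, c) (b', c'). scal ((- 1) ^ (parity H c * parity H b'))
        (tensor (mult_tab H b b') (mult_tab H c c'))) \<rparr>"

definition comult :: "('b, 'a::comm_ring, 'z) hopf_superalgebra_scheme
    \<Rightarrow> ('b \<Rightarrow>\<^sub>0 'a) \<Rightarrow> ('b \<times> 'b \<Rightarrow>\<^sub>0 'a)" where
  "comult H = lin_ext (comult_tab H)"

definition counit :: "('b, 'a::comm_ring, 'z) hopf_superalgebra_scheme \<Rightarrow> ('b \<Rightarrow>\<^sub>0 'a) \<Rightarrow> 'a" where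
  "counit H x = (\<Sum>b\<in>Poly_Mapping.keys x. Poly_Mapping.lookup x b * counit_tab H b)"

definition antipode :: "('b, 'a::comm_ring, 'z) hopf_superalgebra_scheme
    \<Rightarrow> ('b \<Rightarrow>\<^sub>0 'a) \<Rightarrow> ('b \<Rightarrow>\<^sub>0 'a)" where
  "antipode H = lin_ext (antipode_tab H)"

text \<open>For a linear map \<open>\<phi>\<close>, the map \<open>\<phi> \<otimes> \<phi>\<close>; no signs occur because it is only used for
  parity-preserving \<open>\<phi>\<close>.\<close>

definition tensor_map :: "(('b \<Rightarrow>\<^sub>0 'a) \<Rightarrow> ('c \<Rightarrow>\<^sub>0 'a)) \<Rightarrow> ('b \<times> 'b \<Rightarrow>\<^sub>0 'a)
    \<Rightarrow> ('c \<times> 'c \<Rightarrow>\<^sub>0 'a::{comm_ring,comm_monoid_mult})" where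
  "tensor_map \<phi> = lin_ext (\<lambda>(b, c).
     tensor (\<phi> (Poly_Mapping.single b 1)) (\<phi> (Poly_Mapping.single c 1)))"

text \<open>Homomorphisms are extensional functions on the carrier, so that distinct elements of
  \<open>hopf_homs H' H\<close> are distinct homomorphisms \<open>H' \<rightarrow> H\<close>.\<close>

definition hopf_homs :: "('b, 'a::{comm_ring,comm_monoid_mult}) hopf_superalgebra
    \<Rightarrow> ('c, 'a) hopf_superalgebra \<Rightarrow> (('b \<Rightarrow>\<^sub>0 'a) \<Rightarrow> ('c \<Rightarrow>\<^sub>0 'a)) set" where
  "hopf_homs H' H = {\<phi> \<in> carrier_of H' \<rightarrow>\<^sub>E carrier_of H.
     (\<forall>x\<in>carrier_of H'. \<forall>y\<in>carrier_of H'. \<phi> (x + y) = \<phi> x + \<phi> y) \<and>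
     (\<forall>c. \<forall>x\<in>carrier_of H'. \<phi> (scal c x) = scal c (\<phi> x)) \<and>
     (\<forall>e. \<forall>x\<in>carrier_of H'. homogeneous H' e x \<longrightarrow> homogeneous H e (\<phi> x)) \<and>
     \<phi> (unit_el H') = unit_el H \<and>
     (\<forall>x\<in>carrier_of H'. \<forall>y\<in>carrier_of H'. \<phi> (mul H' x y) = mul H (\<phi> x) (\<phi> y)) \<and>
     (\<forall>x\<in>carrier_of H'. comult H (\<phi> x) = tensor_map \<phi> (comult H' x)) \<and>
     (\<forall>x\<in>carrier_of H'. counit H (\<phi> x) = counit H' x) \<and>
     (\<forall>x\<in>carrier_of H'. antipode H (\<phi> x) = \<phi> (antipode H' x))}"


section \<open>Base change and homomorphisms of supergroup schemes\<close>

text \<open>A purely even commutative \<open>k\<close>-algebra is a commutative ring \<open>'a\<close> together with a unital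
  ring homomorphism \<open>\<iota>\<close> from the field \<open>k\<close>.\<close>

definition algebra_map :: "('k::field \<Rightarrow> 'a::{comm_ring,comm_monoid_mult}) \<Rightarrow> bool" where
  "algebra_map \<iota> \<longleftrightarrow> \<iota> 1 = 1 \<and> (\<forall>x y. \<iota> (x + y) = \<iota> x + \<iota> y) \<and> (\<forall>x y. \<iota> (x * y) = \<iota> x * \<iota> y)"

definition is_reduced :: "'a::{comm_ring,comm_monoid_mult} itself \<Rightarrow> bool" where
  "is_reduced _ \<longleftrightarrow> (\<forall>(x::'a) n. x ^ n = 0 \<longrightarrow> x = 0)"

abbreviation scalar_ext :: "('k::field \<Rightarrow> 'a::{comm_ring,comm_monoid_mult}) \<Rightarrow> ('b \<Rightarrow>\<^sub>0 'k) \<Rightarrow> ('b \<Rightarrow>\<^sub>0 'a)" where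
  "scalar_ext \<iota> x \<equiv> Poly_Mapping.map \<iota> x"

definition base_change :: "('k::field \<Rightarrow> 'a::{comm_ring,comm_monoid_mult})
    \<Rightarrow> ('b, 'k) hopf_superalgebra \<Rightarrow> ('b, 'a) hopf_superalgebra" where
  "base_change \<iota> H =
    \<lparr> basis = basis H, parity = parity H,
      unit_el = scalar_ext \<iota> (unit_el H),
      mult_tab = (\<lambda>b c. scalar_ext \<iota> (mult_tab H b c)),
      comult_tab = (\<lambda>b. scalar_ext \<iota> (comult_tab H b)),
      counit_tab = (\<lambda>b. \<iota> (counit_tab H b)),
      antipode_tab = (\<lambda>b. scalar_ext \<iota> (antipode_tab H b)) \<rparr>"

text \<open>An affine supergroup scheme is represented by its coordinate Hopf superalgebra, and a
  homomorphism \<open>G \<otimes> A \<rightarrow> G' \<otimes> A\<close> by its comorphism \<open>A[G'] \<rightarrow> A[G]\<close>.\<close>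

definition Hom :: "('k::field \<Rightarrow> 'a::{comm_ring,comm_monoid_mult}) \<Rightarrow> ('b, 'k) hopf_superalgebra
    \<Rightarrow> ('c, 'k) hopf_superalgebra \<Rightarrow> (('c \<Rightarrow>\<^sub>0 'a) \<Rightarrow> ('b \<Rightarrow>\<^sub>0 'a)) set" where
  "Hom \<iota> G G' = hopf_homs (base_change \<iota> G') (base_change \<iota> G)"

text \<open>For \<open>G \<rightarrow> Q\<close> with comorphism \<open>q : A[Q] \<rightarrow> A[G]\<close>, precomposition
  \<open>Hom(Q, X)(A) \<rightarrow> Hom(G, X)(A)\<close> sends the comorphism \<open>\<phi> : A[X] \<rightarrow> A[Q]\<close> to \<open>q \<circ> \<phi>\<close>.\<close>

definition precomp :: "('k::field \<Rightarrow> 'a::{comm_ring,comm_monoid_mult}) \<Rightarrow> ('x, 'k) hopf_superalgebra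
    \<Rightarrow> (('q \<Rightarrow>\<^sub>0 'a) \<Rightarrow> ('g \<Rightarrow>\<^sub>0 'a)) \<Rightarrow> (('x \<Rightarrow>\<^sub>0 'a) \<Rightarrow> ('q \<Rightarrow>\<^sub>0 'a)) \<Rightarrow> (('x \<Rightarrow>\<^sub>0 'a) \<Rightarrow> ('g \<Rightarrow>\<^sub>0 'a))" where
  "precomp \<iota> X q \<phi> = compose (carrier_of (base_change \<iota> X)) q \<phi>"

text \<open>The set \<open>S\<close> is identified with the parameter set \<open>P\<close>, the member of \<open>S\<close> that corresponds
  to \<open>x \<in> P\<close> being the only one with the property \<open>spec x\<close>.\<close>

definition parametrized_by :: "'s set \<Rightarrow> 'p set \<Rightarrow> ('p \<Rightarrow> 's \<Rightarrow> bool) \<Rightarrow> bool" where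
  "parametrized_by S P spec \<longleftrightarrow>
     (\<exists>\<Phi>. bij_betw \<Phi> P S \<and> (\<forall>x\<in>P. \<forall>\<phi>\<in>S. spec x \<phi> \<longleftrightarrow> \<phi> = \<Phi> x))"


section \<open>The supergroup schemes \<open>M\<^sub>r\<close> and \<open>M\<^sub>r\<^sub>;\<^sub>s\<close>\<close>

text \<open>The triple \<open>(e, i, j)\<close> with \<open>e \<le> 1\<close> and \<open>i < p^(r-1)\<close> stands for the basis monomial
  \<open>\<tau>^e \<theta>^i \<sigma>\<^sub>j\<close>.\<close>

type_synonym idx = "nat \<times> nat \<times> nat"

text \<open>\<open>normal_monomial p r e n j\<close> is \<open>\<tau>^e \<theta>^n \<sigma>\<^sub>j\<close> for \<open>e \<le> 1\<close> and any \<open>n\<close>.  It is brought into normal form with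
  \<open>\<theta>^(p^(r-1)) = \<sigma>\<^sub>1\<close>, \<open>\<sigma>\<^sub>1^q = q! \<sigma>\<^sub>q\<close> and \<open>\<sigma>\<^sub>q \<sigma>\<^sub>j = (q+j choose q) \<sigma>\<^sub>q\<^sub>+\<^sub>j\<close>.\<close>

definition normal_monomial :: "nat \<Rightarrow> nat \<Rightarrow> nat \<Rightarrow> nat \<Rightarrow> nat \<Rightarrow> (idx \<Rightarrow>\<^sub>0 'k::field)" where
  "normal_monomial p r e n j = (let Q = p ^ (r - 1); q = n div Q in
     Poly_Mapping.single (e, n mod Q, q + j) (of_nat (fact q * ((q + j) choose q))))"

abbreviation tau :: "nat \<Rightarrow> nat \<Rightarrow> (idx \<Rightarrow>\<^sub>0 'k::field)" where
  "tau p r \<equiv> normal_monomial p r 1 0 0"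

abbreviation theta :: "nat \<Rightarrow> nat \<Rightarrow> (idx \<Rightarrow>\<^sub>0 'k::field)" where
  "theta p r \<equiv> normal_monomial p r 0 1 0"

abbreviation sigma :: "nat \<Rightarrow> nat \<Rightarrow> nat \<Rightarrow> (idx \<Rightarrow>\<^sub>0 'k::field)" where
  "sigma p r j \<equiv> normal_monomial p r 0 0 j"

definition M_superalgebra :: "nat \<Rightarrow> nat \<Rightarrow> (idx, 'k::field) superalgebra" where
  "M_superalgebra p r =
    \<lparr> basis = {..<2} \<times> {..<p ^ (r - 1)} \<times> UNIV,
      parity = (\<lambda>(e, i, j). e),
      unit_el = normal_monomial p r 0 0 0,
      mult_tab = (\<lambda>(e, i, j) (e', i', j').
        if e + e' \<le> 1
        then scal (of_nat ((j + j') choose j)) (normal_monomial p r (e + e') (i + i') (j + j'))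
        else 0) \<rparr>"

definition primitive_comult :: "('b, 'k::field) superalgebra \<Rightarrow> ('b \<Rightarrow>\<^sub>0 'k) \<Rightarrow> ('b \<times> 'b \<Rightarrow>\<^sub>0 'k)" where
  "primitive_comult H x = tensor x (unit_el H) + tensor (unit_el H) x"

definition sigma_comult :: "nat \<Rightarrow> nat \<Rightarrow> nat \<Rightarrow> (idx \<times> idx \<Rightarrow>\<^sub>0 'k::field)" where
  "sigma_comult p r i =
     (\<Sum>(u, v)\<in>{(u, v). u + v = i}. tensor (sigma p r u) (sigma p r v)) +
     (\<Sum>(u, v)\<in>{(u, v). u + v + p = i}.
        tensor (mul (M_superalgebra p r) (sigma p r u) (tau p r))
               (mul (M_superalgebra p r) (sigma p r v) (tau p r)))"

text \<open>The coproduct is the superalgebra homomorphism with the given values on the generators,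
  so its value on \<open>\<tau>^e \<theta>^i \<sigma>\<^sub>j\<close> is the product of those values in the tensor square.\<close>

definition M :: "nat \<Rightarrow> nat \<Rightarrow> (idx, 'k::field) hopf_superalgebra" where
  "M p r = (let R = M_superalgebra p r; T = tensor_square R in
     superalgebra.extend R
       \<lparr> comult_tab = (\<lambda>(e, i, j).
           mul T (pow T (primitive_comult R (tau p r)) e)
             (mul T (pow T (primitive_comult R (theta p r)) i) (sigma_comult p r j))),
         counit_tab = (\<lambda>b. if b = (0, 0, 0) then 1 else 0),
         antipode_tab = (\<lambda>(e, i, j). scal ((- 1) ^ (e + i + j)) (Poly_Mapping.single (e, i, j) 1)) \<rparr>)"

text \<open>The Hopf subsuperalgebra generated by \<open>\<tau>\<close>, \<open>\<theta>\<close> and the \<open>\<sigma>\<^sub>i\<close> with \<open>i < p^s\<close> is spanned by the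
  basis monomials with \<open>j < p^s\<close>; see \<open>M_sub_generated\<close> below.\<close>

definition M_sub :: "nat \<Rightarrow> nat \<Rightarrow> nat \<Rightarrow> (idx, 'k::field) hopf_superalgebra" where
  "M_sub p r s = (M p r)\<lparr> basis := {..<2} \<times> {..<p ^ (r - 1)} \<times> {..<p ^ s} \<rparr>"


text \<open>The relations of \<open>k[M\<^sub>r]\<close>, and the description of \<open>k[M\<^sub>r\<^sub>;\<^sub>s]\<close> as the subsuperalgebra
  generated by \<open>\<tau>\<close>, \<open>\<theta>\<close> and the \<open>\<sigma>\<^sub>i\<close> with \<open>1 \<le> i < p^s\<close>.\<close>

inductive_set generated :: "('b, 'k::comm_ring, 'z) superalgebra_scheme \<Rightarrow> ('b \<Rightarrow>\<^sub>0 'k) set \<Rightarrow> ('b \<Rightarrow>\<^sub>0 'k) set"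
  for H :: "('b, 'k::comm_ring, 'z) superalgebra_scheme" and X :: "('b \<Rightarrow>\<^sub>0 'k) set" where
  gen: "x \<in> X \<Longrightarrow> x \<in> generated H X"
| unit: "unit_el H \<in> generated H X"
| add: "x \<in> generated H X \<Longrightarrow> y \<in> generated H X \<Longrightarrow> x + y \<in> generated H X"
| scale: "x \<in> generated H X \<Longrightarrow> scal c x \<in> generated H X"
| mult: "x \<in> generated H X \<Longrightarrow> y \<in> generated H X \<Longrightarrow> mul H x y \<in> generated H X"

lemma lookup_scal [simp]: "Poly_Mapping.lookup (scal c x) b = c * Poly_Mapping.lookup x b"
  by (auto simp: scal_def Poly_Mapping.map.rep_eq when_def)

lemma scal_simps [simp]:
  "scal c 0 = 0" "scal 0 x = 0" "scal c (scal d x) = scal (c * d) x"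
  "scal c (Poly_Mapping.single b d) = Poly_Mapping.single b (c * d)"
  by (auto intro!: poly_mapping_eqI simp: lookup_single when_def mult.assoc)

lemma scal_one [simp]: "scal (1::'a::{comm_ring,comm_monoid_mult}) x = x"
  by (auto intro!: poly_mapping_eqI)

lemma lin_ext_single [simp]: "lin_ext f (Poly_Mapping.single b c) = scal c (f b)"
  by (cases "c = 0") (auto simp: lin_ext_def)

lemma mul_single [simp]:
  "mul H (Poly_Mapping.single b c) (Poly_Mapping.single b' c') = scal (c * c') (mult_tab H b b')"
  by (simp add: mul_def)

lemma keys_scal: "Poly_Mapping.keys (scal c x) \<subseteq> Poly_Mapping.keys x"
  by (auto simp: in_keys_iff)

lemma keys_lin_ext: "Poly_Mapping.keys (lin_ext f x) \<subseteq> (\<Union>b\<in>Poly_Mapping.keys x. Poly_Mapping.keys (f b))"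
proof -
  have "Poly_Mapping.keys (lin_ext f x)
      \<subseteq> (\<Union>b\<in>Poly_Mapping.keys x. Poly_Mapping.keys (scal (Poly_Mapping.lookup x b) (f b)))"
    unfolding lin_ext_def by (rule keys_sum)
  also have "\<dots> \<subseteq> (\<Union>b\<in>Poly_Mapping.keys x. Poly_Mapping.keys (f b))"
    using keys_scal by fastforce
  finally show ?thesis .
qed

lemma M_mult_tab: "mult_tab (M p r) = mult_tab (M_superalgebra p r)"
  and M_unit_el: "unit_el (M p r) = unit_el (M_superalgebra p r)"
  and M_mul: "mul (M p r) = mul (M_superalgebra p r)"
  and M_sub_mul: "mul (M_sub p r s) = mul (M_superalgebra p r)"
  by (auto simp: M_def M_sub_def Let_def superalgebra.defs M_superalgebra_def mul_def fun_eq_iff)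

lemma mult_tab_low:
  assumes "e + e' \<le> 1" "i + i' < p ^ (r - 1)"
  shows "mult_tab (M_superalgebra p r) (e, i, j) (e', i', j') =
    Poly_Mapping.single (e + e', i + i', j + j') (of_nat ((j + j') choose j))"
  using assms by (simp add: M_superalgebra_def normal_monomial_def)

lemma M_relations:
  assumes "p \<ge> 2"
  shows "mul (M p r) (tau p r) (tau p r) = (0 :: idx \<Rightarrow>\<^sub>0 'k::field)"
    and "sigma p r 0 = (unit_el (M p r) :: idx \<Rightarrow>\<^sub>0 'k)"
    and "pow (M p r) (theta p r) (p ^ (r - 1)) = (sigma p r 1 :: idx \<Rightarrow>\<^sub>0 'k)"
    and "mul (M p r) (sigma p r i) (sigma p r j) = (scal (of_nat ((i + j) choose i)) (sigma p r (i + j)) :: idx \<Rightarrow>\<^sub>0 'k)"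
proof -
  have Q: "p ^ (r - 1) > 0" using assms by simp
  show "mul (M p r) (tau p r) (tau p r) = (0 :: idx \<Rightarrow>\<^sub>0 'k)"
    by (simp add: M_mul normal_monomial_def M_superalgebra_def)
  show "sigma p r 0 = (unit_el (M p r) :: idx \<Rightarrow>\<^sub>0 'k)"
    by (simp add: M_unit_el M_superalgebra_def)
  show "mul (M p r) (sigma p r i) (sigma p r j) = (scal (of_nat ((i + j) choose i)) (sigma p r (i + j)) :: idx \<Rightarrow>\<^sub>0 'k)"
    by (simp add: M_mul normal_monomial_def M_superalgebra_def)
  have pow_Suc: "pow (M p r) x (Suc n) = mul (M p r) x (pow (M p r) x n)" for x :: "idx \<Rightarrow>\<^sub>0 'k" and n
    by (simp add: pow_def)
  have low: "pow (M p r) (theta p r) n = (Poly_Mapping.single (0, n, 0) 1 :: idx \<Rightarrow>\<^sub>0 'k)" if "n < p ^ (r - 1)" for n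
    using that
  proof (induction n)
    case 0 then show ?case by (simp add: pow_def M_unit_el M_superalgebra_def normal_monomial_def)
  next
    case (Suc n)
    then have "p ^ (r - 1) \<noteq> 1" by auto
    with Suc show ?case by (simp add: pow_Suc M_mul normal_monomial_def mult_tab_low)
  qed
  show "pow (M p r) (theta p r) (p ^ (r - 1)) = (sigma p r 1 :: idx \<Rightarrow>\<^sub>0 'k)"
  proof (cases "p ^ (r - 1) = 1")
    case True
    have "theta p r = (Poly_Mapping.single (0, 0, 1) 1 :: idx \<Rightarrow>\<^sub>0 'k)"
      unfolding normal_monomial_def True by simp
    moreover have "pow (M p r) (theta p r) 0 = (Poly_Mapping.single (0, 0, 0) 1 :: idx \<Rightarrow>\<^sub>0 'k)"
      using low[of 0] Q by blast
    ultimately have "pow (M p r) (theta p r) 1 =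
        (mul (M p r) (Poly_Mapping.single (0, 0, 1) 1) (Poly_Mapping.single (0, 0, 0) 1) :: idx \<Rightarrow>\<^sub>0 'k)"
      unfolding One_nat_def pow_Suc by simp
    also have "\<dots> = Poly_Mapping.single (0, 0, 1) 1"
      unfolding M_mul mul_single using Q by (subst mult_tab_low) auto
    also have "\<dots> = sigma p r 1" by (simp add: normal_monomial_def)
    finally show ?thesis unfolding True .
  next
    case False
    define n where "n = p ^ (r - 1) - 1"
    have n: "p ^ (r - 1) = Suc n" "n > 0" using Q False unfolding n_def by linarith+
    have "theta p r = (Poly_Mapping.single (0, 1, 0) 1 :: idx \<Rightarrow>\<^sub>0 'k)"
      unfolding normal_monomial_def n using n(2) by simp
    moreover have "pow (M p r) (theta p r) n = (Poly_Mapping.single (0, n, 0) 1 :: idx \<Rightarrow>\<^sub>0 'k)"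
      using n by (intro low) simp
    ultimately have "pow (M p r) (theta p r) (Suc n) =
        (mul (M p r) (Poly_Mapping.single (0, 1, 0) 1) (Poly_Mapping.single (0, n, 0) 1) :: idx \<Rightarrow>\<^sub>0 'k)"
      unfolding pow_Suc by simp
    also have "\<dots> = normal_monomial p r 0 (Suc n) 0"
      unfolding M_mul mul_single by (simp add: M_superalgebra_def)
    also have "\<dots> = sigma p r 1"
      unfolding normal_monomial_def n by simp
    finally show ?thesis unfolding n .
  qed
qed

lemma prime_dvd_choose_power:
  assumes "prime (p::nat)" "0 < i" "i < p ^ s"
  shows "p dvd (p ^ s choose i)"
proof (rule ccontr)
  assume "\<not> p dvd (p ^ s choose i)"
  then have c: "coprime (p ^ s) (p ^ s choose i)"
    using prime_imp_coprime[OF assms(1)] by (cases "s = 0") auto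
  have "i * (p ^ s choose i) = p ^ s * ((p ^ s - 1) choose (i - 1))"
    by (rule times_binomial_minus1_eq) (rule assms(2))
  then have "p ^ s dvd i * (p ^ s choose i)" by simp
  with c have "p ^ s dvd i" by (simp add: coprime_dvd_mult_left_iff)
  then have "p ^ s \<le> i" using assms(2) by (rule dvd_imp_le)
  with assms(3) show False by simp
qed

lemma dvd_choose_carry:
  assumes "prime (p::nat)" "j < p ^ s" "j' < p ^ s" "p ^ s \<le> j + j'"
  shows "p dvd ((j + j') choose j)"
proof -
  obtain m where m: "j + j' = p ^ s + m" using le_Suc_ex[OF assms(4)] by blast
  have "((j + j') choose j) = (\<Sum>k\<le>j. (p ^ s choose k) * (m choose (j - k)))"
    unfolding m by (rule vandermonde[symmetric])
  also have "p dvd \<dots>"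
  proof (rule dvd_sum)
    fix k assume "k \<in> {..j}"
    show "p dvd (p ^ s choose k) * (m choose (j - k))"
    proof (cases "k = 0")
      case True
      have "m < j" using m assms by linarith
      then show ?thesis using True by (simp add: binomial_eq_0)
    next
      case False
      then show ?thesis using prime_dvd_choose_power[of p k s] assms \<open>k \<in> {..j}\<close> by simp
    qed
  qed
  finally show ?thesis .
qed

lemma M_sub_closed:
  assumes "CHAR('k::field) = p" "prime p" "s \<ge> 1"
    and "b \<in> basis (M_sub p r s :: (idx, 'k) hopf_superalgebra)" "b' \<in> basis (M_sub p r s :: (idx, 'k) hopf_superalgebra)"
  shows "Poly_Mapping.keys (mult_tab (M_superalgebra p r) b b' :: idx \<Rightarrow>\<^sub>0 'k)
    \<subseteq> basis (M_sub p r s :: (idx, 'k) hopf_superalgebra)"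
proof -
  let ?Q = "p ^ (r - 1)"
  obtain e i j e' i' j' where b: "b = (e, i, j)" "b' = (e', i', j')" by (metis prod_cases3)
  have h: "i < ?Q" "i' < ?Q" "j < p ^ s" "j' < p ^ s" "e < 2" "e' < 2"
    using assms(4,5) by (auto simp: b M_sub_def)
  have Q: "?Q > 0" using h(1) by linarith
  have z: "of_nat n = (0 :: 'k)" if "p dvd n" for n
    using that assms(1) by (simp add: of_nat_eq_0_iff_char_dvd)
  show ?thesis
  proof (cases "e + e' \<le> 1")
    case True
    consider "p ^ s \<le> j + j'" | "i + i' < ?Q" "j + j' < p ^ s" | "?Q \<le> i + i'" "j + j' + 1 < p ^ s"
      | "?Q \<le> i + i'" "j + j' + 1 = p ^ s" by linarith
    then show ?thesis
    proof cases
      case 1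
      then have "of_nat ((j + j') choose j) = (0 :: 'k)"
        using dvd_choose_carry[OF assms(2)] h z by blast
      then show ?thesis by (simp add: b M_superalgebra_def)
    next
      case 2
      then show ?thesis using True by (auto simp: b mult_tab_low M_sub_def)
    next
      case 3
      then have "(i + i') div ?Q = 1" using h by (intro div_nat_eqI) auto
      then show ?thesis using True 3 Q by (auto simp: b M_superalgebra_def normal_monomial_def M_sub_def)
    next
      case 4
      then have d: "(i + i') div ?Q = 1" using h by (intro div_nat_eqI) auto
      have "of_nat (Suc (j + j')) = (0 :: 'k)"
        using 4 assms(3) by (intro z) (simp add: dvd_power)
      then show ?thesis using True 4 d by (simp add: b M_superalgebra_def normal_monomial_def)
    qed
  qed (simp add: b M_superalgebra_def)
qed

lemma M_sub_generated:
  assumes "CHAR('k::field) = p" "p \<ge> 3" "s \<ge> 1"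
  shows "carrier_of (M_sub p r s :: (idx, 'k) hopf_superalgebra) =
    generated (M p r) ({tau p r, theta p r} \<union> sigma p r ` {1..<p ^ s})"
    (is "?C = generated ?M ?X")
proof (rule equalityI; rule subsetI)
  have p: "prime p"
    using prime_CHAR_semidom[where 'a='k] assms by simp
  have ps: "p \<le> p ^ s" using assms by (simp add: self_le_power)
  have Q0: "p ^ (r - 1) > 0" using assms by simp
  fix x assume "x \<in> generated ?M ?X"
  then show "x \<in> ?C"
  proof induction
    case (gen x)
    have "Poly_Mapping.keys (normal_monomial p r e n j :: idx \<Rightarrow>\<^sub>0 'k)
        \<subseteq> basis (M_sub p r s :: (idx, 'k) hopf_superalgebra)"
      if "e < 2" "n div p ^ (r - 1) + j < p ^ s" for e n j
      using that Q0 by (simp add: normal_monomial_def M_sub_def Let_def)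
    moreover have "1 div p ^ (r - 1) < p ^ s"
      using div_le_dividend[of 1 "p ^ (r - 1)"] ps assms(2) by linarith
    ultimately show ?case
      using gen ps assms by (fastforce simp: carrier_of_def)
  next
    case unit
    then show ?case using ps assms Q0
      by (auto simp: carrier_of_def M_unit_el M_superalgebra_def normal_monomial_def M_sub_def)
  next
    case (add x y)
    then show ?case using keys_add by (fastforce simp: carrier_of_def)
  next
    case (scale x c)
    then show ?case using keys_scal by (fastforce simp: carrier_of_def)
  next
    case (mult x y)
    have "Poly_Mapping.keys (mul ?M x y) \<subseteq> (\<Union>b\<in>Poly_Mapping.keys x. \<Union>c\<in>Poly_Mapping.keys y.
        Poly_Mapping.keys (mult_tab (M_superalgebra p r) b c :: idx \<Rightarrow>\<^sub>0 'k))"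
      unfolding M_mul mul_def by (rule subset_trans[OF keys_lin_ext]) (intro UN_mono order_refl keys_lin_ext)
    also have "\<dots> \<subseteq> basis (M_sub p r s :: (idx, 'k) hopf_superalgebra)"
      using mult.IH M_sub_closed[OF assms(1) p assms(3)] unfolding carrier_of_def by blast
    finally show ?case by (simp add: carrier_of_def)
  qed
next
  let ?Q = "p ^ (r - 1)"
  let ?G = "generated ?M ?X"
  have th: "Poly_Mapping.single (0, i, 0) 1 \<in> ?G" if "i < ?Q" for i
    using that
  proof (induction i)
    case 0
    have "unit_el ?M = (Poly_Mapping.single (0, 0, 0) 1 :: idx \<Rightarrow>\<^sub>0 'k)"
      by (simp add: M_unit_el M_superalgebra_def normal_monomial_def)
    then show ?case using generated.unit[of ?M ?X] by simp
  next
    case (Suc i)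
    then have Q1: "?Q \<noteq> 1" "1 < ?Q" by auto
    have "theta p r \<in> ?G" by (rule generated.gen) simp
    then have "mul ?M (theta p r) (Poly_Mapping.single (0, i, 0) 1) \<in> ?G"
      by (rule generated.mult) (use Suc in simp)
    moreover have "mul ?M (theta p r) (Poly_Mapping.single (0, i, 0) 1) = (Poly_Mapping.single (0, Suc i, 0) 1 :: idx \<Rightarrow>\<^sub>0 'k)"
      using Suc Q1 by (simp add: M_mul normal_monomial_def mult_tab_low)
    ultimately show ?case by simp
  qed
  have si: "Poly_Mapping.single (0, 0, j) 1 \<in> ?G" if "j < p ^ s" for j
  proof (cases "j = 0")
    case True
    then show ?thesis using th[of 0] assms by simp
  next
    case False
    have "sigma p r j \<in> ?G" using False that by (intro generated.gen) auto
    then show ?thesis by (simp add: normal_monomial_def)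
  qed
  have si2: "Poly_Mapping.single (0, i, j) 1 \<in> ?G" if "i < ?Q" "j < p ^ s" for i j
    using generated.mult[OF th[OF that(1)] si[OF that(2)]] that by (simp add: M_mul mult_tab_low)
  have mo: "Poly_Mapping.single (e, i, j) 1 \<in> ?G" if "e < 2" "i < ?Q" "j < p ^ s" for e i j
  proof (cases "e = 0")
    case True then show ?thesis using si2 that by simp
  next
    case False
    then have "e = 1" using that by simp
    moreover have "tau p r \<in> ?G" by (intro generated.gen) auto
    ultimately show ?thesis
      using generated.mult[OF _ si2[OF that(2,3)], of "tau p r"] that by (simp add: M_mul normal_monomial_def mult_tab_low)
  qed
  fix x assume x: "x \<in> ?C"
  have "x = (\<Sum>b\<in>Poly_Mapping.keys x. scal (Poly_Mapping.lookup x b) (Poly_Mapping.single b 1))"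
    by (rule poly_mapping_eqI) (auto simp: lookup_sum lookup_single when_def in_keys_iff sum.delta)
  also have "\<dots> \<in> ?G"
  proof -
    have "(\<Sum>b\<in>F. scal (Poly_Mapping.lookup x b) (Poly_Mapping.single b 1)) \<in> ?G"
      if "finite F" "F \<subseteq> Poly_Mapping.keys x" for F
      using that
    proof (induction F)
      case empty
      have "scal 0 (unit_el ?M) \<in> ?G" by (intro generated.intros)
      then show ?case by simp
    next
      case (insert b F)
      have "b \<in> basis (M_sub p r s :: (idx, 'k) hopf_superalgebra)"
        using insert x by (auto simp: carrier_of_def)
      then have "Poly_Mapping.single b 1 \<in> ?G"
        using mo by (auto simp: M_sub_def)
      then have "scal (Poly_Mapping.lookup x b) (Poly_Mapping.single b 1) \<in> ?G"
        by (rule generated.scale)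
      then show ?case using insert by (auto intro!: generated.add simp del: scal_simps)
    qed
    then show ?thesis by simp
  qed
  finally show "x \<in> ?G" .
qed


section \<open>The supergroup schemes \<open>M\<^sub>r\<^sub>;\<^sub>s\<^sub>,\<^sub>\<eta>\<close>\<close>

text \<open>Linear functionals on a Hopf superalgebra \<open>H\<close> are given by their values on the basis (and
  are \<open>0\<close> outside).  The product is dual to the coproduct, with
  \<open>(f \<otimes> g)(x \<otimes> y) = (-1)^(|g||x|) f(x) g(y)\<close>.  The graded dual of \<open>k[M\<^sub>r]\<close> consists of the functionals
  that are nonzero on only finitely many basis elements.\<close>

definition graded_dual :: "('b, 'k::field) hopf_superalgebra \<Rightarrow> ('b \<Rightarrow> 'k) set" where
  "graded_dual H = {f. finite {b. f b \<noteq> 0} \<and> {b. f b \<noteq> 0} \<subseteq> basis H}"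

definition dual_mul :: "('b, 'k::field) hopf_superalgebra \<Rightarrow> ('b \<Rightarrow> 'k) \<Rightarrow> ('b \<Rightarrow> 'k) \<Rightarrow> ('b \<Rightarrow> 'k)" where
  "dual_mul H f g = (\<lambda>x. if x \<in> basis H
     then \<Sum>(b, c)\<in>Poly_Mapping.keys (comult_tab H x).
            (- 1) ^ (parity H b * parity H c) * Poly_Mapping.lookup (comult_tab H x) (b, c) * f b * g c
     else 0)"

definition dual_unit :: "('b, 'k::field) hopf_superalgebra \<Rightarrow> ('b \<Rightarrow> 'k)" where
  "dual_unit H = (\<lambda>x. if x \<in> basis H then counit_tab H x else 0)"

definition dual_pow :: "('b, 'k::field) hopf_superalgebra \<Rightarrow> ('b \<Rightarrow> 'k) \<Rightarrow> nat \<Rightarrow> ('b \<Rightarrow> 'k)" where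
  "dual_pow H f n = ((dual_mul H f) ^^ n) (dual_unit H)"

definition dual_vec :: "'b \<Rightarrow> ('b \<Rightarrow> 'k::field)" where
  "dual_vec b = (\<lambda>x. if x = b then 1 else 0)"

text \<open>The element \<open>u\<^sub>l \<in> P\<^sub>r\<close> (for \<open>l < r\<close>) dual to \<open>\<theta>^(p^l)\<close>; for \<open>l = r - 1\<close> this power is \<open>\<sigma>\<^sub>1\<close>.\<close>

definition u_gen :: "nat \<Rightarrow> nat \<Rightarrow> nat \<Rightarrow> (idx \<Rightarrow> 'k::field)" where
  "u_gen p r l = dual_vec (0, p ^ l mod p ^ (r - 1), p ^ l div p ^ (r - 1))"

text \<open>The ideal \<open>\<langle>u\<^sub>r\<^sub>-\<^sub>1^(p^s) + \<eta> u\<^sub>0\<rangle>\<close> of the commutative algebra \<open>P\<^sub>r\<close>.\<close>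

definition eta_ideal :: "nat \<Rightarrow> nat \<Rightarrow> nat \<Rightarrow> 'k::field \<Rightarrow> (idx \<Rightarrow> 'k) set" where
  "eta_ideal p r s \<eta> =
     {dual_mul (M p r) y (\<lambda>x. dual_pow (M p r) (u_gen p r (r - 1)) (p ^ s) x + \<eta> * u_gen p r 0 x)
      | y. y \<in> graded_dual (M p r)}"

text \<open>The representative modulo the ideal in the span of
  \<open>u\<^sub>0^i\<^sub>0 \<dots> u\<^sub>r\<^sub>-\<^sub>2^i\<^sub>r\<^sub>-\<^sub>2 u\<^sub>r\<^sub>-\<^sub>1^j v^\<epsilon>\<close> (\<open>i\<^sub>l < p\<close>, \<open>j < p^s\<close>), which is the span of the
  vectors dual to the basis of \<open>k[M\<^sub>r\<^sub>;\<^sub>s]\<close>; for \<open>r \<ge> 2\<close> it is unique.\<close>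

definition eta_reduce :: "nat \<Rightarrow> nat \<Rightarrow> nat \<Rightarrow> 'k::field \<Rightarrow> (idx \<Rightarrow> 'k) \<Rightarrow> (idx \<Rightarrow> 'k)" where
  "eta_reduce p r s \<eta> f = (THE g. g \<in> graded_dual (M_sub p r s) \<and> (\<lambda>x. f x - g x) \<in> eta_ideal p r s \<eta>)"

text \<open>Used for \<open>r \<ge> 2\<close> only.  Since the span above is a subcoalgebra of \<open>P\<^sub>r\<close>, stable under the
  antipode, on which the group algebras of \<open>M\<^sub>r\<^sub>;\<^sub>s\<close> and \<open>M\<^sub>r\<^sub>;\<^sub>s\<^sub>,\<^sub>\<eta>\<close> both restrict to the same
  structure, \<open>k[M\<^sub>r\<^sub>;\<^sub>s\<^sub>,\<^sub>\<eta>]\<close> is \<open>k[M\<^sub>r\<^sub>;\<^sub>s]\<close> with another coproduct, namely the one dual to the product of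
  the group algebra \<open>P\<^sub>r / \<langle>u\<^sub>r\<^sub>-\<^sub>1^(p^s) + \<eta> u\<^sub>0\<rangle>\<close>.  On generators it only changes \<open>\<Delta>(\<theta>)\<close>, to
  \<open>\<theta>\<otimes>1 + 1\<otimes>\<theta> - \<eta> (\<Sum>\<^sub>0\<^sub><\<^sub>i\<^sub><\<^sub>p\<^sub>^\<^sub>s \<sigma>\<^sub>i\<otimes>\<sigma>\<^sub>p\<^sub>^\<^sub>s\<^sub>-\<^sub>i + \<Sum>\<^sub>i\<^sub>+\<^sub>j\<^sub>+\<^sub>p\<^sub>=\<^sub>p\<^sub>^\<^sub>s \<sigma>\<^sub>i\<tau>\<otimes>\<sigma>\<^sub>j\<tau>)\<close>.\<close>

definition M_eta :: "nat \<Rightarrow> nat \<Rightarrow> nat \<Rightarrow> 'k::field \<Rightarrow> (idx, 'k) hopf_superalgebra" where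
  "M_eta p r s \<eta> = (let H = M_sub p r s in
     H\<lparr> comult_tab := (\<lambda>x. \<Sum>b\<in>basis H. \<Sum>c\<in>basis H.
       Poly_Mapping.single (b, c) ((- 1) ^ (parity H b * parity H c) *
         eta_reduce p r s \<eta> (dual_mul (M p r) (dual_vec b) (dual_vec c)) x)) \<rparr>)"


section \<open>The supergroup schemes \<open>G\<^sub>a\<^sub>(\<^sub>r\<^sub>)\<close> and \<open>G\<^sub>a\<^sup>-\<close>\<close>

text \<open>Basis \<open>\<theta>^n\<close> with \<open>n < p^r\<close>.\<close>

definition Ga_superalgebra :: "nat \<Rightarrow> nat \<Rightarrow> (nat, 'k::field) superalgebra" where
  "Ga_superalgebra p r =
    \<lparr> basis = {..<p ^ r}, parity = (\<lambda>n. 0), unit_el = Poly_Mapping.single 0 1,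
      mult_tab = (\<lambda>m n. if m + n < p ^ r then Poly_Mapping.single (m + n) 1 else 0) \<rparr>"

definition Ga :: "nat \<Rightarrow> nat \<Rightarrow> (nat, 'k::field) hopf_superalgebra" where
  "Ga p r = (let R = Ga_superalgebra p r in
     superalgebra.extend R
       \<lparr> comult_tab = (\<lambda>n. pow (tensor_square R) (primitive_comult R (Poly_Mapping.single 1 1)) n),
         counit_tab = (\<lambda>n. if n = 0 then 1 else 0),
         antipode_tab = (\<lambda>n. Poly_Mapping.single n ((- 1) ^ n)) \<rparr>)"

text \<open>Basis \<open>\<tau>^n\<close> with \<open>n < 2\<close>.\<close>

definition Ga_odd_superalgebra :: "(nat, 'k::field) superalgebra" where
  "Ga_odd_superalgebra =
    \<lparr> basis = {..<2}, parity = (\<lambda>n. n), unit_el = Poly_Mapping.single 0 1,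
      mult_tab = (\<lambda>m n. if m + n < 2 then Poly_Mapping.single (m + n) 1 else 0) \<rparr>"

definition Ga_odd :: "(nat, 'k::field) hopf_superalgebra" where
  "Ga_odd = (let R = Ga_odd_superalgebra in
     superalgebra.extend R
       \<lparr> comult_tab = (\<lambda>n. pow (tensor_square R) (primitive_comult R (Poly_Mapping.single 1 1)) n),
         counit_tab = (\<lambda>n. if n = 0 then 1 else 0),
         antipode_tab = (\<lambda>n. Poly_Mapping.single n ((- 1) ^ n)) \<rparr>)"


section \<open>Comorphisms of the canonical quotient maps\<close>

text \<open>The inclusions \<open>A[M\<^sub>r\<^sub>;\<^sub>s] \<rightarrow> A[M\<^sub>r\<^sub>;\<^sub>t]\<close> (\<open>s \<le> t\<close>) and \<open>A[M\<^sub>r\<^sub>;\<^sub>s] \<rightarrow> A[M\<^sub>r]\<close>.\<close>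

definition incl_M :: "('k::field \<Rightarrow> 'a::{comm_ring,comm_monoid_mult}) \<Rightarrow> nat \<Rightarrow> nat \<Rightarrow> nat
    \<Rightarrow> (idx \<Rightarrow>\<^sub>0 'a) \<Rightarrow> (idx \<Rightarrow>\<^sub>0 'a)" where
  "incl_M \<iota> p r s = (\<lambda>x\<in>carrier_of (base_change \<iota> (M_sub p r s)). x)"

text \<open>\<open>\<theta> \<mapsto> \<theta>\<close>, from \<open>A[G\<^sub>a\<^sub>(\<^sub>r\<^sub>)]\<close> to \<open>A[M\<^sub>r\<^sub>;\<^sub>t]\<close> or \<open>A[M\<^sub>r]\<close>.\<close>

definition incl_Ga :: "('k::field \<Rightarrow> 'a::{comm_ring,comm_monoid_mult}) \<Rightarrow> nat \<Rightarrow> nat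
    \<Rightarrow> (nat \<Rightarrow>\<^sub>0 'a) \<Rightarrow> (idx \<Rightarrow>\<^sub>0 'a)" where
  "incl_Ga \<iota> p r = (\<lambda>x\<in>carrier_of (base_change \<iota> (Ga p r)).
     lin_ext (\<lambda>n. scalar_ext \<iota> (pow (M p r) (theta p r) n)) x)"

text \<open>\<open>\<tau> \<mapsto> \<tau>\<close>, from \<open>A[G\<^sub>a\<^sup>-]\<close> to \<open>A[M\<^sub>r\<^sub>;\<^sub>t]\<close> or \<open>A[M\<^sub>r]\<close>.\<close>

definition incl_Ga_odd :: "('k::field \<Rightarrow> 'a::{comm_ring,comm_monoid_mult}) \<Rightarrow> nat \<Rightarrow> nat
    \<Rightarrow> (nat \<Rightarrow>\<^sub>0 'a) \<Rightarrow> (idx \<Rightarrow>\<^sub>0 'a)" where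
  "incl_Ga_odd \<iota> p r = (\<lambda>x\<in>carrier_of (base_change \<iota> Ga_odd).
     lin_ext (\<lambda>n. scalar_ext \<iota> (pow (M p r) (tau p r) n)) x)"


section \<open>Generators over \<open>A\<close>\<close>

abbreviation tauA :: "('k::field \<Rightarrow> 'a::{comm_ring,comm_monoid_mult}) \<Rightarrow> nat \<Rightarrow> nat \<Rightarrow> (idx \<Rightarrow>\<^sub>0 'a)" where
  "tauA \<iota> p r \<equiv> scalar_ext \<iota> (tau p r)"

abbreviation thetaA :: "('k::field \<Rightarrow> 'a::{comm_ring,comm_monoid_mult}) \<Rightarrow> nat \<Rightarrow> nat \<Rightarrow> (idx \<Rightarrow>\<^sub>0 'a)" where
  "thetaA \<iota> p r \<equiv> scalar_ext \<iota> (theta p r)"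

abbreviation sigmaA :: "('k::field \<Rightarrow> 'a::{comm_ring,comm_monoid_mult}) \<Rightarrow> nat \<Rightarrow> nat \<Rightarrow> nat \<Rightarrow> (idx \<Rightarrow>\<^sub>0 'a)" where
  "sigmaA \<iota> p r j \<equiv> scalar_ext \<iota> (sigma p r j)"

text \<open>The element \<open>\<Sum>\<^sub>i\<^sub><\<^sub>r a\<^sub>i \<theta>^(p^i)\<close> of \<open>A[M\<^sub>r]\<close>.\<close>

definition additive_poly :: "('k::field \<Rightarrow> 'a::{comm_ring,comm_monoid_mult}) \<Rightarrow> nat \<Rightarrow> nat \<Rightarrow> (nat \<Rightarrow> 'a)
    \<Rightarrow> (idx \<Rightarrow>\<^sub>0 'a)" where
  "additive_poly \<iota> p r a =
     (\<Sum>i<r. scal (a i) (pow (base_change \<iota> (M p r)) (thetaA \<iota> p r) (p ^ i)))"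

text \<open>Tuples \<open>(a\<^sub>0, \<dots>, a\<^sub>r\<^sub>-\<^sub>1)\<close>.\<close>

abbreviation tuples :: "nat \<Rightarrow> (nat \<Rightarrow> 'a) set" where
  "tuples r \<equiv> {..<r} \<rightarrow>\<^sub>E UNIV"

end

theory Submission
  imports Defs "HOL-Computational_Algebra.Polynomial"
begin

text \<open>
  A homomorphism \<open>\<phi>\<close> preserves primitive elements, and the primitive elements of \<open>A[M\<^sub>r]\<close> are the
  multiples of \<open>\<tau>\<close> and the additive polynomials in \<open>\<theta>\<close>.  This determines \<open>\<phi>(\<tau>) = \<mu> \<tau>\<close> and, up to the
  correction for \<open>\<eta>\<close>, \<open>\<phi>(\<theta>)\<close>, hence \<open>\<phi>(\<sigma>\<^sub>1) = c \<sigma>\<^sub>1\<close> with \<open>c = a\<^sub>0^(p^(r-1))\<close>.  By induction on \<open>l\<close>,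
  \<open>\<phi>(\<sigma>\<^sub>p\<^sub>^\<^sub>l)\<close> is determined up to a primitive element, which must be a multiple \<open>b \<sigma>\<^sub>1\<close> because \<open>\<sigma>\<^sub>p\<^sub>^\<^sub>l\<close> has
  \<open>p\<close>-th power \<open>0\<close> and \<open>A\<close> is reduced.  Comparing the coefficients of \<open>\<sigma>\<^sub>1 \<otimes> \<sigma>\<^sub>p\<^sub>-\<^sub>1\<close> and \<open>\<tau> \<otimes> \<tau>\<close> in the
  coproduct of the next \<open>\<phi>(\<sigma>\<^sub>p\<^sub>^\<^sub>l\<^sub>+\<^sub>1)\<close> gives \<open>\<mu>^2 = c^p\<close> in the first step and \<open>b^p = 0\<close>, that is \<open>b = 0\<close>, in
  all later ones; so only the last \<open>b\<close> survives.  Conversely these values satisfy the defining relations.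

  The group algebra of \<open>M\<^sub>r\<^sub>;\<^sub>s\<^sub>,\<^sub>\<eta>\<close> is the quotient of \<open>P\<^sub>r\<close> by \<open>u\<^sub>r\<^sub>-\<^sub>1^(p^s) + \<eta> u\<^sub>0\<close>; dually \<open>k[M\<^sub>r\<^sub>;\<^sub>s\<^sub>,\<^sub>\<eta>]\<close>
  embeds into \<open>k[M\<^sub>r]\<close> by \<open>\<theta> \<mapsto> \<theta> - \<eta> \<sigma>\<^sub>p\<^sub>^\<^sub>s\<close>, and its homomorphisms are obtained from those of \<open>M\<^sub>r\<^sub>;\<^sub>s\<^sub>+\<^sub>1\<close>
  with \<open>b = 0\<close> by composing with this embedding.
\<close>

section \<open>Linear extension\<close>

text \<open>Only the sigma_(p^l) have to be controlled: sigma_(p^l)^m = m! sigma_(m p^l) by Lucas,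
  and m! is invertible for m < p, so base-p digits recover every sigma_j from them. The obstacle to
  existence is that A[M_(r;s)] is only given as a span of monomials. Every homomorphism is therefore
  built on all of A[M_r], through its presentation, with sigma_j sent to 0 for j >= p^s. This
  respects products because p divides C(i+j,i) whenever i, j < p^s <= i+j; compatibility with the
  coproduct is then proved on A[M_(r;s)]. The relation mu^2 = c^p is a weight condition: if sigma_u
  has weight u, the tau-tau terms of the coproduct need mu^2 to have weight p. For M_(r;s,eta), the
  element -phi(theta)/eta satisfies the coproduct equation of phi(sigma_(p^s)), so the induction
  runs one step further than for M_(r;s) and removes b for every s.\<close>

lemma lookup_scalar_ext:
  "\<iota> 0 = 0 \<Longrightarrow> Poly_Mapping.lookup (Poly_Mapping.map \<iota> x) b = \<iota> (Poly_Mapping.lookup x b)"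
  by (simp add: Poly_Mapping.map.rep_eq when_def)

lemma scal_add_right: "scal c (x + y) = scal c x + scal c y"
  by (rule poly_mapping_eqI) (simp add: lookup_add distrib_left)

lemma scal_add_left: "scal (c + d) x = scal c x + scal d x"
  by (rule poly_mapping_eqI) (simp add: lookup_add distrib_right)

lemma scal_minus_right: "scal c (- x) = - scal c x"
  by (rule poly_mapping_eqI) simp

lemma scal_diff_right: "scal c (x - y) = scal c x - scal c y"
  by (rule poly_mapping_eqI) (simp add: lookup_minus right_diff_distrib)

lemma scal_minus_left: "scal (- c) x = - scal c x"
  by (rule poly_mapping_eqI) simp

lemma scal_sum_right: "scal c (\<Sum>i\<in>I. f i) = (\<Sum>i\<in>I. scal c (f i))"
  by (rule poly_mapping_eqI) (simp add: lookup_sum sum_distrib_left)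

lemma scal_sum_left: "scal (\<Sum>i\<in>I. c i) x = (\<Sum>i\<in>I. scal (c i) x)"
  by (rule poly_mapping_eqI) (simp add: lookup_sum sum_distrib_right)

lemma lin_ext_superset:
  assumes "finite F" "Poly_Mapping.keys x \<subseteq> F"
  shows "lin_ext f x = (\<Sum>b\<in>F. scal (Poly_Mapping.lookup x b) (f b))"
  unfolding lin_ext_def using assms
  by (intro sum.mono_neutral_left) (auto simp: in_keys_iff)

lemma lin_ext_zero [simp]: "lin_ext f 0 = 0"
  by (simp add: lin_ext_def)

lemma lin_ext_add: "lin_ext f (x + y) = lin_ext f x + lin_ext f y"
proof -
  let ?F = "Poly_Mapping.keys x \<union> Poly_Mapping.keys y"
  have "Poly_Mapping.keys (x + y) \<subseteq> ?F" by (rule keys_add)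
  then show ?thesis
    by (simp add: lin_ext_superset[of ?F] lookup_add scal_add_left sum.distrib)
qed

lemma lin_ext_scal: "lin_ext f (scal c x) = scal c (lin_ext f x)"
  using keys_scal[of c x]
  by (simp add: lin_ext_superset[of "Poly_Mapping.keys x"] scal_sum_right)

lemma lin_ext_minus: "lin_ext f (- x) = - lin_ext f x"
  using lin_ext_add[of f x "- x"] by (simp add: eq_neg_iff_add_eq_0 add.commute)

lemma lin_ext_diff: "lin_ext f (x - y) = lin_ext f x - lin_ext f y"
  using lin_ext_add[of f x "- y"] by (simp add: lin_ext_minus)

lemma lin_ext_sum: "lin_ext f (\<Sum>i\<in>I. x i) = (\<Sum>i\<in>I. lin_ext f (x i))"
  by (induction I rule: infinite_finite_induct) (auto simp: lin_ext_add)

lemmas lin_ext_linear = lin_ext_add lin_ext_scal lin_ext_minus lin_ext_diff lin_ext_sum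

lemma lin_ext_cong: "(\<And>b. b \<in> Poly_Mapping.keys x \<Longrightarrow> f b = g b) \<Longrightarrow> lin_ext f x = lin_ext g x"
  by (simp add: lin_ext_def)

lemma lin_ext_fun_add: "lin_ext (\<lambda>b. f b + g b) x = lin_ext f x + lin_ext g x"
  by (simp add: lin_ext_def scal_add_right sum.distrib)

lemma lin_ext_fun_scal: "lin_ext (\<lambda>b. scal c (f b)) x = scal c (lin_ext f x)"
  by (simp add: lin_ext_def scal_sum_right mult.commute)

lemma lin_ext_fun_zero [simp]: "lin_ext (\<lambda>b. 0) x = 0"
  by (simp add: lin_ext_def)

lemma poly_mapping_sum_single:
  fixes x :: "'b \<Rightarrow>\<^sub>0 'a::comm_monoid_add"
  shows "(\<Sum>b\<in>Poly_Mapping.keys x. Poly_Mapping.single b (Poly_Mapping.lookup x b)) = x"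
  by (rule poly_mapping_eqI) (simp add: lookup_sum lookup_single when_def in_keys_iff)

lemma lin_ext_id: "lin_ext (\<lambda>b. Poly_Mapping.single b (1::'a::{comm_ring,comm_monoid_mult})) x = x"
  by (simp add: lin_ext_def poly_mapping_sum_single)

text \<open>Bilinear identities are reduced to basis elements by nesting this rule, once per
  argument. The set B carries what must be known of the index, such as membership in a basis or a
  fixed parity.\<close>

lemma poly_mapping_linear_induct [consumes 1, case_names zero add single]:
  fixes x :: "'b \<Rightarrow>\<^sub>0 'a::comm_monoid_add"
  assumes "Poly_Mapping.keys x \<subseteq> B" and "P 0" and "\<And>x y. P x \<Longrightarrow> P y \<Longrightarrow> P (x + y)"
    and "\<And>b c. b \<in> B \<Longrightarrow> P (Poly_Mapping.single b c)"
  shows "P x"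
proof -
  have "P (\<Sum>b\<in>F. Poly_Mapping.single b (Poly_Mapping.lookup x b))"
    if "finite F" "F \<subseteq> B" for F
    using that by (induction F) (auto intro: assms)
  from this[of "Poly_Mapping.keys x"] show ?thesis
    using assms(1) by (simp add: poly_mapping_sum_single)
qed

lemma lin_ext_compose: "lin_ext f (lin_ext g x) = lin_ext (\<lambda>b. lin_ext f (g b)) x"
  by (simp add: lin_ext_def[of g] lin_ext_def[of "\<lambda>b. lin_ext f (g b)"] lin_ext_linear)

lemma mul_add_left: "mul H (x + y) z = mul H x z + mul H y z"
  and mul_add_right: "mul H z (x + y) = mul H z x + mul H z y"
  and mul_scal_left: "mul H (scal c x) z = scal c (mul H x z)"
  and mul_scal_right: "mul H z (scal c x) = scal c (mul H z x)"
  and mul_minus_left: "mul H (- x) z = - mul H x z"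
  and mul_zero_left [simp]: "mul H 0 z = 0"
  and mul_zero_right [simp]: "mul H z 0 = 0"
  by (simp_all add: mul_def lin_ext_linear lin_ext_fun_add lin_ext_fun_scal)

lemma mul_minus_right: "mul H z (- x) = - mul H z x"
  using mul_add_right[of H z x "- x"] by (simp add: eq_neg_iff_add_eq_0 add.commute)

lemma mul_sum_left: "mul H (\<Sum>i\<in>I. f i) z = (\<Sum>i\<in>I. mul H (f i) z)"
  by (simp add: mul_def lin_ext_linear)

lemma mul_sum_right: "mul H z (\<Sum>i\<in>I. f i) = (\<Sum>i\<in>I. mul H z (f i))"
  by (induction I rule: infinite_finite_induct) (auto simp: mul_add_right)

lemma mul_diff_left: "mul H (x - y) z = mul H x z - mul H y z"
  using mul_add_left[of H x "- y" z] by (simp add: mul_minus_left)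

lemma mul_diff_right: "mul H z (x - y) = mul H z x - mul H z y"
  using mul_add_right[of H z x "- y"] by (simp add: mul_minus_right)

lemmas mul_linear = mul_add_left mul_add_right mul_scal_left mul_scal_right mul_minus_left
  mul_minus_right mul_diff_left mul_diff_right mul_sum_left mul_sum_right

lemma lookup_tensor [simp]:
  "Poly_Mapping.lookup (tensor x y) (b, c) = Poly_Mapping.lookup x b * Poly_Mapping.lookup y c"
proof -
  have "Poly_Mapping.lookup (tensor x y) (b, c) =
    (\<Sum>b'\<in>Poly_Mapping.keys x. \<Sum>c'\<in>Poly_Mapping.keys y. if b' = b \<and> c' = c
        then Poly_Mapping.lookup x b' * Poly_Mapping.lookup y c' else 0)"
    by (auto simp: tensor_def lookup_sum lookup_single when_def intro!: sum.cong)
  also have "\<dots> = (\<Sum>b'\<in>Poly_Mapping.keys x. if b' = b then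
      (\<Sum>c'\<in>Poly_Mapping.keys y. if c' = c then Poly_Mapping.lookup x b' * Poly_Mapping.lookup y c' else 0) else 0)"
    by (intro sum.cong) auto
  also have "\<dots> = Poly_Mapping.lookup x b * Poly_Mapping.lookup y c"
    by (simp add: sum.delta' sum.delta in_keys_iff)
  finally show ?thesis .
qed

lemma tensor_add_left: "tensor (x + y) z = tensor x z + tensor y z"
  and tensor_add_right: "tensor z (x + y) = tensor z x + tensor z y"
  and tensor_scal_left: "tensor (scal c x) z = scal c (tensor x z)"
  and tensor_scal_right: "tensor z (scal c x) = scal c (tensor z x)"
  and tensor_minus_left: "tensor (- x) z = - tensor x z"
  and tensor_minus_right: "tensor z (- x) = - tensor z x"
  and tensor_diff_left: "tensor (x - y) z = tensor x z - tensor y z"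
  and tensor_diff_right: "tensor z (x - y) = tensor z x - tensor z y"
  and tensor_zero_left [simp]: "tensor 0 z = 0"
  and tensor_zero_right [simp]: "tensor z 0 = 0"
  by (auto intro!: poly_mapping_eqI simp: lookup_add lookup_minus algebra_simps)

lemma tensor_sum_left: "tensor (\<Sum>i\<in>I. f i) z = (\<Sum>i\<in>I. tensor (f i) z)"
  by (induction I rule: infinite_finite_induct) (auto simp: tensor_add_left)

lemma tensor_sum_right: "tensor z (\<Sum>i\<in>I. f i) = (\<Sum>i\<in>I. tensor z (f i))"
  by (induction I rule: infinite_finite_induct) (auto simp: tensor_add_right)

lemmas tensor_linear = tensor_add_left tensor_add_right tensor_scal_left tensor_scal_right
  tensor_minus_left tensor_minus_right tensor_diff_left tensor_diff_right tensor_sum_left tensor_sum_right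

lemma tensor_single [simp]:
  "tensor (Poly_Mapping.single b c) (Poly_Mapping.single b' c') = Poly_Mapping.single (b, b') (c * c')"
  by (rule poly_mapping_eqI) (auto simp: lookup_single when_def split: if_splits)

lemma keys_tensor: "Poly_Mapping.keys (tensor x y) \<subseteq> Poly_Mapping.keys x \<times> Poly_Mapping.keys y"
  by (auto simp: in_keys_iff)

lemma tensor_map_linear:
  "tensor_map \<phi> (x + y) = tensor_map \<phi> x + tensor_map \<phi> y"
  "tensor_map \<phi> (scal c x) = scal c (tensor_map \<phi> x)"
  "tensor_map \<phi> (- x) = - tensor_map \<phi> x"
  "tensor_map \<phi> (x - y) = tensor_map \<phi> x - tensor_map \<phi> y"
  "tensor_map \<phi> (\<Sum>i\<in>I. f i) = (\<Sum>i\<in>I. tensor_map \<phi> (f i))"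
  "tensor_map \<phi> 0 = 0"
  by (simp_all add: tensor_map_def lin_ext_linear)

lemma tensor_map_single:
  "tensor_map \<phi> (Poly_Mapping.single (b, c) a) =
    scal a (tensor (\<phi> (Poly_Mapping.single b 1)) (\<phi> (Poly_Mapping.single c 1)))"
  by (simp add: tensor_map_def)

lemma tensor_map_cong:
  assumes "Poly_Mapping.keys x \<subseteq> B \<times> B" "\<And>b. b \<in> B \<Longrightarrow> \<phi> (Poly_Mapping.single b 1) = \<psi> (Poly_Mapping.single b 1)"
  shows "tensor_map \<phi> x = tensor_map \<psi> x"
  unfolding tensor_map_def using assms by (intro lin_ext_cong) auto

lemma tensor_map_lin_ext_tensor:
  "tensor_map (lin_ext f) (tensor x y) = tensor (lin_ext f x) (lin_ext f y)"
proof (induction x rule: poly_mapping_linear_induct[OF subset_UNIV, case_names zero add single])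
  case (single b c)
  show ?case
  proof (induction y rule: poly_mapping_linear_induct[OF subset_UNIV, case_names zero add single])
    case (single b' c')
    show ?case by (simp add: tensor_map_single tensor_linear mult.commute)
  qed (simp_all add: tensor_linear tensor_map_linear lin_ext_linear)
qed (simp_all add: tensor_linear tensor_map_linear lin_ext_linear)

lemma tensor_map_compose:
  "tensor_map (lin_ext f) (tensor_map \<phi> x) = tensor_map (\<lambda>z. lin_ext f (\<phi> z)) x"
proof (induction x rule: poly_mapping_linear_induct[OF subset_UNIV, case_names zero add single])
  case (single b c)
  show ?case by (cases b) (simp add: tensor_map_single tensor_map_linear tensor_map_lin_ext_tensor)
qed (simp_all add: tensor_map_linear)

lemma tensor_map_id:
  assumes "Poly_Mapping.keys x \<subseteq> B \<times> B" "\<And>b. b \<in> B \<Longrightarrow> \<phi> (Poly_Mapping.single b 1) = Poly_Mapping.single b 1"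
  shows "tensor_map \<phi> x = x"
  using assms(1)
proof (induction x rule: poly_mapping_linear_induct)
  case (single b c)
  then show ?case by (cases b) (simp add: tensor_map_single assms(2))
qed (simp_all add: tensor_map_linear)

lemma carrier_of_iff: "x \<in> carrier_of H \<longleftrightarrow> Poly_Mapping.keys x \<subseteq> basis H"
  by (simp add: carrier_of_def)

lemma carrier_of_lookup: "x \<in> carrier_of H \<longleftrightarrow> (\<forall>b. b \<notin> basis H \<longrightarrow> Poly_Mapping.lookup x b = 0)"
  by (auto simp: carrier_of_def in_keys_iff)

lemma carrier_closed:
  "0 \<in> carrier_of H"
  "x \<in> carrier_of H \<Longrightarrow> y \<in> carrier_of H \<Longrightarrow> x + y \<in> carrier_of H"
  "x \<in> carrier_of H \<Longrightarrow> y \<in> carrier_of H \<Longrightarrow> x - y \<in> carrier_of H"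
  "x \<in> carrier_of H \<Longrightarrow> - x \<in> carrier_of H"
  "b \<in> basis H \<Longrightarrow> Poly_Mapping.single b a \<in> carrier_of H"
  by (auto simp: carrier_of_lookup lookup_add lookup_minus lookup_single when_def)

lemma carrier_scal: "x \<in> carrier_of H \<Longrightarrow> scal c x \<in> carrier_of H"
  by (simp add: carrier_of_lookup)

lemma carrier_sum: "(\<And>i. i \<in> I \<Longrightarrow> f i \<in> carrier_of H) \<Longrightarrow> (\<Sum>i\<in>I. f i) \<in> carrier_of H"
  by (auto simp: carrier_of_lookup lookup_sum intro!: sum.neutral)

lemma carrier_lin_ext:
  "x \<in> carrier_of H \<Longrightarrow> (\<And>b. b \<in> basis H \<Longrightarrow> f b \<in> carrier_of H') \<Longrightarrow> lin_ext f x \<in> carrier_of H'"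
  unfolding lin_ext_def by (intro carrier_sum carrier_scal) (auto simp: carrier_of_def)

lemma homogeneous_lookup: "homogeneous H e x \<longleftrightarrow> (\<forall>b. Poly_Mapping.lookup x b \<noteq> 0 \<longrightarrow> parity H b = e)"
  by (auto simp: homogeneous_def in_keys_iff)

lemma homogeneous_closed:
  "homogeneous H e 0"
  "homogeneous H e x \<Longrightarrow> homogeneous H e y \<Longrightarrow> homogeneous H e (x + y)"
  "homogeneous H e x \<Longrightarrow> homogeneous H e y \<Longrightarrow> homogeneous H e (x - y)"
  "homogeneous H e x \<Longrightarrow> homogeneous H e (scal c x)"
  "parity H b = e \<Longrightarrow> homogeneous H e (Poly_Mapping.single b a)"
proof -
  have *: "homogeneous H e z \<longleftrightarrow> (\<forall>b. parity H b \<noteq> e \<longrightarrow> Poly_Mapping.lookup z b = 0)" for z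
    by (auto simp: homogeneous_lookup)
  show "homogeneous H e 0"
    "homogeneous H e x \<Longrightarrow> homogeneous H e y \<Longrightarrow> homogeneous H e (x + y)"
    "homogeneous H e x \<Longrightarrow> homogeneous H e y \<Longrightarrow> homogeneous H e (x - y)"
    "homogeneous H e x \<Longrightarrow> homogeneous H e (scal c x)"
    "parity H b = e \<Longrightarrow> homogeneous H e (Poly_Mapping.single b a)"
    unfolding * by (auto simp: lookup_add lookup_minus lookup_single when_def)
qed

lemma homogeneous_sum:
  fixes f :: "'i \<Rightarrow> 'b \<Rightarrow>\<^sub>0 'a::comm_ring"
  shows "(\<And>i. i \<in> I \<Longrightarrow> homogeneous H e (f i)) \<Longrightarrow> homogeneous H e (\<Sum>i\<in>I. f i)"
  by (induction I rule: infinite_finite_induct) (simp_all add: homogeneous_closed)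

lemma homogeneous_lin_ext:
  "homogeneous H e x \<Longrightarrow> (\<And>b. parity H b = e \<Longrightarrow> homogeneous H' e (f b)) \<Longrightarrow> homogeneous H' e (lin_ext f x)"
  unfolding lin_ext_def by (intro homogeneous_sum homogeneous_closed(4)) (auto simp: homogeneous_def)

section \<open>Superalgebras with a monomial basis\<close>

text \<open>Associativity is required of all finitely supported functions, since the monomial rules
  of the instances multiply indices outside the basis as well; closure and the unit laws are
  confined to the carrier.\<close>

locale assoc_superalgebra =
  fixes H :: "('b, 'a::{comm_ring,comm_monoid_mult}, 'z) superalgebra_scheme"
  assumes mul_assoc: "mul H (mul H x y) z = mul H x (mul H y z)"
    and mul_closed: "x \<in> carrier_of H \<Longrightarrow> y \<in> carrier_of H \<Longrightarrow> mul H x y \<in> carrier_of H"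
    and unit_closed: "unit_el H \<in> carrier_of H"
    and unit_left: "x \<in> carrier_of H \<Longrightarrow> mul H (unit_el H) x = x"
    and unit_right: "x \<in> carrier_of H \<Longrightarrow> mul H x (unit_el H) = x"
begin

lemma pow_0: "pow H x 0 = unit_el H"
  and pow_Suc: "pow H x (Suc n) = mul H x (pow H x n)"
  by (simp_all add: pow_def)

lemma pow_1: "x \<in> carrier_of H \<Longrightarrow> pow H x (Suc 0) = x"
  by (simp add: pow_Suc pow_0 unit_right)

lemma pow_closed: "x \<in> carrier_of H \<Longrightarrow> pow H x n \<in> carrier_of H"
  by (induction n) (auto simp: pow_0 pow_Suc unit_closed mul_closed)

lemma pow_add: "x \<in> carrier_of H \<Longrightarrow> pow H x (m + n) = mul H (pow H x m) (pow H x n)"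
  by (induction m) (auto simp: pow_0 pow_Suc unit_left pow_closed mul_assoc)

lemma pow_mult: "x \<in> carrier_of H \<Longrightarrow> pow H x (m * n) = pow H (pow H x m) n"
  by (induction n) (auto simp: pow_0 pow_Suc pow_add)

lemma pow_scal: "pow H (scal c x) n = scal (c ^ n) (pow H x n)"
  by (induction n) (simp_all add: pow_0 pow_Suc mul_scal_left mul_scal_right mult.commute)

lemma pow_zero: "n > 0 \<Longrightarrow> pow H 0 n = 0"
  by (cases n) (auto simp: pow_Suc)

lemma pow_eq_zero_ge:
  "x \<in> carrier_of H \<Longrightarrow> pow H x m = 0 \<Longrightarrow> m \<le> n \<Longrightarrow> pow H x n = 0"
  using pow_add[of x m "n - m"] by simp

lemma commute_pow:
  assumes "x \<in> carrier_of H" "y \<in> carrier_of H" "mul H x y = mul H y x"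
  shows "mul H x (pow H y n) = mul H (pow H y n) x"
proof (induction n)
  case 0 show ?case using assms by (simp add: pow_0 unit_left unit_right)
next
  case (Suc n)
  have "mul H x (pow H y (Suc n)) = mul H y (mul H x (pow H y n))"
    by (simp add: pow_Suc assms(3) mul_assoc flip: mul_assoc[of x y])
  then show ?case by (simp add: Suc pow_Suc mul_assoc)
qed

lemma mul_left_commute: "mul H x y = mul H y x \<Longrightarrow> mul H x (mul H y z) = mul H y (mul H x z)"
  by (simp flip: mul_assoc)

end

section \<open>Scalars in A, the binomial theorem and the Frobenius map\<close>

locale algebra_over =
  fixes \<iota> :: "'k::field \<Rightarrow> 'a::{comm_ring,comm_monoid_mult}"
  assumes algebra: "algebra_map \<iota>"
begin

lemma map_1 [simp]: "\<iota> 1 = 1"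
  and map_add: "\<iota> (x + y) = \<iota> x + \<iota> y"
  and map_mult: "\<iota> (x * y) = \<iota> x * \<iota> y"
  using algebra by (auto simp: algebra_map_def)

lemma map_0 [simp]: "\<iota> 0 = 0"
  using map_add[of 0 0] by simp

lemma map_minus: "\<iota> (- x) = - \<iota> x"
  using map_add[of x "- x"] by (simp add: eq_neg_iff_add_eq_0 add.commute)

lemma map_power: "\<iota> (x ^ n) = \<iota> x ^ n"
  by (induction n) (auto simp: map_mult)

lemma map_sum: "\<iota> (\<Sum>i\<in>I. f i) = (\<Sum>i\<in>I. \<iota> (f i))"
  by (induction I rule: infinite_finite_induct) (auto simp: map_add)

text \<open>A may be the zero ring, whereas \<open>of_nat\<close> presupposes that 0 and 1 differ.
  Natural numbers therefore enter A through k, where those prime to p are invertible.\<close>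

definition nu :: "nat \<Rightarrow> 'a" where "nu n = \<iota> (of_nat n)"

lemma nu_simps [simp]: "nu 0 = 0" "nu (Suc 0) = 1" "nu 1 = 1"
  and nu_add: "nu (m + n) = nu m + nu n"
  and nu_mult: "nu (m * n) = nu m * nu n"
  by (simp_all add: nu_def map_add map_mult)

lemma nu_eq: "of_nat m = (of_nat n :: 'k) \<Longrightarrow> nu m = nu n"
  by (simp add: nu_def)

lemma nu_dvd: "CHAR('k) dvd n \<Longrightarrow> nu n = 0"
  by (simp add: nu_def of_nat_eq_0_iff_char_dvd[THEN iffD2])

lemma nu_inverse: "\<not> CHAR('k) dvd n \<Longrightarrow> \<iota> (inverse (of_nat n)) * nu n = 1"
  by (simp add: nu_def of_nat_eq_0_iff_char_dvd flip: map_mult)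

lemma nu_cancel: "\<not> CHAR('k) dvd n \<Longrightarrow> nu n * x = 0 \<Longrightarrow> x = 0"
  by (metis nu_inverse mult.assoc mult.commute mult_1 mult_zero_right)

lemma scal_nu_cancel: "\<not> CHAR('k) dvd n \<Longrightarrow> scal (nu n) x = scal (nu n) y \<Longrightarrow> x = y"
proof -
  assume n: "\<not> CHAR('k) dvd n" and e: "scal (nu n) x = scal (nu n) y"
  have "scal (\<iota> (inverse (of_nat n))) (scal (nu n) x) = scal (\<iota> (inverse (of_nat n))) (scal (nu n) y)"
    by (simp only: e)
  then show "x = y" by (simp only: scal_simps nu_inverse[OF n] scal_one)
qed

lemma lookup_scalar_ext [simp]: "Poly_Mapping.lookup (scalar_ext \<iota> x) b = \<iota> (Poly_Mapping.lookup x b)"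
  by (simp add: Submission.lookup_scalar_ext)

lemma scalar_ext_simps:
  "scalar_ext \<iota> 0 = 0"
  "scalar_ext \<iota> (x + y) = scalar_ext \<iota> x + scalar_ext \<iota> y"
  "scalar_ext \<iota> (scal c x) = scal (\<iota> c) (scalar_ext \<iota> x)"
  "scalar_ext \<iota> (Poly_Mapping.single b c) = Poly_Mapping.single b (\<iota> c)"
  by (auto intro!: poly_mapping_eqI simp: lookup_add map_add map_mult lookup_single when_def)

lemma scalar_ext_sum: "scalar_ext \<iota> (\<Sum>i\<in>I. f i) = (\<Sum>i\<in>I. scalar_ext \<iota> (f i))"
  by (induction I rule: infinite_finite_induct) (auto simp: scalar_ext_simps)

lemma scalar_ext_tensor: "scalar_ext \<iota> (tensor x y) = tensor (scalar_ext \<iota> x) (scalar_ext \<iota> y)"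
  by (rule poly_mapping_eqI) (auto simp: map_mult)

lemma scalar_ext_mul:
  assumes "\<And>b c. mult_tab H' b c = scalar_ext \<iota> (mult_tab H b c)"
  shows "scalar_ext \<iota> (mul H x y) = mul H' (scalar_ext \<iota> x) (scalar_ext \<iota> y)"
proof (induction x rule: poly_mapping_linear_induct[OF subset_UNIV, case_names zero add single])
  case (single b c)
  show ?case
  proof (induction y rule: poly_mapping_linear_induct[OF subset_UNIV, case_names zero add single])
    case (single b' c')
    show ?case by (simp add: scalar_ext_simps assms map_mult)
  qed (simp_all add: mul_linear scalar_ext_simps)
qed (simp_all add: mul_linear scalar_ext_simps)

lemma scalar_ext_pow:
  assumes "\<And>b c. mult_tab H' b c = scalar_ext \<iota> (mult_tab H b c)" "unit_el H' = scalar_ext \<iota> (unit_el H)"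
  shows "scalar_ext \<iota> (pow H x n) = pow H' (scalar_ext \<iota> x) n"
  by (induction n) (simp_all add: pow_def assms(2) scalar_ext_mul[OF assms(1)])

lemma tensor_square_scalar_ext:
  assumes "\<And>b c. mult_tab H' b c = scalar_ext \<iota> (mult_tab H b c)" "unit_el H' = scalar_ext \<iota> (unit_el H)"
    "parity H' = parity H"
  shows "mult_tab (tensor_square H') b c = scalar_ext \<iota> (mult_tab (tensor_square H) b c)"
    and "unit_el (tensor_square H') = scalar_ext \<iota> (unit_el (tensor_square H))"
proof -
  show "mult_tab (tensor_square H') b c = scalar_ext \<iota> (mult_tab (tensor_square H) b c)"
    by (cases b; cases c)
      (simp add: tensor_square_def assms scalar_ext_simps scalar_ext_tensor map_power map_minus)
  show "unit_el (tensor_square H') = scalar_ext \<iota> (unit_el (tensor_square H))"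
    by (simp add: tensor_square_def assms scalar_ext_tensor)
qed

lemma map_uminus_power: "\<iota> ((- 1) ^ n) = (- 1) ^ n"
  by (simp add: map_power map_minus)

text \<open>Commutation is asked of the two elements only: the tensor square, where coproducts of
  powers are expanded, contains anticommuting odd elements.\<close>

lemma binomial_pow:
  fixes H :: "('b, 'a, 'z) superalgebra_scheme"
  assumes "assoc_superalgebra H" "x \<in> carrier_of H" "y \<in> carrier_of H" "mul H x y = mul H y x"
  shows "pow H (x + y) n =
    (\<Sum>k\<le>n. scal (nu (n choose k)) (mul H (pow H x k) (pow H y (n - k))))"
proof -
  interpret assoc_superalgebra H by fact
  define P where "P k m = mul H (pow H x k) (pow H y m)" for k m
  have x: "mul H x (P k m) = P (Suc k) m" for k m
    by (simp add: P_def pow_Suc mul_assoc)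
  have y: "mul H y (P k m) = P k (Suc m)" for k m
  proof -
    have "mul H y (pow H x k) = mul H (pow H x k) y"
      using commute_pow[of y x k] assms by simp
    then show ?thesis by (simp add: P_def pow_Suc flip: mul_assoc)
  qed
  have "pow H (x + y) n = (\<Sum>k\<le>n. scal (nu (n choose k)) (P k (n - k)))"
  proof (induction n)
    case 0 show ?case by (simp add: pow_0 P_def unit_left unit_closed)
  next
    case (Suc n)
    have "pow H (x + y) (Suc n) =
        (\<Sum>k\<le>n. scal (nu (n choose k)) (P (Suc k) (n - k))) +
        (\<Sum>k\<le>n. scal (nu (n choose k)) (P k (Suc n - k)))"
      unfolding pow_Suc Suc mul_add_left mul_sum_right mul_scal_right x y
      by (simp add: Suc_diff_le sum.distrib scal_add_right mul_add_left)
    also have "(\<Sum>k\<le>n. scal (nu (n choose k)) (P k (Suc n - k))) =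
        (\<Sum>k\<le>Suc n. scal (nu (n choose k)) (P k (Suc n - k)))"
      by (simp add: binomial_eq_0)
    also have "\<dots> = P 0 (Suc n) + (\<Sum>k\<le>n. scal (nu (n choose Suc k)) (P (Suc k) (n - k)))"
      by (subst sum.atMost_Suc_shift) simp
    also have "(\<Sum>k\<le>n. scal (nu (n choose k)) (P (Suc k) (n - k))) + \<dots> =
        P 0 (Suc n) + (\<Sum>k\<le>n. scal (nu (Suc n choose Suc k)) (P (Suc k) (n - k)))"
      by (simp add: sum.distrib nu_add scal_add_left)
    also have "\<dots> = (\<Sum>k\<le>Suc n. scal (nu (Suc n choose k)) (P k (Suc n - k)))"
      by (subst sum.atMost_Suc_shift) simp
    finally show ?case .
  qed
  then show ?thesis by (simp add: P_def)
qed

lemma frobenius_add: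
  fixes H :: "('b, 'a, 'z) superalgebra_scheme"
  assumes "assoc_superalgebra H" "x \<in> carrier_of H" "y \<in> carrier_of H" "mul H x y = mul H y x"
    and "prime CHAR('k)"
  shows "pow H (x + y) (CHAR('k) ^ l) = pow H x (CHAR('k) ^ l) + pow H y (CHAR('k) ^ l)"
proof -
  interpret assoc_superalgebra H by fact
  let ?n = "CHAR('k) ^ l"
  have n: "?n > 0" using assms(5) by (simp add: prime_gt_0_nat)
  have "pow H (x + y) ?n = (\<Sum>k\<le>?n. scal (nu (?n choose k)) (mul H (pow H x k) (pow H y (?n - k))))"
    by (rule binomial_pow) fact+
  also have "\<dots> = (\<Sum>k\<in>{0, ?n}. scal (nu (?n choose k)) (mul H (pow H x k) (pow H y (?n - k))))"
  proof (rule sum.mono_neutral_right)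
    show "\<forall>k\<in>{..?n} - {0, ?n}. scal (nu (?n choose k)) (mul H (pow H x k) (pow H y (?n - k))) = 0"
      using prime_dvd_choose_power[OF assms(5)] by (auto simp: nu_dvd)
  qed auto
  also have "\<dots> = pow H x ?n + pow H y ?n"
    using n assms by (simp add: pow_0 unit_left unit_right pow_closed add.commute)
  finally show ?thesis .
qed

lemma frobenius_sum:
  fixes H :: "('b, 'a, 'z) superalgebra_scheme"
  assumes "assoc_superalgebra H" "\<And>i. i \<in> I \<Longrightarrow> f i \<in> carrier_of H"
    "\<And>i j. i \<in> I \<Longrightarrow> j \<in> I \<Longrightarrow> mul H (f i) (f j) = mul H (f j) (f i)"
    and "prime CHAR('k)"
  shows "pow H (\<Sum>i\<in>I. f i) (CHAR('k) ^ l) = (\<Sum>i\<in>I. pow H (f i) (CHAR('k) ^ l))"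
  using assms(2,3)
proof (induction I rule: infinite_finite_induct)
  case (insert i I)
  have "mul H (f i) (\<Sum>i\<in>I. f i) = mul H (\<Sum>i\<in>I. f i) (f i)"
    by (simp add: mul_sum_left mul_sum_right insert.prems)
  then show ?case
    using insert by (simp add: frobenius_add[OF assms(1)] carrier_sum assms(4))
qed (use assms(4) in \<open>simp_all add: assoc_superalgebra.pow_zero[OF assms(1)] prime_gt_0_nat\<close>)

end

text \<open>In A[M_r], its tensor square and the truncated polynomial rings, a product of basis
  elements is a scalar times a single index. Associativity is then the 2-cocycle identity for
  \<kappa>, and \<open>op\<close> may leave the basis where \<kappa> is 0.\<close>

locale monomial_superalgebra =
  fixes H :: "('b, 'a::{comm_ring,comm_monoid_mult}, 'z) superalgebra_scheme"
    and op :: "'b \<Rightarrow> 'b \<Rightarrow> 'b" and \<kappa> :: "'b \<Rightarrow> 'b \<Rightarrow> 'a" and one :: 'b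
  assumes tab: "mult_tab H b c = Poly_Mapping.single (op b c) (\<kappa> b c)"
    and unit: "unit_el H = Poly_Mapping.single one 1"
    and op_assoc: "op (op a b) c = op a (op b c)"
    and cocycle: "\<kappa> a b * \<kappa> (op a b) c = \<kappa> b c * \<kappa> a (op b c)"
    and op_closed: "a \<in> basis H \<Longrightarrow> b \<in> basis H \<Longrightarrow> op a b \<in> basis H \<or> \<kappa> a b = 0"
    and one_closed: "one \<in> basis H"
    and one_left: "a \<in> basis H \<Longrightarrow> op one a = a \<and> \<kappa> one a = 1"
    and one_right: "a \<in> basis H \<Longrightarrow> op a one = a \<and> \<kappa> a one = 1"
begin

lemma mul_singles:
  "mul H (Poly_Mapping.single b x) (Poly_Mapping.single c y) = Poly_Mapping.single (op b c) (x * y * \<kappa> b c)"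
  by (simp add: tab)

sublocale assoc_superalgebra H
proof
  show "mul H (mul H x y) z = mul H x (mul H y z)" for x y z
  proof (induction x rule: poly_mapping_linear_induct[OF subset_UNIV, case_names zero add single])
    case (single a u)
    show ?case
    proof (induction y rule: poly_mapping_linear_induct[OF subset_UNIV, case_names zero add single])
      case (single b v)
      show ?case
      proof (induction z rule: poly_mapping_linear_induct[OF subset_UNIV, case_names zero add single])
        case (single c w)
        have "u * v * \<kappa> a b * w * \<kappa> (op a b) c = u * v * w * (\<kappa> a b * \<kappa> (op a b) c)"
          by (simp add: algebra_simps)
        also have "\<dots> = u * (v * w * \<kappa> b c) * \<kappa> a (op b c)"
          by (simp add: cocycle algebra_simps)
        finally show ?case by (simp add: mul_singles op_assoc del: mul_single)
      qed (simp_all add: mul_linear)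
    qed (simp_all add: mul_linear)
  qed (simp_all add: mul_linear)
  show "mul H x y \<in> carrier_of H" if "x \<in> carrier_of H" "y \<in> carrier_of H" for x y
    unfolding mul_def using op_closed
    by (intro carrier_lin_ext[OF that(1)] carrier_lin_ext[OF that(2)])
      (fastforce simp: tab carrier_of_iff)
  show "unit_el H \<in> carrier_of H"
    using one_closed by (simp add: unit carrier_closed)
  show "mul H (unit_el H) x = x" if "x \<in> carrier_of H" for x
    using that unfolding carrier_of_iff
    by (induction x rule: poly_mapping_linear_induct) (simp_all add: mul_linear unit mul_singles one_left del: mul_single)
  show "mul H x (unit_el H) = x" if "x \<in> carrier_of H" for x
    using that unfolding carrier_of_iff
    by (induction x rule: poly_mapping_linear_induct) (simp_all add: mul_linear unit mul_singles one_right del: mul_single)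
qed

end

text \<open>Parities add as natural numbers, not modulo 2. In the instances a product index of
  parity 2 or more has coefficient 0.\<close>

locale graded_monomial_superalgebra = monomial_superalgebra +
  assumes par: "parity H (op a b) = parity H a + parity H b"
    and par_one: "parity H one = 0"
begin

definition op_T :: "'a \<times> 'a \<Rightarrow> 'a \<times> 'a \<Rightarrow> 'a \<times> 'a" where
  "op_T = (\<lambda>(b, c) (b', c'). (op b b', op c c'))"

definition kappa_T :: "'a \<times> 'a \<Rightarrow> 'a \<times> 'a \<Rightarrow> 'b" where
  "kappa_T = (\<lambda>(b, c) (b', c'). (- 1) ^ (parity H c * parity H b') * \<kappa> b b' * \<kappa> c c')"

text \<open>The exponent of the sign is biadditive in the parities, so the sign is a 2-cocycle by
  itself; together with the two copies of \<kappa> it gives a product of cocycles, which is a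
  cocycle.\<close>

lemma tensor_square_monomial: "monomial_superalgebra (tensor_square H) op_T kappa_T (one, one)"
proof
  fix a b c :: "'a \<times> 'a"
  show "mult_tab (tensor_square H) b c = Poly_Mapping.single (op_T b c) (kappa_T b c)"
    by (cases b; cases c) (simp add: tensor_square_def tab op_T_def kappa_T_def mult.assoc)
  show "unit_el (tensor_square H) = Poly_Mapping.single (one, one) 1"
    by (simp add: tensor_square_def unit)
  show "op_T (op_T a b) c = op_T a (op_T b c)"
    by (cases a; cases b; cases c) (simp add: op_T_def op_assoc)
  obtain a1 a2 b1 b2 c1 c2 where *: "a = (a1, a2)" "b = (b1, b2)" "c = (c1, c2)"
    by (metis surj_pair)
  have "kappa_T a b * kappa_T (op_T a b) c =
      (- 1) ^ (parity H a2 * parity H b1 + (parity H a2 + parity H b2) * parity H c1) *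
        (\<kappa> a1 b1 * \<kappa> (op a1 b1) c1) * (\<kappa> a2 b2 * \<kappa> (op a2 b2) c2)"
    by (simp add: * op_T_def kappa_T_def par power_add mult_ac)
  also have "\<dots> = kappa_T b c * kappa_T a (op_T b c)"
    unfolding cocycle
    by (simp add: * op_T_def kappa_T_def par power_add algebra_simps)
  finally show "kappa_T a b * kappa_T (op_T a b) c = kappa_T b c * kappa_T a (op_T b c)" .
next
  fix a b :: "'a \<times> 'a"
  assume ab: "a \<in> basis (tensor_square H)"
  have pm: "parity H one = 0" using par_one .
  show "op_T (one, one) a = a \<and> kappa_T (one, one) a = 1" "op_T a (one, one) = a \<and> kappa_T a (one, one) = 1"
    using ab by (auto simp: op_T_def kappa_T_def tensor_square_def one_left one_right pm)
  assume "b \<in> basis (tensor_square H)"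
  with ab show "op_T a b \<in> basis (tensor_square H) \<or> kappa_T a b = 0"
    using op_closed by (fastforce simp: op_T_def kappa_T_def tensor_square_def)
next
  show "(one, one) \<in> basis (tensor_square H)"
    by (simp add: tensor_square_def one_closed)
qed

sublocale T: monomial_superalgebra "tensor_square H" op_T kappa_T "(one, one)"
  by (rule tensor_square_monomial)

text \<open>Only the two inner factors, which are moved past each other, have to be
  homogeneous.\<close>

lemma mul_tensor:
  assumes "homogeneous H e y" "homogeneous H e' x'"
  shows "mul (tensor_square H) (tensor x y) (tensor x' y') =
    scal ((- 1) ^ (e * e')) (tensor (mul H x x') (mul H y y'))"
proof -
  define B where "B e = {b. parity H b = e}" for e
  have y: "Poly_Mapping.keys y \<subseteq> B e" and x': "Poly_Mapping.keys x' \<subseteq> B e'"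
    using assms by (auto simp: homogeneous_def B_def)
  show ?thesis
  proof (induction x rule: poly_mapping_linear_induct[OF subset_UNIV, case_names zero add single])
    case (single b1 a1)
    from y show ?case
    proof (induction y rule: poly_mapping_linear_induct)
      case (single b2 a2)
      from x' show ?case
      proof (induction x' rule: poly_mapping_linear_induct)
        case (single b3 a3)
        show ?case
        proof (induction y' rule: poly_mapping_linear_induct[OF subset_UNIV, case_names zero add single])
          case (single b4 a4)
          show ?case using \<open>b2 \<in> B e\<close> \<open>b3 \<in> B e'\<close>
            by (simp add: mul_singles T.mul_singles op_T_def kappa_T_def B_def mult_ac del: mul_single)
        qed (simp_all add: mul_linear tensor_linear scal_add_right)
      qed (simp_all add: mul_linear tensor_linear scal_add_right)
    qed (simp_all add: mul_linear tensor_linear scal_add_right)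
  qed (simp_all add: mul_linear tensor_linear scal_add_right)
qed

lemma mul_homogeneous:
  "homogeneous H e x \<Longrightarrow> homogeneous H e' y \<Longrightarrow> homogeneous H (e + e') (mul H x y)"
proof -
  assume "homogeneous H e x" "homogeneous H e' y"
  then have x: "Poly_Mapping.keys x \<subseteq> {b. parity H b = e}" and y: "Poly_Mapping.keys y \<subseteq> {b. parity H b = e'}"
    by (auto simp: homogeneous_def)
  from x show ?thesis
  proof (induction x rule: poly_mapping_linear_induct)
    case (single b1 a1)
    from y show ?case
    proof (induction y rule: poly_mapping_linear_induct)
      case (single b2 a2)
      then show ?case using \<open>b1 \<in> _\<close>
        by (simp add: mul_singles homogeneous_closed par del: mul_single)
    qed (simp_all add: mul_linear homogeneous_closed)
  qed (simp_all add: mul_linear homogeneous_closed)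
qed

lemma pow_homogeneous: "homogeneous H e x \<Longrightarrow> homogeneous H (n * e) (pow H x n)"
  by (induction n) (auto simp: pow_0 pow_Suc unit par_one homogeneous_closed intro: mul_homogeneous)

end

text \<open>Parity preservation makes the signs agree, since the sign in a product of tensors
  depends only on the parities of the inner factors.\<close>

lemma tensor_map_mul:
  assumes "graded_monomial_superalgebra H1 op1 \<kappa>1 one1" "graded_monomial_superalgebra H2 op2 \<kappa>2 one2"
    and hom: "\<And>x y. lin_ext f (mul H1 x y) = mul H2 (lin_ext f x) (lin_ext f y)"
    and par: "\<And>b. homogeneous H2 (parity H1 b) (f b)"
  shows "tensor_map (lin_ext f) (mul (tensor_square H1) u v) =
    mul (tensor_square H2) (tensor_map (lin_ext f) u) (tensor_map (lin_ext f) v)"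
proof -
  interpret H1: graded_monomial_superalgebra H1 op1 \<kappa>1 one1 by fact
  interpret H2: graded_monomial_superalgebra H2 op2 \<kappa>2 one2 by fact
  show ?thesis
  proof (induction u rule: poly_mapping_linear_induct[OF subset_UNIV, case_names zero add single])
    case (single b a)
    show ?case
    proof (induction v rule: poly_mapping_linear_induct[OF subset_UNIV, case_names zero add single])
      case (single b' a')
      obtain x y x' y' where b: "b = (x, y)" "b' = (x', y')" by (metis surj_pair)
      have *: "Poly_Mapping.single (x, y) a = scal a (tensor (Poly_Mapping.single x 1) (Poly_Mapping.single y 1))" for x y and a :: 'b
        by simp
      have h: "homogeneous H2 (parity H1 z) (lin_ext f (Poly_Mapping.single z 1))" for z
        using par by simp
      show ?case unfolding b *
        by (simp add: tensor_map_linear tensor_map_lin_ext_tensor mul_linear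
            H1.mul_tensor[of "parity H1 y" _ "parity H1 x'"] H2.mul_tensor[OF h h]
            homogeneous_closed hom mult_ac del: tensor_single mul_single lin_ext_single)
    qed (simp_all add: mul_linear tensor_map_linear)
  qed (simp_all add: mul_linear tensor_map_linear)
qed

section \<open>The superalgebra \<open>A[M\<^sub>r]\<close>\<close>

locale hopf_M = algebra_over \<iota> for \<iota> :: "'k::field \<Rightarrow> 'a::{comm_ring,comm_monoid_mult}" +
  fixes p r :: nat
  assumes char_p: "CHAR('k) = p" and p3: "p \<ge> 3" and r1: "r \<ge> 1"
begin

definition Q :: nat where "Q = p ^ (r - 1)"

lemma prime_p: "prime p"
  using prime_CHAR_semidom[where 'a='k] char_p p3 by simp

lemma p_gt: "p > 0" "p > 1" using p3 by auto

lemma odd_p: "odd p"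
  using prime_p p3 prime_odd_nat by force

lemma Q_pos: "Q > 0" and odd_Q: "odd Q"
  using p3 odd_p by (auto simp: Q_def)

lemma p_Q: "p * Q = p ^ r"
  unfolding Q_def using r1 by (simp add: power_eq_if[of p r])

lemma nu_zero: "p dvd n \<Longrightarrow> nu n = 0"
  using nu_dvd char_p by simp

lemma nu_fact_cancel:
  assumes "n < p" "scal (nu (fact n)) x = scal (nu (fact n)) y" shows "x = y"
  using scal_nu_cancel[of "fact n" x y] assms prime_dvd_fact_iff[OF prime_p] char_p by simp

text \<open>With P = p^l, compare the coefficients of X^(Pc+d) in (1+X)^(Pa+b) = (1+X^P)^a (1+X)^b
  over k. As b, d < P, only the term X^(Pc) of the first factor contributes.\<close>

lemma lucas:
  assumes "b < p ^ l" "d < p ^ l"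
  shows "nu ((p ^ l * a + b) choose (p ^ l * c + d)) = nu (a choose c) * nu (b choose d)"
proof -
  let ?P = "p ^ l" and ?L = "[:1, 1:] :: 'k poly"
  have L: "coeff (?L ^ n) i = of_nat (n choose i)" for n i
    by (cases "i \<le> n") (simp_all add: coeff_linear_poly_power binomial_eq_0 coeff_eq_0 degree_power_eq)
  have "?L ^ ?P = (1 + monom 1 1) ^ (CHAR('k poly) ^ l)"
    by (simp add: char_p one_pCons monom_altdef)
  also have "\<dots> = 1 ^ (CHAR('k poly) ^ l) + monom 1 1 ^ (CHAR('k poly) ^ l)"
    by (rule freshmans_dream') (simp_all add: char_p prime_p)
  also have "\<dots> = monom 1 ?P + 1"
    by (simp add: char_p monom_power)
  finally have LP: "?L ^ ?P = monom 1 ?P + 1" .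
  have "?L ^ (?P * a + b) = (monom 1 ?P + 1) ^ a * ?L ^ b"
    by (simp only: power_add power_mult LP)
  also have "\<dots> = (\<Sum>m\<le>a. monom (of_nat (a choose m)) (?P * m) * ?L ^ b)"
    by (simp add: binomial_ring sum_distrib_right monom_power of_nat_poly mult_monom flip: monom_0)
  finally have "coeff (?L ^ (?P * a + b)) (?P * c + d) =
      (\<Sum>m\<le>a. coeff (monom (of_nat (a choose m)) (?P * m) * ?L ^ b) (?P * c + d))"
    by (simp add: coeff_sum)
  also have "\<dots> = (\<Sum>m\<le>a. if m = c then of_nat (a choose c) * of_nat (b choose d) else 0)"
  proof (rule sum.cong)
    fix m
    consider "m < c" | "m = c" | "c < m" by linarith
    then show "coeff (monom (of_nat (a choose m)) (?P * m) * ?L ^ b) (?P * c + d) =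
        (if m = c then of_nat (a choose c) * of_nat (b choose d) else 0)"
    proof cases
      case 1
      then have "?P * m + ?P \<le> ?P * c" by (metis Suc_leI mult_Suc_right mult_le_mono2 add.commute)
      then have "b < ?P * c + d - ?P * m" using assms by linarith
      then show ?thesis using 1 by (simp add: coeff_monom_mult L binomial_eq_0)
    next
      case 2 then show ?thesis by (simp add: coeff_monom_mult L)
    next
      case 3
      then have "?P * c + ?P \<le> ?P * m" by (metis Suc_leI mult_Suc_right mult_le_mono2 add.commute)
      then have "\<not> ?P * m \<le> ?P * c + d" using assms by linarith
      then show ?thesis using 3 by (simp add: coeff_monom_mult)
    qed
  qed simp
  also have "\<dots> = of_nat (a choose c) * of_nat (b choose d)"
    by (simp add: binomial_eq_0)
  finally show ?thesis
    unfolding L nu_mult[symmetric] by (intro nu_eq) simp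
qed

lemma lucas_0: "b < p ^ l \<Longrightarrow> nu ((p ^ l * a + b) choose (p ^ l * c)) = nu (a choose c)"
  using lucas[of b l 0 a c] p_gt by simp

abbreviation AM :: "(idx, 'a) hopf_superalgebra" where "AM \<equiv> base_change \<iota> (M p r)"
abbreviation T :: "(idx \<times> idx, 'a) superalgebra" where "T \<equiv> tensor_square AM"

abbreviation mono :: "nat \<Rightarrow> nat \<Rightarrow> nat \<Rightarrow> (idx \<Rightarrow>\<^sub>0 'a)" where
  "mono e i j \<equiv> Poly_Mapping.single (e, i, j) 1"

definition op_M :: "idx \<Rightarrow> idx \<Rightarrow> idx" where
  "op_M = (\<lambda>(e, i, j) (e', i', j'). (e + e', (i + i') mod Q, j + j' + (i + i') div Q))"

text \<open>The coefficient of sigma_(d+j+j') in theta^(dQ) sigma_j sigma_j', where d is the carry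
  and theta^(dQ) = sigma_1^d = d! sigma_d. By \<open>mult_coeff_fact\<close> it equals (j+j'+d)!/(j!
  j'!).\<close>

definition mult_coeff :: "nat \<Rightarrow> nat \<Rightarrow> nat \<Rightarrow> nat" where
  "mult_coeff j j' d = ((j + j') choose j) * (fact d * ((d + (j + j')) choose d))"

definition kappa_M :: "idx \<Rightarrow> idx \<Rightarrow> 'a" where
  "kappa_M = (\<lambda>(e, i, j) (e', i', j'). if e + e' \<le> 1 then nu (mult_coeff j j' ((i + i') div Q)) else 0)"

lemma mult_coeff_fact: "mult_coeff j j' d * (fact j * fact j') = fact (j + j' + d)"
proof -
  have "mult_coeff j j' d * (fact j * fact j') =
      (fact j * fact j' * ((j + j') choose j)) * (fact d * ((d + (j + j')) choose d))"
    by (simp add: mult_coeff_def mult_ac)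
  also have "fact j * fact j' * ((j + j') choose j) = (fact (j + j') :: nat)"
    using binomial_fact_lemma[of j "j + j'"] by simp
  also have "fact (j + j') * (fact d * ((d + (j + j')) choose d)) =
      fact d * fact (j + j') * ((d + (j + j')) choose d)" by (simp only: mult_ac)
  also have "\<dots> = (fact (d + (j + j')) :: nat)"
    using binomial_fact_lemma[of d "d + (j + j')"] by simp
  finally show ?thesis by (simp add: add_ac)
qed

text \<open>Multiplied by j! j'! j''!, both sides become the factorial of j+j'+j'' plus the total
  carry, which by hypothesis is the same for both bracketings.\<close>

lemma mult_coeff_cocycle:
  assumes "d + d2 = d' + d2'"
  shows "mult_coeff j j' d * mult_coeff (j + j' + d) j'' d2 =
    mult_coeff j' j'' d' * mult_coeff j (j' + j'' + d') d2'"
proof -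
  let ?F = "fact j * fact j' * fact j'' :: nat"
  have "mult_coeff j j' d * mult_coeff (j + j' + d) j'' d2 * ?F =
      mult_coeff (j + j' + d) j'' d2 * ((mult_coeff j j' d * (fact j * fact j')) * fact j'')"
    by simp
  also have "\<dots> = fact (j + j' + d + j'' + d2)" unfolding mult_coeff_fact ..
  also have "j + j' + d + j'' + d2 = j + (j' + j'' + d') + d2'" using assms by simp
  also have "fact \<dots> = mult_coeff j (j' + j'' + d') d2' * (fact j * (mult_coeff j' j'' d' * (fact j' * fact j'')))"
    unfolding mult_coeff_fact ..
  also have "\<dots> = mult_coeff j' j'' d' * mult_coeff j (j' + j'' + d') d2' * ?F" by simp
  finally show ?thesis by simp
qed

lemma AM_simps [simp]:
  "basis AM = {..<2} \<times> {..<Q} \<times> UNIV" "parity AM = fst" "unit_el AM = mono 0 0 0"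
  by (auto simp: base_change_def M_def M_superalgebra_def superalgebra.defs Let_def Q_def scalar_ext_simps normal_monomial_def)

lemma scalar_ext_normal_monomial: "scalar_ext \<iota> (normal_monomial p r e n j) =
    Poly_Mapping.single (e, n mod Q, n div Q + j) (nu (fact (n div Q) * ((n div Q + j) choose (n div Q))))"
  by (simp add: normal_monomial_def Let_def Q_def scalar_ext_simps nu_def)

lemma AM_mult_tab: "mult_tab AM (e, i, j) (e', i', j') = (if e + e' \<le> 1
    then scal (nu ((j + j') choose j)) (scalar_ext \<iota> (normal_monomial p r (e + e') (i + i') (j + j'))) else 0)"
  by (simp add: base_change_def M_mult_tab M_superalgebra_def scalar_ext_simps nu_def)

sublocale R: graded_monomial_superalgebra AM op_M kappa_M "(0, 0, 0)"
proof
  fix a b c :: idx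
  obtain e i j e' i' j' e'' i'' j'' where *: "a = (e, i, j)" "b = (e', i', j')" "c = (e'', i'', j'')"
    by (metis prod_cases3)
  show "mult_tab AM a b = Poly_Mapping.single (op_M a b) (kappa_M a b)"
    by (simp add: * AM_mult_tab scalar_ext_normal_monomial op_M_def kappa_M_def mult_coeff_def nu_mult add.commute)
  \<comment> \<open>For either bracketing the total carry of the three exponents is (i+i'+i'') div
    Q; this supplies the hypothesis of \<open>mult_coeff_cocycle\<close>.\<close>
  have d: "((i + i') mod Q + i'') div Q + (i + i') div Q = (i + i' + i'') div Q"
    "(i + (i' + i'') mod Q) div Q + (i' + i'') div Q = (i + i' + i'') div Q"
  proof -
    have "((i + i') mod Q + i'') div Q + (i + i') div Q = ((i + i') mod Q + i'' + (i + i') div Q * Q) div Q"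
      using Q_pos by simp
    also have "(i + i') mod Q + i'' + (i + i') div Q * Q = i + i' + i''"
      using mod_div_mult_eq[of "i + i'" Q] by linarith
    finally show "((i + i') mod Q + i'') div Q + (i + i') div Q = (i + i' + i'') div Q" .
    have "(i + (i' + i'') mod Q) div Q + (i' + i'') div Q = (i + (i' + i'') mod Q + (i' + i'') div Q * Q) div Q"
      using Q_pos by simp
    also have "i + (i' + i'') mod Q + (i' + i'') div Q * Q = i + i' + i''"
      using mod_div_mult_eq[of "i' + i''" Q] by linarith
    finally show "(i + (i' + i'') mod Q) div Q + (i' + i'') div Q = (i + i' + i'') div Q" .
  qed
  show "op_M (op_M a b) c = op_M a (op_M b c)"
    using d by (simp add: * op_M_def mod_simps add.assoc)
  show "kappa_M a b * kappa_M (op_M a b) c = kappa_M b c * kappa_M a (op_M b c)"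
    using mult_coeff_cocycle[of "(i + i') div Q" "((i + i') mod Q + i'') div Q"
        "(i' + i'') div Q" "(i + (i' + i'') mod Q) div Q" j j' j''] d
    by (simp add: * op_M_def kappa_M_def nu_mult[symmetric])
  show "parity AM (op_M a b) = parity AM a + parity AM b"
    by (simp add: * op_M_def)
  show "parity AM (0, 0, 0) = 0" by simp
  show "unit_el AM = Poly_Mapping.single (0, 0, 0) 1" by simp
  show "(0, 0, 0) \<in> basis AM" using Q_pos by simp
next
  fix a b assume "a \<in> basis AM"
  then show "op_M (0, 0, 0) a = a \<and> kappa_M (0, 0, 0) a = 1" "op_M a (0, 0, 0) = a \<and> kappa_M a (0, 0, 0) = 1"
    by (auto simp: op_M_def kappa_M_def mult_coeff_def)
  assume "b \<in> basis AM"
  then show "op_M a b \<in> basis AM \<or> kappa_M a b = 0"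
    using \<open>a \<in> basis AM\<close> Q_pos by (auto simp: op_M_def kappa_M_def split: if_splits)
qed

lemma mono_closed [simp]: "e < 2 \<Longrightarrow> i < Q \<Longrightarrow> mono e i j \<in> carrier_of AM"
  by (intro carrier_closed) simp

lemma AM_commute: "mul AM x y = mul AM y x"
proof (induction x rule: poly_mapping_linear_induct[OF subset_UNIV, case_names zero add single])
  case (single b u)
  show ?case
  proof (induction y rule: poly_mapping_linear_induct[OF subset_UNIV, case_names zero add single])
    case (single c v)
    obtain e i j e' i' j' where *: "b = (e, i, j)" "c = (e', i', j')" by (metis prod_cases3)
    have "((j + j') choose j) = ((j' + j) choose j')"
      using binomial_symmetric[of j "j + j'"] by (simp add: add.commute)
    then show ?case
      by (simp add: * AM_mult_tab add.commute mult.commute)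
  qed (simp_all add: mul_linear)
qed (simp_all add: mul_linear)

section \<open>The universal property of A[M_r]\<close>

definition gens_map :: "('c, 'a, 'z) superalgebra_scheme \<Rightarrow> ('c \<Rightarrow>\<^sub>0 'a) \<Rightarrow> ('c \<Rightarrow>\<^sub>0 'a) \<Rightarrow> (nat \<Rightarrow> 'c \<Rightarrow>\<^sub>0 'a)
    \<Rightarrow> (idx \<Rightarrow>\<^sub>0 'a) \<Rightarrow> ('c \<Rightarrow>\<^sub>0 'a)" where
  "gens_map B t x y = lin_ext (\<lambda>(e, i, j). mul B (pow B t e) (mul B (pow B x i) (y j)))"

text \<open>The target B is allowed to be noncommutative, as it will be the tensor square when the
  coproduct is treated; commutation rules therefore count among the relations.\<close>

definition M_relations_in :: "('c, 'a, 'z) superalgebra_scheme \<Rightarrow> ('c \<Rightarrow>\<^sub>0 'a) \<Rightarrow> ('c \<Rightarrow>\<^sub>0 'a) \<Rightarrow> (nat \<Rightarrow> 'c \<Rightarrow>\<^sub>0 'a) \<Rightarrow> bool" where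
  "M_relations_in B t x y \<longleftrightarrow> t \<in> carrier_of B \<and> x \<in> carrier_of B \<and> (\<forall>j. y j \<in> carrier_of B) \<and>
     mul B t t = 0 \<and> mul B t x = mul B x t \<and> (\<forall>j. mul B t (y j) = mul B (y j) t) \<and>
     (\<forall>j. mul B x (y j) = mul B (y j) x) \<and> y 0 = unit_el B \<and> pow B x Q = y 1 \<and>
     (\<forall>i j. mul B (y i) (y j) = scal (nu ((i + j) choose i)) (y (i + j)))"

text \<open>By x^Q = y_1 and y_1^q y_j = q! C(q+j,q) y_(q+j), evaluation at t, x, y is blind to the
  reduction of theta^n to normal form. This is what makes \<open>gens_map\<close>
  multiplicative.\<close>

lemma gens_map_normal:
  assumes "assoc_superalgebra B" "M_relations_in B t x y"
  shows "lin_ext (\<lambda>(e, i, j). mul B (pow B t e) (mul B (pow B x i) (y j)))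
      (scalar_ext \<iota> (normal_monomial p r e n j)) = mul B (pow B t e) (mul B (pow B x n) (y j))"
proof -
  interpret B: assoc_superalgebra B by fact
  note rel = assms(2)[unfolded M_relations_in_def]
  have y: "mul B (pow B (y 1) q) (y j) = scal (nu (fact q * ((q + j) choose q))) (y (q + j))" for q
  proof (induction q)
    case 0 show ?case using rel by (simp add: B.pow_0 B.unit_left)
  next
    case (Suc q)
    have "mul B (pow B (y 1) (Suc q)) (y j) = scal (nu (fact q * ((q + j) choose q))) (mul B (y 1) (y (q + j)))"
      by (simp only: B.pow_Suc B.mul_assoc Suc mul_linear)
    also have "mul B (y 1) (y (q + j)) = scal (nu (Suc (q + j))) (y (Suc (q + j)))"
      using rel by simp
    finally have E: "mul B (pow B (y 1) (Suc q)) (y j) =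
      scal (nu (fact q * ((q + j) choose q)) * nu (Suc (q + j))) (y (Suc q + j))" by simp
    have "fact (Suc q) * (Suc (q + j) choose Suc q) = fact q * (Suc q * (Suc (q + j) choose Suc q))"
      by (simp add: algebra_simps del: binomial_Suc_Suc)
    then have "fact q * ((q + j) choose q) * Suc (q + j) = fact (Suc q) * (Suc (q + j) choose Suc q)"
      by (simp only: Suc_times_binomial mult_ac)
    then have "nu (fact q * ((q + j) choose q)) * nu (Suc (q + j)) = nu (fact (Suc q) * (Suc (q + j) choose Suc q))"
      by (simp only: flip: nu_mult)
    then show ?case unfolding E by simp
  qed
  have "pow B x n = mul B (pow B x (n mod Q)) (pow B (y 1) (n div Q))"
    using rel B.pow_add[of x "n mod Q" "n div Q * Q"] B.pow_mult[of x Q "n div Q"]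
    by (simp add: mult.commute)
  then have "mul B (pow B t e) (mul B (pow B x n) (y j)) =
      scal (nu (fact (n div Q) * ((n div Q + j) choose (n div Q))))
        (mul B (pow B t e) (mul B (pow B x (n mod Q)) (y (n div Q + j))))"
    by (simp only: B.mul_assoc y mul_linear)
  then show ?thesis by (simp add: scalar_ext_normal_monomial)
qed

text \<open>Commuting the factors into the order t, x, y turns the product of two values into the
  value of an unreduced monomial; \<open>gens_map_normal\<close> absorbs the carry, and t^2 = 0
  covers two odd factors.\<close>

lemma gens_map_mul:
  assumes "assoc_superalgebra B" "M_relations_in B t x y"
  shows "gens_map B t x y (mul AM u v) = mul B (gens_map B t x y u) (gens_map B t x y v)"
proof -
  interpret B: assoc_superalgebra B by fact
  note rel = assms(2)[unfolded M_relations_in_def]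
  let ?F = "\<lambda>(e, i, j). mul B (pow B t e) (mul B (pow B x i) (y j))"
  have t: "t \<in> carrier_of B" "x \<in> carrier_of B" "y j \<in> carrier_of B" for j using rel by auto
  have xt: "mul B (pow B x i) (mul B (pow B t e) z) = mul B (pow B t e) (mul B (pow B x i) z)" for i e z
    by (intro B.mul_left_commute B.commute_pow B.pow_closed t)
      (rule B.commute_pow[symmetric]; use rel in simp)
  have yt: "mul B (y j) (mul B (pow B t e) z) = mul B (pow B t e) (mul B (y j) z)" for j e z
    by (intro B.mul_left_commute B.commute_pow t) (use rel in simp)
  have yx: "mul B (y j) (mul B (pow B x i) z) = mul B (pow B x i) (mul B (y j) z)" for j i z
    by (intro B.mul_left_commute B.commute_pow t) (use rel in simp)
  have tt: "pow B t e = 0" if "e > 1" for e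
    using that rel B.pow_eq_zero_ge[of t 2 e] by (simp add: B.pow_Suc B.pow_0 numeral_2_eq_2 B.unit_right)
  have "lin_ext ?F (mul AM u v) = mul B (lin_ext ?F u) (lin_ext ?F v)"
  proof (induction u rule: poly_mapping_linear_induct[OF subset_UNIV, case_names zero add single])
    case (single b a)
    show ?case
    proof (induction v rule: poly_mapping_linear_induct[OF subset_UNIV, case_names zero add single])
      case (single b' a')
      obtain e i j e' i' j' where *: "b = (e, i, j)" "b' = (e', i', j')" by (metis prod_cases3)
      have "mul B (?F b) (?F b') =
          mul B (mul B (pow B t e) (pow B t e')) (mul B (mul B (pow B x i) (pow B x i')) (mul B (y j) (y j')))"
        by (simp only: * B.mul_assoc xt yt yx prod.case)
      also have "\<dots> = mul B (pow B t (e + e')) (mul B (pow B x (i + i')) (scal (nu ((j + j') choose j)) (y (j + j'))))"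
        using rel by (simp only: B.pow_add[OF t(1)] B.pow_add[OF t(2)])
      also have "\<dots> = lin_ext ?F (mult_tab AM b b')"
      proof (cases "e + e' \<le> 1")
        case True
        then have "lin_ext ?F (mult_tab AM b b') = scal (nu ((j + j') choose j))
            (lin_ext ?F (scalar_ext \<iota> (normal_monomial p r (e + e') (i + i') (j + j'))))"
          by (simp only: * AM_mult_tab if_True lin_ext_scal)
        then show ?thesis by (simp only: gens_map_normal[OF assms] mul_linear)
      next
        case False
        then show ?thesis using tt[of "e + e'"] by (simp only: * AM_mult_tab if_False) simp
      qed
      finally have "mul B (?F b) (?F b') = lin_ext ?F (mult_tab AM b b')" .
      then show ?case
        by (simp only: mul_single lin_ext_single lin_ext_scal mul_scal_left mul_scal_right scal_simps mult.commute)
    qed (simp_all add: mul_linear lin_ext_linear)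
  qed (simp_all add: mul_linear lin_ext_linear)
  then show ?thesis by (simp add: gens_map_def)
qed

section \<open>The coproduct of \<open>A[M\<^sub>r]\<close> and its primitive elements\<close>

definition tau_A :: "idx \<Rightarrow>\<^sub>0 'a" where "tau_A = mono 1 0 0"
definition theta_A :: "idx \<Rightarrow>\<^sub>0 'a" where "theta_A = scalar_ext \<iota> (theta p r)"
definition sigma_A :: "nat \<Rightarrow> idx \<Rightarrow>\<^sub>0 'a" where "sigma_A j = mono 0 0 j"

definition prim :: "(idx \<Rightarrow>\<^sub>0 'a) \<Rightarrow> (idx \<times> idx \<Rightarrow>\<^sub>0 'a)" where
  "prim x = tensor x (mono 0 0 0) + tensor (mono 0 0 0) x"

text \<open>The sum over u of tau^e sigma_u tensor tau^e sigma_(j-u); the cases e = 0 and e = 1 are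
  the two sums in the coproduct of a sigma.\<close>

definition diag :: "nat \<Rightarrow> nat \<Rightarrow> (idx \<times> idx \<Rightarrow>\<^sub>0 'a)" where
  "diag e j = (\<Sum>u\<le>j. Poly_Mapping.single ((e, 0, u), (e, 0, j - u)) 1)"

definition comult_sigma :: "nat \<Rightarrow> (idx \<times> idx \<Rightarrow>\<^sub>0 'a)" where
  "comult_sigma j = diag 0 j + (if p \<le> j then diag 1 (j - p) else 0)"

lemma theta_A_eq: "theta_A = Poly_Mapping.single (0, 1 mod Q, 1 div Q) 1"
  using Q_pos by (cases "Q = 1") (simp_all add: theta_A_def scalar_ext_normal_monomial)

lemma theta_A_closed [simp]: "theta_A \<in> carrier_of AM"
  using Q_pos by (auto simp: theta_A_eq intro!: carrier_closed)

lemma gens_closed [simp]: "tau_A \<in> carrier_of AM" "sigma_A j \<in> carrier_of AM"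
  using Q_pos by (auto simp: tau_A_def sigma_A_def)

lemma unit_AM_closed [simp]: "mono 0 0 0 \<in> carrier_of AM"
  using R.unit_closed by simp

lemma homogeneous_gens [simp]:
  "homogeneous AM 0 theta_A" "homogeneous AM 0 (sigma_A j)" "homogeneous AM (Suc 0) tau_A"
  by (simp_all add: theta_A_eq sigma_A_def tau_A_def homogeneous_closed)

lemma scalar_ext_gens:
  "scalar_ext \<iota> (tau p r) = tau_A" "scalar_ext \<iota> (theta p r) = theta_A" "scalar_ext \<iota> (sigma p r j) = sigma_A j"
  by (simp_all add: tau_A_def theta_A_def sigma_A_def scalar_ext_normal_monomial)

lemma T_simps: "basis T = basis AM \<times> basis AM" "unit_el T = Poly_Mapping.single ((0, 0, 0), (0, 0, 0)) 1"
  by (simp_all add: tensor_square_def)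

lemma T_mul_singles:
  "mul T (Poly_Mapping.single (b, c) u) (Poly_Mapping.single (b', c') v) =
    Poly_Mapping.single (op_M b b', op_M c c') (u * v * ((- 1) ^ (fst c * fst b') * kappa_M b b' * kappa_M c c'))"
  by (simp only: R.T.mul_singles R.op_T_def R.kappa_T_def prod.case AM_simps)

lemma sum_diagonal: "(\<Sum>(u, v)\<in>{(u, v). u + v = i}. f u v) = (\<Sum>u\<le>i. f u (i - u))" for i :: nat
proof -
  have "{(u, v). u + v = i} = (\<lambda>u. (u, i - u)) ` {..i}" by auto
  then show ?thesis by (simp add: sum.reindex inj_on_def)
qed

lemma sum_diagonal_shift:
  "(\<Sum>(u, v)\<in>{(u, v). u + v + q = i}. f u v) = (if q \<le> i then (\<Sum>u\<le>i - q. f u (i - q - u)) else 0)" for i :: nat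
proof (cases "q \<le> i")
  case True
  then have "{(u, v). u + v + q = i} = {(u, v). u + v = i - q}" by auto
  then show ?thesis using True by (simp add: sum_diagonal)
next
  case False
  then have "{(u, v). u + v + q = i} = {}" by auto
  then show ?thesis using False by simp
qed

lemma scalar_ext_sigma_comult: "scalar_ext \<iota> (sigma_comult p r j) = comult_sigma j"
proof -
  have "mul (M_superalgebra p r) (sigma p r u) (tau p r) = (Poly_Mapping.single (1, 0, u) 1 :: idx \<Rightarrow>\<^sub>0 'k)" for u
    using mult_tab_low[of 0 1 0 0 p r u 0] p_gt by (simp add: normal_monomial_def)
  then show ?thesis
    by (simp add: sigma_comult_def sum_diagonal sum_diagonal_shift comult_sigma_def diag_def scalar_ext_simps
        scalar_ext_sum normal_monomial_def)
qed

lemma comult_tab_AM: "comult_tab AM (e, i, j) =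
    mul T (pow T (prim tau_A) e) (mul T (pow T (prim theta_A) i) (comult_sigma j))"
proof -
  let ?R = "M_superalgebra p r :: (idx, 'k) superalgebra"
  have 1: "mult_tab AM b c = scalar_ext \<iota> (mult_tab ?R b c)" for b c
    by (simp add: base_change_def M_mult_tab)
  have 2: "unit_el AM = scalar_ext \<iota> (unit_el ?R)"
    by (simp add: base_change_def M_unit_el del: AM_simps)
  have 3: "parity AM = parity ?R"
    by (auto simp: M_superalgebra_def)
  note T = tensor_square_scalar_ext[of AM ?R, OF 1 2 3]
  have pr: "scalar_ext \<iota> (primitive_comult ?R x) = prim (scalar_ext \<iota> x)" for x
    using 2 by (simp add: primitive_comult_def prim_def scalar_ext_simps scalar_ext_tensor)
  have "comult_tab AM (e, i, j) = scalar_ext \<iota> (comult_tab (M p r) (e, i, j))"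
    by (simp add: base_change_def)
  also have "comult_tab (M p r) (e, i, j) = mul (tensor_square ?R) (pow (tensor_square ?R) (primitive_comult ?R (tau p r)) e)
             (mul (tensor_square ?R) (pow (tensor_square ?R) (primitive_comult ?R (theta p r)) i) (sigma_comult p r j))"
    by (simp add: M_def Let_def superalgebra.defs)
  also have "scalar_ext \<iota> \<dots> = mul T (pow T (prim tau_A) e) (mul T (pow T (prim theta_A) i) (comult_sigma j))"
    by (simp only: scalar_ext_mul[OF T(1)] scalar_ext_pow[OF T] pr scalar_ext_gens scalar_ext_sigma_comult)
  finally show ?thesis .
qed

lemma comult_AM: "comult AM = gens_map T (prim tau_A) (prim theta_A) comult_sigma"
  unfolding comult_def gens_map_def
  by (rule arg_cong[where f = lin_ext]) (auto simp: comult_tab_AM)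

lemma op_M_commute: "op_M b c = op_M c b" and kappa_M_commute: "kappa_M b c = kappa_M c b"
proof -
  obtain e i j e' i' j' where *: "b = (e, i, j)" "c = (e', i', j')" by (metis prod_cases3)
  have "((j + j') choose j) = ((j' + j) choose j')"
    using binomial_symmetric[of j "j + j'"] by (simp add: add.commute)
  then show "op_M b c = op_M c b" "kappa_M b c = kappa_M c b"
    by (simp_all add: * op_M_def kappa_M_def mult_coeff_def add.commute)
qed

text \<open>A[M_r] commutes without signs, so only the tensor sign matters. It can differ between
  the two orders only if both components of an index of x and one component of an index of y are
  odd, and then tau^2 = 0 makes both products vanish.\<close>

lemma T_even_commute:
  assumes "\<And>b c. (b, c) \<in> Poly_Mapping.keys x \<Longrightarrow> fst b = fst c"
  shows "mul T x y = mul T y x"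
proof -
  have "Poly_Mapping.keys x \<subseteq> {(b, c). fst b = fst c}" using assms by auto
  then show ?thesis
  proof (induction x rule: poly_mapping_linear_induct)
    case (single b u)
    show ?case
    proof (induction y rule: poly_mapping_linear_induct[OF subset_UNIV, case_names zero add single])
      case (single c v)
      obtain b1 b2 c1 c2 where *: "b = (b1, b2)" "c = (c1, c2)" by (metis surj_pair)
      have e: "fst b1 = fst b2" using \<open>b \<in> _\<close> * by simp
      have "R.kappa_T b c = R.kappa_T c b"
      proof (cases "fst b1 = 0 \<or> (fst c1 = 0 \<and> fst c2 = 0)")
        case True
        then show ?thesis using e by (auto simp: * R.kappa_T_def kappa_M_commute)
      next
        case False
        then have "kappa_M b1 c1 = 0 \<or> kappa_M b2 c2 = 0"
          using e by (cases b1; cases b2; cases c1; cases c2) (auto simp: kappa_M_def)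
        then have "kappa_M c1 b1 = 0 \<or> kappa_M c2 b2 = 0" by (simp only: kappa_M_commute[of c1] kappa_M_commute[of c2])
        then show ?thesis using \<open>kappa_M b1 c1 = 0 \<or> kappa_M b2 c2 = 0\<close>
          by (auto simp: * R.kappa_T_def)
      qed
      moreover have "R.op_T b c = R.op_T c b" by (simp add: * R.op_T_def op_M_commute)
      ultimately show ?case by (simp add: R.T.mul_singles mult.commute[of u] del: mul_single)
    qed (simp_all add: mul_linear)
  qed (simp_all add: mul_linear)
qed

lemma even_prim:
  assumes "homogeneous AM 0 x" "(b, c) \<in> Poly_Mapping.keys (prim x)"
  shows "fst b = fst c"
proof -
  have "(b, c) \<in> Poly_Mapping.keys (tensor x (mono 0 0 0)) \<union> Poly_Mapping.keys (tensor (mono 0 0 0) x)"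
    by (rule subsetD[OF keys_add assms(2)[unfolded prim_def]])
  then have "(b \<in> Poly_Mapping.keys x \<and> c \<in> Poly_Mapping.keys (mono 0 0 0)) \<or>
      (b \<in> Poly_Mapping.keys (mono 0 0 0) \<and> c \<in> Poly_Mapping.keys x)"
    using keys_tensor[of x "mono 0 0 0"] keys_tensor[of "mono 0 0 0" x] by blast
  then show ?thesis using assms(1) by (auto simp: homogeneous_def split: if_splits)
qed

lemma keys_diag: "Poly_Mapping.keys (diag e j) \<subseteq> (\<lambda>u. ((e, 0, u), (e, 0, j - u))) ` {..j}"
proof -
  have "Poly_Mapping.keys (diag e j) \<subseteq>
      (\<Union>u\<in>{..j}. Poly_Mapping.keys (Poly_Mapping.single ((e, 0, u), (e, 0, j - u)) (1 :: 'a)))"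
    unfolding diag_def by (rule keys_sum)
  then show ?thesis by (auto split: if_splits)
qed

lemma even_comult_sigma:
  assumes "(b, c) \<in> Poly_Mapping.keys (comult_sigma j)" shows "fst b = fst c"
proof -
  have "(b, c) \<in> Poly_Mapping.keys (diag 0 j) \<union> Poly_Mapping.keys (diag 1 (j - p))"
    using assms keys_add[of "diag 0 j" "diag 1 (j - p)"] by (auto simp: comult_sigma_def split: if_splits)
  then show ?thesis using keys_diag[of 0 j] keys_diag[of 1 "j - p"] by fastforce
qed

lemma T_closed_iff: "x \<in> carrier_of T \<longleftrightarrow> Poly_Mapping.keys x \<subseteq> basis AM \<times> basis AM"
  by (simp add: carrier_of_iff tensor_square_def)

lemma tensor_closed: "x \<in> carrier_of AM \<Longrightarrow> y \<in> carrier_of AM \<Longrightarrow> tensor x y \<in> carrier_of T"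
  using keys_tensor[of x y] unfolding T_closed_iff unfolding carrier_of_iff by blast

lemma prim_closed: "x \<in> carrier_of AM \<Longrightarrow> prim x \<in> carrier_of T"
  unfolding prim_def by (intro carrier_closed(2) tensor_closed) simp_all

lemma diag_closed: "e < 2 \<Longrightarrow> diag e j \<in> carrier_of T"
  using keys_diag[of e j] Q_pos by (fastforce simp: T_closed_iff)

lemma comult_sigma_closed: "comult_sigma j \<in> carrier_of T"
  by (auto simp: comult_sigma_def intro!: carrier_closed diag_closed)

text \<open>Collect the terms with u + u' = U: the coefficient of \<open>g U\<close> is the sum over
  u of C(U,u) C(i+j-U,i-u), which is C(i+j,i) by Vandermonde.\<close>

lemma binomial_convolution:
  fixes g :: "nat \<Rightarrow> ('c \<Rightarrow>\<^sub>0 'a)"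
  shows "(\<Sum>u\<le>i. \<Sum>u'\<le>j. scal (nu (((u + u') choose u) * ((i - u + (j - u')) choose (i - u)))) (g (u + u'))) =
    scal (nu ((i + j) choose i)) (\<Sum>U\<le>i + j. g U)"
proof -
  define f where "f u U = scal (nu ((U choose u) * ((i + j - U) choose (i - u)))) (g U)" for u U
  have "(\<Sum>u'\<le>j. scal (nu (((u + u') choose u) * ((i - u + (j - u')) choose (i - u)))) (g (u + u'))) =
      (\<Sum>U\<le>i + j. f u U)" if "u \<le> i" for u
  proof -
    have "(\<Sum>u'\<le>j. scal (nu (((u + u') choose u) * ((i - u + (j - u')) choose (i - u)))) (g (u + u'))) =
        (\<Sum>u'\<le>j. f u (u + u'))"
      using that by (intro sum.cong) (auto simp: f_def)
    also have "\<dots> = sum (f u) ((+) u ` {..j})"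
      by (simp add: sum.reindex o_def)
    also have "\<dots> = (\<Sum>U\<le>i + j. f u U)"
    proof (rule sum.mono_neutral_left)
      show "(+) u ` {..j} \<subseteq> {..i + j}" using that by auto
      show "\<forall>U\<in>{..i + j} - (+) u ` {..j}. f u U = 0"
      proof
        fix U assume U: "U \<in> {..i + j} - (+) u ` {..j}"
        have "U < u \<or> j < U - u"
        proof (rule ccontr)
          assume "\<not> (U < u \<or> j < U - u)"
          then have "U = u + (U - u)" "U - u \<in> {..j}" by auto
          then have "U \<in> (+) u ` {..j}" by blast
          then show False using U by simp
        qed
        then have "(U choose u) * ((i + j - U) choose (i - u)) = 0"
          using U that by (auto simp: binomial_eq_0)
        then show "f u U = 0" by (simp only: f_def nu_simps scal_simps)
      qed
    qed simp
    finally show ?thesis .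
  qed
  then have "(\<Sum>u\<le>i. \<Sum>u'\<le>j. scal (nu (((u + u') choose u) * ((i - u + (j - u')) choose (i - u)))) (g (u + u'))) =
      (\<Sum>u\<le>i. \<Sum>U\<le>i + j. f u U)" by simp
  also have "\<dots> = (\<Sum>U\<le>i + j. \<Sum>u\<le>i. f u U)" by (rule sum.swap)
  also have "\<dots> = (\<Sum>U\<le>i + j. scal (nu ((i + j) choose i)) (g U))"
  proof (rule sum.cong)
    fix U assume "U \<in> {..i + j}"
    then have "(\<Sum>u\<le>i. (U choose u) * ((i + j - U) choose (i - u))) = (i + j) choose i"
      using vandermonde[of U "i + j - U" i] by simp
    then have "(\<Sum>u\<le>i. nu ((U choose u) * ((i + j - U) choose (i - u)))) = nu ((i + j) choose i)"
      unfolding nu_def map_sum[symmetric] of_nat_sum[symmetric] by (simp only:)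
    then show "(\<Sum>u\<le>i. f u U) = scal (nu ((i + j) choose i)) (g U)"
      by (simp only: f_def flip: scal_sum_left)
  qed simp
  finally show ?thesis by (simp add: scal_sum_right)
qed

lemma diag_mul:
  assumes "e + e' \<le> 1"
  shows "mul T (diag e i) (diag e' j) = scal (nu ((i + j) choose i)) (diag (e + e') (i + j))"
proof -
  have "mul T (diag e i) (diag e' j) = (\<Sum>u\<le>i. \<Sum>u'\<le>j.
      scal (nu (((u + u') choose u) * ((i - u + (j - u')) choose (i - u))))
        (Poly_Mapping.single ((e + e', 0, u + u'), (e + e', 0, i + j - (u + u'))) 1))"
    unfolding diag_def mul_sum_left mul_sum_right
  proof (subst sum.swap, intro sum.cong refl)
    fix u u' assume "u \<in> {..i}" "u' \<in> {..j}"
    then show "mul T (Poly_Mapping.single ((e, 0, u), (e, 0, i - u)) 1) (Poly_Mapping.single ((e', 0, u'), (e', 0, j - u')) 1) =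
      scal (nu (((u + u') choose u) * ((i - u + (j - u')) choose (i - u))))
        (Poly_Mapping.single ((e + e', 0, u + u'), (e + e', 0, i + j - (u + u'))) 1)"
      using assms by (cases "e * e' = 0") (auto simp: T_mul_singles op_M_def kappa_M_def mult_coeff_def nu_mult add.commute
        simp del: mul_single)
  qed
  also have "\<dots> = scal (nu ((i + j) choose i))
      (\<Sum>U\<le>i + j. Poly_Mapping.single ((e + e', 0, U), (e + e', 0, i + j - U)) 1)"
    by (rule binomial_convolution[where g = "\<lambda>U. Poly_Mapping.single ((e + e', 0, U), (e + e', 0, i + j - U)) 1"])
  finally show ?thesis by (simp only: diag_def)
qed

lemma diag_mul_odd: "mul T (diag 1 i) (diag 1 j) = 0"
  unfolding diag_def mul_sum_left mul_sum_right
  by (simp add: T_mul_singles kappa_M_def del: mul_single)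

text \<open>Modulo p, (1+X)^n = (1+X)^(n-p) (1+X^p): in Vandermonde's sum only C(p,0) and C(p,p)
  survive.\<close>

lemma binomial_p:
  assumes "p \<le> n"
  shows "nu (n choose i) = nu ((n - p) choose i) + (if p \<le> i then nu ((n - p) choose (i - p)) else 0)"
proof -
  have "nu (n choose i) = nu (\<Sum>k\<le>i. (p choose k) * ((n - p) choose (i - k)))"
    using vandermonde[of p "n - p" i] assms by simp
  also have "\<dots> = (\<Sum>k\<le>i. nu (p choose k) * nu ((n - p) choose (i - k)))"
    by (simp add: nu_def map_sum map_mult)
  also have "\<dots> = (\<Sum>k\<in>(if p \<le> i then {0, p} else {0}). nu (p choose k) * nu ((n - p) choose (i - k)))"
  proof (rule sum.mono_neutral_right)
    show "\<forall>k\<in>{..i} - (if p \<le> i then {0, p} else {0}). nu (p choose k) * nu ((n - p) choose (i - k)) = 0"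
    proof
      fix k assume k: "k \<in> {..i} - (if p \<le> i then {0, p} else {0})"
      have "nu (p choose k) = 0"
      proof (cases "k < p")
        case True
        then show ?thesis using k prime_dvd_choose_power[OF prime_p, of k 1]
          by (intro nu_zero) (auto split: if_splits)
      next
        case False
        then have "p < k" using k by (auto split: if_splits)
        then show ?thesis by (simp add: binomial_eq_0)
      qed
      then show "nu (p choose k) * nu ((n - p) choose (i - k)) = 0" by simp
    qed
  qed auto
  also have "\<dots> = nu ((n - p) choose i) + (if p \<le> i then nu ((n - p) choose (i - p)) else 0)"
    using p_gt by simp
  finally show ?thesis .
qed

text \<open>The two mixed products of a tau-free sum with a tau-tau sum have the coefficients
  C(i+j-p,i) and C(i+j-p,i-p), and \<open>binomial_p\<close> adds them to C(i+j,i). The product of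
  the two tau-tau sums is 0 because tau^2 = 0.\<close>

lemma comult_sigma_mul:
  "mul T (comult_sigma i) (comult_sigma j) = scal (nu ((i + j) choose i)) (comult_sigma (i + j))"
proof -
  let ?A = "if p \<le> j then scal (nu ((i + (j - p)) choose i)) (diag 1 (i + j - p)) else 0"
  let ?B = "if p \<le> i then scal (nu ((i - p + j) choose (i - p))) (diag 1 (i + j - p)) else 0"
  have "mul T (comult_sigma i) (comult_sigma j) = scal (nu ((i + j) choose i)) (diag 0 (i + j)) + (?A + ?B)"
    using diag_mul[of 0 1] diag_mul[of 1 0] diag_mul[of 0 0]
    using diag_mul_odd by (auto simp: comult_sigma_def mul_add_left mul_add_right)
  also have "?A + ?B = (if p \<le> i + j then scal (nu ((i + j) choose i)) (diag 1 (i + j - p)) else 0)"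
  proof (cases "p \<le> i + j")
    case True
    have A: "?A = scal (nu ((i + j - p) choose i)) (diag 1 (i + j - p))"
    proof (cases "p \<le> j")
      case False
      then have "i + j - p < i" using True by linarith
      then show ?thesis using False by (simp add: binomial_eq_0)
    qed simp
    have B: "?B = scal (if p \<le> i then nu ((i + j - p) choose (i - p)) else 0) (diag 1 (i + j - p))"
      by simp
    show ?thesis
      by (simp only: A B True if_True binomial_p[OF True, of i] scal_add_left)
  qed auto
  finally show ?thesis
    by (simp add: comult_sigma_def scal_add_right)
qed

lemma pow_theta_Q: "pow AM theta_A Q = sigma_A 1"
proof -
  have 1: "mult_tab AM b c = scalar_ext \<iota> (mult_tab (M p r) b c)" "unit_el AM = scalar_ext \<iota> (unit_el (M p r))" for b c
    by (simp_all add: base_change_def del: AM_simps)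
  have "pow AM theta_A Q = scalar_ext \<iota> (pow (M p r) (theta p r) Q)"
    unfolding theta_A_def by (rule scalar_ext_pow[OF 1, symmetric])
  also have "\<dots> = sigma_A 1"
    using M_relations(3)[of p r, where 'k='k] p3 unfolding Q_def by (simp only: scalar_ext_gens)
  finally show ?thesis .
qed

lemma pow_theta: "pow AM theta_A n = scalar_ext \<iota> (normal_monomial p r 0 n 0)"
proof (induction n)
  case 0 show ?case by (simp add: R.pow_0 scalar_ext_normal_monomial)
next
  case (Suc n)
  have "pow AM theta_A (Suc n) = mul AM (Poly_Mapping.single (0, 1 mod Q, 1 div Q) 1) (Poly_Mapping.single (0, n mod Q, n div Q) (nu (fact (n div Q))))"
    unfolding R.pow_Suc Suc by (simp add: theta_A_eq scalar_ext_normal_monomial del: mul_single)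
  also have "\<dots> = Poly_Mapping.single (0, Suc n mod Q, Suc n div Q) (nu (fact (Suc n div Q)))"
  \<comment> \<open>For r = 1 theta is sigma_1, so each factor raises the index of sigma; otherwise
    it does so only when the exponent of theta reaches Q.\<close>
  proof (cases "Q = 1")
    case True
    then show ?thesis by (simp add: R.mul_singles op_M_def kappa_M_def mult_coeff_def mult.commute algebra_simps del: mul_single flip: nu_mult)
  next
    case False
    then have Q: "1 < Q" using Q_pos by simp
    show ?thesis
    proof (cases "Suc (n mod Q) = Q")
      case True
      then have "Suc n div Q = Suc (n div Q)" "Suc n mod Q = 0"
        by (simp_all add: div_Suc mod_Suc)
      then show ?thesis using True Q by (simp add: R.mul_singles op_M_def kappa_M_def mult_coeff_def add.commute mult.commute del: mul_single flip: nu_mult)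
    next
      case False
      then have "Suc n div Q = n div Q" "Suc n mod Q = Suc (n mod Q)" "Suc (n mod Q) < Q"
        using mod_less_divisor[OF Q_pos, of n] by (auto simp: div_Suc mod_Suc)
      then show ?thesis using Q by (simp add: R.mul_singles op_M_def kappa_M_def mult_coeff_def del: mul_single)
    qed
  qed
  finally show ?case by (simp add: scalar_ext_normal_monomial)
qed

lemma pow_tensor_left:
  assumes "homogeneous AM 0 x" "x \<in> carrier_of AM"
  shows "pow T (tensor x (mono 0 0 0)) n = tensor (pow AM x n) (mono 0 0 0)"
proof (induction n)
  case 0 show ?case by (simp add: R.T.pow_0 R.pow_0 T_simps)
next
  case (Suc n)
  have "homogeneous AM 0 (mono 0 0 0)" "homogeneous AM 0 (pow AM x n)"
    using R.pow_homogeneous[OF assms(1), of n] by (simp_all add: homogeneous_closed)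
  then show ?case
    using R.unit_left[OF R.unit_closed]
    by (simp add: R.T.pow_Suc R.pow_Suc Suc R.mul_tensor del: mul_single)
qed

lemma pow_tensor_right:
  assumes "homogeneous AM 0 x" "x \<in> carrier_of AM"
  shows "pow T (tensor (mono 0 0 0) x) n = tensor (mono 0 0 0) (pow AM x n)"
proof (induction n)
  case 0 show ?case by (simp add: R.T.pow_0 R.pow_0 T_simps)
next
  case (Suc n)
  have "homogeneous AM 0 (mono 0 0 0)" "homogeneous AM 0 (pow AM x n)"
    using R.pow_homogeneous[OF assms(1), of n] by (simp_all add: homogeneous_closed)
  then show ?case
    using R.unit_left[OF R.unit_closed] assms
    by (simp add: R.T.pow_Suc R.pow_Suc Suc R.mul_tensor del: mul_single)
qed

lemma tensor_split:
  assumes "homogeneous AM 0 x" "homogeneous AM 0 y" "x \<in> carrier_of AM" "y \<in> carrier_of AM"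
  shows "mul T (tensor x (mono 0 0 0)) (tensor (mono 0 0 0) y) = tensor x y"
    "mul T (tensor (mono 0 0 0) y) (tensor x (mono 0 0 0)) = tensor x y"
proof -
  have "homogeneous AM 0 (mono 0 0 0)" by (simp add: homogeneous_closed)
  then show "mul T (tensor x (mono 0 0 0)) (tensor (mono 0 0 0) y) = tensor x y"
    "mul T (tensor (mono 0 0 0) y) (tensor x (mono 0 0 0)) = tensor x y"
    using R.unit_left R.unit_right assms by (simp_all add: R.mul_tensor del: mul_single)
qed

lemma frobenius_prim:
  assumes "homogeneous AM 0 x" "x \<in> carrier_of AM"
  shows "pow T (prim x) (p ^ l) = prim (pow AM x (p ^ l))"
proof -
  have "pow T (prim x) (CHAR('k) ^ l) = pow T (tensor x (mono 0 0 0)) (CHAR('k) ^ l) + pow T (tensor (mono 0 0 0) x) (CHAR('k) ^ l)"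
    unfolding prim_def
    using assms prime_p char_p
    by (intro frobenius_add R.T.assoc_superalgebra_axioms tensor_closed) (simp_all add: tensor_split)
  then show ?thesis using assms by (simp add: char_p pow_tensor_left pow_tensor_right prim_def)
qed

text \<open>Hence the coproduct is a \<open>gens_map\<close> into \<open>T\<close> and is
  multiplicative. The relation for theta^Q uses that Q is a power of p, so that Frobenius applies,
  and that the coproduct of sigma_1 has no tau terms, as 1 < p.\<close>

lemma comult_relations: "M_relations_in T (prim tau_A) (prim theta_A) comult_sigma"
  unfolding M_relations_in_def
proof (intro conjI allI)
  show "mul T (prim tau_A) (prim tau_A) = 0"
    by (simp add: prim_def tau_A_def mul_linear T_mul_singles op_M_def kappa_M_def mult_coeff_def
        single_add[symmetric] del: mul_single)
  show "mul T (prim tau_A) (prim theta_A) = mul T (prim theta_A) (prim tau_A)"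
    by (rule T_even_commute[symmetric], rule even_prim[OF homogeneous_gens(1)])
  fix i j
  show "mul T (prim tau_A) (comult_sigma j) = mul T (comult_sigma j) (prim tau_A)"
    "mul T (prim theta_A) (comult_sigma j) = mul T (comult_sigma j) (prim theta_A)"
    by (rule T_even_commute[symmetric], rule even_comult_sigma, assumption)+
  show "comult_sigma 0 = unit_el T"
    using p_gt by (simp add: comult_sigma_def diag_def T_simps)
  show "pow T (prim theta_A) Q = comult_sigma 1"
    using frobenius_prim[of theta_A "r - 1", folded Q_def] p_gt pow_theta_Q
    by (simp add: comult_sigma_def diag_def prim_def sigma_A_def add.commute)
qed (simp_all add: prim_closed comult_sigma_closed comult_sigma_mul)

lemma comult_mul: "comult AM (mul AM x y) = mul T (comult AM x) (comult AM y)"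
  unfolding comult_AM by (rule gens_map_mul[OF R.T.assoc_superalgebra_axioms comult_relations])

end

text \<open>Members of \<open>hopf_homs\<close> are linear only on the carrier, being undefined
  outside it, while maps of the form \<open>lin_ext\<close> are linear everywhere; both kinds are
  compared below.\<close>

definition linear_on :: "('b \<Rightarrow>\<^sub>0 'a) set \<Rightarrow> (('b \<Rightarrow>\<^sub>0 'a) \<Rightarrow> ('c \<Rightarrow>\<^sub>0 'a::comm_ring)) \<Rightarrow> bool" where
  "linear_on C F \<longleftrightarrow> (\<forall>x\<in>C. \<forall>y\<in>C. F (x + y) = F x + F y) \<and> (\<forall>c. \<forall>x\<in>C. F (scal c x) = scal c (F x))"

lemma linear_on_lin_ext: "linear_on C (lin_ext f)"
  by (simp add: linear_on_def lin_ext_linear)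

lemma linear_on_basis:
  fixes F :: "('b \<Rightarrow>\<^sub>0 'a::{comm_ring,comm_monoid_mult}) \<Rightarrow> ('c \<Rightarrow>\<^sub>0 'a)"
  assumes "linear_on (carrier_of H) F" "x \<in> carrier_of H"
  shows "F x = lin_ext (\<lambda>b. F (Poly_Mapping.single b 1)) x"
proof -
  have z: "F 0 = 0"
    using assms(1) unfolding linear_on_def by (metis carrier_closed(1) scal_simps(2))
  have "Poly_Mapping.keys x \<subseteq> basis H \<Longrightarrow> x \<in> carrier_of H \<and> F x = lin_ext (\<lambda>b. F (Poly_Mapping.single b 1)) x"
  proof (induction x rule: poly_mapping_linear_induct)
    case zero then show ?case by (simp add: z carrier_closed)
  next
    case (add x y)
    then show ?case using assms(1) by (auto simp: linear_on_def lin_ext_linear intro: carrier_closed)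
  next
    case (single b c)
    have "F (scal c (Poly_Mapping.single b 1)) = scal c (F (Poly_Mapping.single b 1))"
      using assms(1) single by (auto simp: linear_on_def intro!: carrier_closed simp del: scal_simps)
    then show ?case using single by (simp add: carrier_closed)
  qed
  then show ?thesis using assms(2) by (simp add: carrier_of_iff)
qed

lemma linear_on_eq:
  fixes F :: "('b \<Rightarrow>\<^sub>0 'a::{comm_ring,comm_monoid_mult}) \<Rightarrow> ('c \<Rightarrow>\<^sub>0 'a)"
  assumes "linear_on (carrier_of H) F" "linear_on (carrier_of H) G" "x \<in> carrier_of H"
    "\<And>b. b \<in> basis H \<Longrightarrow> F (Poly_Mapping.single b 1) = G (Poly_Mapping.single b 1)"
  shows "F x = G x"
  unfolding linear_on_basis[OF assms(1,3)] linear_on_basis[OF assms(2,3)]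
  using assms(3,4) by (intro lin_ext_cong) (auto simp: carrier_of_iff)

section \<open>Coefficients of the coproduct\<close>

context hopf_M begin

text \<open>The shape taken by the component of the coproduct of a basis monomial in which the
  powers of tau in the two tensor factors are fixed as e and e'.\<close>

definition block :: "nat \<Rightarrow> nat \<Rightarrow> nat \<Rightarrow> nat \<Rightarrow> (idx \<times> idx \<Rightarrow>\<^sub>0 'a)" where
  "block e e' i j = (\<Sum>k\<le>i. \<Sum>u\<le>j. Poly_Mapping.single ((e, k, u), (e', i - k, j - u)) (nu (i choose k)))"

lemma sum_delta2: "(\<Sum>k\<le>i. \<Sum>u\<le>j. if k = i1 \<and> u = j1 \<and> P then (f k :: 'a) else 0) =
    (if i1 \<le> i \<and> j1 \<le> j \<and> P then f i1 else 0)" for i j :: nat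
proof -
  have "(\<Sum>k\<le>i. \<Sum>u\<le>j. if k = i1 \<and> u = j1 \<and> P then f k else 0) =
      (\<Sum>k\<le>i. if k = i1 then (\<Sum>u\<le>j. if u = j1 then (if P then f i1 else 0) else 0) else 0)"
    by (intro sum.cong refl) auto
  then show ?thesis by (simp only: sum.delta' sum.delta finite_atMost) auto
qed

lemma lookup_block:
  "Poly_Mapping.lookup (block e e' i j) ((e1, i1, j1), (e2, i2, j2)) =
    (if e1 = e \<and> e2 = e' \<and> i1 + i2 = i \<and> j1 + j2 = j then nu (i choose i1) else 0)"
proof -
  have "Poly_Mapping.lookup (block e e' i j) ((e1, i1, j1), (e2, i2, j2)) =
      (\<Sum>k\<le>i. \<Sum>u\<le>j. if k = i1 \<and> u = j1 \<and> (e = e1 \<and> e' = e2 \<and> i - i1 = i2 \<and> j - j1 = j2) then nu (i choose k) else 0)"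
    unfolding block_def lookup_sum lookup_single when_def by (intro sum.cong refl) auto
  then show ?thesis unfolding sum_delta2 by auto
qed

lemma pow_theta_low: "n < Q \<Longrightarrow> pow AM theta_A n = mono 0 n 0"
  by (simp add: pow_theta scalar_ext_normal_monomial)

lemma pow_prim_theta:
  assumes "i < Q"
  shows "pow T (prim theta_A) i = (\<Sum>k\<le>i. Poly_Mapping.single ((0, k, 0), (0, i - k, 0)) (nu (i choose k)))"
proof -
  have "pow T (prim theta_A) i = (\<Sum>k\<le>i. scal (nu (i choose k))
      (mul T (pow T (tensor theta_A (mono 0 0 0)) k) (pow T (tensor (mono 0 0 0) theta_A) (i - k))))"
    unfolding prim_def
    by (intro binomial_pow R.T.assoc_superalgebra_axioms tensor_closed) (simp_all add: tensor_split)
  also have "\<dots> = (\<Sum>k\<le>i. Poly_Mapping.single ((0, k, 0), (0, i - k, 0)) (nu (i choose k)))"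
    using assms by (intro sum.cong refl)
      (simp add: pow_tensor_left pow_tensor_right tensor_split homogeneous_closed pow_theta_low del: tensor_single,
       simp)
  finally show ?thesis .
qed

lemma pow_theta_diag:
  assumes "i < Q" "e \<le> 1"
  shows "mul T (pow T (prim theta_A) i) (diag e j) = block e e i j"
  unfolding pow_prim_theta[OF assms(1)] diag_def mul_sum_left mul_sum_right block_def
proof (subst sum.swap, intro sum.cong refl)
  fix k u assume "k \<in> {..i}" "u \<in> {..j}"
  then show "mul T (Poly_Mapping.single ((0, k, 0), (0, i - k, 0)) (nu (i choose k)))
      (Poly_Mapping.single ((e, 0, u), (e, 0, j - u)) 1) =
    Poly_Mapping.single ((e, k, u), (e, i - k, j - u)) (nu (i choose k))"
    using assms by (simp add: T_mul_singles op_M_def kappa_M_def mult_coeff_def del: mul_single)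
qed

lemma comult_mono_even:
  assumes "i < Q"
  shows "comult AM (mono 0 i j) = block 0 0 i j + (if p \<le> j then block 1 1 i (j - p) else 0)"
proof -
  have "mul T (pow T (prim theta_A) i) (comult_sigma j) \<in> carrier_of T"
    by (intro R.T.mul_closed R.T.pow_closed prim_closed comult_sigma_closed theta_A_closed)
  then have "comult AM (mono 0 i j) = mul T (pow T (prim theta_A) i) (comult_sigma j)"
    by (simp add: comult_def comult_tab_AM R.T.pow_0 R.T.unit_left)
  then show ?thesis
    using assms pow_theta_diag[of i 0] pow_theta_diag[of i 1] by (simp add: comult_sigma_def mul_add_right)
qed

lemma prim_tau_block:
  assumes "i < Q"
  shows "mul T (prim tau_A) (block 0 0 i j) = block 1 0 i j + block 0 1 i j"
    and "mul T (prim tau_A) (block 1 1 i j) = 0"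
proof -
  have "mul T (tensor tau_A (mono 0 0 0)) (block 0 0 i j) = block 1 0 i j"
    unfolding block_def mul_sum_right using assms
    by (intro sum.cong refl) (simp add: tau_A_def T_mul_singles op_M_def kappa_M_def mult_coeff_def del: mul_single)
  moreover have "mul T (tensor (mono 0 0 0) tau_A) (block 0 0 i j) = block 0 1 i j"
    unfolding block_def mul_sum_right using assms
    by (intro sum.cong refl) (simp add: tau_A_def T_mul_singles op_M_def kappa_M_def mult_coeff_def del: mul_single)
  ultimately show "mul T (prim tau_A) (block 0 0 i j) = block 1 0 i j + block 0 1 i j"
    by (simp add: prim_def mul_add_left)
  show "mul T (prim tau_A) (block 1 1 i j) = 0"
    unfolding block_def mul_sum_right prim_def
    by (simp add: mul_add_left tau_A_def T_mul_singles kappa_M_def del: mul_single)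
qed

lemma comult_mono_odd:
  assumes "i < Q"
  shows "comult AM (mono 1 i j) = block 1 0 i j + block 0 1 i j"
proof -
  have *: "mul T (pow T (prim theta_A) i) (comult_sigma j) = block 0 0 i j + (if p \<le> j then block 1 1 i (j - p) else 0)"
    using assms pow_theta_diag[of i 0] pow_theta_diag[of i 1] by (simp add: comult_sigma_def mul_add_right)
  have "comult AM (mono 1 i j) = mul T (prim tau_A) (mul T (pow T (prim theta_A) i) (comult_sigma j))"
    by (simp add: comult_def comult_tab_AM R.T.pow_1 prim_closed)
  then show ?thesis unfolding *
    using prim_tau_block(1)[OF assms] prim_tau_block(2)[OF assms] by (simp add: mul_add_right split del: if_split) simp
qed

text \<open>Each coefficient of the coproduct is a binomial times one coefficient of x; dually, a
  product of two dual basis vectors is a multiple of one such vector. The arguments on primitive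
  elements and on the parameters \<mu> and b read coefficients off with this formula.\<close>

lemma lookup_comult:
  assumes "x \<in> carrier_of AM"
  shows "Poly_Mapping.lookup (comult AM x) ((e1, i1, j1), (e2, i2, j2)) = nu ((i1 + i2) choose i1) *
    (if e1 = 1 \<and> e2 = 1 then Poly_Mapping.lookup x (0, i1 + i2, j1 + j2 + p)
     else if e1 + e2 \<le> 1 then Poly_Mapping.lookup x (e1 + e2, i1 + i2, j1 + j2) else 0)"
    (is "?L x = ?R x")
proof -
  have "Poly_Mapping.keys x \<subseteq> basis AM" using assms by (simp add: carrier_of_iff)
  then show ?thesis
  proof (induction x rule: poly_mapping_linear_induct)
    case zero then show ?case by (simp add: comult_def)
  next
    case (add x y) then show ?case by (simp add: comult_def lin_ext_linear lookup_add distrib_left)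
  next
    case (single b c)
    obtain e i j where b: "b = (e, i, j)" by (metis prod_cases3)
    have i: "i < Q" and e: "e = 0 \<or> e = 1" using single b by auto
    have "Poly_Mapping.single b c = scal c (mono e i j)" by (simp add: b)
    then have "?L (Poly_Mapping.single b c) = c * ?L (mono e i j)"
      by (simp only: comult_def lin_ext_scal lookup_scal)
    also have "?L (mono e i j) = ?R (mono e i j)"
      using e
    proof
      assume "e = 0"
      then show ?thesis
        by (auto simp: comult_mono_even[OF i] lookup_add lookup_block lookup_single when_def)
    next
      assume "e = 1"
      then show ?thesis
        using comult_mono_odd[OF i, of j]
        by (auto simp: lookup_add lookup_block lookup_single when_def)
    qed
    also have "c * ?R (mono e i j) = ?R (Poly_Mapping.single b c)"
      by (auto simp: b lookup_single when_def mult.commute)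
    finally show ?case .
  qed
qed

section \<open>Counit and antipode\<close>

lemma counit_AM: "counit AM x = Poly_Mapping.lookup x (0, 0, 0)"
proof -
  have "counit_tab AM b = (if b = (0, 0, 0) then 1 else 0)" for b
    by (simp add: base_change_def M_def Let_def superalgebra.defs)
  then have "counit AM x = (\<Sum>b\<in>Poly_Mapping.keys x. if b = (0, 0, 0) then Poly_Mapping.lookup x b else 0)"
    unfolding counit_def by (intro sum.cong) auto
  then show ?thesis by (simp add: in_keys_iff)
qed

lemma counit_mul: "counit AM (mul AM x y) = counit AM x * counit AM y"
  if "x \<in> carrier_of AM" "y \<in> carrier_of AM"
  using that(1) unfolding carrier_of_iff
proof (induction x rule: poly_mapping_linear_induct)
  case (single b u)
  show ?case using that(2) unfolding carrier_of_iff
  proof (induction y rule: poly_mapping_linear_induct)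
    case (single c v)
    obtain e i j e' i' j' where *: "b = (e, i, j)" "c = (e', i', j')" by (metis prod_cases3)
    have "op_M b c = (0, 0, 0) \<longleftrightarrow> b = (0, 0, 0) \<and> c = (0, 0, 0)"
    proof
      assume h: "op_M b c = (0, 0, 0)"
      then have "(i + i') mod Q = 0" "(i + i') div Q = 0" by (auto simp: * op_M_def)
      then have "i + i' = 0" by (metis div_mult_mod_eq add.right_neutral mult_zero_left)
      then show "b = (0, 0, 0) \<and> c = (0, 0, 0)" using h by (auto simp: * op_M_def)
    qed (auto simp: op_M_def)
    then show ?case
      by (auto simp: counit_AM R.mul_singles lookup_single when_def kappa_M_def mult_coeff_def simp del: mul_single)
  qed (simp_all add: counit_AM mul_linear lookup_add distrib_left)
qed (simp_all add: counit_AM mul_linear lookup_add distrib_right)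

text \<open>Since A[M_r] commutes without signs, its antipode is an algebra homomorphism given by
  its values on generators. \<open>antipode_AM\<close> identifies the two on the carrier; this
  version is multiplicative by \<open>gens_map_mul\<close>.\<close>

definition antipode_sign :: "(idx \<Rightarrow>\<^sub>0 'a) \<Rightarrow> (idx \<Rightarrow>\<^sub>0 'a)" where
  "antipode_sign = gens_map AM (- tau_A) (- theta_A) (\<lambda>j. scal ((- 1) ^ j) (sigma_A j))"

lemma sigma_mul: "mul AM (sigma_A i) (sigma_A j) = scal (nu ((i + j) choose i)) (sigma_A (i + j))"
  using Q_pos by (simp add: sigma_A_def R.mul_singles op_M_def kappa_M_def mult_coeff_def del: mul_single)

lemma tau_mul: "mul AM tau_A tau_A = 0"
  by (simp add: tau_A_def R.mul_singles kappa_M_def del: mul_single)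

lemma uminus_one_power_odd: "odd n \<Longrightarrow> (- 1 :: 'a) ^ n = - 1"
proof -
  have "(- 1 :: 'a) ^ (2 * k) = 1" for k
    by (induction k) simp_all
  moreover assume "odd n"
  then obtain k where "n = Suc (2 * k)" by (auto elim!: oddE)
  ultimately show ?thesis by simp
qed

lemma scal_minus_one: "scal (- 1) x = - (x :: 'c \<Rightarrow>\<^sub>0 'a)"
  using scal_minus_left[of 1 x] by simp

text \<open>The relation (-theta)^Q = -sigma_1 holds because Q, a power of the odd prime p, is
  odd.\<close>

lemma antipode_relations: "M_relations_in AM (- tau_A) (- theta_A) (\<lambda>j. scal ((- 1) ^ j) (sigma_A j))"
proof -
  have "pow AM (- theta_A) Q = - sigma_A (Suc 0)"
    using R.pow_scal[of "- 1" theta_A Q] uminus_one_power_odd[OF odd_Q] pow_theta_Q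
    by (simp add: scal_minus_one)
  moreover have "sigma_A 0 = mono 0 0 0" by (simp add: sigma_A_def)
  ultimately show ?thesis
    unfolding M_relations_in_def
    by (auto simp: carrier_closed carrier_scal mul_linear tau_mul sigma_mul power_add scal_minus_one scal_minus_right mult_ac AM_commute)
qed

lemma antipode_AM:
  assumes "x \<in> carrier_of AM"
  shows "antipode AM x = antipode_sign x"
  unfolding antipode_def antipode_sign_def gens_map_def
proof (rule lin_ext_cong)
  fix b assume "b \<in> Poly_Mapping.keys x"
  then have "b \<in> basis AM" using assms by (auto simp: carrier_of_iff)
  then obtain e i j where b: "b = (e, i, j)" "e < 2" "i < Q" by auto
  have "antipode_tab AM b = Poly_Mapping.single b ((- 1) ^ (e + i + j))"
    by (simp add: base_change_def M_def Let_def superalgebra.defs b scalar_ext_simps map_uminus_power)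
  moreover have "pow AM (- theta_A) i = Poly_Mapping.single (0, i, 0) ((- 1) ^ i)"
    using R.pow_scal[of "- 1" theta_A i] b pow_theta_low[of i] by (simp add: scal_minus_one)
  moreover have "pow AM (- tau_A) e = Poly_Mapping.single (e, 0, 0) ((- 1) ^ e)"
  proof -
    have "e = 0 \<or> e = 1" using b by auto
    then show ?thesis
      by (auto simp: R.pow_0 R.pow_1[of "- tau_A"] carrier_closed(4) single_uminus simp flip: tau_A_def)
        (simp add: tau_A_def)
  qed
  ultimately show "antipode_tab AM b = (case b of (e, i, j) \<Rightarrow> mul AM (pow AM (- tau_A) e)
      (mul AM (pow AM (- theta_A) i) (scal ((- 1) ^ j) (sigma_A j))))"
    using b by (simp add: sigma_A_def R.mul_singles op_M_def kappa_M_def mult_coeff_def power_add mult_ac del: mul_single)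
qed

lemma antipode_sign_mul: "antipode_sign (mul AM x y) = mul AM (antipode_sign x) (antipode_sign y)"
  unfolding antipode_sign_def by (rule gens_map_mul[OF R.assoc_superalgebra_axioms antipode_relations])

lemma gens_map_gens:
  assumes "assoc_superalgebra B" "M_relations_in B t x y"
  shows "gens_map B t x y tau_A = t" "gens_map B t x y theta_A = x" "gens_map B t x y (sigma_A j) = y j"
    "gens_map B t x y (mono 0 0 0) = unit_el B"
proof -
  interpret B: assoc_superalgebra B by fact
  note rel = assms(2)[unfolded M_relations_in_def]
  have c: "t \<in> carrier_of B" "x \<in> carrier_of B" "y j \<in> carrier_of B" "y 0 = unit_el B" for j using rel by auto
  show "gens_map B t x y theta_A = x"
    using gens_map_normal[OF assms, of 0 1 0] c
    by (simp add: gens_map_def theta_A_def B.pow_0 B.pow_1 B.unit_left B.unit_right)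
  show "gens_map B t x y tau_A = t" "gens_map B t x y (sigma_A j) = y j"
    "gens_map B t x y (mono 0 0 0) = unit_el B"
    using c by (simp_all add: gens_map_def tau_A_def sigma_A_def B.pow_0 B.pow_1 B.unit_left B.unit_right B.unit_closed)
qed

text \<open>By Lucas C(p^l + p^l m, p^l) is m + 1 modulo p, which produces the factorial step by
  step. For m = p the result is 0.\<close>

lemma sigma_pow: "pow AM (sigma_A (p ^ l)) m = scal (nu (fact m)) (sigma_A (p ^ l * m))"
proof (induction m)
  case 0 show ?case by (simp add: R.pow_0 sigma_A_def)
next
  case (Suc m)
  have "nu ((p ^ l + p ^ l * m) choose (p ^ l)) = nu (Suc m)"
    using lucas_0[of 0 l "Suc m" 1] p_gt by simp
  then show ?case
    by (simp add: R.pow_Suc Suc mul_linear sigma_mul nu_mult[symmetric] mult.commute)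
qed

text \<open>In normal form this power carries the factor q! with q = p^(m-r+1), and q >= p.\<close>

lemma pow_theta_zero: "r \<le> m \<Longrightarrow> pow AM theta_A (p ^ m) = 0"
proof -
  assume m: "r \<le> m"
  have "p ^ m = Q * p ^ (m - (r - 1))" using m r1 by (simp add: Q_def flip: power_add)
  then have "p ^ m div Q = p ^ (m - (r - 1))" using Q_pos by simp
  moreover have "p ^ 1 \<le> p ^ (m - (r - 1))" using m r1 p_gt by (intro power_increasing) auto
  ultimately have "p dvd fact (p ^ m div Q)" using prime_p by (simp add: prime_dvd_fact_iff)
  then show ?thesis by (simp add: pow_theta scalar_ext_normal_monomial nu_zero)
qed

text \<open>For l < r this is the basis index of theta^(p^l); at l = r - 1 that power is
  sigma_1.\<close>

definition gidx :: "nat \<Rightarrow> idx" where "gidx l = (0, p ^ l mod Q, p ^ l div Q)"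

lemma gidx_low: "l < r - 1 \<Longrightarrow> gidx l = (0, p ^ l, 0)"
  and gidx_top: "gidx (r - 1) = (0, 0, 1)"
  using p_gt Q_pos power_strict_increasing[of l "r - 1" p] by (auto simp: gidx_def Q_def)

lemma pow_theta_gidx: "l < r \<Longrightarrow> pow AM theta_A (p ^ l) = Poly_Mapping.single (gidx l) 1"
proof -
  assume "l < r"
  then have "l < r - 1 \<or> l = r - 1" by auto
  then have "p ^ l div Q \<le> 1"
  proof
    assume "l < r - 1"
    then have "p ^ l < Q" using p_gt by (simp add: Q_def)
    then show ?thesis by simp
  next
    assume "l = r - 1"
    then show ?thesis using Q_pos by (simp only: Q_def[symmetric]) simp
  qed
  then have "nu (fact (p ^ l div Q)) = 1" by (cases "p ^ l div Q") auto
  then show ?thesis by (simp add: pow_theta scalar_ext_normal_monomial gidx_def)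
qed

lemma inj_gidx: "inj_on gidx {..<r}"
proof (rule inj_onI)
  fix l l' assume "gidx l = gidx l'"
  then have "p ^ l = p ^ l'" by (auto simp: gidx_def) (metis div_mult_mod_eq)
  then show "l = l'" using p_gt by simp
qed

abbreviation add_poly :: "(nat \<Rightarrow> 'a) \<Rightarrow> (idx \<Rightarrow>\<^sub>0 'a)" where "add_poly \<equiv> additive_poly \<iota> p r"

lemma add_poly_eq: "add_poly a = (\<Sum>i<r. scal (a i) (pow AM theta_A (p ^ i)))"
  by (simp add: additive_poly_def theta_A_def)

lemma add_poly_closed: "add_poly a \<in> carrier_of AM"
  unfolding add_poly_eq by (intro carrier_sum carrier_scal R.pow_closed theta_A_closed)

lemma add_poly_even: "homogeneous AM 0 (add_poly a)"
  unfolding add_poly_eq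
  by (intro homogeneous_sum homogeneous_closed) (metis R.pow_homogeneous homogeneous_gens(1) mult_zero_right)

lemma add_poly_pow: "pow AM (add_poly a) (p ^ l) = (\<Sum>i<r. scal (a i ^ p ^ l) (pow AM theta_A (p ^ (i + l))))"
proof -
  have "pow AM (add_poly a) (CHAR('k) ^ l) = (\<Sum>i<r. pow AM (scal (a i) (pow AM theta_A (p ^ i))) (CHAR('k) ^ l))"
    unfolding add_poly_eq using prime_p char_p
    by (intro frobenius_sum R.assoc_superalgebra_axioms carrier_scal R.pow_closed AM_commute) simp_all
  then show ?thesis by (simp add: char_p R.pow_scal power_add R.pow_mult)
qed

text \<open>Frobenius turns the i-th term into a multiple of theta^(p^(i+r-1)), which is 0 for i >=
  1. Hence sigma_1 = theta^Q is scaled by the power p^(r-1) of a_0.\<close>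

lemma add_poly_pow_Q: "pow AM (add_poly a) Q = scal (a 0 ^ Q) (sigma_A 1)"
proof -
  have "pow AM (add_poly a) (p ^ (r - 1)) = (\<Sum>i<r. if i = 0 then scal (a 0 ^ Q) (sigma_A 1) else 0)"
    unfolding add_poly_pow using pow_theta_Q by (intro sum.cong) (auto simp: pow_theta_zero Q_def)
  then show ?thesis using r1 by (simp add: Q_def)
qed

lemma add_poly_pow_r: "pow AM (add_poly a) (p ^ r) = 0"
  unfolding add_poly_pow by (intro sum.neutral) (simp add: pow_theta_zero)

lemma lookup_add_poly: "l < r \<Longrightarrow> Poly_Mapping.lookup (add_poly a) (gidx l) = a l"
proof -
  assume l: "l < r"
  have "add_poly a = (\<Sum>i<r. Poly_Mapping.single (gidx i) (a i))"
    by (simp add: add_poly_eq pow_theta_gidx)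
  then have "Poly_Mapping.lookup (add_poly a) (gidx l) = (\<Sum>i<r. if gidx i = gidx l then a i else 0)"
    by (simp add: lookup_sum lookup_single when_def)
  also have "\<dots> = (\<Sum>i<r. if i = l then a i else 0)"
    using l inj_onD[OF inj_gidx] by (intro sum.cong refl if_cong) auto
  finally show ?thesis using l by simp
qed

lemma add_poly_inj: "a \<in> tuples r \<Longrightarrow> a' \<in> tuples r \<Longrightarrow> add_poly a = add_poly a' \<Longrightarrow> a = a'"
  using lookup_add_poly[of _ a] lookup_add_poly[of _ a'] by (intro PiE_ext[of a "{..<r}" "\<lambda>_. UNIV" a']) auto

lemma comult_pow: "comult AM (pow AM x n) = pow T (comult AM x) n"
proof (induction n)
  case 0
  have "comult AM (mono 0 0 0) = unit_el T"
    using gens_map_gens(4)[OF R.T.assoc_superalgebra_axioms comult_relations] by (simp add: comult_AM)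
  then show ?case by (simp add: R.pow_0 R.T.pow_0)
qed (simp add: R.pow_Suc R.T.pow_Suc comult_mul)

lemma comult_gens: "comult AM tau_A = prim tau_A" "comult AM theta_A = prim theta_A"
    "comult AM (sigma_A j) = comult_sigma j"
  unfolding comult_AM using gens_map_gens[OF R.T.assoc_superalgebra_axioms comult_relations] by simp_all

lemma prim_linear: "prim (x + y) = prim x + prim y" "prim (scal c x) = scal c (prim x)"
  "prim (\<Sum>i\<in>I. f i) = (\<Sum>i\<in>I. prim (f i))" "prim (x - y) = prim x - prim y"
  by (simp_all add: prim_def tensor_linear scal_add_right sum.distrib)

lemma comult_linear: "comult H (x + y) = comult H x + comult H y" "comult H (scal c x) = scal c (comult H x)"
  "comult H (\<Sum>i\<in>I. f i) = (\<Sum>i\<in>I. comult H (f i))" "comult H (x - y) = comult H x - comult H y"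
  by (simp_all add: comult_def lin_ext_linear)

lemma comult_add_poly: "comult AM (add_poly a) = prim (add_poly a)"
  by (simp add: add_poly_eq comult_linear prim_linear comult_pow comult_gens frobenius_prim)

section \<open>The primitive elements of A[M_r]\<close>

lemma primitive_lookup:
  assumes "comult AM x = prim x" "b \<noteq> (0, 0, 0)" "c \<noteq> (0, 0, 0)"
  shows "Poly_Mapping.lookup (comult AM x) (b, c) = 0"
  using assms by (simp add: prim_def lookup_add lookup_single when_def)

lemma primitive_counit:
  assumes "x \<in> carrier_of AM" "comult AM x = prim x"
  shows "Poly_Mapping.lookup x (0, 0, 0) = 0"
proof -
  have "Poly_Mapping.lookup (comult AM x) ((0, 0, 0), (0, 0, 0)) = Poly_Mapping.lookup x (0, 0, 0)"
    by (simp add: lookup_comult[OF assms(1)])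
  then show ?thesis unfolding assms(2) by (simp add: prim_def lookup_add)
qed

lemma not_power_decomp:
  fixes i :: nat
  assumes "i > 0"
  obtains l m where "i = p ^ l * m" "\<not> p dvd m"
proof -
  have "i \<noteq> 0" "\<not> is_unit p" using assms p_gt by auto
  then show ?thesis
    using that multiplicity_decompose[of i p] multiplicity_decompose'[of i p] by metis
qed

text \<open>A monomial other than the theta^(p^l) splits into two nontrivial monomials whose tensor
  occurs in its coproduct with a coefficient invertible in k. By \<open>lookup_comult\<close> its
  coefficient in x then appears in the coproduct of x at a place where a primitive element has
  none.\<close>

lemma even_primitive:
  assumes x: "x \<in> carrier_of AM" "comult AM x = prim x" "homogeneous AM 0 x"
  shows "x = add_poly (\<lambda>l. Poly_Mapping.lookup x (gidx l))"
proof (rule poly_mapping_eqI)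
  fix b :: idx
  have eq: "Poly_Mapping.lookup (add_poly a) b = (\<Sum>l<r. if gidx l = b then a l else 0)" for a
    by (simp add: add_poly_eq pow_theta_gidx lookup_sum lookup_single when_def)
  note look = lookup_comult[OF x(1)]
  show "Poly_Mapping.lookup x b = Poly_Mapping.lookup (add_poly (\<lambda>l. Poly_Mapping.lookup x (gidx l))) b"
  proof (cases "b \<in> gidx ` {..<r}")
    case True then show ?thesis using lookup_add_poly by auto
  next
    case False
    then have "Poly_Mapping.lookup (add_poly (\<lambda>l. Poly_Mapping.lookup x (gidx l))) b = 0"
      unfolding eq by (intro sum.neutral) auto
    moreover have "Poly_Mapping.lookup x b = 0"
    proof (rule ccontr)
      assume nz: "Poly_Mapping.lookup x b \<noteq> 0"
      then have "b \<in> basis AM" using x(1) by (meson carrier_of_lookup)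
      moreover have "parity AM b = 0" using nz x(3) by (meson homogeneous_lookup)
      ultimately obtain i j where b: "b = (0, i, j)" "i < Q" by auto
      consider "i = 0" "j = 0" | "i > 0" "j > 0" | "i = 0" "j = 1" | "i = 0" "j \<ge> 2" | "i > 0" "j = 0" by linarith
      then show False
      proof cases
        case 1 then show False using nz primitive_counit[OF x(1,2)] b by simp
      next
        case 2
        then show False using nz primitive_lookup[OF x(2), of "(0, i, 0)" "(0, 0, j)"] b by (simp add: look)
      next
        case 3
        then have "b = gidx (r - 1)" using gidx_top b by simp
        then show False using False r1 by auto
      next
        case 4
        then show False using nz primitive_lookup[OF x(2), of "(0, 0, 1)" "(0, 0, j - 1)"] b by (simp add: look)
      next
        case 5
        \<comment> \<open>For theta^i the factor split off is theta^(p^l): by Lucas C(i,p^l) is m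
          modulo p, which is nonzero, and the complement is nontrivial once m > 1.\<close>
        then obtain l m where lm: "i = p ^ l * m" "\<not> p dvd m" using not_power_decomp by blast
        have m: "m \<noteq> 1"
        proof
          assume "m = 1"
          then have i: "i = p ^ l" using lm by simp
          then have "p ^ l < p ^ (r - 1)" using b by (simp add: Q_def)
          then have "l < r - 1" using p_gt by (simp add: power_strict_increasing_iff)
          then have "b = gidx l" using gidx_low b i 5 by simp
          then show False using False \<open>l < r - 1\<close> by auto
        qed
        then have m: "m > 1" using lm 5 by (cases m) auto
        have "p ^ l * 1 < p ^ l * m" using m p_gt by simp
        then have "p ^ l < i" using lm by simp
        then have "nu (i choose (p ^ l)) * Poly_Mapping.lookup x b = 0"
          using primitive_lookup[OF x(2), of "(0, p ^ l, 0)" "(0, i - p ^ l, 0)"] b 5 p_gt by (simp add: look)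
        moreover have "nu (i choose (p ^ l)) = nu m"
          using lucas_0[of 0 l m 1] p_gt lm by simp
        ultimately show False using nz nu_cancel[of m] lm char_p by auto
      qed
    qed
    ultimately show ?thesis by simp
  qed
qed

text \<open>Splitting off tau has coefficient 1, so a primitive element cannot contain a product of
  tau with a nontrivial even monomial.\<close>

lemma odd_primitive:
  assumes x: "x \<in> carrier_of AM" "comult AM x = prim x" "homogeneous AM 1 x"
  shows "x = scal (Poly_Mapping.lookup x (1, 0, 0)) tau_A"
proof (rule poly_mapping_eqI)
  fix b :: idx
  show "Poly_Mapping.lookup x b = Poly_Mapping.lookup (scal (Poly_Mapping.lookup x (1, 0, 0)) tau_A) b"
  proof (cases "b = (1, 0, 0) \<or> Poly_Mapping.lookup x b = 0")
    case True then show ?thesis by (auto simp: tau_A_def lookup_single when_def)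
  next
    case False
    then have "parity AM b = 1" using x(3) by (meson homogeneous_lookup)
    then obtain i j where b: "b = (1, i, j)" by (cases b) auto
    then show ?thesis
      using False primitive_lookup[OF x(2), of "(1, 0, 0)" "(0, i, j)"] by (simp add: lookup_comult[OF x(1)])
  qed
qed

section \<open>Homomorphisms out of \<open>A[M\<^sub>r\<^sub>;\<^sub>s]\<close>\<close>

abbreviation AMs :: "nat \<Rightarrow> (idx, 'a) hopf_superalgebra" where "AMs s \<equiv> base_change \<iota> (M_sub p r s)"

lemma AMs_simps [simp]:
  "basis (AMs s) = {..<2} \<times> {..<Q} \<times> {..<p ^ s}" "parity (AMs s) = fst" "unit_el (AMs s) = mono 0 0 0"
  "comult_tab (AMs s) = comult_tab AM" "counit_tab (AMs s) = counit_tab AM"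
  "antipode_tab (AMs s) = antipode_tab AM" "mult_tab (AMs s) = mult_tab AM"
  using AM_simps(2,3) by (simp_all add: base_change_def M_sub_def Q_def)

lemma AMs_ops: "mul (AMs s) = mul AM" "comult (AMs s) = comult AM" "counit (AMs s) = counit AM"
    "antipode (AMs s) = antipode AM" "homogeneous (AMs s) = homogeneous AM"
  by (simp_all add: mul_def comult_def counit_def antipode_def homogeneous_def fun_eq_iff)

lemma AMs_carrier_mono: "s \<le> t \<Longrightarrow> x \<in> carrier_of (AMs s) \<Longrightarrow> x \<in> carrier_of (AMs t)"
proof -
  assume "s \<le> t"
  then have "p ^ s \<le> p ^ t" using p_gt by (intro power_increasing) auto
  then have "basis (AMs s) \<subseteq> basis (AMs t)" by auto
  then show "x \<in> carrier_of (AMs s) \<Longrightarrow> x \<in> carrier_of (AMs t)" unfolding carrier_of_iff by blast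
qed

lemma AMs_carrier: "x \<in> carrier_of (AMs s) \<Longrightarrow> x \<in> carrier_of AM"
  by (auto simp: carrier_of_iff)

lemma p_power_ge: "1 \<le> s \<Longrightarrow> p \<le> p ^ s"
  using p_gt by (simp add: self_le_power)

lemma AMs_gens_closed:
  "1 \<le> s \<Longrightarrow> theta_A \<in> carrier_of (AMs s)" "tau_A \<in> carrier_of (AMs s)"
  "j < p ^ s \<Longrightarrow> sigma_A j \<in> carrier_of (AMs s)" "mono 0 0 0 \<in> carrier_of (AMs s)"
proof -
  assume "1 \<le> s"
  then have "1 div Q < p ^ s" using p_power_ge[of s] p_gt div_le_dividend[of 1 Q] by linarith
  then show "theta_A \<in> carrier_of (AMs s)"
    using Q_pos by (auto simp: theta_A_eq intro!: carrier_closed)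
qed (use Q_pos p_gt in \<open>auto simp: tau_A_def sigma_A_def intro!: carrier_closed\<close>)

lemma AMs_mul_closed:
  assumes "1 \<le> s" "x \<in> carrier_of (AMs s)" "y \<in> carrier_of (AMs s)"
  shows "mul AM x y \<in> carrier_of (AMs s)"
  unfolding mul_def
proof (intro carrier_lin_ext[OF assms(2)] carrier_lin_ext[OF assms(3)])
  fix b c assume b: "b \<in> basis (AMs s)" "c \<in> basis (AMs s)"
  have bs: "basis (AMs s) = basis (M_sub p r s :: (idx, 'k) hopf_superalgebra)"
    by (simp add: base_change_def)
  have "Poly_Mapping.keys (mult_tab AM b c) \<subseteq> Poly_Mapping.keys (mult_tab (M_superalgebra p r) b c :: idx \<Rightarrow>\<^sub>0 'k)"
    by (auto simp: base_change_def M_mult_tab in_keys_iff)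
  also have "\<dots> \<subseteq> basis (AMs s)"
    using M_sub_closed[OF char_p prime_p assms(1), of b r c] b unfolding bs by blast
  finally show "mult_tab AM b c \<in> carrier_of (AMs s)" by (simp only: carrier_of_iff)
qed

lemma AMs_pow_closed: "1 \<le> s \<Longrightarrow> x \<in> carrier_of (AMs s) \<Longrightarrow> pow AM x n \<in> carrier_of (AMs s)"
  by (induction n) (auto simp: R.pow_0 R.pow_Suc AMs_gens_closed AMs_mul_closed)

lemma comult_closed: "x \<in> carrier_of AM \<Longrightarrow> comult AM x \<in> carrier_of T"
  unfolding comult_AM gens_map_def
  by (erule carrier_lin_ext)
    (auto intro!: R.T.mul_closed R.T.pow_closed prim_closed comult_sigma_closed)

lemma AMs_comult_closed:
  assumes "x \<in> carrier_of (AMs s)"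
  shows "Poly_Mapping.keys (comult AM x) \<subseteq> basis (AMs s) \<times> basis (AMs s)"
proof
  fix bc assume bc: "bc \<in> Poly_Mapping.keys (comult AM x)"
  obtain e1 i1 j1 e2 i2 j2 where *: "bc = ((e1, i1, j1), (e2, i2, j2))" by (metis prod_cases3 surj_pair)
  note x = AMs_carrier[OF assms]
  have "bc \<in> basis AM \<times> basis AM" using bc comult_closed[OF x] by (auto simp: T_closed_iff)
  moreover have "j1 < p ^ s \<and> j2 < p ^ s"
  proof (rule ccontr)
    assume a: "\<not> (j1 < p ^ s \<and> j2 < p ^ s)"
    have z: "Poly_Mapping.lookup x (e, i, j) = 0" if "\<not> j < p ^ s" for e i j
      using assms that by (auto simp: carrier_of_lookup)
    have "Poly_Mapping.lookup (comult AM x) bc = 0"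
      using a unfolding * lookup_comult[OF x] by (auto simp: z)
    then show False using bc by (simp add: in_keys_iff)
  qed
  ultimately show "bc \<in> basis (AMs s) \<times> basis (AMs s)" by (auto simp: *)
qed

lemma antipode_tab_AM: "antipode_tab AM (e, i, j) = Poly_Mapping.single (e, i, j) ((- 1) ^ (e + i + j))"
  by (simp add: base_change_def M_def Let_def superalgebra.defs scalar_ext_simps map_uminus_power)

lemma AMs_antipode_closed: "x \<in> carrier_of (AMs s) \<Longrightarrow> antipode AM x \<in> carrier_of (AMs s)"
  unfolding antipode_def by (erule carrier_lin_ext) (auto simp: antipode_tab_AM intro!: carrier_closed)

text \<open>What A[M_(r;s)] and A[M_(r;s,eta)] have in common: everything except the coproduct, of
  which only the stability of the carrier is kept.\<close>

definition sub_like :: "(idx, 'a) hopf_superalgebra \<Rightarrow> nat \<Rightarrow> bool" where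
  "sub_like X s \<longleftrightarrow> 1 \<le> s \<and> basis X = basis (AMs s) \<and> parity X = fst \<and> unit_el X = mono 0 0 0 \<and>
     mul X = mul AM \<and> counit X = counit AM \<and> antipode X = antipode AM \<and>
     (\<forall>x\<in>carrier_of X. Poly_Mapping.keys (comult X x) \<subseteq> basis X \<times> basis X)"

lemma sub_like_AMs: "1 \<le> s \<Longrightarrow> sub_like (AMs s) s"
  using AMs_comult_closed[of _ s] by (auto simp: sub_like_def AMs_ops)

lemma sub_like_carrier: "sub_like X s \<Longrightarrow> carrier_of X = carrier_of (AMs s)"
  by (simp add: sub_like_def carrier_of_def)

lemma sub_like_homogeneous: "sub_like X s \<Longrightarrow> homogeneous X = homogeneous AM"
  by (intro ext) (simp add: sub_like_def homogeneous_def)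

lemma mono_product:
  "i < Q \<Longrightarrow> mono 0 i j = mul AM (pow AM theta_A i) (sigma_A j)"
  "i < Q \<Longrightarrow> mono 1 i j = mul AM tau_A (mono 0 i j)"
  by (simp_all add: pow_theta_low sigma_A_def tau_A_def R.mul_singles op_M_def kappa_M_def mult_coeff_def del: mul_single)

text \<open>The operation m is left abstract because the values lie in A[M_r] in some uses and, when
  coproducts are compared, in its tensor square in others.\<close>

lemma multiplicative_eqI:
  fixes F G :: "(idx \<Rightarrow>\<^sub>0 'a) \<Rightarrow> ('c \<Rightarrow>\<^sub>0 'a)"
  assumes s: "1 \<le> s" and x: "x \<in> carrier_of (AMs s)"
    and lin: "linear_on (carrier_of (AMs s)) F" "linear_on (carrier_of (AMs s)) G"
    and mult: "\<And>u v. u \<in> carrier_of (AMs s) \<Longrightarrow> v \<in> carrier_of (AMs s) \<Longrightarrow> F (mul AM u v) = m (F u) (F v)"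
      "\<And>u v. u \<in> carrier_of (AMs s) \<Longrightarrow> v \<in> carrier_of (AMs s) \<Longrightarrow> G (mul AM u v) = m (G u) (G v)"
    and gens: "F tau_A = G tau_A" "F theta_A = G theta_A" "\<And>j. j < p ^ s \<Longrightarrow> F (sigma_A j) = G (sigma_A j)"
  shows "F x = G x"
  using lin x
proof (rule linear_on_eq)
  fix b assume "b \<in> basis (AMs s)"
  then obtain e i j where b: "b = (e, i, j)" "e < 2" "i < Q" "j < p ^ s" by auto
  have c: "pow AM theta_A i \<in> carrier_of (AMs s)" for i by (intro AMs_pow_closed AMs_gens_closed s)
  have even: "F (mono 0 i j) = G (mono 0 i j) \<and> mono 0 i j \<in> carrier_of (AMs s)"
  proof -
    have "F (mul AM (pow AM theta_A i) (sigma_A j)) = G (mul AM (pow AM theta_A i) (sigma_A j))" for i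
    proof (induction i)
      case 0
      show ?case using b gens by (simp add: R.pow_0 R.unit_left[of "sigma_A j", simplified])
    next
      case (Suc i)
      have z: "mul AM (pow AM theta_A i) (sigma_A j) \<in> carrier_of (AMs s)"
        using AMs_mul_closed[OF s c] AMs_gens_closed(3) b by simp
      show ?case
        unfolding R.pow_Suc R.mul_assoc mult(1)[OF AMs_gens_closed(1)[OF s] z] mult(2)[OF AMs_gens_closed(1)[OF s] z]
          Suc gens ..
    qed
    then show ?thesis using b c s by (simp add: mono_product AMs_mul_closed AMs_gens_closed)
  qed
  have "e = 0 \<or> e = 1" using b by auto
  then show "F (Poly_Mapping.single b 1) = G (Poly_Mapping.single b 1)"
  proof
    assume "e = 1"
    then show ?thesis using even mono_product(2)[of i j] b s
      by (simp add: mult AMs_gens_closed gens)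
  qed (use even b in simp)
qed

lemma hopf_homsD:
  assumes "\<phi> \<in> hopf_homs X H"
  shows "\<phi> \<in> carrier_of X \<rightarrow>\<^sub>E carrier_of H" "linear_on (carrier_of X) \<phi>"
    "x \<in> carrier_of X \<Longrightarrow> \<phi> x \<in> carrier_of H"
    "x \<in> carrier_of X \<Longrightarrow> homogeneous X e x \<Longrightarrow> homogeneous H e (\<phi> x)"
    "\<phi> (unit_el X) = unit_el H"
    "x \<in> carrier_of X \<Longrightarrow> y \<in> carrier_of X \<Longrightarrow> \<phi> (mul X x y) = mul H (\<phi> x) (\<phi> y)"
    "x \<in> carrier_of X \<Longrightarrow> comult H (\<phi> x) = tensor_map \<phi> (comult X x)"
    "x \<in> carrier_of X \<Longrightarrow> counit H (\<phi> x) = counit X x"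
    "x \<in> carrier_of X \<Longrightarrow> antipode H (\<phi> x) = \<phi> (antipode X x)"
  using assms by (auto simp: hopf_homs_def linear_on_def)

lemma hopf_homs_AMs:
  "hopf_homs X (AMs t) = {\<phi> \<in> hopf_homs X AM. \<forall>x\<in>carrier_of X. \<phi> x \<in> carrier_of (AMs t)}"
  unfolding hopf_homs_def AMs_ops AMs_simps AM_simps using AMs_carrier by (auto simp: PiE_iff)

lemma precomp_incl_M:
  assumes "\<phi> \<in> carrier_of (base_change \<iota> X) \<rightarrow>\<^sub>E carrier_of (AMs s)"
  shows "precomp \<iota> X (incl_M \<iota> p r s) \<phi> = \<phi>"
proof
  fix x
  show "precomp \<iota> X (incl_M \<iota> p r s) \<phi> x = \<phi> x"
    using assms by (cases "x \<in> carrier_of (base_change \<iota> X)")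
      (auto simp: precomp_def compose_def incl_M_def PiE_iff extensional_def)
qed

text \<open>If all homomorphisms from A[X] to A[M_r] already land in A[M_(r;s)], then the three sets
  coincide as sets of functions and precomposition is the identity. The identifications thus reduce
  to a bound on images.\<close>

lemma bij_precomp_incl_M:
  assumes "\<forall>\<phi>\<in>Hom \<iota> (M p r) X. \<forall>x\<in>carrier_of (base_change \<iota> X). \<phi> x \<in> carrier_of (AMs s)"
    and "s \<le> t"
  shows "bij_betw (precomp \<iota> X (incl_M \<iota> p r s)) (Hom \<iota> (M_sub p r s) X) (Hom \<iota> (M_sub p r t) X)"
    and "bij_betw (precomp \<iota> X (incl_M \<iota> p r t)) (Hom \<iota> (M_sub p r t) X) (Hom \<iota> (M p r) X)"
proof -
  have eq: "Hom \<iota> (M_sub p r u) X = Hom \<iota> (M p r) X" if "s \<le> u" for u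
    using assms(1) AMs_carrier_mono[OF that] unfolding Hom_def hopf_homs_AMs by blast
  have id: "precomp \<iota> X (incl_M \<iota> p r u) \<phi> = \<phi>" if "\<phi> \<in> Hom \<iota> (M_sub p r u) X" for u \<phi>
    using that unfolding Hom_def by (intro precomp_incl_M hopf_homsD(1))
  have bij: "bij_betw (precomp \<iota> X (incl_M \<iota> p r u)) (Hom \<iota> (M_sub p r u) X) (Hom \<iota> (M_sub p r u) X)" for u
    using id[of _ u] by (intro bij_betw_imageI inj_onI) auto
  show "bij_betw (precomp \<iota> X (incl_M \<iota> p r s)) (Hom \<iota> (M_sub p r s) X) (Hom \<iota> (M_sub p r t) X)"
    using bij[of s] eq[of s] eq[of t] assms(2) by simp
  show "bij_betw (precomp \<iota> X (incl_M \<iota> p r t)) (Hom \<iota> (M_sub p r t) X) (Hom \<iota> (M p r) X)"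
    using bij[of t] eq[of t] assms(2) by simp
qed

lemma tensor_map_restrict:
  assumes "Poly_Mapping.keys z \<subseteq> basis X \<times> basis X"
  shows "tensor_map (restrict F (carrier_of X)) z = tensor_map F z"
  using assms by (rule tensor_map_cong) (simp add: carrier_closed)

text \<open>The maps are constructed on all finitely supported functions, where they are linear and
  multiplicative without conditions, whereas \<open>hopf_homs\<close> consists of functions
  restricted to the carrier.\<close>

lemma hopf_hom_restrictI:
  assumes X: "sub_like X s" and lin: "linear_on UNIV F"
    and closed: "\<And>x. x \<in> carrier_of X \<Longrightarrow> F x \<in> carrier_of AM"
    and par: "\<And>e x. x \<in> carrier_of X \<Longrightarrow> homogeneous AM e x \<Longrightarrow> homogeneous AM e (F x)"
    and one: "F (mono 0 0 0) = mono 0 0 0"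
    and mult: "\<And>x y. F (mul AM x y) = mul AM (F x) (F y)"
    and comult: "\<And>x. x \<in> carrier_of X \<Longrightarrow> comult AM (F x) = tensor_map F (comult X x)"
    and counit: "\<And>x. x \<in> carrier_of X \<Longrightarrow> counit AM (F x) = counit AM x"
    and antipode: "\<And>x. x \<in> carrier_of X \<Longrightarrow> antipode AM (F x) = F (antipode AM x)"
  shows "restrict F (carrier_of X) \<in> hopf_homs X AM"
proof -
  note X' = X[unfolded sub_like_def] sub_like_carrier[OF X] sub_like_homogeneous[OF X]
  have s: "1 \<le> s" using X' by simp
  have "mul AM x y \<in> carrier_of X" if "x \<in> carrier_of X" "y \<in> carrier_of X" for x y
    using AMs_mul_closed[OF s] that unfolding X' by blast
  moreover have "antipode AM x \<in> carrier_of X" if "x \<in> carrier_of X" for x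
    using AMs_antipode_closed that unfolding X' by blast
  moreover have "mono 0 0 0 \<in> carrier_of X" unfolding X' by (rule AMs_gens_closed)
  moreover have "comult AM (F x) = tensor_map (restrict F (carrier_of X)) (comult X x)" if "x \<in> carrier_of X" for x
  proof -
    have "Poly_Mapping.keys (comult X x) \<subseteq> basis X \<times> basis X"
      using X that unfolding sub_like_def by blast
    then show ?thesis using comult[OF that] tensor_map_restrict[of "comult X x" X F] by simp
  qed
  moreover have "unit_el X = mono 0 0 0" "unit_el AM = mono 0 0 0" "mul X = mul AM" "counit X = counit AM"
    "antipode X = antipode AM" "homogeneous X = homogeneous AM" using X' by simp_all
  ultimately show ?thesis
    using lin closed par one mult counit antipode
    unfolding hopf_homs_def linear_on_def by (auto simp: carrier_closed carrier_scal)
qed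

lemma sigma_digits:
  assumes "j0 < p ^ l"
  shows "mul AM (pow AM (sigma_A (p ^ l)) j1) (sigma_A j0) = scal (nu (fact j1)) (sigma_A (p ^ l * j1 + j0))"
proof -
  have "nu ((p ^ l * j1 + j0) choose (p ^ l * j1)) = 1"
    using lucas_0[OF assms, of j1 j1] by simp
  then show ?thesis by (simp add: sigma_pow mul_linear sigma_mul)
qed

text \<open>sigma_1 is theta^Q, and for j = p^l j1 + j0 the element sigma_j is sigma_(p^l)^j1
  sigma_j0 up to j1!, invertible since j1 < p. Induction on l therefore reaches all j < p^s from the
  sigma_(p^l).\<close>

lemma multiplicative_eqI':
  fixes F G :: "(idx \<Rightarrow>\<^sub>0 'a) \<Rightarrow> ('c \<Rightarrow>\<^sub>0 'a)"
  assumes s: "1 \<le> s" and x: "x \<in> carrier_of (AMs s)"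
    and lin: "linear_on (carrier_of (AMs s)) F" "linear_on (carrier_of (AMs s)) G"
    and mult: "\<And>u v. u \<in> carrier_of (AMs s) \<Longrightarrow> v \<in> carrier_of (AMs s) \<Longrightarrow> F (mul AM u v) = m (F u) (F v)"
      "\<And>u v. u \<in> carrier_of (AMs s) \<Longrightarrow> v \<in> carrier_of (AMs s) \<Longrightarrow> G (mul AM u v) = m (G u) (G v)"
    and gens: "F tau_A = G tau_A" "F theta_A = G theta_A" "F (mono 0 0 0) = G (mono 0 0 0)"
      "\<And>l. 1 \<le> l \<Longrightarrow> l < s \<Longrightarrow> F (sigma_A (p ^ l)) = G (sigma_A (p ^ l))"
  shows "F x = G x"
proof -
  have prod: "F (mul AM (pow AM u n) v) = G (mul AM (pow AM u n) v)"
    if uv: "u \<in> carrier_of (AMs s)" "v \<in> carrier_of (AMs s)" "F u = G u" "F v = G v" for u v n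
  proof (induction n)
    case 0
    show ?case using uv AMs_carrier by (simp add: R.pow_0 R.unit_left[simplified])
  next
    case (Suc n)
    have "mul AM (pow AM u n) v \<in> carrier_of (AMs s)"
      by (intro AMs_mul_closed AMs_pow_closed s uv)
    then show ?case unfolding R.pow_Suc R.mul_assoc using mult uv Suc by simp
  qed
  have 1: "F (sigma_A 1) = G (sigma_A 1)"
  proof -
    have "mul AM (pow AM theta_A Q) (mono 0 0 0) = sigma_A 1"
      using R.unit_right[of "sigma_A 1"] by (simp add: pow_theta_Q)
    then show ?thesis using prod[of theta_A "mono 0 0 0" Q] gens AMs_gens_closed s by simp
  qed
  have "\<forall>j<p ^ l. F (sigma_A j) = G (sigma_A j)" if "l \<le> s" for l
    using that
  proof (induction l)
    case 0
    then show ?case using gens by (simp add: sigma_A_def)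
  next
    case (Suc l)
    show ?case
    proof (intro allI impI)
      fix j assume j: "j < p ^ Suc l"
      define j0 j1 where "j0 = j mod p ^ l" and "j1 = j div p ^ l"
      have eq: "j = p ^ l * j1 + j0" by (simp add: j0_def j1_def)
      have j0: "j0 < p ^ l" using p_gt by (simp add: j0_def)
      have j1: "j1 < p" using j p_gt by (simp add: j1_def less_mult_imp_div_less mult.commute)
      have pl: "p ^ l < p ^ s" using Suc.prems p_gt by (intro power_strict_increasing) auto
      have js: "j < p ^ s" using j power_increasing[of "Suc l" s p] Suc.prems p_gt by linarith
      have "F (sigma_A (p ^ l)) = G (sigma_A (p ^ l))"
        using 1 gens(4)[of l] Suc.prems by (cases "l = 0") auto
      then have "F (scal (nu (fact j1)) (sigma_A j)) = G (scal (nu (fact j1)) (sigma_A j))"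
        unfolding eq sigma_digits[OF j0, symmetric]
        using Suc j0 pl by (intro prod AMs_gens_closed) auto
      then have "scal (nu (fact j1)) (F (sigma_A j)) = scal (nu (fact j1)) (G (sigma_A j))"
        using lin AMs_gens_closed(3)[OF js] by (simp add: linear_on_def)
      then show "F (sigma_A j) = G (sigma_A j)" using nu_fact_cancel[OF j1] by blast
    qed
  qed
  then show ?thesis
    using multiplicative_eqI[OF s x lin mult gens(1,2)] by blast
qed

lemma gens_map_linear: "linear_on C (gens_map B t x y)"
  unfolding gens_map_def by (rule linear_on_lin_ext)

lemma gens_map_minus: "gens_map B t x y (- z) = - gens_map B t x y z"
  and gens_map_add: "gens_map B t x y (z + z') = gens_map B t x y z + gens_map B t x y z'"
  and gens_map_diff: "gens_map B t x y (z - z') = gens_map B t x y z - gens_map B t x y z'"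
  and gens_map_scal: "gens_map B t x y (scal c z) = scal c (gens_map B t x y z)"
  by (simp_all add: gens_map_def lin_ext_linear)

lemma gens_map_mono: "gens_map B t x y (mono e i j) = mul B (pow B t e) (mul B (pow B x i) (y j))"
  by (simp add: gens_map_def)

lemma tensor_map_tensor: "tensor_map (gens_map B t x y) (tensor u v) = tensor (gens_map B t x y u) (gens_map B t x y v)"
  unfolding gens_map_def by (rule tensor_map_lin_ext_tensor)

lemma tensor_map_prim:
  assumes "gens_map AM t x y (mono 0 0 0) = mono 0 0 0"
  shows "tensor_map (gens_map AM t x y) (prim z) = prim (gens_map AM t x y z)"
  using assms by (simp add: prim_def tensor_map_linear tensor_map_tensor del: tensor_single)

lemma tensor_map_diag:
  "tensor_map (gens_map AM t x y) (diag e j) =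
    (\<Sum>u\<le>j. tensor (gens_map AM t x y (mono e 0 u)) (gens_map AM t x y (mono e 0 (j - u))))"
  by (simp add: diag_def tensor_map_linear tensor_map_single)

lemma antipode_sign_linear:
  "antipode_sign (x + y) = antipode_sign x + antipode_sign y"
  "antipode_sign (x - y) = antipode_sign x - antipode_sign y"
  "antipode_sign (- x) = - antipode_sign x"
  "antipode_sign (scal c x) = scal c (antipode_sign x)"
  "antipode_sign (\<Sum>i\<in>I. f i) = (\<Sum>i\<in>I. antipode_sign (f i))"
  by (simp_all add: antipode_sign_def gens_map_def lin_ext_linear)

lemma antipode_sign_gens:
  "antipode_sign tau_A = - tau_A" "antipode_sign theta_A = - theta_A"
  "antipode_sign (sigma_A j) = scal ((- 1) ^ j) (sigma_A j)" "antipode_sign (mono 0 0 0) = mono 0 0 0"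
  unfolding antipode_sign_def gens_map_gens[OF R.assoc_superalgebra_axioms antipode_relations] by simp_all

lemma antipode_sign_sigma_odd: "odd j \<Longrightarrow> antipode_sign (sigma_A j) = - sigma_A j"
  by (simp add: antipode_sign_gens uminus_one_power_odd scal_minus_one)

lemma antipode_sign_pow: "antipode_sign (pow AM x n) = pow AM (antipode_sign x) n"
  by (induction n) (simp_all add: R.pow_0 R.pow_Suc antipode_sign_gens antipode_sign_mul)

lemma antipode_sign_add_poly: "antipode_sign (add_poly a) = - add_poly a"
proof -
  have "pow AM (- theta_A) (p ^ i) = - pow AM theta_A (p ^ i)" for i
    using R.pow_scal[of "- 1" theta_A "p ^ i"] uminus_one_power_odd[of "p ^ i"] odd_p
    by (simp add: scal_minus_one)
  then show ?thesis
    by (simp add: add_poly_eq antipode_sign_linear antipode_sign_pow antipode_sign_gens scal_minus_right sum_negf)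
qed

lemma counit_linear: "counit AM (x + y) = counit AM x + counit AM y" "counit AM (scal c x) = c * counit AM x"
  "counit AM (x - y) = counit AM x - counit AM y"
  by (simp_all add: counit_AM lookup_add lookup_minus)

lemma counit_pow: "x \<in> carrier_of AM \<Longrightarrow> counit AM x = 0 \<Longrightarrow> counit AM (pow AM x n) = (if n = 0 then 1 else 0)"
  by (cases n) (simp_all add: R.pow_0 R.pow_Suc R.pow_closed counit_mul, simp_all add: counit_AM)

lemma counit_gens: "counit AM tau_A = 0" "counit AM theta_A = 0" "counit AM (sigma_A j) = (if j = 0 then 1 else 0)"
proof -
  have "1 mod Q = 0 \<Longrightarrow> 1 div Q \<noteq> 0"
    by (metis div_mult_mod_eq add.right_neutral mult_zero_left zero_neq_one)
  then show "counit AM theta_A = 0" by (auto simp: counit_AM theta_A_eq lookup_single when_def)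
qed (auto simp: counit_AM tau_A_def sigma_A_def lookup_single when_def)

lemma counit_add_poly: "counit AM (add_poly a) = 0"
  using primitive_counit[OF add_poly_closed comult_add_poly] by (simp add: counit_AM)

text \<open>The coproduct is kept apart because it differs between A[M_(r;s)] and A[M_(r;s,eta)].
  The antipode is tested on generators only, and the sign -1 at sigma_(p^l) is right because p^l is
  odd.\<close>

definition hopf_data :: "nat \<Rightarrow> (idx \<Rightarrow>\<^sub>0 'a) \<Rightarrow> (idx \<Rightarrow>\<^sub>0 'a) \<Rightarrow> (nat \<Rightarrow> idx \<Rightarrow>\<^sub>0 'a) \<Rightarrow> bool" where
  "hopf_data s t x y \<longleftrightarrow> M_relations_in AM t x y \<and>
     homogeneous AM 1 t \<and> homogeneous AM 0 x \<and> (\<forall>j. homogeneous AM 0 (y j)) \<and>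
     counit AM t = 0 \<and> counit AM x = 0 \<and> (\<forall>j. 0 < j \<longrightarrow> j < p ^ s \<longrightarrow> counit AM (y j) = 0) \<and>
     antipode_sign t = - t \<and> antipode_sign x = - x \<and> (\<forall>l<s. antipode_sign (y (p ^ l)) = - y (p ^ l))"

lemma gens_map_homogeneous:
  assumes "homogeneous AM 1 t" "homogeneous AM 0 x" "\<forall>j. homogeneous AM 0 (y j)"
  shows "homogeneous AM e (mul AM (pow AM t e) (mul AM (pow AM x i) (y j)))"
    and "homogeneous AM e z \<Longrightarrow> homogeneous AM e (gens_map AM t x y z)"
proof -
  show *: "homogeneous AM e (mul AM (pow AM t e) (mul AM (pow AM x i) (y j)))" for e i j
    using R.mul_homogeneous[OF R.pow_homogeneous[OF assms(1), of e]
        R.mul_homogeneous[OF R.pow_homogeneous[OF assms(2), of i] assms(3)[rule_format, of j]]] by simp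
  show "homogeneous AM e z \<Longrightarrow> homogeneous AM e (gens_map AM t x y z)"
    unfolding gens_map_def by (erule homogeneous_lin_ext) (use * in auto)
qed

lemma gens_map_closed:
  assumes "M_relations_in B t x y" "assoc_superalgebra B" "z \<in> carrier_of AM"
  shows "gens_map B t x y z \<in> carrier_of B"
proof -
  interpret B: assoc_superalgebra B by fact
  show ?thesis unfolding gens_map_def
    using assms(1) unfolding M_relations_in_def
    by (intro carrier_lin_ext[OF assms(3)]) (auto intro!: B.mul_closed B.pow_closed)
qed

lemma tensor_map_gens_map_mul:
  assumes "hopf_data s t x y"
  shows "tensor_map (gens_map AM t x y) (mul T u v) = mul T (tensor_map (gens_map AM t x y) u) (tensor_map (gens_map AM t x y) v)"
  unfolding gens_map_def
proof (rule tensor_map_mul[OF R.graded_monomial_superalgebra_axioms R.graded_monomial_superalgebra_axioms])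
  have d: "M_relations_in AM t x y" "homogeneous AM 1 t" "homogeneous AM 0 x" "\<forall>j. homogeneous AM 0 (y j)"
    using assms by (auto simp: hopf_data_def)
  show "lin_ext (\<lambda>(e, i, j). mul AM (pow AM t e) (mul AM (pow AM x i) (y j))) (mul AM u v) =
      mul AM (lin_ext (\<lambda>(e, i, j). mul AM (pow AM t e) (mul AM (pow AM x i) (y j))) u)
        (lin_ext (\<lambda>(e, i, j). mul AM (pow AM t e) (mul AM (pow AM x i) (y j))) v)" for u v
    using gens_map_mul[OF R.assoc_superalgebra_axioms d(1)] by (simp add: gens_map_def)
  show "homogeneous AM (parity AM b) (case b of (e, i, j) \<Rightarrow> mul AM (pow AM t e) (mul AM (pow AM x i) (y j)))" for b
    using gens_map_homogeneous(1)[OF d(2-4)] by (cases b) simp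
qed

lemma gens_map_hopf:
  assumes X: "sub_like X s" and d: "hopf_data s t x y"
    and comult: "\<And>z. z \<in> carrier_of X \<Longrightarrow> comult AM (gens_map AM t x y z) = tensor_map (gens_map AM t x y) (comult X z)"
  shows "restrict (gens_map AM t x y) (carrier_of X) \<in> hopf_homs X AM"
proof (rule hopf_hom_restrictI[OF X _ _ _ _ _ comult])
  let ?F = "gens_map AM t x y"
  note d' = d[unfolded hopf_data_def]
  have s: "1 \<le> s" using X by (simp add: sub_like_def)
  have rel: "M_relations_in AM t x y" using d' by simp
  have tx: "t \<in> carrier_of AM" "x \<in> carrier_of AM" "y j \<in> carrier_of AM" for j
    using rel by (auto simp: M_relations_in_def)
  note gens = gens_map_gens[OF R.assoc_superalgebra_axioms rel]
  have XA: "z \<in> carrier_of AM" "z \<in> carrier_of (AMs s)" if "z \<in> carrier_of X" for z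
    using that AMs_carrier sub_like_carrier[OF X] by auto
  show "linear_on UNIV ?F" by (rule gens_map_linear)
  show closed: "?F z \<in> carrier_of AM" if "z \<in> carrier_of X" for z
    by (rule gens_map_closed[OF rel R.assoc_superalgebra_axioms XA(1)[OF that]])
  show "homogeneous AM e z \<Longrightarrow> homogeneous AM e (?F z)" for e z
    by (rule gens_map_homogeneous(2)) (use d' in auto)
  show "?F (mono 0 0 0) = mono 0 0 0" using gens by simp
  show mult: "?F (mul AM u v) = mul AM (?F u) (?F v)" for u v
    by (rule gens_map_mul[OF R.assoc_superalgebra_axioms rel])
  show "counit AM (?F z) = counit AM z" if "z \<in> carrier_of X" for z
  proof -
    have "Poly_Mapping.keys z \<subseteq> basis (AMs s)" using XA(2)[OF that] by (simp only: carrier_of_iff)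
    then show ?thesis
    proof (induction z rule: poly_mapping_linear_induct)
      case zero then show ?case using gens_map_linear[of UNIV AM t x y] by (simp add: gens_map_def counit_AM)
    next
      case (add z z') then show ?case by (simp add: gens_map_add counit_linear)
    next
      case (single b c)
      then obtain e i j where b: "b = (e, i, j)" "j < p ^ s" by auto
      have "y 0 = mono 0 0 0" using rel by (simp add: M_relations_in_def)
      then have y: "counit AM (y j) = (if j = 0 then 1 else 0)"
        using d' b by (auto simp: counit_AM)
      have "counit AM (?F (mono e i j)) = (if b = (0, 0, 0) then 1 else 0)"
        using d' by (simp add: gens_map_mono counit_mul counit_pow R.mul_closed R.pow_closed tx y b)
      moreover have "Poly_Mapping.single b c = scal c (mono e i j)" by (simp add: b)
      ultimately show ?case
        by (simp only: gens_map_scal counit_linear) (auto simp: counit_AM b lookup_single when_def)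
    qed
  qed
  show "antipode AM (?F z) = ?F (antipode AM z)" if "z \<in> carrier_of X" for z
  proof -
    have "antipode_sign (?F z) = ?F (antipode_sign z)"
    proof (rule multiplicative_eqI'[OF s XA(2)[OF that], where m = "mul AM"])
      show "linear_on (carrier_of (AMs s)) (\<lambda>z. antipode_sign (?F z))"
        "linear_on (carrier_of (AMs s)) (\<lambda>z. ?F (antipode_sign z))"
        by (auto simp: linear_on_def gens_map_add gens_map_scal antipode_sign_linear)
      fix l assume l: "1 \<le> l" "l < s"
      then show "antipode_sign (?F (sigma_A (p ^ l))) = ?F (antipode_sign (sigma_A (p ^ l)))"
        using d' odd_p by (simp add: gens antipode_sign_sigma_odd gens_map_minus)
    qed (use d' gens in \<open>simp_all add: mult antipode_sign_mul antipode_sign_gens gens_map_minus\<close>)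
    then show ?thesis using antipode_AM[OF closed[OF that]] antipode_AM[OF XA(1)[OF that]] by simp
  qed
qed

text \<open>Both sides are multiplicative maps into the tensor square, the right one because
  \<open>gens_map\<close> preserves parity, so they are compared on generators.\<close>

lemma gens_map_comult:
  assumes s: "1 \<le> s" and d: "hopf_data s t x y" and z: "z \<in> carrier_of (AMs s)"
    and comult_gens': "comult AM t = prim t" "comult AM x = prim x"
      "\<And>l. 1 \<le> l \<Longrightarrow> l < s \<Longrightarrow> comult AM (y (p ^ l)) = tensor_map (gens_map AM t x y) (comult_sigma (p ^ l))"
  shows "comult AM (gens_map AM t x y z) = tensor_map (gens_map AM t x y) (comult AM z)"
proof (rule multiplicative_eqI'[OF s z, where m = "mul T"])
  let ?F = "gens_map AM t x y"
  have rel: "M_relations_in AM t x y" using d by (simp add: hopf_data_def)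
  note gens = gens_map_gens[OF R.assoc_superalgebra_axioms rel]
  have unit: "comult AM (mono 0 0 0) = tensor (mono 0 0 0) (mono 0 0 0)"
    using gens_map_gens(4)[OF R.T.assoc_superalgebra_axioms comult_relations] by (simp add: comult_AM T_simps)
  have F1: "?F (mono 0 0 0) = mono 0 0 0" using gens by simp
  show "linear_on (carrier_of (AMs s)) (\<lambda>z. comult AM (?F z))" "linear_on (carrier_of (AMs s)) (\<lambda>z. tensor_map ?F (comult AM z))"
    by (auto simp: linear_on_def gens_map_add gens_map_scal comult_linear tensor_map_linear)
  show "comult AM (?F (mul AM u v)) = mul T (comult AM (?F u)) (comult AM (?F v))" for u v
    by (simp add: gens_map_mul[OF R.assoc_superalgebra_axioms rel] comult_mul)
  show "tensor_map ?F (comult AM (mul AM u v)) = mul T (tensor_map ?F (comult AM u)) (tensor_map ?F (comult AM v))" for u v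
    by (simp add: comult_mul tensor_map_gens_map_mul[OF d])
  show "comult AM (?F (mono 0 0 0)) = tensor_map ?F (comult AM (mono 0 0 0))"
    unfolding unit tensor_map_tensor F1 ..
qed (use comult_gens' gens_map_gens[OF R.assoc_superalgebra_axioms, of t x y] d in
    \<open>simp_all add: comult_gens tensor_map_prim hopf_data_def\<close>)

text \<open>For m >= p the factorial is 0 in k and so is its inverse by convention, which makes the
  value 0. The exponents that matter are base-p digits.\<close>

definition divided_power :: "(idx \<Rightarrow>\<^sub>0 'a) \<Rightarrow> nat \<Rightarrow> (idx \<Rightarrow>\<^sub>0 'a)" where
  "divided_power Y m = scal (\<iota> (inverse (of_nat (fact m)))) (pow AM Y m)"

lemma fact_nonzero: "m < p \<Longrightarrow> (of_nat (fact m) :: 'k) \<noteq> 0"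
  using prime_dvd_fact_iff[OF prime_p, of m] char_p by (simp add: of_nat_eq_0_iff_char_dvd del: of_nat_fact)

lemma divided_power_closed: "Y \<in> carrier_of AM \<Longrightarrow> divided_power Y m \<in> carrier_of AM"
  by (simp add: divided_power_def carrier_scal R.pow_closed)

lemma divided_power_0: "divided_power Y 0 = mono 0 0 0"
  by (simp add: divided_power_def R.pow_0)

lemma divided_power_1: "Y \<in> carrier_of AM \<Longrightarrow> divided_power Y (Suc 0) = Y"
  by (simp add: divided_power_def R.pow_1)

lemma divided_power_mul:
  assumes "Y \<in> carrier_of AM" "m + n < p"
  shows "mul AM (divided_power Y m) (divided_power Y n) = scal (nu ((m + n) choose m)) (divided_power Y (m + n))"
proof -
  have "fact m * fact n * ((m + n) choose m) = (fact (m + n) :: nat)"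
    using binomial_fact_lemma[of m "m + n"] by simp
  then have "of_nat (fact m) * of_nat (fact n) * of_nat ((m + n) choose m) = (of_nat (fact (m + n)) :: 'k)"
    by (simp only: flip: of_nat_mult)
  moreover have "of_nat (fact m) \<noteq> (0 :: 'k)" "of_nat (fact n) \<noteq> (0 :: 'k)" "of_nat (fact (m + n)) \<noteq> (0 :: 'k)"
    using assms(2) by (intro fact_nonzero; simp)+
  ultimately have "inverse (of_nat (fact m)) * inverse (of_nat (fact n)) =
      of_nat ((m + n) choose m) * (inverse (of_nat (fact (m + n))) :: 'k)"
    by (simp add: field_simps del: of_nat_fact)
  then have "\<iota> (inverse (of_nat (fact m))) * \<iota> (inverse (of_nat (fact n))) =
      nu ((m + n) choose m) * \<iota> (inverse (of_nat (fact (m + n))))"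
    by (simp only: nu_def flip: map_mult)
  then have "\<iota> (inverse (of_nat (fact n))) * \<iota> (inverse (of_nat (fact m))) =
      nu ((m + n) choose m) * \<iota> (inverse (of_nat (fact (m + n))))"
    by (simp only: mult.commute)
  then show ?thesis
    by (simp add: divided_power_def mul_linear R.pow_add assms(1) del: of_nat_fact)
qed

lemma divided_power_mul_zero:
  assumes "Y \<in> carrier_of AM" "pow AM Y p = 0" "p \<le> m + n"
  shows "mul AM (divided_power Y m) (divided_power Y n) = 0"
  using R.pow_eq_zero_ge[OF assms] by (simp add: divided_power_def mul_linear R.pow_add assms(1))

text \<open>With c the scalar by which sigma_1 is multiplied, the multiple of sigma_(p^l) is forced
  by the coproduct, and b is the coefficient of the primitive element that remains free.\<close>

definition top_image :: "nat \<Rightarrow> 'a \<Rightarrow> 'a \<Rightarrow> (idx \<Rightarrow>\<^sub>0 'a)" where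
  "top_image l c b = scal (c ^ p ^ l) (sigma_A (p ^ l)) + scal b (sigma_A 1)"

text \<open>If a comorphism maps \<open>\<sigma>\<^sub>u\<close> to \<open>c^u \<sigma>\<^sub>u\<close> for \<open>u < p^l\<close> and \<open>\<sigma>\<^sub>p\<^sub>^\<^sub>l\<close> to \<open>top_image l c b\<close>, then this is its value
  at \<open>\<sigma>\<^sub>j\<close> for \<open>j < p^(l+1)\<close>, as \<open>\<sigma>\<^sub>j\<close> is \<open>\<sigma>\<^bsub>j mod p^l\<^esub>\<close> times a divided power of \<open>\<sigma>\<^sub>p\<^sub>^\<^sub>l\<close>.\<close>

definition sigma_image :: "nat \<Rightarrow> 'a \<Rightarrow> 'a \<Rightarrow> nat \<Rightarrow> (idx \<Rightarrow>\<^sub>0 'a)" where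
  "sigma_image l c b j = scal (c ^ (j mod p ^ l)) (mul AM (sigma_A (j mod p ^ l)) (divided_power (top_image l c b) (j div p ^ l)))"

text \<open>The value 0 from p^s on makes the relations hold for all indices; compatibility with the
  coproduct is claimed on A[M_(r;s)] only.\<close>

definition cut_image :: "nat \<Rightarrow> 'a \<Rightarrow> 'a \<Rightarrow> nat \<Rightarrow> (idx \<Rightarrow>\<^sub>0 'a)" where
  "cut_image s c b j = (if j < p ^ s then sigma_image (s - 1) c b j else 0)"

section \<open>Existence: homomorphisms with prescribed values on generators\<close>

lemma sigma_pow_p: "pow AM (sigma_A (p ^ l)) p = 0"
  using prime_p by (simp add: sigma_pow nu_zero prime_dvd_fact_iff)

lemma frobenius_AM:
  assumes "x \<in> carrier_of AM" "y \<in> carrier_of AM"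
  shows "pow AM (x + y) (p ^ l) = pow AM x (p ^ l) + pow AM y (p ^ l)"
  using frobenius_add[OF R.assoc_superalgebra_axioms assms AM_commute] prime_p char_p by simp

lemma top_image_closed: "top_image l c b \<in> carrier_of AM"
  unfolding top_image_def by (intro carrier_closed carrier_scal gens_closed)

lemma top_image_pow: "pow AM (top_image l c b) p = 0"
proof -
  have "pow AM (top_image l c b) (p ^ 1) = 0"
    unfolding top_image_def using sigma_pow_p[of l] sigma_pow_p[of 0]
    by (subst frobenius_AM) (simp_all add: carrier_scal R.pow_scal)
  then show ?thesis by simp
qed

lemma sigma_image_closed: "sigma_image l c b j \<in> carrier_of AM"
  unfolding sigma_image_def by (intro carrier_scal R.mul_closed gens_closed divided_power_closed top_image_closed)

lemma sigma_image_small: "j < p ^ l \<Longrightarrow> sigma_image l c b j = scal (c ^ j) (sigma_A j)"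
  using R.unit_right[of "sigma_A j"] by (simp add: sigma_image_def divided_power_0)

lemma sigma_image_top: "sigma_image l c b (p ^ l) = top_image l c b"
  using p_gt top_image_closed R.unit_left[of "top_image l c b"]
  by (simp add: sigma_image_def divided_power_1 sigma_A_def)

text \<open>With P = p^l, the low digits multiply like sigmas and the high digits like divided
  powers, and Lucas combines the two binomials. A high digit sum of p or more gives 0 because
  \<open>top_image\<close> has p-th power 0.\<close>

lemma sigma_image_mul:
  assumes "i < p ^ Suc l" "j < p ^ Suc l"
  shows "mul AM (sigma_image l c b i) (sigma_image l c b j) =
    (if i + j < p ^ Suc l then scal (nu ((i + j) choose i)) (sigma_image l c b (i + j)) else 0)"
    and "p ^ Suc l \<le> i + j \<Longrightarrow> nu ((i + j) choose i) = 0"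
proof -
  show "nu ((i + j) choose i) = 0" if "p ^ Suc l \<le> i + j"
    using dvd_choose_carry[OF prime_p assms that] by (rule nu_zero)
  let ?P = "p ^ l"
  define i0 i1 j0 j1 where "i0 = i mod ?P" and "i1 = i div ?P" and "j0 = j mod ?P" and "j1 = j div ?P"
  have P: "?P > 0" using p_gt by simp
  have ij: "i = ?P * i1 + i0" "j = ?P * j1 + j0" by (simp_all add: i0_def i1_def j0_def j1_def)
  have lt: "i0 < ?P" "j0 < ?P" using P by (simp_all add: i0_def j0_def)
  let ?Y = "top_image l c b"
  note Y = top_image_closed[of l c b]
  have prod: "mul AM (sigma_image l c b i) (sigma_image l c b j) =
      scal (c ^ (i0 + j0) * nu ((i0 + j0) choose i0)) (mul AM (sigma_A (i0 + j0)) (mul AM (divided_power ?Y i1) (divided_power ?Y j1)))"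
  proof -
    have "mul AM (mul AM (sigma_A i0) (divided_power ?Y i1)) (mul AM (sigma_A j0) (divided_power ?Y j1)) =
        mul AM (mul AM (sigma_A i0) (sigma_A j0)) (mul AM (divided_power ?Y i1) (divided_power ?Y j1))"
      using R.mul_left_commute[OF AM_commute] by (simp add: R.mul_assoc)
    then show ?thesis
      by (simp add: sigma_image_def mul_linear sigma_mul power_add mult_ac flip: i0_def i1_def j0_def j1_def)
  qed
  show "mul AM (sigma_image l c b i) (sigma_image l c b j) =
    (if i + j < p ^ Suc l then scal (nu ((i + j) choose i)) (sigma_image l c b (i + j)) else 0)"
  proof (cases "i0 + j0 < ?P")
    case True
    have sum: "i + j = ?P * (i1 + j1) + (i0 + j0)" by (simp add: ij algebra_simps)
    then have dm: "(i + j) div ?P = i1 + j1" "(i + j) mod ?P = i0 + j0" using True P by simp_all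
    have C: "nu ((i + j) choose i) = nu ((i1 + j1) choose i1) * nu ((i0 + j0) choose i0)"
      unfolding sum by (subst ij(1)) (rule lucas[OF True lt(1)])
    have "i1 + j1 < p \<longleftrightarrow> i + j < p ^ Suc l"
      using dm(1) P by (simp add: div_less_iff_less_mult mult.commute flip: dm(1))
    then show ?thesis
      using divided_power_mul[OF Y, of i1 j1] divided_power_mul_zero[OF Y top_image_pow, of i1 j1]
      unfolding prod C by (auto simp: sigma_image_def dm mul_linear mult_ac)
  next
    case False
    have "?P \<le> i0 + j0" using False by simp
    then have z: "nu ((i0 + j0) choose i0) = 0"
      using dvd_choose_carry[OF prime_p lt] by (intro nu_zero) simp
    \<comment> \<open>After a carry the low digit of i + j is i0 + j0 - P, which is less than i0, so
      C(i+j,i) vanishes by Lucas; the product on the left vanishes through C(i0+j0,i0).\<close>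
    have sum: "i + j = ?P * (i1 + j1 + 1) + (i0 + j0 - ?P)" using False by (simp add: ij algebra_simps)
    have "nu ((i + j) choose i) = nu ((i1 + j1 + 1) choose i1) * nu ((i0 + j0 - ?P) choose i0)"
      unfolding sum by (subst ij(1)) (rule lucas; use lt in linarith)
    moreover have "i0 + j0 - ?P < i0" using lt False by linarith
    ultimately have "nu ((i + j) choose i) = 0" by (simp add: binomial_eq_0)
    then show ?thesis unfolding prod z by simp
  qed
qed

text \<open>For s = 1 the top generator is sigma_1 = theta^Q, whose value is already determined by
  that of theta; this excludes b there. For s >= 2 the value at sigma_1 lies below the top and is
  not affected by b.\<close>

lemma psi_relations:
  assumes s: "1 \<le> s" and b: "2 \<le> s \<or> b = 0"
  shows "M_relations_in AM (scal \<mu> tau_A) (add_poly a) (cut_image s (a 0 ^ Q) b)"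
  unfolding M_relations_in_def
proof (intro conjI allI)
  let ?y = "cut_image s (a 0 ^ Q) b"
  have S: "Suc (s - 1) = s" using s by simp
  have ps: "1 < p ^ s" using p_power_ge[OF s] p_gt by linarith
  show "mul AM (scal \<mu> tau_A) (scal \<mu> tau_A) = 0" by (simp add: mul_linear tau_mul)
  show "scal \<mu> tau_A \<in> carrier_of AM" "add_poly a \<in> carrier_of AM"
    by (simp_all add: carrier_scal add_poly_closed)
  show "?y j \<in> carrier_of AM" for j
    by (auto simp: cut_image_def carrier_closed(1) sigma_image_closed simp del: AM_simps)
  show "?y 0 = unit_el AM"
    using ps p_gt by (simp add: cut_image_def sigma_image_small sigma_A_def)
  show "pow AM (add_poly a) Q = ?y 1"
  proof (cases "s = 1")
    case True
    then show ?thesis using b ps sigma_image_top[of 0 "a 0 ^ Q" 0] by (simp add: add_poly_pow_Q cut_image_def top_image_def)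
  next
    case False
    then have "1 < p ^ (s - 1)" using s p_power_ge[of "s - 1"] p_gt by linarith
    then show ?thesis using ps by (simp add: add_poly_pow_Q cut_image_def sigma_image_small)
  qed
  fix i j
  show "mul AM (?y i) (?y j) = scal (nu ((i + j) choose i)) (?y (i + j))"
    using sigma_image_mul(1)[of i "s - 1" j "a 0 ^ Q" b] sigma_image_mul(2)[of i "s - 1" j] unfolding S
    by (auto simp: cut_image_def)
qed (rule AM_commute)+

lemma top_image_homogeneous: "homogeneous AM 0 (top_image l c b)"
  unfolding top_image_def by (intro homogeneous_closed homogeneous_gens)

lemma sigma_image_homogeneous: "homogeneous AM 0 (sigma_image l c b j)"
proof -
  have "homogeneous AM 0 (divided_power (top_image l c b) m)" for m
    unfolding divided_power_def using R.pow_homogeneous[OF top_image_homogeneous[of l c b], of m]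
    by (intro homogeneous_closed) simp
  then have "homogeneous AM (0 + 0) (mul AM (sigma_A (j mod p ^ l)) (divided_power (top_image l c b) (j div p ^ l)))"
    by (intro R.mul_homogeneous homogeneous_gens)
  then show ?thesis unfolding sigma_image_def by (intro homogeneous_closed) simp
qed

lemma counit_sigma_image: "0 < j \<Longrightarrow> counit AM (sigma_image l c b j) = 0"
proof -
  assume j: "0 < j"
  have Y: "counit AM (top_image l c b) = 0"
    using p_gt by (simp add: top_image_def counit_linear counit_gens)
  have "j mod p ^ l \<noteq> 0 \<or> j div p ^ l \<noteq> 0"
    using j by (metis div_mult_mod_eq add.right_neutral mult_zero_left neq0_conv)
  then show ?thesis
    by (auto simp: sigma_image_def counit_linear counit_mul divided_power_closed top_image_closed counit_gens divided_power_def
        R.pow_closed counit_pow[OF top_image_closed Y] carrier_scal)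
qed

lemma psi_data:
  assumes s: "1 \<le> s" and b: "2 \<le> s \<or> b = 0"
  shows "hopf_data s (scal \<mu> tau_A) (add_poly a) (cut_image s (a 0 ^ Q) b)"
  unfolding hopf_data_def
proof (intro conjI allI impI)
  show "M_relations_in AM (scal \<mu> tau_A) (add_poly a) (cut_image s (a 0 ^ Q) b)"
    by (rule psi_relations[OF assms])
  show "homogeneous AM 1 (scal \<mu> tau_A)" by (simp add: homogeneous_closed)
  show "homogeneous AM 0 (cut_image s (a 0 ^ Q) b j)" for j
    by (simp add: cut_image_def sigma_image_homogeneous homogeneous_closed)
  show "counit AM (cut_image s (a 0 ^ Q) b j) = 0" if "0 < j" "j < p ^ s" for j
    using that by (simp add: cut_image_def counit_sigma_image)
  show "antipode_sign (cut_image s (a 0 ^ Q) b (p ^ l)) = - cut_image s (a 0 ^ Q) b (p ^ l)" if "l < s" for l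
  proof -
    have ps: "p ^ l < p ^ s" using that p_gt by (intro power_strict_increasing) auto
    show ?thesis
    proof (cases "l = s - 1")
      case True
      then show ?thesis using ps odd_p
        by (simp add: cut_image_def sigma_image_top top_image_def antipode_sign_linear antipode_sign_sigma_odd scal_minus_right)
    next
      case False
      then have "p ^ l < p ^ (s - 1)" using that p_gt by (intro power_strict_increasing) auto
      then show ?thesis using ps odd_p
        by (simp add: cut_image_def sigma_image_small antipode_sign_linear antipode_sign_sigma_odd scal_minus_right)
    qed
  qed
qed (simp_all add: counit_linear counit_gens counit_add_poly add_poly_even antipode_sign_linear antipode_sign_gens
    antipode_sign_add_poly scal_minus_right)

lemma mono_tau_sigma: "mono 1 0 u = mul AM tau_A (sigma_A u)"
  using Q_pos by (simp add: tau_A_def sigma_A_def R.mul_singles op_M_def kappa_M_def mult_coeff_def del: mul_single)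

lemma gens_map_tau_sigma:
  assumes "M_relations_in AM t x y"
  shows "gens_map AM t x y (mono 1 0 u) = mul AM t (y u)" "gens_map AM t x y (mono 0 0 u) = y u"
  using gens_map_gens[OF R.assoc_superalgebra_axioms assms]
  by (simp_all only: mono_tau_sigma gens_map_mul[OF R.assoc_superalgebra_axioms assms] flip: sigma_A_def)

lemma tensor_sigma: "tensor (sigma_A u) (sigma_A v) = Poly_Mapping.single ((0, 0, u), (0, 0, v)) 1"
  "tensor (mul AM tau_A (sigma_A u)) (mul AM tau_A (sigma_A v)) = Poly_Mapping.single ((1, 0, u), (1, 0, v)) 1"
  unfolding mono_tau_sigma[symmetric] by (simp_all add: sigma_A_def)

text \<open>The coproduct of \<open>\<sigma>\<^sub>j\<close> with \<open>y\<^sub>u\<close> substituted for \<open>\<sigma>\<^sub>u\<close> and \<open>t\<close> for \<open>\<tau>\<close>.\<close>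

definition conv :: "(idx \<Rightarrow>\<^sub>0 'a) \<Rightarrow> (nat \<Rightarrow> idx \<Rightarrow>\<^sub>0 'a) \<Rightarrow> nat \<Rightarrow> (idx \<times> idx \<Rightarrow>\<^sub>0 'a)" where
  "conv t y j = (\<Sum>u\<le>j. tensor (y u) (y (j - u))) +
     (if p \<le> j then \<Sum>u\<le>j - p. tensor (mul AM t (y u)) (mul AM t (y (j - p - u))) else 0)"

lemma tensor_map_comult_sigma:
  "M_relations_in AM t x y \<Longrightarrow> tensor_map (gens_map AM t x y) (comult_sigma j) = conv t y j"
  using gens_map_tau_sigma[of t x y] by (simp add: comult_sigma_def conv_def tensor_map_linear tensor_map_diag)

lemma conv_cong: "(\<And>u. u \<le> j \<Longrightarrow> y u = z u) \<Longrightarrow> conv t y j = conv t z j"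
  unfolding conv_def by (auto intro!: sum.cong arg_cong2[where f = "(+)"])

text \<open>A tau-free term is scaled by c^j. A tau-tau term acquires \<mu>^2 c^(j-p), and equality
  with c^j is where the relation \<mu>^2 = c^p comes from.\<close>

lemma conv_sigma:
  assumes "p \<le> j \<Longrightarrow> \<mu> ^ 2 = c ^ p"
  shows "conv (scal \<mu> tau_A) (\<lambda>u. scal (c ^ u) (sigma_A u)) j = scal (c ^ j) (comult_sigma j)"
proof -
  have 1: "(\<Sum>u\<le>j. tensor (scal (c ^ u) (sigma_A u)) (scal (c ^ (j - u)) (sigma_A (j - u)))) = scal (c ^ j) (diag 0 j)"
    unfolding diag_def scal_sum_right
    by (intro sum.cong refl) (simp add: tensor_linear tensor_sigma flip: power_add)
  have 2: "(\<Sum>u\<le>j - p. tensor (mul AM (scal \<mu> tau_A) (scal (c ^ u) (sigma_A u)))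
      (mul AM (scal \<mu> tau_A) (scal (c ^ (j - p - u)) (sigma_A (j - p - u))))) = scal (c ^ j) (diag 1 (j - p))"
    if "p \<le> j"
  proof -
    show ?thesis unfolding diag_def scal_sum_right
    proof (rule sum.cong[OF refl])
      fix u assume "u \<in> {..j - p}"
      then have u: "p + (u + (j - p - u)) = j" using that by simp
      have "tensor (mul AM (scal \<mu> tau_A) (scal (c ^ u) (sigma_A u)))
          (mul AM (scal \<mu> tau_A) (scal (c ^ (j - p - u)) (sigma_A (j - p - u)))) =
        scal (\<mu> ^ 2 * (c ^ u * c ^ (j - p - u)))
          (tensor (mul AM tau_A (sigma_A u)) (mul AM tau_A (sigma_A (j - p - u))))"
        by (simp only: mul_linear tensor_linear scal_simps power2_eq_square mult_ac)
      also have "\<mu> ^ 2 * (c ^ u * c ^ (j - p - u)) = c ^ (p + (u + (j - p - u)))"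
        using assms[OF that] by (simp only: power_add)
      finally show "tensor (mul AM (scal \<mu> tau_A) (scal (c ^ u) (sigma_A u)))
          (mul AM (scal \<mu> tau_A) (scal (c ^ (j - p - u)) (sigma_A (j - p - u)))) =
        scal (c ^ j) (Poly_Mapping.single ((1, 0, u), (1, 0, j - p - u)) 1)"
        by (simp only: u tensor_sigma)
    qed
  qed
  show ?thesis using 1 2 by (simp add: conv_def comult_sigma_def scal_add_right)
qed

text \<open>The top value y_j occurs only beside y_0 = 1, in the two extreme terms of the first sum;
  the tau terms involve indices up to j - p only. A change of y_j by w hence adds
  \<open>prim w\<close>.\<close>

lemma conv_perturb:
  assumes "0 < j" "y 0 = mono 0 0 0"
  shows "conv t (\<lambda>u. y u + (if u = j then w else 0)) j = conv t y j + prim w"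
proof -
  let ?z = "\<lambda>u. y u + (if u = j then w else 0)"
  have "(\<Sum>u\<le>j. tensor (?z u) (?z (j - u))) =
      (\<Sum>u\<le>j. tensor (y u) (y (j - u)) +
         ((if u = j then tensor w (mono 0 0 0) else 0) + (if u = 0 then tensor (mono 0 0 0) w else 0)))"
    using assms by (intro sum.cong refl) (auto simp: tensor_linear)
  also have "\<dots> = (\<Sum>u\<le>j. tensor (y u) (y (j - u))) + prim w"
    by (simp add: sum.distrib prim_def)
  finally have 1: "(\<Sum>u\<le>j. tensor (?z u) (?z (j - u))) = \<dots>" .
  have 2: "(\<Sum>u\<le>j - p. tensor (mul AM t (?z u)) (mul AM t (?z (j - p - u)))) =
      (\<Sum>u\<le>j - p. tensor (mul AM t (y u)) (mul AM t (y (j - p - u))))"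
  proof (rule sum.cong[OF refl])
    fix u assume "u \<in> {..j - p}"
    moreover have "j - p < j" using p_gt assms by (intro diff_less)
    ultimately have "u \<noteq> j" "j - p - u \<noteq> j" by auto
    then show "tensor (mul AM t (?z u)) (mul AM t (?z (j - p - u))) = tensor (mul AM t (y u)) (mul AM t (y (j - p - u)))"
      by simp
  qed
  show ?thesis unfolding conv_def 1 2 by (simp add: add_ac)
qed

lemma comult_sigma_1: "comult_sigma 1 = prim (sigma_A 1)"
  using p_gt by (simp add: comult_sigma_def diag_def prim_def sigma_A_def add.commute)

lemma psi_comult:
  assumes s: "1 \<le> s" and b: "2 \<le> s \<or> b = 0" and \<mu>: "2 \<le> s \<Longrightarrow> \<mu> ^ 2 = (a 0 ^ Q) ^ p" and l: "l < s"
  shows "comult AM (cut_image s (a 0 ^ Q) b (p ^ l)) = conv (scal \<mu> tau_A) (cut_image s (a 0 ^ Q) b) (p ^ l)"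
proof -
  define c where "c = a 0 ^ Q"
  have ps: "p ^ l < p ^ s" using l p_gt by (intro power_strict_increasing) auto
  \<comment> \<open>For l = 0 there are no tau terms, as 1 < p; from l = 1 on s is at least 2, where
    the relation on \<mu> is assumed.\<close>
  have mu: "p \<le> p ^ l \<Longrightarrow> \<mu> ^ 2 = c ^ p"
  proof -
    assume "p \<le> p ^ l"
    then have "l \<noteq> 0" using p_gt by (cases l) auto
    then show ?thesis using \<mu> l by (simp add: c_def)
  qed
  have cs: "conv (scal \<mu> tau_A) (\<lambda>u. scal (c ^ u) (sigma_A u)) (p ^ l) = scal (c ^ p ^ l) (comult_sigma (p ^ l))"
    by (rule conv_sigma) (rule mu)
  show ?thesis
  proof (cases "l = s - 1")
    case False
    then have pl: "p ^ l < p ^ (s - 1)" using l p_gt by (intro power_strict_increasing) auto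
    have "cut_image s c b u = scal (c ^ u) (sigma_A u)" if "u \<le> p ^ l" for u
      using that ps pl by (simp add: cut_image_def sigma_image_small)
    then show ?thesis
      using conv_cong[of "p ^ l" "cut_image s c b" "\<lambda>u. scal (c ^ u) (sigma_A u)"] cs
      by (simp add: comult_linear comult_gens flip: c_def)
  next
    case True
    let ?z = "\<lambda>u. scal (c ^ u) (sigma_A u) + (if u = p ^ l then scal b (sigma_A 1) else 0)"
    have "cut_image s c b u = ?z u" if "u \<le> p ^ l" for u
      using that ps True by (cases "u = p ^ l") (simp_all add: cut_image_def sigma_image_small sigma_image_top top_image_def)
    then have "conv (scal \<mu> tau_A) (cut_image s c b) (p ^ l) = conv (scal \<mu> tau_A) ?z (p ^ l)"
      by (rule conv_cong)
    also have "\<dots> = conv (scal \<mu> tau_A) (\<lambda>u. scal (c ^ u) (sigma_A u)) (p ^ l) + prim (scal b (sigma_A 1))"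
      using p_gt by (intro conv_perturb) (simp_all add: sigma_A_def)
    also have "\<dots> = comult AM (top_image l c b)"
      unfolding cs by (simp only: top_image_def comult_linear comult_gens comult_sigma_1 prim_linear)
    also have "top_image l c b = cut_image s c b (p ^ l)"
      using True ps by (simp add: cut_image_def sigma_image_top)
    finally show ?thesis by (simp add: c_def)
  qed
qed

lemma psi_hom:
  assumes s: "1 \<le> s" and b: "2 \<le> s \<or> b = 0" and \<mu>: "2 \<le> s \<Longrightarrow> \<mu> ^ 2 = (a 0 ^ Q) ^ p"
  shows "restrict (gens_map AM (scal \<mu> tau_A) (add_poly a) (cut_image s (a 0 ^ Q) b)) (carrier_of (AMs s)) \<in> hopf_homs (AMs s) AM"
proof (rule gens_map_hopf[OF sub_like_AMs[OF s] psi_data[OF s b]])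
  fix z assume "z \<in> carrier_of (AMs s)"
  then show "comult AM (gens_map AM (scal \<mu> tau_A) (add_poly a) (cut_image s (a 0 ^ Q) b) z) =
      tensor_map (gens_map AM (scal \<mu> tau_A) (add_poly a) (cut_image s (a 0 ^ Q) b)) (comult (AMs s) z)"
    unfolding AMs_ops
    by (rule gens_map_comult[OF s psi_data[OF s b]])
      (simp_all add: comult_linear comult_gens prim_linear comult_add_poly psi_comult[OF s b] \<mu>
        tensor_map_comult_sigma[OF psi_relations[OF s b]])
qed

section \<open>Truncation and the substitution of theta - h sigma_(p^s) for theta\<close>

definition cut_sigma :: "nat \<Rightarrow> nat \<Rightarrow> (idx \<Rightarrow>\<^sub>0 'a)" where
  "cut_sigma s j = (if j < p ^ s then sigma_A j else 0)"

text \<open>\<open>eta_map s (\<iota> \<eta>)\<close> embeds \<open>A[M\<^sub>r\<^sub>;\<^sub>s\<^sub>,\<^sub>\<eta>]\<close> into \<open>A[M\<^sub>r]\<close>; \<open>eta_map s 0\<close> is the truncation that kills all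
  \<open>\<sigma>\<^sub>j\<close> with \<open>j \<ge> p^s\<close>.\<close>

definition eta_map :: "nat \<Rightarrow> 'a \<Rightarrow> (idx \<Rightarrow>\<^sub>0 'a) \<Rightarrow> (idx \<Rightarrow>\<^sub>0 'a)" where
  "eta_map s h = gens_map AM tau_A (theta_A - scal h (sigma_A (p ^ s))) (cut_sigma s)"

lemma eta_theta_closed: "theta_A - scal h (sigma_A (p ^ s)) \<in> carrier_of AM"
  by (intro carrier_closed carrier_scal gens_closed theta_A_closed)

text \<open>For r >= 2 the prime p divides Q, so sigma_(p^s)^Q = 0 and by Frobenius the Q-th power
  of theta - h sigma_(p^s) is still sigma_1.\<close>

lemma eta_relations:
  assumes s: "1 \<le> s" and h: "h = 0 \<or> 2 \<le> r"
  shows "M_relations_in AM tau_A (theta_A - scal h (sigma_A (p ^ s))) (cut_sigma s)"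
  unfolding M_relations_in_def
proof (intro conjI allI)
  have ps: "1 < p ^ s" using p_power_ge[OF s] p_gt by linarith
  show "pow AM (theta_A - scal h (sigma_A (p ^ s))) Q = cut_sigma s 1"
  proof (cases "h = 0")
    case True then show ?thesis using ps pow_theta_Q by (simp add: cut_sigma_def)
  next
    case False
    then have "p ^ 1 \<le> Q" using h p_gt unfolding Q_def by (intro power_increasing) auto
    then have "pow AM (sigma_A (p ^ s)) Q = 0"
      using prime_p by (simp add: sigma_pow nu_zero prime_dvd_fact_iff)
    then have "pow AM (scal (- h) (sigma_A (p ^ s))) (p ^ (r - 1)) = 0"
      by (simp only: R.pow_scal Q_def scal_simps)
    then have "pow AM (theta_A + scal (- h) (sigma_A (p ^ s))) (p ^ (r - 1)) = pow AM theta_A (p ^ (r - 1))"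
      by (subst frobenius_AM) (simp_all add: carrier_scal)
    then show ?thesis using ps pow_theta_Q by (simp add: cut_sigma_def scal_minus_left Q_def)
  qed
  fix i j
  show "mul AM (cut_sigma s i) (cut_sigma s j) = scal (nu ((i + j) choose i)) (cut_sigma s (i + j))"
    using dvd_choose_carry[OF prime_p, of i s j]
    by (auto simp: cut_sigma_def sigma_mul nu_zero)
qed (use p_gt in \<open>auto simp: tau_mul cut_sigma_def sigma_A_def carrier_closed eta_theta_closed AM_commute intro: gens_closed
      simp flip: sigma_A_def\<close>)

lemma eta_data:
  assumes s: "1 \<le> s" and h: "h = 0 \<or> 2 \<le> r"
  shows "hopf_data s tau_A (theta_A - scal h (sigma_A (p ^ s))) (cut_sigma s)"
  unfolding hopf_data_def
proof (intro conjI allI impI eta_relations[OF assms])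
  show "homogeneous AM 0 (theta_A - scal h (sigma_A (p ^ s)))"
    by (intro homogeneous_closed homogeneous_gens)
  show "counit AM (theta_A - scal h (sigma_A (p ^ s))) = 0"
    using p_gt by (simp add: counit_linear counit_gens)
  show "antipode_sign (theta_A - scal h (sigma_A (p ^ s))) = - (theta_A - scal h (sigma_A (p ^ s)))"
    using odd_p by (simp add: antipode_sign_linear antipode_sign_gens(2) antipode_sign_sigma_odd scal_minus_right)
  show "antipode_sign (cut_sigma s (p ^ l)) = - cut_sigma s (p ^ l)" if "l < s" for l
    using odd_p that p_gt by (simp add: cut_sigma_def antipode_sign_sigma_odd)
qed (auto simp: cut_sigma_def homogeneous_closed counit_gens antipode_sign_gens)

lemma eta_map_mul: "1 \<le> s \<Longrightarrow> h = 0 \<or> 2 \<le> r \<Longrightarrow> eta_map s h (mul AM u v) = mul AM (eta_map s h u) (eta_map s h v)"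
  unfolding eta_map_def by (rule gens_map_mul[OF R.assoc_superalgebra_axioms eta_relations])

lemma eta_map_linear: "eta_map s h (x + y) = eta_map s h x + eta_map s h y" "eta_map s h (scal c x) = scal c (eta_map s h x)"
  "eta_map s h 0 = 0"
  by (simp_all add: eta_map_def gens_map_add gens_map_scal) (simp add: gens_map_def)

lemma eta_map_gens:
  assumes "1 \<le> s" "h = 0 \<or> 2 \<le> r"
  shows "eta_map s h tau_A = tau_A" "eta_map s h theta_A = theta_A - scal h (sigma_A (p ^ s))"
    "eta_map s h (sigma_A j) = cut_sigma s j" "eta_map s h (mono 0 0 0) = mono 0 0 0"
  unfolding eta_map_def gens_map_gens[OF R.assoc_superalgebra_axioms eta_relations[OF assms]] by simp_all

lemma lookup_trunc:
  assumes "1 \<le> s" "z \<in> carrier_of AM"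
  shows "Poly_Mapping.lookup (eta_map s 0 z) (e, i, j) = (if j < p ^ s then Poly_Mapping.lookup z (e, i, j) else 0)"
proof -
  have "Poly_Mapping.keys z \<subseteq> basis AM" using assms(2) by (simp only: carrier_of_iff)
  then show ?thesis
  proof (induction z rule: poly_mapping_linear_induct)
    case (single b c)
    obtain e' i' j' where b: "b = (e', i', j')" by (metis prod_cases3)
    then have e: "e' = 0 \<or> e' = 1" and i: "i' < Q" using single by auto
    have "eta_map s 0 (mono e' i' j') = mul AM (pow AM tau_A e') (mul AM (pow AM theta_A i') (cut_sigma s j'))"
      by (simp only: eta_map_def gens_map_mono scal_simps diff_zero)
    also have "mul AM (pow AM theta_A i') (cut_sigma s j') = (if j' < p ^ s then mono 0 i' j' else 0)"
      by (simp add: cut_sigma_def mono_product(1)[OF i])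
    also have "mul AM (pow AM tau_A e') \<dots> = (if j' < p ^ s then mono e' i' j' else 0)"
    proof -
      have "mul AM (mono 0 0 0) (mono 0 i' j') = mono 0 i' j'"
        using R.unit_left[of "mono 0 i' j'"] i by (simp del: mul_single)
      then have "mul AM (pow AM tau_A e') (mono 0 i' j') = mono e' i' j'"
        using e
      proof (elim disjE)
        assume "e' = 1"
        then show ?thesis
          by (simp only: One_nat_def R.pow_1[OF gens_closed(1)] mono_product(2)[OF i, unfolded One_nat_def])
      qed (simp add: R.pow_0)
      then show ?thesis by simp
    qed
    finally have "eta_map s 0 (mono e' i' j') = (if j' < p ^ s then mono e' i' j' else 0)" .
    moreover have "Poly_Mapping.single b c = scal c (mono e' i' j')" by (simp add: b)
    ultimately show ?case
      by (simp only: eta_map_linear) (auto simp: b lookup_single when_def)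
  qed (simp_all add: eta_map_linear lookup_add)
qed

section \<open>Necessary conditions on \<mu>, b and the primitive part\<close>

lemma top_image_digits:
  assumes "u0 < p ^ l" "u1 < p"
  shows "sigma_image l c b (p ^ l * u1 + u0) = scal (c ^ u0) (mul AM (sigma_A u0) (divided_power (top_image l c b) u1))"
  using assms p_gt by (simp add: sigma_image_def)

lemma fact_divided_power: "m < p \<Longrightarrow> scal (nu (fact m)) (divided_power Y m) = pow AM Y m"
  using nu_inverse[of "fact m"] prime_dvd_fact_iff[OF prime_p, of m] char_p
  by (simp add: divided_power_def mult.commute del: of_nat_fact)

lemma divided_power_scal_sigma: "m < p \<Longrightarrow> divided_power (scal b (sigma_A (p ^ l))) m = scal (b ^ m) (sigma_A (p ^ l * m))"
proof -
  assume m: "m < p"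
  have "scal (nu (fact m)) (divided_power (scal b (sigma_A (p ^ l))) m) = scal (nu (fact m)) (scal (b ^ m) (sigma_A (p ^ l * m)))"
    unfolding fact_divided_power[OF m] by (simp add: R.pow_scal sigma_pow mult.commute)
  then show ?thesis by (rule nu_fact_cancel[OF m])
qed

lemma div_less_p: "u < p ^ Suc l \<Longrightarrow> u div p ^ l < p"
  by (simp add: less_mult_imp_div_less mult.commute)

lemma sigma_image_zero:
  assumes "u < p ^ Suc l"
  shows "sigma_image l c 0 u = scal (c ^ u) (sigma_A u)"
proof -
  define u0 u1 where "u0 = u mod p ^ l" and "u1 = u div p ^ l"
  have u: "u = p ^ l * u1 + u0" by (simp add: u0_def u1_def)
  have lt: "u0 < p ^ l" "u1 < p" using p_gt div_less_p[OF assms] by (simp_all add: u0_def u1_def)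
  have "nu ((p ^ l * u1 + u0) choose u0) = 1"
    using lucas[OF lt(1) lt(1), of u1 0] by simp
  then have "mul AM (sigma_A u0) (sigma_A (p ^ l * u1)) = sigma_A (p ^ l * u1 + u0)"
    by (simp add: sigma_mul add.commute)
  moreover have "divided_power (top_image l c 0) u1 = scal ((c ^ p ^ l) ^ u1) (sigma_A (p ^ l * u1))"
    using divided_power_scal_sigma[OF lt(2)] by (simp add: top_image_def)
  moreover have "c ^ u0 * (c ^ p ^ l) ^ u1 = c ^ (p ^ l * u1 + u0)"
    by (simp add: power_add power_mult[of c "p ^ l" u1] mult.commute[of "c ^ u0"])
  ultimately show ?thesis unfolding u top_image_digits[OF lt]
    by (simp only: mul_linear scal_simps)
qed

text \<open>Truncation at p^l keeps the coefficients at sigma_n with n < p^l and kills sigma_(p^l),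
  so \<open>top_image\<close> becomes b sigma_1 and the image turns into c^u0 b^u1 sigma_u0
  sigma_u1, cut off at p^l.\<close>

lemma lookup_sigma_image:
  assumes l: "1 \<le> l" and n: "n < p ^ l" and u: "u0 < p ^ l" "u1 < p"
  shows "Poly_Mapping.lookup (sigma_image l c b (p ^ l * u1 + u0)) (0, 0, n) =
    (if u0 + u1 = n then c ^ u0 * b ^ u1 * nu (n choose u0) else 0)"
proof -
  have tr: "eta_map l 0 (top_image l c b) = scal b (sigma_A 1)"
    using l p_power_ge[OF l] p_gt by (simp add: top_image_def eta_map_linear eta_map_gens cut_sigma_def)
  have pw: "eta_map l 0 (pow AM z m) = pow AM (eta_map l 0 z) m" for z m
    by (induction m) (use l in \<open>simp_all add: R.pow_0 R.pow_Suc eta_map_gens eta_map_mul\<close>)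
  have "eta_map l 0 (divided_power (top_image l c b) u1) = divided_power (scal b (sigma_A (p ^ 0))) u1"
    by (simp add: divided_power_def eta_map_linear pw tr)
  also have "\<dots> = scal (b ^ u1) (sigma_A u1)" using divided_power_scal_sigma[OF u(2), of b 0] by simp
  finally have "eta_map l 0 (sigma_image l c b (p ^ l * u1 + u0)) = scal (c ^ u0 * (b ^ u1 * nu ((u0 + u1) choose u0))) (sigma_A (u0 + u1))"
    unfolding top_image_digits[OF u]
    using u l by (simp add: eta_map_linear eta_map_mul eta_map_gens cut_sigma_def mul_linear sigma_mul mult_ac)
  moreover have "Poly_Mapping.lookup (sigma_image l c b (p ^ l * u1 + u0)) (0, 0, n) =
      Poly_Mapping.lookup (eta_map l 0 (sigma_image l c b (p ^ l * u1 + u0))) (0, 0, n)"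
    using lookup_trunc[OF l sigma_image_closed] n by simp
  ultimately show ?thesis by (auto simp: sigma_A_def lookup_single when_def mult_ac)
qed

text \<open>Both sides are the coefficient of \<open>\<sigma>\<^sub>p\<close> in \<open>z\<close>, read off \<open>\<Delta>(z)\<close> at \<open>\<sigma>\<^sub>1 \<otimes> \<sigma>\<^sub>p\<^sub>-\<^sub>1\<close> and at \<open>\<tau> \<otimes> \<tau>\<close>.\<close>

lemma lookup_conv:
  assumes y: "\<And>u. homogeneous AM 0 (y u)" "\<And>u. y u \<in> carrier_of AM"
    and eps: "\<And>u. Poly_Mapping.lookup (y u) (0, 0, 0) = (if u = 0 then 1 else 0)"
    and z: "z \<in> carrier_of AM" "comult AM z = conv (scal \<mu> tau_A) y j" and j: "p \<le> j"
  shows "(\<Sum>u\<le>j. Poly_Mapping.lookup (y u) (0, 0, 1) * Poly_Mapping.lookup (y (j - u)) (0, 0, p - 1)) =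
    (if j = p then \<mu> ^ 2 else 0)"
proof -
  have odd: "Poly_Mapping.lookup (y u) (1, i, n) = 0" for u i n
    using y(1)[of u] by (auto simp: homogeneous_lookup)
  have tau: "Poly_Mapping.lookup (mul AM (scal \<mu> tau_A) (y u)) (0, i, n) = 0" for u i n
  proof -
    have "homogeneous AM (1 + 0) (mul AM (scal \<mu> tau_A) (y u))"
      using y(1) by (intro R.mul_homogeneous homogeneous_closed) simp_all
    then show ?thesis by (auto simp: homogeneous_lookup)
  qed
  have tau1: "Poly_Mapping.lookup (mul AM (scal \<mu> tau_A) (y u)) (1, 0, 0) = \<mu> * Poly_Mapping.lookup (y u) (0, 0, 0)" for u
  proof -
    have "Poly_Mapping.lookup (mul AM tau_A v) (1, 0, 0) = Poly_Mapping.lookup v (0, 0, 0)"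
      if "Poly_Mapping.keys v \<subseteq> basis AM" for v
      using that
    proof (induction v rule: poly_mapping_linear_induct)
      case (single b c)
      then show ?case
        by (cases b) (auto simp: tau_A_def R.mul_singles op_M_def kappa_M_def mult_coeff_def lookup_single when_def simp del: mul_single)
    qed (simp_all add: mul_linear lookup_add)
    then have "Poly_Mapping.lookup (mul AM tau_A (y u)) (1, 0, 0) = Poly_Mapping.lookup (y u) (0, 0, 0)"
      using y(2) by (simp only: carrier_of_iff)
    then show ?thesis by (simp add: mul_linear)
  qed
  note look = lookup_comult[OF z(1)]
  have "Poly_Mapping.lookup (comult AM z) ((0, 0, 1), (0, 0, p - 1)) = Poly_Mapping.lookup (comult AM z) ((1, 0, 0), (1, 0, 0))"
    using p_gt by (simp add: look)
  then have "(\<Sum>u\<le>j. Poly_Mapping.lookup (y u) (0, 0, 1) * Poly_Mapping.lookup (y (j - u)) (0, 0, p - 1)) =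
      (\<Sum>u\<le>j - p. \<mu> ^ 2 * (Poly_Mapping.lookup (y u) (0, 0, 0) * Poly_Mapping.lookup (y (j - p - u)) (0, 0, 0)))"
    using j tau1 odd[of _ 0 0] tau[of _ 0 1] unfolding z(2) conv_def by (simp add: lookup_add lookup_sum power2_eq_square mult_ac)
  also have "\<dots> = (\<Sum>u\<le>j - p. if u = 0 then (if j = p then \<mu> ^ 2 else 0) else 0)"
    using j by (intro sum.cong refl) (auto simp: eps)
  finally show ?thesis by simp
qed

text \<open>In \<open>lookup_conv\<close> with j = p^(l+1) > p the right side is 0. On the left, for
  0 < u < j, y_u has a coefficient at sigma_1 only if its digits u mod p^l and u div p^l add up to
  1. Of the two candidates u = 1 drops out, and u = p^l contributes b times b^(p-1).\<close>

lemma conv_extension_nilpotent: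
  assumes l: "1 \<le> l" and z: "z \<in> carrier_of AM" "homogeneous AM 0 z" "Poly_Mapping.lookup z (0, 0, 0) = 0"
    and comult: "comult AM z = conv (scal \<mu> tau_A) (\<lambda>u. if u < p ^ Suc l then sigma_image l c b u else if u = p ^ Suc l then z else 0) (p ^ Suc l)"
  shows "b ^ p = 0"
proof -
  let ?P = "p ^ l" and ?j = "p ^ Suc l"
  define y where "y = (\<lambda>u. if u < ?j then sigma_image l c b u else if u = ?j then z else 0)"
  have P: "p \<le> ?P" by (rule p_power_ge[OF l])
  have Pj: "?P < ?j" using p_gt by (intro power_strict_increasing) auto
  have j: "p < ?j" using P Pj by linarith
  have y0: "y 0 = mono 0 0 0" using p_gt by (simp add: y_def sigma_image_small sigma_A_def)
  have eps: "Poly_Mapping.lookup (y u) (0, 0, 0) = (if u = 0 then 1 else 0)" for u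
    using counit_sigma_image[of u l c b] z(3) y0 by (cases "u = 0") (auto simp: y_def counit_AM)
  have sum: "(\<Sum>u\<le>?j. Poly_Mapping.lookup (y u) (0, 0, 1) * Poly_Mapping.lookup (y (?j - u)) (0, 0, p - 1)) = 0"
    using lookup_conv[of y z \<mu> ?j] eps z comult j sigma_image_closed sigma_image_homogeneous
    by (simp add: y_def carrier_closed homogeneous_closed del: power_Suc AM_simps)
  have low: "Poly_Mapping.lookup (y u) (0, 0, n) =
      (if u mod ?P + u div ?P = n then c ^ (u mod ?P) * b ^ (u div ?P) * nu (n choose (u mod ?P)) else 0)"
    if "u < ?j" "n < ?P" for u n
    using lookup_sigma_image[OF l that(2), of "u mod ?P" "u div ?P" c b] div_less_p[OF that(1)] that p_gt
    by (simp add: y_def)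
  have summand: "Poly_Mapping.lookup (y u) (0, 0, 1) * Poly_Mapping.lookup (y (?j - u)) (0, 0, p - 1) =
      (if u = ?P then b ^ p else 0)" if uj: "u \<le> ?j" for u
  proof -
    consider "u = 0" | "u = ?j" | "0 < u" "u < ?j"
      using uj by (metis le_neq_implies_less neq0_conv)
    then show ?thesis
    proof cases
      case 1 then show ?thesis using p_gt by (simp add: y0 lookup_single when_def)
    next
      case 2 then show ?thesis using p3 Pj by (simp add: y0 lookup_single when_def del: power_Suc)
    next
      case 3
      have P1: "1 < ?P" using P p_gt by linarith
      show ?thesis
      proof (cases "u mod ?P + u div ?P = 1")
        case False
        moreover have "?P mod ?P + ?P div ?P = 1" by (simp only: mod_self div_self[OF gr_implies_not0[OF P1]])
        ultimately have "u \<noteq> ?P" by blast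
        then show ?thesis using False low[OF 3(2) P1] by simp
      next
        case True
        then consider "u mod ?P = 1" "u div ?P = 0" | "u mod ?P = 0" "u div ?P = 1" by linarith
        then show ?thesis
        proof cases
          case 1
          then have u: "u = 1" using div_mult_mod_eq[of u ?P] by simp
          \<comment> \<open>The complement of u = 1 has the digits p^l - 1 and p - 1. Their sum
            exceeds p - 1, so there is no coefficient at sigma_(p-1).\<close>
          have "?j - 1 = ?P * (p - 1) + (?P - 1)"
            using P1 p_gt by (simp add: algebra_simps diff_mult_distrib2)
          moreover have "(?P * (p - 1) + v) mod ?P = v" "(?P * (p - 1) + v) div ?P = p - 1" if "v < ?P" for v
            using that p_gt by (simp_all add: div_mult_self4)
          moreover have "?P - 1 < ?P" using P1 by linarith
          ultimately have "(?j - 1) mod ?P = ?P - 1" "(?j - 1) div ?P = p - 1" by metis+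
          then have "(?j - 1) mod ?P + (?j - 1) div ?P \<noteq> p - 1" using P1 by linarith
          then show ?thesis using low[of "?j - 1" "p - 1"] P P1 p_gt j u by simp
        next
          case 2
          then have u: "u = ?P" using div_mult_mod_eq[of u ?P] by simp
          have "?j - ?P = ?P * (p - 1)" by (simp add: algebra_simps diff_mult_distrib2)
          then have dm: "(?j - ?P) mod ?P = 0" "(?j - ?P) div ?P = p - 1" using P1 by simp_all
          have "Poly_Mapping.lookup (y (?j - ?P)) (0, 0, p - 1) = b ^ (p - 1)"
            using low[of "?j - ?P" "p - 1"] dm P p_gt P1 Pj by simp
          moreover have "Poly_Mapping.lookup (y ?P) (0, 0, 1) = b"
            using low[OF Pj P1] P1 p_gt by simp
          moreover have "b * b ^ (p - 1) = b ^ p" using p_gt by (simp flip: power_Suc)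
          ultimately show ?thesis by (simp add: u)
        qed
      qed
    qed
  qed
  have "(\<Sum>u\<le>?j. Poly_Mapping.lookup (y u) (0, 0, 1) * Poly_Mapping.lookup (y (?j - u)) (0, 0, p - 1)) =
      (\<Sum>u\<le>?j. if u = ?P then b ^ p else 0)"
    by (intro sum.cong refl summand) simp
  then show ?thesis using sum Pj by simp
qed

text \<open>For l = 1 the only term left in \<open>lookup_conv\<close> is u = 1, with value c times
  c^(p-1), against \<mu>^2. Once \<mu>^2 = c^p is known, c^(p^l) sigma_(p^l) solves the same
  coproduct equation by \<open>conv_sigma\<close>, and by \<open>conv_perturb\<close> two solutions
  differ by a primitive element.\<close>

lemma conv_extension:
  assumes l: "1 \<le> l" and z: "z \<in> carrier_of AM" "homogeneous AM 0 z" "Poly_Mapping.lookup z (0, 0, 0) = 0"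
    and comult: "comult AM z = conv (scal \<mu> tau_A) (\<lambda>u. if u < p ^ l then scal (c ^ u) (sigma_A u) else if u = p ^ l then z else 0) (p ^ l)"
    and \<mu>: "l = 1 \<or> \<mu> ^ 2 = c ^ p"
  shows "\<mu> ^ 2 = c ^ p" "\<exists>a. z = scal (c ^ p ^ l) (sigma_A (p ^ l)) + add_poly a"
proof -
  define y where "y = (\<lambda>u. if u < p ^ l then scal (c ^ u) (sigma_A u) else if u = p ^ l then z else 0)"
  have pl: "p \<le> p ^ l" by (rule p_power_ge[OF l])
  show mu: "\<mu> ^ 2 = c ^ p"
  proof (cases "l = 1")
    case True
    have "(\<Sum>u\<le>p. Poly_Mapping.lookup (y u) (0, 0, 1) * Poly_Mapping.lookup (y (p - u)) (0, 0, p - 1)) = \<mu> ^ 2"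
    proof -
      have "Poly_Mapping.lookup (y u) (0, 0, 0) = (if u = 0 then 1 else 0)" for u
        using z(3) p_gt True by (auto simp: y_def sigma_A_def lookup_single when_def)
      then show ?thesis
        using lookup_conv[of y z \<mu> p] z comult True
        by (simp add: y_def carrier_closed homogeneous_closed carrier_scal del: AM_simps)
    qed
    also have "(\<Sum>u\<le>p. Poly_Mapping.lookup (y u) (0, 0, 1) * Poly_Mapping.lookup (y (p - u)) (0, 0, p - 1)) =
        (\<Sum>u\<le>p. if u = 1 then c ^ p else 0)"
    proof (rule sum.cong[OF refl])
      fix u assume "u \<in> {..p}"
      then consider "u = 0" | "u = p" | "u = 1" | "1 < u" "u < p" by fastforce
      then show "Poly_Mapping.lookup (y u) (0, 0, 1) * Poly_Mapping.lookup (y (p - u)) (0, 0, p - 1) = (if u = 1 then c ^ p else 0)"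
        using p3 True by cases (auto simp: y_def sigma_A_def lookup_single when_def simp flip: power_Suc)
    qed
    finally show ?thesis using p_gt by simp
  qed (use \<mu> in simp)
  define w where "w = z - scal (c ^ p ^ l) (sigma_A (p ^ l))"
  have z': "z = scal (c ^ p ^ l) (sigma_A (p ^ l)) + w" by (simp add: w_def)
  have "conv (scal \<mu> tau_A) y (p ^ l) =
      conv (scal \<mu> tau_A) (\<lambda>u. scal (c ^ u) (sigma_A u) + (if u = p ^ l then w else 0)) (p ^ l)"
    by (rule conv_cong) (auto simp: y_def z')
  also have "\<dots> = conv (scal \<mu> tau_A) (\<lambda>u. scal (c ^ u) (sigma_A u)) (p ^ l) + prim w"
    using p_gt by (intro conv_perturb) (simp_all add: sigma_A_def)
  also have "conv (scal \<mu> tau_A) (\<lambda>u. scal (c ^ u) (sigma_A u)) (p ^ l) = scal (c ^ p ^ l) (comult_sigma (p ^ l))"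
    by (rule conv_sigma) (rule mu)
  finally have "comult AM w = prim w"
    using comult by (simp add: w_def comult_linear comult_gens y_def)
  moreover have "w \<in> carrier_of AM" "homogeneous AM 0 w"
    using z by (simp_all add: w_def carrier_closed carrier_scal homogeneous_closed del: AM_simps)
  ultimately have "w = add_poly (\<lambda>l. Poly_Mapping.lookup w (gidx l))" by (intro even_primitive)
  then show "\<exists>a. z = scal (c ^ p ^ l) (sigma_A (p ^ l)) + add_poly a" using z' by metis
qed

text \<open>The p-th power is the sum of the a_i^p theta^(p^(i+1)). For i < r - 1 these powers of
  theta are distinct basis elements, so a_i^p = 0 and a_i = 0 over a reduced A; the last one is 0,
  which leaves a_(r-1) free.\<close>

lemma add_poly_nilpotent:
  assumes red: "is_reduced TYPE('a)" and zero: "pow AM (add_poly a) p = 0"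
  shows "add_poly a = scal (a (r - 1)) (sigma_A 1)"
proof -
  have a: "a i = 0" if "i < r - 1" for i
  proof -
    have "(\<Sum>j<r. scal (a j ^ p) (pow AM theta_A (p ^ (j + 1)))) = 0"
      using add_poly_pow[of a 1] zero by simp
    then have "0 = Poly_Mapping.lookup (\<Sum>j<r. scal (a j ^ p) (pow AM theta_A (p ^ (j + 1)))) (gidx (i + 1))" by simp
    also have "\<dots> = (\<Sum>j<r. if j = i then a i ^ p else 0)"
      unfolding lookup_sum
    proof (rule sum.cong[OF refl])
      fix j assume j: "j \<in> {..<r}"
      show "Poly_Mapping.lookup (scal (a j ^ p) (pow AM theta_A (p ^ (j + 1)))) (gidx (i + 1)) = (if j = i then a i ^ p else 0)"
      proof (cases "j + 1 < r")
        case True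
        then have "gidx (j + 1) = gidx (i + 1) \<longleftrightarrow> j = i" using that inj_onD[OF inj_gidx, of "j + 1" "i + 1"] by auto
        then show ?thesis using True pow_theta_gidx[of "j + 1"] by (simp add: lookup_single when_def)
      next
        case False
        then show ?thesis using that j pow_theta_zero[of "j + 1"] by auto
      qed
    qed
    also have "\<dots> = a i ^ p"
    proof -
      have "i < r" using that by linarith
      then show ?thesis by simp
    qed
    finally show ?thesis using red unfolding is_reduced_def by metis
  qed
  have "add_poly a = (\<Sum>i<r. if i = r - 1 then scal (a (r - 1)) (sigma_A 1) else 0)"
    unfolding add_poly_eq
  proof (rule sum.cong[OF refl])
    fix i assume "i \<in> {..<r}"
    then show "scal (a i) (pow AM theta_A (p ^ i)) = (if i = r - 1 then scal (a (r - 1)) (sigma_A 1) else 0)"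
      using a[of i] pow_theta_Q by (auto simp: Q_def)
  qed
  then show ?thesis using r1 by simp
qed

lemma top_image_of_nilpotent:
  assumes red: "is_reduced TYPE('a)" and z: "z = scal (c ^ p ^ l) (sigma_A (p ^ l)) + add_poly a" and zero: "pow AM z p = 0"
  shows "\<exists>b. z = top_image l c b"
proof -
  have "pow AM z (p ^ 1) = pow AM (scal (c ^ p ^ l) (sigma_A (p ^ l))) (p ^ 1) + pow AM (add_poly a) (p ^ 1)"
    unfolding z by (rule frobenius_AM) (simp_all add: carrier_scal add_poly_closed)
  then have "pow AM (add_poly a) p = 0" using zero by (simp add: R.pow_scal sigma_pow_p)
  then have "add_poly a = scal (a (r - 1)) (sigma_A 1)" by (rule add_poly_nilpotent[OF red])
  then show ?thesis unfolding z top_image_def by auto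
qed

end

section \<open>Homomorphisms into \<open>A[M\<^sub>r]\<close>\<close>

lemma parametrized_byI:
  assumes ex: "\<And>x. x \<in> P \<Longrightarrow> \<exists>\<phi>\<in>S. spec x \<phi>"
    and par: "\<And>\<phi>. \<phi> \<in> S \<Longrightarrow> \<exists>x\<in>P. spec x \<phi>"
    and inj: "\<And>x y \<phi>. x \<in> P \<Longrightarrow> y \<in> P \<Longrightarrow> \<phi> \<in> S \<Longrightarrow> spec x \<phi> \<Longrightarrow> spec y \<phi> \<Longrightarrow> x = y"
    and uniq: "\<And>x \<phi> \<psi>. x \<in> P \<Longrightarrow> \<phi> \<in> S \<Longrightarrow> \<psi> \<in> S \<Longrightarrow> spec x \<phi> \<Longrightarrow> spec x \<psi> \<Longrightarrow> \<phi> = \<psi>"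
  shows "parametrized_by S P spec"
proof -
  define \<Phi> where "\<Phi> x = (SOME \<phi>. \<phi> \<in> S \<and> spec x \<phi>)" for x
  have \<Phi>: "\<Phi> x \<in> S" "spec x (\<Phi> x)" if "x \<in> P" for x
    using someI_ex[of "\<lambda>\<phi>. \<phi> \<in> S \<and> spec x \<phi>"] ex[OF that] unfolding \<Phi>_def by blast+
  have "bij_betw \<Phi> P S"
  proof (rule bij_betw_imageI)
    show "inj_on \<Phi> P" using inj \<Phi> by (metis inj_onI)
    show "\<Phi> ` P = S" using par uniq \<Phi> by blast
  qed
  moreover have "spec x \<phi> \<longleftrightarrow> \<phi> = \<Phi> x" if "x \<in> P" "\<phi> \<in> S" for x \<phi>
    using uniq \<Phi> that by blast
  ultimately show ?thesis unfolding parametrized_by_def by blast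
qed

context hopf_M begin

text \<open>Nothing is said about theta, whose coproduct is the one that M_(r;s,eta) changes; the
  induction over the sigma_(p^l) can thus be carried out for both kinds at once.\<close>

definition M_like :: "(idx, 'a) hopf_superalgebra \<Rightarrow> nat \<Rightarrow> bool" where
  "M_like X s \<longleftrightarrow> sub_like X s \<and> comult X tau_A = prim tau_A \<and> (\<forall>j<p ^ s. comult X (sigma_A j) = comult_sigma j)"

lemma M_like_AMs: "1 \<le> s \<Longrightarrow> M_like (AMs s) s"
  by (simp only: M_like_def sub_like_AMs AMs_ops comult_gens simp_thms)

lemma tensor_map_linear_on:
  assumes "linear_on (carrier_of X) \<phi>" "u \<in> carrier_of X" "v \<in> carrier_of X"
  shows "tensor_map \<phi> (tensor u v) = tensor (\<phi> u) (\<phi> v)"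
proof -
  let ?f = "\<lambda>b. \<phi> (Poly_Mapping.single b 1)"
  have "tensor_map \<phi> = tensor_map (lin_ext ?f)" by (simp add: tensor_map_def)
  then show ?thesis
    using tensor_map_lin_ext_tensor[of ?f u v] linear_on_basis[OF assms(1)] assms(2,3) by simp
qed

lemma comult_sigma_conv: "comult_sigma j = conv tau_A sigma_A j"
  by (simp only: comult_sigma_def diag_def conv_def tensor_sigma)

lemma hom_ext:
  assumes X: "sub_like X s" and \<phi>: "\<phi> \<in> hopf_homs X AM" "\<psi> \<in> hopf_homs X AM"
    and eq: "\<phi> tau_A = \<psi> tau_A" "\<phi> theta_A = \<psi> theta_A"
      "\<And>l. 1 \<le> l \<Longrightarrow> l < s \<Longrightarrow> \<phi> (sigma_A (p ^ l)) = \<psi> (sigma_A (p ^ l))"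
  shows "\<phi> = \<psi>"
proof
  fix z
  note X' = X[unfolded sub_like_def] sub_like_carrier[OF X]
  show "\<phi> z = \<psi> z"
  proof (cases "z \<in> carrier_of X")
    case True
    show ?thesis
    proof (rule multiplicative_eqI'[where m = "mul AM" and s = s and F = \<phi> and G = \<psi> and x = z])
      show "z \<in> carrier_of (AMs s)" using True X' by simp
      show "\<phi> (mono 0 0 0) = \<psi> (mono 0 0 0)" using hopf_homsD(5)[OF \<phi>(1)] hopf_homsD(5)[OF \<phi>(2)] X' by simp
    qed (use hopf_homsD(2,6)[OF \<phi>(1)] hopf_homsD(2,6)[OF \<phi>(2)] X' eq in auto)
  next
    case False
    then show ?thesis using hopf_homsD(1)[OF \<phi>(1)] hopf_homsD(1)[OF \<phi>(2)] by (auto simp: PiE_iff extensional_def)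
  qed
qed

lemma gens_map_image:
  assumes s: "1 \<le> s" and "t \<in> carrier_of (AMs s)" "x \<in> carrier_of (AMs s)" "\<And>j. y j \<in> carrier_of (AMs s)"
    and z: "z \<in> carrier_of AM"
  shows "gens_map AM t x y z \<in> carrier_of (AMs s)"
  unfolding gens_map_def
  by (intro carrier_lin_ext[OF z]) (auto intro!: AMs_mul_closed[OF s] AMs_pow_closed[OF s] assms)

lemma top_image_AMs: "top_image l c b \<in> carrier_of (AMs (Suc l))"
proof -
  have "1 < p ^ Suc l" using p_power_ge[of "Suc l"] p_gt by linarith
  moreover have "p ^ l < p ^ Suc l" using p_gt by (intro power_strict_increasing) auto
  ultimately show ?thesis unfolding top_image_def
    by (intro carrier_closed(2) carrier_scal AMs_gens_closed)
qed

lemma sigma_image_AMs: "sigma_image l c b j \<in> carrier_of (AMs (Suc l))"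
proof -
  have "j mod p ^ l < p ^ l" "p ^ l < p ^ Suc l" using p_gt by (simp_all del: power_Suc add: power_strict_increasing)
  then have "j mod p ^ l < p ^ Suc l" by linarith
  then show ?thesis unfolding sigma_image_def divided_power_def
    by (intro carrier_scal AMs_mul_closed AMs_gens_closed AMs_pow_closed top_image_AMs) simp_all
qed

lemma cut_image_AMs: "1 \<le> s \<Longrightarrow> cut_image s c b j \<in> carrier_of (AMs s)"
  using sigma_image_AMs[of "s - 1" c b j] by (simp add: cut_image_def carrier_closed(1) del: AMs_simps)

lemma add_poly_AMs: "1 \<le> s \<Longrightarrow> add_poly a \<in> carrier_of (AMs s)"
  unfolding add_poly_eq by (intro carrier_sum carrier_scal AMs_pow_closed AMs_gens_closed)

text \<open>In terms of c = a_0^Q, the scalar by which sigma_1 is multiplied, the exponents of the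
  theorem become the weights i, p^(s-1), p^s and p.\<close>

lemma c_powers:
  fixes a :: 'a
  shows "a ^ (i * p ^ (r - 1)) = (a ^ Q) ^ i" "1 \<le> s \<Longrightarrow> a ^ p ^ (r + s - 2) = (a ^ Q) ^ p ^ (s - 1)"
    "a ^ p ^ (r + s - 1) = (a ^ Q) ^ p ^ s" "a ^ p ^ r = (a ^ Q) ^ p"
proof -
  have e: "(a ^ Q) ^ n = a ^ (Q * n)" for n by (rule power_mult[symmetric])
  show "a ^ (i * p ^ (r - 1)) = (a ^ Q) ^ i" unfolding e by (simp only: Q_def mult.commute)
  have "r + s - 1 = (r - 1) + s" using r1 by simp
  then have "p ^ (r + s - 1) = Q * p ^ s" by (simp only: Q_def power_add)
  then show "a ^ p ^ (r + s - 1) = (a ^ Q) ^ p ^ s" unfolding e by (rule arg_cong)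
  have "p ^ r = Q * p" using p_Q by (simp only: mult.commute)
  then show "a ^ p ^ r = (a ^ Q) ^ p" unfolding e by (rule arg_cong)
  assume "1 \<le> s"
  then have "r + s - 2 = (r - 1) + (s - 1)" using r1 by simp
  then have "p ^ (r + s - 2) = Q * p ^ (s - 1)" by (simp only: Q_def power_add)
  then show "a ^ p ^ (r + s - 2) = (a ^ Q) ^ p ^ (s - 1)" unfolding e by (rule arg_cong)
qed

lemma add_poly_restrict: "add_poly (restrict a {..<r}) = add_poly a"
  unfolding add_poly_eq by (intro sum.cong) auto

end

section \<open>An arbitrary homomorphism out of A[M_(r;s)] or A[M_(r;s,eta)]\<close>

locale hopf_M_hom = hopf_M \<iota> p r
  for \<iota> :: "'k::field \<Rightarrow> 'a::{comm_ring,comm_monoid_mult}" and p r :: nat +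
  fixes X :: "(idx, 'a) hopf_superalgebra" and s :: nat and \<phi> :: "(idx \<Rightarrow>\<^sub>0 'a) \<Rightarrow> (idx \<Rightarrow>\<^sub>0 'a)"
  assumes X: "M_like X s" and hom: "\<phi> \<in> hopf_homs X AM"
begin

lemma X': "sub_like X s" "1 \<le> s" "carrier_of X = carrier_of (AMs s)" "mul X = mul AM" "unit_el X = mono 0 0 0"
    "comult X tau_A = prim tau_A" "j < p ^ s \<Longrightarrow> comult X (sigma_A j) = comult_sigma j"
    "counit X = counit AM" "homogeneous X = homogeneous AM"
proof -
  show 1: "sub_like X s" using X unfolding M_like_def by blast
  show "1 \<le> s" "mul X = mul AM" "unit_el X = mono 0 0 0" "counit X = counit AM"
    using 1 unfolding sub_like_def by blast+
  show "carrier_of X = carrier_of (AMs s)" "homogeneous X = homogeneous AM"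
    by (rule sub_like_carrier[OF 1], rule sub_like_homogeneous[OF 1])
  show "comult X tau_A = prim tau_A" "j < p ^ s \<Longrightarrow> comult X (sigma_A j) = comult_sigma j"
    using X unfolding M_like_def by blast+
qed

lemmas homD = hopf_homsD[OF hom, unfolded X'(3,4,5,8,9)]

lemma phi_unit: "\<phi> (mono 0 0 0) = mono 0 0 0" using homD(5) by simp

lemma phi_scal: "z \<in> carrier_of (AMs s) \<Longrightarrow> \<phi> (scal c z) = scal c (\<phi> z)"
  using homD(2) by (simp add: linear_on_def)

lemma phi_zero: "\<phi> 0 = 0"
  using phi_scal[of 0 0] by (simp add: carrier_closed(1) del: AMs_simps)

lemma phi_pow: "z \<in> carrier_of (AMs s) \<Longrightarrow> \<phi> (pow AM z n) = pow AM (\<phi> z) n"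
proof (induction n)
  case (Suc n)
  then show ?case
    by (simp only: R.pow_Suc homD(6)[OF Suc.prems AMs_pow_closed[OF X'(2) Suc.prems]])
qed (simp add: R.pow_0 phi_unit)

lemma tensor_map_phi: "u \<in> carrier_of (AMs s) \<Longrightarrow> v \<in> carrier_of (AMs s) \<Longrightarrow> tensor_map \<phi> (tensor u v) = tensor (\<phi> u) (\<phi> v)"
  using tensor_map_linear_on[of X \<phi> u v] homD(2) X'(3) by simp

lemma tensor_map_phi_prim: "z \<in> carrier_of (AMs s) \<Longrightarrow> tensor_map \<phi> (prim z) = prim (\<phi> z)"
  by (simp add: prim_def tensor_map_linear tensor_map_phi AMs_gens_closed phi_unit del: tensor_single)

definition \<mu> :: 'a where "\<mu> = Poly_Mapping.lookup (\<phi> tau_A) (1, 0, 0)"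

lemma phi_tau: "\<phi> tau_A = scal \<mu> tau_A"
  unfolding \<mu>_def
proof (rule odd_primitive)
  note t = AMs_gens_closed(2)[of s]
  show "\<phi> tau_A \<in> carrier_of AM" using homD(3) t by simp
  show "homogeneous AM 1 (\<phi> tau_A)" using homD(4)[OF t] by simp
  show "comult AM (\<phi> tau_A) = prim (\<phi> tau_A)"
    using homD(7)[OF t] tensor_map_phi_prim[OF t] X' by simp
qed

lemma phi_sigma: "j < p ^ s \<Longrightarrow> \<phi> (sigma_A j) \<in> carrier_of AM" "j < p ^ s \<Longrightarrow> homogeneous AM 0 (\<phi> (sigma_A j))"
    "j < p ^ s \<Longrightarrow> Poly_Mapping.lookup (\<phi> (sigma_A j)) (0, 0, 0) = (if j = 0 then 1 else 0)"
  using homD(3,4,8)[OF AMs_gens_closed(3)[of j s]] counit_gens(3)[of j] by (simp_all add: counit_AM)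

lemma tensor_map_phi_conv:
  assumes y: "\<And>u. u \<le> j \<Longrightarrow> y u \<in> carrier_of (AMs s)"
  shows "tensor_map \<phi> (conv tau_A y j) = conv (scal \<mu> tau_A) (\<lambda>u. \<phi> (y u)) j"
proof -
  have c: "mul AM tau_A (y u) \<in> carrier_of (AMs s)" "\<phi> (mul AM tau_A (y u)) = mul AM (scal \<mu> tau_A) (\<phi> (y u))"
    if "u \<le> j" for u
    using AMs_mul_closed[OF X'(2) AMs_gens_closed(2) y[OF that]] homD(6)[OF AMs_gens_closed(2) y[OF that]] phi_tau
    by simp_all
  show ?thesis
    unfolding conv_def by (auto simp: tensor_map_linear tensor_map_phi c y intro!: arg_cong2[where f = "(+)"] sum.cong)
qed

lemma phi_conv:
  assumes "j < p ^ s"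
  shows "comult AM (\<phi> (sigma_A j)) = conv (scal \<mu> tau_A) (\<lambda>u. \<phi> (sigma_A u)) j"
proof -
  have c: "sigma_A u \<in> carrier_of (AMs s)" if "u \<le> j" for u
    using that assms by (intro AMs_gens_closed) simp
  show ?thesis
    using homD(7)[OF c[OF order.refl]] X'(7)[OF assms] tensor_map_phi_conv[OF c] by (simp add: comult_sigma_conv)
qed

lemma phi_from_top:
  assumes l: "Suc l \<le> s" and low: "\<And>u. u < p ^ l \<Longrightarrow> \<phi> (sigma_A u) = scal (c ^ u) (sigma_A u)"
    and top: "\<phi> (sigma_A (p ^ l)) = top_image l c b" and u: "u < p ^ Suc l"
  shows "\<phi> (sigma_A u) = sigma_image l c b u"
proof -
  define u0 u1 where "u0 = u mod p ^ l" and "u1 = u div p ^ l"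
  have eq: "u = p ^ l * u1 + u0" by (simp add: u0_def u1_def)
  have lt: "u0 < p ^ l" "u1 < p" using p_gt div_less_p[OF u] by (simp_all add: u0_def u1_def)
  have "p ^ Suc l \<le> p ^ s" using l p_gt by (intro power_increasing) auto
  then have us: "u < p ^ s" using u by linarith
  have pl: "p ^ l < p ^ s" using l p_gt by (intro power_strict_increasing) auto
  have "u0 < p ^ s" using lt pl by linarith
  note cl = AMs_gens_closed(3)[OF pl] AMs_gens_closed(3)[OF us] AMs_gens_closed(3)[OF \<open>u0 < p ^ s\<close>]
  have "scal (nu (fact u1)) (\<phi> (sigma_A u)) = \<phi> (mul AM (pow AM (sigma_A (p ^ l)) u1) (sigma_A u0))"
    using phi_scal[OF cl(2)] sigma_digits[OF lt(1), of u1] by (simp add: eq)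
  also have "\<dots> = mul AM (pow AM (top_image l c b) u1) (scal (c ^ u0) (sigma_A u0))"
    using homD(6)[OF AMs_pow_closed[OF X'(2) cl(1)] cl(3)] phi_pow[OF cl(1)] top low[OF lt(1)] by simp
  also have "\<dots> = scal (nu (fact u1)) (sigma_image l c b u)"
    unfolding eq top_image_digits[OF lt] fact_divided_power[OF lt(2), symmetric]
    by (simp add: mul_linear AM_commute[of "sigma_A u0"] mult_ac)
  finally show ?thesis by (rule nu_fact_cancel[OF lt(2)])
qed

text \<open>The element z is any solution of the coproduct equation of phi(sigma_(p^l)), so that l =
  s can be included. The induction takes z = phi(sigma_(p^l)) with l < s; for M_(r;s,eta) a multiple
  of phi(theta) serves as z at l = s.\<close>

lemma phi_extension:
  assumes red: "is_reduced TYPE('a)" and l: "1 \<le> l" "l \<le> s"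
    and b: "l = 1 \<Longrightarrow> b = 0" and low: "\<And>u. u < p ^ l \<Longrightarrow> \<phi> (sigma_A u) = sigma_image (l - 1) c b u"
    and mu: "2 \<le> l \<Longrightarrow> \<mu> ^ 2 = c ^ p"
    and z: "z \<in> carrier_of AM" "homogeneous AM 0 z" "Poly_Mapping.lookup z (0, 0, 0) = 0"
    and comult: "comult AM z = conv (scal \<mu> tau_A) (\<lambda>u. if u < p ^ l then \<phi> (sigma_A u) else if u = p ^ l then z else 0) (p ^ l)"
  shows "\<And>u. u < p ^ l \<Longrightarrow> \<phi> (sigma_A u) = scal (c ^ u) (sigma_A u)" "\<mu> ^ 2 = c ^ p"
    "\<exists>a. z = scal (c ^ p ^ l) (sigma_A (p ^ l)) + add_poly a"
proof -
  have b0: "b = 0"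
  proof (cases "l = 1")
    case False
    then have l': "1 \<le> l - 1" "Suc (l - 1) = l" using l by simp_all
    have "conv (scal \<mu> tau_A) (\<lambda>u. if u < p ^ l then \<phi> (sigma_A u) else if u = p ^ l then z else 0) (p ^ l) =
        conv (scal \<mu> tau_A) (\<lambda>u. if u < p ^ l then sigma_image (l - 1) c b u else if u = p ^ l then z else 0) (p ^ l)"
      using low by (intro conv_cong) simp
    then have "b ^ p = 0"
      using conv_extension_nilpotent[OF l'(1) z, of \<mu> c b] comult unfolding l'(2) by simp
    then show ?thesis using red unfolding is_reduced_def by blast
  qed (rule b)
  show c: "\<phi> (sigma_A u) = scal (c ^ u) (sigma_A u)" if "u < p ^ l" for u
    using low[OF that] sigma_image_zero[of u "l - 1" c] that l b0 by simp
  have "conv (scal \<mu> tau_A) (\<lambda>u. if u < p ^ l then \<phi> (sigma_A u) else if u = p ^ l then z else 0) (p ^ l) =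
      conv (scal \<mu> tau_A) (\<lambda>u. if u < p ^ l then scal (c ^ u) (sigma_A u) else if u = p ^ l then z else 0) (p ^ l)"
    using c by (intro conv_cong) simp
  then have *: "comult AM z = conv (scal \<mu> tau_A) (\<lambda>u. if u < p ^ l then scal (c ^ u) (sigma_A u) else if u = p ^ l then z else 0) (p ^ l)"
    using comult by simp
  have "l = 1 \<or> \<mu> ^ 2 = c ^ p" using mu l by linarith
  then show "\<mu> ^ 2 = c ^ p" "\<exists>a. z = scal (c ^ p ^ l) (sigma_A (p ^ l)) + add_poly a"
    using conv_extension[OF l(1) z *] by blast+
qed

text \<open>The parameter b changes with l: passing from l to l + 1 forces the old one to vanish and
  introduces a new one for sigma_(p^l). The cases l = 1 and 2 <= l record that sigma_1 leaves no
  freedom and that \<mu> first enters with sigma_p.\<close>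

lemma phi_sigma_all:
  assumes red: "is_reduced TYPE('a)" and c: "\<phi> (sigma_A 1) = scal c (sigma_A 1)" and l: "1 \<le> l" "l \<le> s"
  shows "\<exists>b. (l = 1 \<longrightarrow> b = 0) \<and> (\<forall>u<p ^ l. \<phi> (sigma_A u) = sigma_image (l - 1) c b u) \<and> (2 \<le> l \<longrightarrow> \<mu> ^ 2 = c ^ p) \<and>
    \<phi> (sigma_A (p ^ (l - 1))) = top_image (l - 1) c b \<and> (\<forall>u<p ^ (l - 1). \<phi> (sigma_A u) = scal (c ^ u) (sigma_A u))"
  using l
proof (induction l rule: nat_induct_at_least)
  case base
  have low: "\<phi> (sigma_A u) = scal (c ^ u) (sigma_A u)" if "u < p ^ 0" for u
    using that phi_unit by (simp add: sigma_A_def)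
  have top: "\<phi> (sigma_A (p ^ 0)) = top_image 0 c 0" using c by (simp add: top_image_def)
  show ?case
    using phi_from_top[OF _ low top] low top base by (intro exI[of _ 0]) simp
next
  case (Suc l)
  then obtain b where b: "l = 1 \<longrightarrow> b = 0" "\<forall>u<p ^ l. \<phi> (sigma_A u) = sigma_image (l - 1) c b u"
    "2 \<le> l \<longrightarrow> \<mu> ^ 2 = c ^ p" by auto
  have pl: "p ^ l < p ^ s" using Suc.prems p_gt by (intro power_strict_increasing) auto
  let ?z = "\<phi> (sigma_A (p ^ l))"
  have "conv (scal \<mu> tau_A) (\<lambda>u. \<phi> (sigma_A u)) (p ^ l) =
      conv (scal \<mu> tau_A) (\<lambda>u. if u < p ^ l then \<phi> (sigma_A u) else if u = p ^ l then ?z else 0) (p ^ l)"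
    by (intro conv_cong) auto
  then have cm: "comult AM ?z = conv (scal \<mu> tau_A) (\<lambda>u. if u < p ^ l then \<phi> (sigma_A u) else if u = p ^ l then ?z else 0) (p ^ l)"
    using phi_conv[OF pl] by simp
  have lk: "Poly_Mapping.lookup ?z (0, 0, 0) = 0" using phi_sigma(3)[OF pl] p_gt by simp
  have ls: "l \<le> s" using Suc.prems by simp
  note ab = phi_extension[OF red Suc.hyps(1) ls b(1)[rule_format] b(2)[rule_format] b(3)[rule_format]
      phi_sigma(1)[OF pl] phi_sigma(2)[OF pl] lk cm]
  have "pow AM ?z p = 0"
    using phi_pow[OF AMs_gens_closed(3)[OF pl], of p] sigma_pow_p[of l] phi_zero by simp
  then obtain b' where b': "?z = top_image l c b'" using top_image_of_nilpotent[OF red] ab(3) by blast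
  have "\<phi> (sigma_A u) = sigma_image l c b' u" if "u < p ^ Suc l" for u
    by (rule phi_from_top[OF Suc.prems ab(1) b' that])
  then show ?case
    using ab(1,2) b' Suc.hyps unfolding diff_Suc_1 by (intro exI[of _ b'] conjI) auto
qed

end

section \<open>The coproduct of \<open>A[M\<^sub>r\<^sub>;\<^sub>s\<^sub>,\<^sub>\<eta>]\<close>\<close>

lemma algebra_map_id: "algebra_map (\<lambda>x :: 'k::field. x)"
  by (simp add: algebra_map_def)

lemma scalar_ext_id: "scalar_ext (\<lambda>x :: 'k::field. x) z = z"
  by (rule poly_mapping_eqI) (simp add: Submission.lookup_scalar_ext)

lemma base_change_id: "base_change (\<lambda>x :: 'k::field. x) H = H"
  by (rule hopf_superalgebra.equality) (simp_all add: base_change_def scalar_ext_id)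

context hopf_M begin

abbreviation Mk :: "(idx, 'k) hopf_superalgebra" where "Mk \<equiv> M p r"
abbreviation Mks :: "nat \<Rightarrow> (idx, 'k) hopf_superalgebra" where "Mks s \<equiv> M_sub p r s"

text \<open>The only basis index whose coproduct can contain b tensor c, hence the index of the
  product of the two dual vectors. The shift by p for two odd indices reflects v^2 = -u_(r-1)^p, the
  sign being kept outside \<open>comult_coeff\<close>.\<close>

definition comult_index :: "idx \<Rightarrow> idx \<Rightarrow> idx" where
  "comult_index = (\<lambda>(e1, i1, j1) (e2, i2, j2). ((e1 + e2) mod 2, i1 + i2, j1 + j2 + (if e1 = 1 \<and> e2 = 1 then p else 0)))"

definition comult_coeff :: "idx \<Rightarrow> idx \<Rightarrow> nat" where
  "comult_coeff = (\<lambda>(e1, i1, j1) (e2, i2, j2). if e1 < 2 \<and> e2 < 2 then (i1 + i2) choose i1 else 0)"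

lemma Mk_simps: "basis Mk = {..<2} \<times> {..<Q} \<times> UNIV" "parity Mk = fst"
  "basis (Mks s) = {..<2} \<times> {..<Q} \<times> {..<p ^ s}" "parity (Mks s) = fst"
  "counit_tab Mk b = (if b = (0, 0, 0) then 1 else 0)"
  by (auto simp: M_def M_sub_def M_superalgebra_def superalgebra.defs Let_def Q_def)

lemma lookup_comult_comult_index:
  assumes "x \<in> carrier_of AM"
  shows "Poly_Mapping.lookup (comult AM x) (b, c) = nu (comult_coeff b c) * Poly_Mapping.lookup x (comult_index b c)"
proof -
  obtain e1 i1 j1 e2 i2 j2 where *: "b = (e1, i1, j1)" "c = (e2, i2, j2)" by (metis prod_cases3)
  consider "e1 \<ge> 2 \<or> e2 \<ge> 2" | "e1 = 0" "e2 = 0" | "e1 = 0" "e2 = 1" | "e1 = 1" "e2 = 0" | "e1 = 1" "e2 = 1" by linarith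
  then show ?thesis
    by cases (auto simp: * comult_index_def comult_coeff_def lookup_comult[OF assms])
qed

lemma comult_tab_k:
  assumes "x \<in> basis Mk"
  shows "Poly_Mapping.lookup (comult_tab Mk x) (b, c) = (of_nat (comult_coeff b c) * (if x = comult_index b c then 1 else 0) :: 'k)"
proof -
  \<comment> \<open>The group algebra is formed over k, so the coefficient formula is taken for A =
    k with the identity as structure map.\<close>
  interpret K: hopf_M "\<lambda>x :: 'k. x" p r
    using r1 p3 char_p algebra_map_id by unfold_locales
  have "Poly_Mapping.single x 1 \<in> carrier_of K.AM"
    using assms by (intro carrier_closed) (simp add: Mk_simps)
  from K.lookup_comult_comult_index[OF this, of b c] show ?thesis
    unfolding comult_def base_change_id K.nu_def lin_ext_single lookup_scal lookup_single when_def mult_1 .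
qed

lemma dual_mul_vec:
  assumes "x \<in> basis Mk"
  shows "dual_mul Mk (dual_vec b) (dual_vec c) x =
    (if x = comult_index b c then (- 1) ^ (fst b * fst c) * of_nat (comult_coeff b c) else 0)"
proof -
  have "dual_mul Mk (dual_vec b) (dual_vec c) x =
      (\<Sum>bc\<in>Poly_Mapping.keys (comult_tab Mk x). if bc = (b, c) then (- 1) ^ (fst b * fst c) * Poly_Mapping.lookup (comult_tab Mk x) (b, c) else 0)"
    using assms unfolding dual_mul_def by (simp only: if_True, intro sum.cong refl) (auto simp: Mk_simps dual_vec_def split: if_splits)
  also have "\<dots> = (- 1) ^ (fst b * fst c) * Poly_Mapping.lookup (comult_tab Mk x) (b, c)"
    by (simp add: in_keys_iff)
  finally show ?thesis by (simp add: comult_tab_k[OF assms])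
qed

lemma dual_mul_outside: "x \<notin> basis Mk \<Longrightarrow> dual_mul Mk f g x = 0"
  by (simp add: dual_mul_def)

lemma dual_pow_top: "dual_pow Mk (u_gen p r (r - 1)) n = (dual_vec (0, 0, n) :: idx \<Rightarrow> 'k)"
proof (induction n)
  case 0
  show ?case using Q_pos by (auto simp: dual_pow_def dual_unit_def dual_vec_def Mk_simps fun_eq_iff)
next
  case (Suc n)
  have u: "u_gen p r (r - 1) = (dual_vec (0, 0, 1) :: idx \<Rightarrow> 'k)"
    unfolding u_gen_def Q_def[symmetric] using Q_pos by simp
  have "dual_pow Mk (u_gen p r (r - 1)) (Suc n) = (dual_mul Mk (dual_vec (0, 0, 1)) (dual_vec (0, 0, n)) :: idx \<Rightarrow> 'k)"
    using Suc unfolding dual_pow_def u by simp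
  also have "\<dots> = dual_vec (0, 0, Suc n)"
  proof
    fix x :: idx
    show "dual_mul Mk (dual_vec (0, 0, 1)) (dual_vec (0, 0, n)) x = (dual_vec (0, 0, Suc n) x :: 'k)"
    proof (cases "x \<in> basis Mk")
      case True
      then show ?thesis unfolding dual_mul_vec[OF True] by (simp add: comult_index_def comult_coeff_def dual_vec_def)
    next
      case False
      then show ?thesis unfolding dual_mul_outside[OF False] using Q_pos by (auto simp: dual_vec_def Mk_simps)
    qed
  qed
  finally show ?case .
qed

end

section \<open>Division by the relator in the group algebra\<close>

locale eta_setting = hopf_M \<iota> p r
  for \<iota> :: "'k::field \<Rightarrow> 'a::{comm_ring,comm_monoid_mult}" and p r :: nat +
  fixes s :: nat and \<eta> :: 'k
  assumes r2: "2 \<le> r" and s1: "1 \<le> s"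
begin

lemma Q_gt: "1 < Q"
proof -
  have "p ^ 1 \<le> Q" unfolding Q_def using r2 p_gt by (intro power_increasing) auto
  then show ?thesis using p_gt by simp
qed

definition eta_relator :: "idx \<Rightarrow> 'k" where
  "eta_relator = (\<lambda>x. dual_pow Mk (u_gen p r (r - 1)) (p ^ s) x + \<eta> * u_gen p r 0 x)"

lemma eta_relator: "eta_relator x = (if x = (0, 0, p ^ s) then 1 else if x = (0, 1, 0) then \<eta> else 0)"
proof -
  have "u_gen p r 0 = (dual_vec (0, 1, 0) :: idx \<Rightarrow> 'k)"
    unfolding u_gen_def Q_def[symmetric] using Q_gt by simp
  then show ?thesis unfolding eta_relator_def dual_pow_top by (simp add: dual_vec_def)
qed

lemma eta_ideal: "eta_ideal p r s \<eta> = {dual_mul Mk y eta_relator | y. y \<in> graded_dual Mk}"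
  unfolding eta_ideal_def eta_relator_def ..

text \<open>u_(r-1)^(p^s) raises j by p^s, and u_0, being dual to theta, takes the vector dual to
  theta^(i-1) sigma_j to i times the one dual to theta^i sigma_j.\<close>

lemma dual_mul_g:
  assumes "e < 2" "i < Q"
  shows "dual_mul Mk y eta_relator (e, i, j) =
    (if p ^ s \<le> j then y (e, i, j - p ^ s) else 0) + \<eta> * of_nat i * (if 1 \<le> i then y (e, i - 1, j) else 0)"
proof -
  let ?x = "(e, i, j)" and ?w = "(0, 0, p ^ s) :: idx" and ?u = "(0, 1, 0) :: idx"
  let ?b1 = "(e, i, j - p ^ s)" and ?b2 = "(e, i - 1, j)"
  have x: "?x \<in> basis Mk" using assms by (simp add: Mk_simps)
  define t where "t = (\<lambda>(b, c). (- 1) ^ (fst b * fst c) * Poly_Mapping.lookup (comult_tab Mk ?x) (b, c) * y b * eta_relator c)"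
  let ?K = "Poly_Mapping.keys (comult_tab Mk ?x)"
  let ?G = "{(?b1, ?w), (?b2, ?u)}"
  have z: "t bc = 0" if "bc \<notin> ?G" for bc
  proof (rule ccontr)
    obtain b c where bc: "bc = (b, c)" by (cases bc)
    assume "t bc \<noteq> 0"
    then have nz: "Poly_Mapping.lookup (comult_tab Mk ?x) (b, c) \<noteq> 0" "eta_relator c \<noteq> 0" by (auto simp: t_def bc)
    then have eq: "?x = comult_index b c" "(of_nat (comult_coeff b c) :: 'k) \<noteq> 0"
      unfolding comult_tab_k[OF x] by (metis mult_zero_right, metis mult_zero_left)
    from eq(2) have bc': "comult_coeff b c \<noteq> 0" by (metis of_nat_0)
    obtain e1 i1 j1 where b: "b = (e1, i1, j1)" by (metis prod_cases3)
    have "c = ?w \<or> c = ?u" using nz(2) by (auto simp: eta_relator split: if_splits)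
    then show False using that eq(1) bc' by (auto simp: bc b comult_index_def comult_coeff_def split: if_splits)
  qed
  have "dual_mul Mk y eta_relator ?x = sum t ?K"
    using x unfolding dual_mul_def t_def by (simp add: Mk_simps split_def)
  also have "\<dots> = sum t (?K \<union> ?G)"
    by (intro sum.mono_neutral_left) (auto simp: t_def in_keys_iff)
  also have "\<dots> = sum t ?G"
    using z by (intro sum.mono_neutral_right) auto
  also have "\<dots> = t (?b1, ?w) + t (?b2, ?u)" by (subst sum.insert) auto
  also have "t (?b1, ?w) = (if p ^ s \<le> j then y ?b1 else 0)"
    using assms p_gt by (auto simp: t_def comult_tab_k[OF x] comult_index_def comult_coeff_def eta_relator)
  also have "t (?b2, ?u) = \<eta> * of_nat i * (if 1 \<le> i then y ?b2 else 0)"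
    unfolding t_def prod.case comult_tab_k[OF x]
    using assms p_gt by (cases i) (auto simp: comult_index_def comult_coeff_def eta_relator)
  finally show ?thesis .
qed

text \<open>The coefficient of \<open>w\<close> in \<open>\<tau>\<^sup>e (\<theta> - \<eta> \<sigma>\<^bsub>p^s\<^esub>)\<^sup>i \<sigma>\<^sub>j\<close>, where \<open>x = (e, i, j)\<close>.\<close>

definition ecoef :: "idx \<Rightarrow> idx \<Rightarrow> 'k" where
  "ecoef = (\<lambda>(e', i', j') (e, i, j). if e = e' \<and> i \<le> i' \<and> j = p ^ s * (i' - i) + j'
     then of_nat ((i' choose i) * fact (i' - i)) * (- \<eta>) ^ (i' - i) else 0)"

text \<open>The relator is monic of degree p^s in u_(r-1). If y is nonzero and J is maximal among
  the j in its support, y times the relator is nonzero at some index with j = J + p^s, where both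
  remainders vanish.\<close>

lemma reduce_unique:
  assumes "g1 \<in> graded_dual (Mks s)" "(\<lambda>x. f x - g1 x) \<in> eta_ideal p r s \<eta>"
    and "g2 \<in> graded_dual (Mks s)" "(\<lambda>x. f x - g2 x) \<in> eta_ideal p r s \<eta>"
  shows "g1 = g2"
proof -
  obtain y1 y2 where y: "y1 \<in> graded_dual Mk" "y2 \<in> graded_dual Mk"
    "(\<lambda>x. f x - g1 x) = dual_mul Mk y1 eta_relator" "(\<lambda>x. f x - g2 x) = dual_mul Mk y2 eta_relator"
    using assms(2,4) unfolding eta_ideal by blast
  define y where "y = (\<lambda>x. y1 x - y2 x)"
  have diff: "g2 (e, i, j) - g1 (e, i, j) = (if p ^ s \<le> j then y (e, i, j - p ^ s) else 0) +
      \<eta> * of_nat i * (if 1 \<le> i then y (e, i - 1, j) else 0)" if "e < 2" "i < Q" for e i j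
  proof -
    have "g2 (e, i, j) - g1 (e, i, j) = (f (e, i, j) - g1 (e, i, j)) - (f (e, i, j) - g2 (e, i, j))" by simp
    also have "\<dots> = dual_mul Mk y1 eta_relator (e, i, j) - dual_mul Mk y2 eta_relator (e, i, j)"
      using fun_cong[OF y(3), of "(e, i, j)"] fun_cong[OF y(4), of "(e, i, j)"] by (simp only:)
    finally show ?thesis unfolding dual_mul_g[OF that]
      by (cases "p ^ s \<le> j"; cases "1 \<le> i") (simp_all add: y_def algebra_simps)
  qed
  define S where "S = {x. y x \<noteq> 0}"
  have "S \<subseteq> {x. y1 x \<noteq> 0} \<union> {x. y2 x \<noteq> 0}" by (auto simp: S_def y_def)
  then have fin: "finite S" and sub: "S \<subseteq> basis Mk"
    using y(1,2) unfolding graded_dual_def by (auto intro: finite_subset)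
  have "S = {}"
  proof (rule ccontr)
    assume "S \<noteq> {}"
    then have "Max ((\<lambda>(e, i, j). j) ` S) \<in> (\<lambda>(e, i, j). j) ` S" using fin by (intro Max_in) auto
    then obtain e i J where S: "(e, i, J) \<in> S" and J: "J = Max ((\<lambda>(e, i, j). j) ` S)" by auto
    have ei: "e < 2" "i < Q" using S sub by (auto simp: Mk_simps)
    have "j \<le> J" if "(e', i', j) \<in> S" for e' i' j
      unfolding J using fin that by (intro Max_ge) force+
    then have "(e, i - 1, J + p ^ s) \<notin> S" using p_gt by (metis add_le_same_cancel1 leD zero_less_power)
    then have 0: "y (e, i - 1, J + p ^ s) = 0" by (simp add: S_def)
    have "g1 (e, i, J + p ^ s) = 0" "g2 (e, i, J + p ^ s) = 0"
      using assms(1,3) unfolding graded_dual_def by (auto simp: Mk_simps)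
    then have "y (e, i, J) = 0" using diff[OF ei, of "J + p ^ s"] 0 by (cases "1 \<le> i") simp_all
    then show False using S by (simp add: S_def)
  qed
  then have y0: "y x = 0" for x unfolding S_def by blast
  show ?thesis
  proof
    fix x :: idx
    obtain e i j where x: "x = (e, i, j)" by (metis prod_cases3)
    show "g1 x = g2 x"
    proof (cases "e < 2 \<and> i < Q")
      case True
      then have "g2 (e, i, j) - g1 (e, i, j) = 0"
        using diff[of e i j] unfolding y0 by simp
      then show ?thesis by (simp add: x)
    next
      case False
      then have "x \<notin> basis (Mks s)" by (auto simp: x Mk_simps)
      then have "g1 x = 0" "g2 x = 0" using assms(1,3) unfolding graded_dual_def by blast+
      then show ?thesis by simp
    qed
  qed
qed

lemma fact_choose_step:
  assumes "i < (I :: nat)"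
  shows "fact (I - i) * (I choose i) = I * (fact (I - 1 - i) * ((I - 1) choose i) :: nat)"
proof -
  have "fact i * (fact (I - i) * (I choose i)) = (fact I :: nat)"
    using binomial_fact_lemma[of i I] assms by (simp add: mult_ac)
  also have "\<dots> = I * fact (I - 1)" using assms fact_reduce[of I, where 'a=nat] by simp
  also have "fact (I - 1) = fact i * (fact (I - 1 - i) * ((I - 1) choose i))"
    using binomial_fact_lemma[of i "I - 1"] assms by (simp add: mult_ac)
  finally have "fact i * (fact (I - i) * (I choose i)) = fact i * (I * (fact (I - 1 - i) * ((I - 1) choose i)) :: nat)"
    by (simp only: mult.left_commute)
  then show ?thesis by simp
qed

text \<open>Replacing u_(r-1)^(p^s) by -\<eta> u_0 lowers j by p^s and raises i to i + 1 with the
  factor -\<eta> (i+1). From i up to I these factors multiply to (-\<eta>)^(I-i) (I-i)! C(I,i), the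
  coefficient in \<open>ecoef\<close>.\<close>

lemma eta_reduce_vec:
  assumes w: "w \<in> basis Mk"
  shows "eta_reduce p r s \<eta> (\<lambda>x. \<gamma> * dual_vec w x) = (\<lambda>x. if x \<in> basis (Mks s) then \<gamma> * ecoef x w else 0)"
    (is "_ = ?\<rho>")
  unfolding eta_reduce_def
proof (rule the_equality)
  obtain e i j where w': "w = (e, i, j)" by (metis prod_cases3)
  have ei: "e < 2" "i < Q" using w by (auto simp: w' Mk_simps)
  define k where "k I = \<gamma> * (of_nat ((I choose i) * fact (I - i)) * (- \<eta>) ^ (I - i))" for I
  have k_step: "k I = - \<eta> * of_nat I * k (I - 1)" if "i < I" for I
  proof -
    have "I - i = Suc (I - 1 - i)" using that by simp
    then have "(- \<eta>) ^ (I - i) = - \<eta> * (- \<eta>) ^ (I - 1 - i)" by (metis power_Suc)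
    moreover have "(I choose i) * fact (I - i) = I * (((I - 1) choose i) * fact (I - 1 - i))"
      using fact_choose_step[OF that] by (simp only: mult.commute)
    then have "(of_nat ((I choose i) * fact (I - i)) :: 'k) = of_nat I * of_nat (((I - 1) choose i) * fact (I - 1 - i))"
      by (metis of_nat_mult)
    ultimately show ?thesis unfolding k_def by (simp only: mult_ac)
  qed
  \<comment> \<open>The quotient of the division: the remainder \<open>k I\<close> at (e, I, j - p^s
    (I-i)) is removed by \<open>k I\<close> times the dual vector whose last index is smaller by
    p^s. The chain ends at I = Q - 1, beyond which there is no basis index.\<close>
  define y where "y = (\<lambda>(E, I, J). if E = e \<and> I < Q \<and> i \<le> I \<and> J + p ^ s * (I - i + 1) = j then k I else 0)"
  have gd: "?\<rho> \<in> graded_dual (Mks s)"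
  proof -
    have "{x. ?\<rho> x \<noteq> 0} \<subseteq> basis (Mks s)" by auto
    moreover have "finite (basis (Mks s))" by (simp add: Mk_simps)
    ultimately show ?thesis unfolding graded_dual_def using finite_subset by blast
  qed
  have "y \<in> graded_dual Mk"
  proof -
    have "{x. y x \<noteq> 0} \<subseteq> {e} \<times> {..<Q} \<times> {..j}" by (auto simp: y_def split: if_splits)
    moreover have "{e} \<times> {..<Q} \<times> {..j} \<subseteq> basis Mk" using ei by (auto simp: Mk_simps)
    ultimately show ?thesis unfolding graded_dual_def using finite_subset by fastforce
  qed
  moreover have "(\<lambda>x. \<gamma> * dual_vec w x - ?\<rho> x) = dual_mul Mk y eta_relator"
  proof
    fix x :: idx
    obtain E I J where x: "x = (E, I, J)" by (metis prod_cases3)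
    show "\<gamma> * dual_vec w x - ?\<rho> x = dual_mul Mk y eta_relator x"
    proof (cases "x \<in> basis Mk")
      case False
      moreover from this have "x \<noteq> w" "x \<notin> basis (Mks s)" using w by (auto simp: Mk_simps)
      ultimately show ?thesis by (simp add: dual_mul_outside dual_vec_def)
    next
      case True
      then have EI: "E < 2" "I < Q" by (auto simp: x Mk_simps)
      have e1: "ecoef x w * \<gamma> = (if E = e \<and> i \<le> I \<and> j = p ^ s * (I - i) + J then k I else 0)"
        by (auto simp: ecoef_def x w' k_def)
      have \<rho>: "?\<rho> x = (if J < p ^ s \<and> E = e \<and> i \<le> I \<and> j = p ^ s * (I - i) + J then k I else 0)"
        using EI e1 by (auto simp: x Mk_simps mult.commute)
      have y1: "(if p ^ s \<le> J then y (E, I, J - p ^ s) else 0) =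
          (if p ^ s \<le> J \<and> E = e \<and> i \<le> I \<and> j = p ^ s * (I - i) + J then k I else 0)"
      proof -
        have "J - p ^ s + p ^ s * (I - i + 1) = p ^ s * (I - i) + J" if "p ^ s \<le> J"
          using that unfolding distrib_left by simp
        then show ?thesis using EI by (auto simp: y_def)
      qed
      have y2: "(if 1 \<le> I then y (E, I - 1, J) else 0) =
          (if E = e \<and> i < I \<and> j = p ^ s * (I - i) + J then k (I - 1) else 0)"
      proof -
        have "p ^ s * (I - 1 - i + 1) = p ^ s * (I - i)" if "i < I"
        proof -
          have "I - 1 - i + 1 = I - i" using that by simp
          then show ?thesis by (rule arg_cong)
        qed
        then show ?thesis using EI unfolding y_def prod.case
          by (cases "i < I"; cases "1 \<le> I") (auto simp only: add.commute, auto)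
      qed
      have d: "\<gamma> * dual_vec w x = (if E = e \<and> I = i \<and> j = J then k I else 0)"
        by (auto simp: dual_vec_def x w' k_def)
      show ?thesis
      proof (cases "E = e \<and> i \<le> I \<and> j = p ^ s * (I - i) + J")
        case False
        then show ?thesis unfolding x dual_mul_g[OF EI] y1 y2 unfolding x[symmetric] \<rho> d by auto
      next
        case True
        show ?thesis
        proof (cases "I = i")
          case eq: True
          then show ?thesis using True unfolding x dual_mul_g[OF EI] y1 y2 unfolding x[symmetric] \<rho> d by auto
        next
          case False
          then have "i < I" using True by simp
          then show ?thesis using True k_step[of I]
            unfolding x dual_mul_g[OF EI] y1 y2 unfolding x[symmetric] \<rho> d by auto
        qed
      qed
    qed
  qed
  ultimately have id: "(\<lambda>x. \<gamma> * dual_vec w x - ?\<rho> x) \<in> eta_ideal p r s \<eta>"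
    unfolding eta_ideal by blast
  show "?\<rho> \<in> graded_dual (Mks s) \<and> (\<lambda>x. \<gamma> * dual_vec w x - ?\<rho> x) \<in> eta_ideal p r s \<eta>"
    using gd id by blast
  fix g assume "g \<in> graded_dual (Mks s) \<and> (\<lambda>x. \<gamma> * dual_vec w x - g x) \<in> eta_ideal p r s \<eta>"
  then show "g = ?\<rho>" by (elim conjE, intro reduce_unique[OF _ _ gd id])
qed

abbreviation ME :: "(idx, 'k) hopf_superalgebra" where "ME \<equiv> M_eta p r s \<eta>"

lemma lookup_comult_tab_ME:
  assumes x: "x \<in> basis (Mks s)"
  shows "Poly_Mapping.lookup (comult_tab ME x) (b, c) =
    (if b \<in> basis (Mks s) \<and> c \<in> basis (Mks s) \<and> comult_index b c \<in> basis Mk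
     then of_nat (comult_coeff b c) * ecoef x (comult_index b c) else 0)"
proof -
  let ?B = "basis (Mks s)"
  let ?f = "\<lambda>b c. (- 1) ^ (fst b * fst c) * eta_reduce p r s \<eta> (dual_mul Mk (dual_vec b) (dual_vec c)) x"
  have fin: "finite ?B" by (simp add: Mk_simps)
  have "comult_tab ME x = (\<Sum>b\<in>?B. \<Sum>c\<in>?B. Poly_Mapping.single (b, c) (?f b c))"
    by (simp add: M_eta_def Let_def Mk_simps(4))
  then have "Poly_Mapping.lookup (comult_tab ME x) (b, c) = (\<Sum>b'\<in>?B. \<Sum>c'\<in>?B. if b' = b \<and> c' = c then ?f b' c' else 0)"
    by (simp add: lookup_sum lookup_single when_def)
  also have "\<dots> = (\<Sum>b'\<in>?B. if b' = b then (\<Sum>c'\<in>?B. if c' = c then ?f b c' else 0) else 0)"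
    by (intro sum.cong refl) (auto intro!: sum.cong sum.neutral)
  also have "\<dots> = (if b \<in> ?B \<and> c \<in> ?B then ?f b c else 0)"
    using fin by (simp add: sum.delta')
  also have "\<dots> = (if b \<in> ?B \<and> c \<in> ?B \<and> comult_index b c \<in> basis Mk then of_nat (comult_coeff b c) * ecoef x (comult_index b c) else 0)"
  proof (cases "b \<in> ?B \<and> c \<in> ?B")
    case True
    \<comment> \<open>If the index lies outside the basis, the dual product is 0; this is encoded by
      a zero scalar and the placeholder (0, 0, 0), so that \<open>eta_reduce_vec\<close> applies in
      both cases.\<close>
    let ?w = "if comult_index b c \<in> basis Mk then comult_index b c else (0, 0, 0)"
    let ?\<gamma> = "if comult_index b c \<in> basis Mk then (- 1) ^ (fst b * fst c) * of_nat (comult_coeff b c) else 0 :: 'k"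
    have w: "?w \<in> basis Mk" using Q_pos by (simp add: Mk_simps)
    have "dual_mul Mk (dual_vec b) (dual_vec c) = (\<lambda>x. ?\<gamma> * dual_vec ?w x)"
    proof
      fix x :: idx
      show "dual_mul Mk (dual_vec b) (dual_vec c) x = ?\<gamma> * dual_vec ?w x"
      proof (cases "x \<in> basis Mk")
        case True
        then show ?thesis unfolding dual_mul_vec[OF True] by (auto simp: dual_vec_def)
      next
        case False
        then show ?thesis unfolding dual_mul_outside[OF False] by (auto simp: dual_vec_def)
      qed
    qed
    then have red: "eta_reduce p r s \<eta> (dual_mul Mk (dual_vec b) (dual_vec c)) x = ?\<gamma> * ecoef x ?w"
      using x by (simp only: eta_reduce_vec[OF w]) simp
    \<comment> \<open>The sign in the coproduct of \<open>M_eta\<close> cancels the one from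
      \<open>dual_mul\<close>.\<close>
    have sq: "(- 1) ^ n * ((- 1) ^ n * z) = z" for n and z :: 'k
      by (simp flip: mult.assoc power_add)
    show ?thesis using True by (simp only: red) (auto simp: sq mult.assoc)
  qed auto
  finally show ?thesis .
qed

section \<open>The embedding \<open>E\<close> of A[M_(r;s,eta)] into A[M_r]\<close>

abbreviation ME_A :: "(idx, 'a) hopf_superalgebra" where "ME_A \<equiv> base_change \<iota> ME"
abbreviation E :: "(idx \<Rightarrow>\<^sub>0 'a) \<Rightarrow> (idx \<Rightarrow>\<^sub>0 'a)" where "E \<equiv> eta_map s (\<iota> \<eta>)"
abbreviation trunc :: "(idx \<Rightarrow>\<^sub>0 'a) \<Rightarrow> (idx \<Rightarrow>\<^sub>0 'a)" where "trunc \<equiv> eta_map s 0"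

lemma eta_conditions: "\<iota> \<eta> = 0 \<or> 2 \<le> r" "(0 :: 'a) = 0 \<or> 2 \<le> r" using r2 by simp_all

lemmas E_gens = eta_map_gens[OF s1 eta_conditions(1)]
lemmas trunc_gens = eta_map_gens[OF s1 eta_conditions(2), unfolded scal_simps diff_zero]

text \<open>The power of theta - \<eta> sigma_(p^s) expands binomially with sigma_(p^s)^m = m!
  sigma_(m p^s), and multiplying by sigma_j' costs no binomial by Lucas, as j' < p^s. The
  coefficients are those found in \<open>eta_reduce_vec\<close>, transposed.\<close>

lemma E_mono:
  assumes "e' < 2" "i' < Q" "j' < p ^ s"
  shows "E (mono e' i' j') = (\<Sum>k\<le>i'. Poly_Mapping.single (e', k, p ^ s * (i' - k) + j')
    (nu ((i' choose k) * fact (i' - k)) * (- \<iota> \<eta>) ^ (i' - k)))"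
proof -
  let ?h = "\<iota> \<eta>"
  have pw: "pow AM (theta_A - scal ?h (sigma_A (p ^ s))) i' =
      (\<Sum>k\<le>i'. scal (nu (i' choose k)) (mul AM (pow AM theta_A k) (pow AM (scal (- ?h) (sigma_A (p ^ s))) (i' - k))))"
  proof -
    have "theta_A - scal ?h (sigma_A (p ^ s)) = theta_A + scal (- ?h) (sigma_A (p ^ s))"
      by (simp add: scal_minus_left)
    then show ?thesis
      by (simp only:) (rule binomial_pow[OF R.assoc_superalgebra_axioms theta_A_closed carrier_scal[OF gens_closed(2)] AM_commute])
  qed
  have one: "nu ((p ^ s * k + j') choose (p ^ s * k)) = 1" for k
    using lucas_0[OF assms(3), of k k] by simp
  have "mul AM (pow AM (theta_A - scal ?h (sigma_A (p ^ s))) i') (sigma_A j') =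
      (\<Sum>k\<le>i'. scal (nu ((i' choose k) * fact (i' - k)) * (- ?h) ^ (i' - k)) (mul AM (pow AM theta_A k) (sigma_A (p ^ s * (i' - k) + j'))))"
    unfolding pw mul_sum_left
    by (intro sum.cong refl)
      (simp add: R.mul_assoc R.pow_scal sigma_pow mul_linear sigma_mul one one[unfolded mult.commute[of "p ^ s"]] nu_mult mult_ac)
  also have "\<dots> = (\<Sum>k\<le>i'. scal (nu ((i' choose k) * fact (i' - k)) * (- ?h) ^ (i' - k)) (mono 0 k (p ^ s * (i' - k) + j')))"
    using assms(2) by (intro sum.cong refl) (simp add: mono_product(1))
  finally have ev: "mul AM (pow AM (theta_A - scal ?h (sigma_A (p ^ s))) i') (sigma_A j') = \<dots>" .
  have tau: "mul AM (pow AM tau_A e') (mono 0 k m) = mono e' k m" if "k < Q" for k m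
  proof -
    have "e' = 0 \<or> e' = 1" using assms by auto
    then show ?thesis
    proof
      assume "e' = 0"
      then show ?thesis using R.unit_left[of "mono 0 k m"] that by (simp add: R.pow_0 del: mul_single)
    next
      assume "e' = 1"
      then show ?thesis
        by (simp only: One_nat_def R.pow_1[OF gens_closed(1)] mono_product(2)[OF that, unfolded One_nat_def])
    qed
  qed
  have "E (mono e' i' j') = mul AM (pow AM tau_A e') (mul AM (pow AM (theta_A - scal ?h (sigma_A (p ^ s))) i') (sigma_A j'))"
    using assms(3) by (simp add: eta_map_def gens_map_mono cut_sigma_def)
  also have "\<dots> = (\<Sum>k\<le>i'. scal (nu ((i' choose k) * fact (i' - k)) * (- ?h) ^ (i' - k)) (mono e' k (p ^ s * (i' - k) + j')))"
    unfolding ev mul_sum_right using assms(2)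
    by (intro sum.cong refl) (simp add: mul_scal_right tau del: scal_simps(4))
  finally show ?thesis by simp
qed

lemma lookup_E:
  assumes "x \<in> basis (AMs s)"
  shows "Poly_Mapping.lookup (E (Poly_Mapping.single x 1)) w = \<iota> (ecoef x w)"
proof -
  obtain e' i' j' where x: "x = (e', i', j')" by (metis prod_cases3)
  obtain e i j where w: "w = (e, i, j)" by (metis prod_cases3)
  have b: "e' < 2" "i' < Q" "j' < p ^ s" using assms by (auto simp: x)
  let ?c = "\<lambda>k. nu ((i' choose k) * fact (i' - k)) * (- \<iota> \<eta>) ^ (i' - k)"
  have "Poly_Mapping.lookup (E (Poly_Mapping.single x 1)) w =
      (\<Sum>k\<le>i'. if k = i then (if e = e' \<and> j = p ^ s * (i' - i) + j' then ?c i else 0) else 0)"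
    unfolding x E_mono[OF b] lookup_sum lookup_single when_def w by (intro sum.cong refl) auto
  also have "\<dots> = (if e = e' \<and> i \<le> i' \<and> j = p ^ s * (i' - i) + j' then ?c i else 0)"
    by (simp only: sum.delta sum.delta' finite_atMost) auto
  also have "\<dots> = \<iota> (ecoef x w)"
    by (simp add: ecoef_def x w nu_def map_mult map_power map_minus)
  finally show ?thesis .
qed

lemma E_closed: "z \<in> carrier_of AM \<Longrightarrow> E z \<in> carrier_of AM"
  unfolding eta_map_def by (rule gens_map_closed[OF eta_relations[OF s1 eta_conditions(1)] R.assoc_superalgebra_axioms])

lemma lookup_tensor_trunc:
  assumes "u \<in> carrier_of T"
  shows "Poly_Mapping.lookup (tensor_map trunc u) (b, c) =
    (if b \<in> basis (AMs s) \<and> c \<in> basis (AMs s) then Poly_Mapping.lookup u (b, c) else 0)"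
proof -
  have "Poly_Mapping.keys u \<subseteq> basis AM \<times> basis AM" using assms by (simp only: T_closed_iff)
  then show ?thesis
  proof (induction u rule: poly_mapping_linear_induct)
    case (single bc a)
    obtain b' c' where bc: "bc = (b', c')" by (cases bc)
    have cl: "Poly_Mapping.single b' 1 \<in> carrier_of AM" "Poly_Mapping.single c' 1 \<in> carrier_of AM"
      using single by (simp_all only: bc mem_Times_iff fst_conv snd_conv carrier_closed(5))
    have tr: "Poly_Mapping.lookup (trunc (Poly_Mapping.single d' 1)) d = (if d \<in> basis (AMs s) then (if d' = d then 1 else 0) else 0)"
      if "Poly_Mapping.single d' 1 \<in> carrier_of AM" "d' \<in> basis AM" for d d'
      using lookup_trunc[OF s1 that(1), of "fst d" "fst (snd d)" "snd (snd d)"] that(2)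
      by (auto simp: lookup_single when_def)
    have b': "b' \<in> basis AM" "c' \<in> basis AM" using single by (simp_all only: bc mem_Times_iff fst_conv snd_conv)
    show ?case unfolding bc tensor_map_single lookup_scal lookup_tensor tr[OF cl(1) b'(1)] tr[OF cl(2) b'(2)]
      by (auto simp: lookup_single when_def)
  qed (simp_all add: tensor_map_linear lookup_add)
qed

lemma ME_A_simps: "basis ME_A = basis (AMs s)" "parity ME_A = fst" "unit_el ME_A = mono 0 0 0"
  "mult_tab ME_A = mult_tab AM" "counit_tab ME_A = counit_tab AM" "antipode_tab ME_A = antipode_tab AM"
  "comult_tab ME_A x = scalar_ext \<iota> (comult_tab ME x)"
proof -
  have "basis ME_A = basis (AMs s)" "parity ME_A = parity (AMs s)" "unit_el ME_A = unit_el (AMs s)"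
    "mult_tab ME_A = mult_tab (AMs s)" "counit_tab ME_A = counit_tab (AMs s)" "antipode_tab ME_A = antipode_tab (AMs s)"
    unfolding base_change_def M_eta_def Let_def by simp_all
  then show "basis ME_A = basis (AMs s)" "parity ME_A = fst" "unit_el ME_A = mono 0 0 0"
    "mult_tab ME_A = mult_tab AM" "counit_tab ME_A = counit_tab AM" "antipode_tab ME_A = antipode_tab AM"
    by simp_all
  show "comult_tab ME_A x = scalar_ext \<iota> (comult_tab ME x)" by (simp add: base_change_def)
qed

text \<open>Duality between \<open>E\<close> and the reduction modulo \<open>u\<^sub>r\<^sub>-\<^sub>1^(p^s) + \<eta> u\<^sub>0\<close>: the new coproduct is obtained
  from the old one along \<open>E\<close>, the coefficients of \<open>E\<close> being those of the reduction.\<close>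

lemma comult_ME:
  assumes "z \<in> carrier_of (AMs s)"
  shows "comult ME_A z = tensor_map trunc (comult AM (E z))"
proof (rule linear_on_eq[OF _ _ assms])
  show "linear_on (carrier_of (AMs s)) (comult ME_A)"
    unfolding comult_def by (rule linear_on_lin_ext)
  show "linear_on (carrier_of (AMs s)) (\<lambda>z. tensor_map trunc (comult AM (E z)))"
    by (auto simp: linear_on_def eta_map_linear comult_linear tensor_map_linear)
  fix x assume x: "x \<in> basis (AMs s)"
  then have xk: "x \<in> basis (Mks s)" by (simp add: Mk_simps)
  have cx: "Poly_Mapping.single x 1 \<in> carrier_of AM" by (rule AMs_carrier[OF carrier_closed(5)[OF x]])
  note Ex = E_closed[OF cx]
  show "comult ME_A (Poly_Mapping.single x 1) = tensor_map trunc (comult AM (E (Poly_Mapping.single x 1)))"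
  proof (rule poly_mapping_eqI)
    fix bc :: "idx \<times> idx"
    obtain b c where bc: "bc = (b, c)" by (cases bc)
    have "Poly_Mapping.lookup (comult ME_A (Poly_Mapping.single x 1)) bc = \<iota> (Poly_Mapping.lookup (comult_tab ME x) (b, c))"
      by (simp add: comult_def ME_A_simps bc)
    also have "\<dots> = (if b \<in> basis (Mks s) \<and> c \<in> basis (Mks s) \<and> comult_index b c \<in> basis Mk
        then nu (comult_coeff b c) * \<iota> (ecoef x (comult_index b c)) else 0)"
      unfolding lookup_comult_tab_ME[OF xk] by (simp add: map_mult nu_def)
    also have "\<dots> = (if b \<in> basis (AMs s) \<and> c \<in> basis (AMs s) then nu (comult_coeff b c) * Poly_Mapping.lookup (E (Poly_Mapping.single x 1)) (comult_index b c) else 0)"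
    proof -
      have bs: "basis (Mks s) = basis (AMs s)" "basis Mk = basis AM" by (simp_all add: Mk_simps)
      have "Poly_Mapping.lookup (E (Poly_Mapping.single x 1)) (comult_index b c) = 0" if "comult_index b c \<notin> basis Mk"
        using Ex that unfolding carrier_of_lookup bs by blast
      then show ?thesis unfolding bs lookup_E[OF x] by auto
    qed
    also have "\<dots> = Poly_Mapping.lookup (tensor_map trunc (comult AM (E (Poly_Mapping.single x 1)))) bc"
      unfolding bc lookup_tensor_trunc[OF comult_closed[OF Ex]] lookup_comult_comult_index[OF Ex] ..
    finally show "Poly_Mapping.lookup (comult ME_A (Poly_Mapping.single x 1)) bc = \<dots>" .
  qed
qed

text \<open>The coproduct of sigma_(p^s) without its two extreme terms, which is the bracket
  multiplied by -\<eta> in the coproduct of theta on M_(r;s,eta).\<close>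

definition cut_comult :: "(idx \<times> idx \<Rightarrow>\<^sub>0 'a)" where
  "cut_comult = conv tau_A (cut_sigma s) (p ^ s)"

lemma comult_sigma_top: "comult_sigma (p ^ s) = cut_comult + prim (sigma_A (p ^ s))"
proof -
  have "comult_sigma (p ^ s) = conv tau_A (\<lambda>u. cut_sigma s u + (if u = p ^ s then sigma_A (p ^ s) else 0)) (p ^ s)"
    unfolding comult_sigma_conv by (rule conv_cong) (auto simp: cut_sigma_def)
  also have "\<dots> = cut_comult + prim (sigma_A (p ^ s))"
    unfolding cut_comult_def using p_gt by (intro conv_perturb) (simp_all add: cut_sigma_def sigma_A_def)
  finally show ?thesis .
qed

lemma tensor_map_cut:
  assumes "h' = 0 \<or> 2 \<le> r"
  shows "j < p ^ s \<Longrightarrow> tensor_map (eta_map s h') (comult_sigma j) = comult_sigma j"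
    "tensor_map (eta_map s h') (comult_sigma (p ^ s)) = cut_comult"
    "tensor_map (eta_map s h') (prim z) = prim (eta_map s h' z)"
    "tensor_map (eta_map s h') cut_comult = cut_comult"
proof -
  note rel = eta_relations[OF s1 assms]
  have *: "tensor_map (eta_map s h') (comult_sigma j) = conv tau_A (cut_sigma s) j" for j
    unfolding eta_map_def by (rule tensor_map_comult_sigma[OF rel])
  show "tensor_map (eta_map s h') (comult_sigma j) = comult_sigma j" if "j < p ^ s" for j
    unfolding * unfolding comult_sigma_conv using that by (intro conv_cong) (simp add: cut_sigma_def)
  show 2: "tensor_map (eta_map s h') (comult_sigma (p ^ s)) = cut_comult"
    unfolding * cut_comult_def ..
  show 3: "tensor_map (eta_map s h') (prim z) = prim (eta_map s h' z)" for z
    unfolding eta_map_def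
    by (rule tensor_map_prim) (use eta_map_gens(4)[OF s1 assms] in \<open>simp add: eta_map_def\<close>)
  have "cut_comult = comult_sigma (p ^ s) - prim (sigma_A (p ^ s))" by (simp add: comult_sigma_top)
  then have "tensor_map (eta_map s h') cut_comult = cut_comult - prim (eta_map s h' (sigma_A (p ^ s)))"
    using 2 3 by (simp add: tensor_map_linear)
  then show "tensor_map (eta_map s h') cut_comult = cut_comult"
    by (simp add: eta_map_gens[OF s1 assms] cut_sigma_def prim_def)
qed

lemma comult_ME_gens: "comult ME_A tau_A = prim tau_A" "j < p ^ s \<Longrightarrow> comult ME_A (sigma_A j) = comult_sigma j"
  "comult ME_A theta_A = prim theta_A - scal (\<iota> \<eta>) cut_comult"
proof -
  show "comult ME_A tau_A = prim tau_A"
    unfolding comult_ME[OF AMs_gens_closed(2)] E_gens comult_gens tensor_map_cut(3)[OF eta_conditions(2)] trunc_gens ..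
  show "comult ME_A (sigma_A j) = comult_sigma j" if "j < p ^ s"
    unfolding comult_ME[OF AMs_gens_closed(3)[OF that]] E_gens
    using tensor_map_cut(1)[OF eta_conditions(2) that] that by (simp add: cut_sigma_def comult_gens)
  have "tensor_map trunc (comult AM (theta_A - scal (\<iota> \<eta>) (sigma_A (p ^ s)))) = prim theta_A - scal (\<iota> \<eta>) cut_comult"
    unfolding comult_linear comult_gens tensor_map_linear tensor_map_cut(2,3)[OF eta_conditions(2)] trunc_gens ..
  then show "comult ME_A theta_A = prim theta_A - scal (\<iota> \<eta>) cut_comult"
    unfolding comult_ME[OF AMs_gens_closed(1)[OF s1]] E_gens .
qed

lemma comult_ME_keys:
  assumes "z \<in> carrier_of (AMs s)"
  shows "Poly_Mapping.keys (comult ME_A z) \<subseteq> basis (AMs s) \<times> basis (AMs s)"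
proof
  fix bc assume "bc \<in> Poly_Mapping.keys (comult ME_A z)"
  moreover obtain b c where bc: "bc = (b, c)" by (cases bc)
  ultimately have "Poly_Mapping.lookup (tensor_map trunc (comult AM (E z))) (b, c) \<noteq> 0"
    unfolding comult_ME[OF assms] by (simp add: in_keys_iff)
  then show "bc \<in> basis (AMs s) \<times> basis (AMs s)"
    unfolding lookup_tensor_trunc[OF comult_closed[OF E_closed[OF AMs_carrier[OF assms]]]] bc
    by (metis mem_Sigma_iff)
qed

lemma M_like_ME: "M_like ME_A s"
proof -
  have c: "carrier_of ME_A = carrier_of (AMs s)" by (simp only: carrier_of_def ME_A_simps)
  have "mul ME_A = mul AM" "counit ME_A = counit AM" "antipode ME_A = antipode AM"
    by (simp_all only: mul_def counit_def antipode_def ME_A_simps fun_eq_iff simp_thms)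
  then show ?thesis
    unfolding M_like_def sub_like_def c using s1 comult_ME_gens(1,2) comult_ME_keys ME_A_simps(1-3) by simp
qed

text \<open>By \<open>comult_ME\<close> the claim is that truncating both factors of the coproduct
  of \<open>E z\<close> and then applying \<open>E\<close> to both restores it. By multiplicativity
  this is checked on generators; at theta, \<open>E\<close> puts back the extreme terms of the
  coproduct of sigma_(p^s) that \<open>cut_comult\<close> lacks.\<close>

lemma E_hom: "restrict E (carrier_of (AMs s)) \<in> hopf_homs ME_A AM"
proof -
  have sl: "sub_like ME_A s" using M_like_ME by (simp add: M_like_def)
  have "comult AM (E z) = tensor_map E (comult ME_A z)" if z: "z \<in> carrier_of ME_A" for z
  proof -
    have z': "z \<in> carrier_of (AMs s)" using z sub_like_carrier[OF sl] by simp
    let ?D = "\<lambda>z. tensor_map trunc (comult AM (E z))"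
    have D: "?D tau_A = prim tau_A" "?D theta_A = prim theta_A - scal (\<iota> \<eta>) cut_comult"
      "\<And>j. j < p ^ s \<Longrightarrow> ?D (sigma_A j) = comult_sigma j"
      using comult_ME_gens comult_ME[OF AMs_gens_closed(1)[OF s1]] comult_ME[OF AMs_gens_closed(2)]
        comult_ME[OF AMs_gens_closed(3)] by metis+
    have mulE: "E (mul AM u v) = mul AM (E u) (E v)" for u v by (rule eta_map_mul[OF s1 eta_conditions(1)])
    have mulT: "tensor_map (eta_map s h') (mul T u v) = mul T (tensor_map (eta_map s h') u) (tensor_map (eta_map s h') v)"
      if "h' = 0 \<or> 2 \<le> r" for u v h'
      unfolding eta_map_def by (rule tensor_map_gens_map_mul[OF eta_data[OF s1 that]])
    have "comult AM (E z) = tensor_map E (?D z)"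
    proof (rule multiplicative_eqI[OF s1 z', where m = "mul T" and F = "\<lambda>z. comult AM (E z)" and G = "\<lambda>z. tensor_map E (?D z)"])
      show "linear_on (carrier_of (AMs s)) (\<lambda>z. comult AM (E z))" "linear_on (carrier_of (AMs s)) (\<lambda>z. tensor_map E (?D z))"
        by (auto simp: linear_on_def eta_map_linear comult_linear tensor_map_linear)
      show "comult AM (E (mul AM u v)) = mul T (comult AM (E u)) (comult AM (E v))" for u v
        by (simp only: mulE comult_mul)
      show "tensor_map E (?D (mul AM u v)) = mul T (tensor_map E (?D u)) (tensor_map E (?D v))" for u v
        by (simp only: mulE comult_mul mulT[OF eta_conditions(1)] mulT[OF eta_conditions(2)])
      show "comult AM (E tau_A) = tensor_map E (?D tau_A)"
        unfolding D unfolding tensor_map_cut(3)[OF eta_conditions(1)] E_gens comult_gens ..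
      show "comult AM (E (sigma_A j)) = tensor_map E (?D (sigma_A j))" if "j < p ^ s" for j
        unfolding D(3)[OF that] unfolding tensor_map_cut(1)[OF eta_conditions(1) that] E_gens using that by (simp add: cut_sigma_def comult_gens)
      show "comult AM (E theta_A) = tensor_map E (?D theta_A)"
        unfolding D unfolding tensor_map_linear tensor_map_cut[OF eta_conditions(1)] E_gens comult_linear comult_gens comult_sigma_top
        by (simp add: prim_linear scal_add_right)
    qed
    then show ?thesis unfolding comult_ME[OF z'] .
  qed
  then have "restrict E (carrier_of ME_A) \<in> hopf_homs ME_A AM"
    unfolding eta_map_def by (rule gens_map_hopf[OF sl eta_data[OF s1 eta_conditions(1)]])
  then show ?thesis using sub_like_carrier[OF sl] by simp
qed

end

section \<open>The classification for \<open>M\<^sub>r\<^sub>;\<^sub>s\<close> and \<open>M\<^sub>r\<^sub>;\<^sub>s\<^sub>,\<^sub>\<eta>\<close>\<close>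

context hopf_M begin

definition psi :: "nat \<Rightarrow> 'a \<Rightarrow> (nat \<Rightarrow> 'a) \<Rightarrow> 'a \<Rightarrow> (idx \<Rightarrow>\<^sub>0 'a) \<Rightarrow> (idx \<Rightarrow>\<^sub>0 'a)" where
  "psi s \<mu> a b = gens_map AM (scal \<mu> tau_A) (add_poly a) (cut_image s (a 0 ^ Q) b)"

lemma psi_gens:
  assumes "1 \<le> s" "2 \<le> s \<or> b = 0"
  shows "psi s \<mu> a b tau_A = scal \<mu> tau_A" "psi s \<mu> a b theta_A = add_poly a"
    "psi s \<mu> a b (sigma_A j) = cut_image s (a 0 ^ Q) b j" "psi s \<mu> a b (mono 0 0 0) = mono 0 0 0"
  unfolding psi_def gens_map_gens[OF R.assoc_superalgebra_axioms psi_relations[OF assms]] by simp_all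

lemma psi_sigma:
  assumes "1 \<le> s" "2 \<le> s \<or> b = 0"
  shows "j < p ^ (s - 1) \<Longrightarrow> psi s \<mu> a b (sigma_A j) = scal ((a 0 ^ Q) ^ j) (sigma_A j)"
    "psi s \<mu> a b (sigma_A (p ^ (s - 1))) = top_image (s - 1) (a 0 ^ Q) b"
proof -
  have lt: "p ^ (s - 1) < p ^ s" using assms p_gt by (intro power_strict_increasing) auto
  show "psi s \<mu> a b (sigma_A j) = scal ((a 0 ^ Q) ^ j) (sigma_A j)" if "j < p ^ (s - 1)"
    using that lt unfolding psi_gens[OF assms] by (simp add: cut_image_def sigma_image_small)
  show "psi s \<mu> a b (sigma_A (p ^ (s - 1))) = top_image (s - 1) (a 0 ^ Q) b"
    using lt unfolding psi_gens[OF assms] by (simp add: cut_image_def sigma_image_top)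
qed

lemma psi_image: "1 \<le> s \<Longrightarrow> z \<in> carrier_of AM \<Longrightarrow> psi s \<mu> a b z \<in> carrier_of (AMs s)"
  unfolding psi_def by (intro gens_map_image carrier_scal AMs_gens_closed add_poly_AMs cut_image_AMs)

lemma Hom_eq: "Hom \<iota> (M p r) X = hopf_homs (base_change \<iota> X) AM"
  by (simp add: Hom_def)

lemma psi_in_Hom:
  assumes "1 \<le> s" "2 \<le> s \<or> b = 0" "2 \<le> s \<Longrightarrow> \<mu> ^ 2 = (a 0 ^ Q) ^ p"
  shows "restrict (psi s \<mu> a b) (carrier_of (AMs s)) \<in> hopf_homs (AMs s) AM"
  unfolding psi_def by (rule psi_hom[where \<mu> = \<mu> and a = a, OF assms])

lemma scal_tau_inj:
  assumes "scal \<mu> tau_A = scal \<nu> tau_A" shows "\<mu> = \<nu>"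
proof -
  have "Poly_Mapping.lookup (scal \<mu> tau_A) (1, 0, 0) = Poly_Mapping.lookup (scal \<nu> tau_A) (1, 0, 0)"
    by (simp only: assms)
  then show ?thesis unfolding lookup_scal by (simp add: tau_A_def)
qed

lemma even_primitive_tuple:
  assumes "x \<in> carrier_of AM" "comult AM x = prim x" "homogeneous AM 0 x"
  shows "\<exists>a\<in>tuples r. x = add_poly a"
proof
  show "restrict (\<lambda>l. Poly_Mapping.lookup x (gidx l)) {..<r} \<in> tuples r" by simp
  show "x = add_poly (restrict (\<lambda>l. Poly_Mapping.lookup x (gidx l)) {..<r})"
    unfolding add_poly_restrict by (rule even_primitive[OF assms])
qed

end

context hopf_M_hom begin

lemma phi_theta:
  assumes "comult X theta_A = prim theta_A"
  shows "\<exists>a\<in>tuples r. \<phi> theta_A = add_poly a"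
proof (rule even_primitive_tuple)
  note t = AMs_gens_closed(1)[OF X'(2)]
  show "\<phi> theta_A \<in> carrier_of AM" "homogeneous AM 0 (\<phi> theta_A)" using homD(3)[OF t] homD(4)[OF t] by simp_all
  show "comult AM (\<phi> theta_A) = prim (\<phi> theta_A)"
    using homD(7)[OF t] tensor_map_phi_prim[OF t] assms by simp
qed

lemma phi_sigma_1: "\<phi> (sigma_A 1) = pow AM (\<phi> theta_A) Q"
  using phi_pow[OF AMs_gens_closed(1)[OF X'(2)], of Q] by (simp add: pow_theta_Q)

end

section \<open>Homomorphisms to M_(r;1), and to M_(r;s) with s >= 2\<close>

context hopf_M begin

lemma AMs_comult_theta: "comult (AMs s) theta_A = prim theta_A"
  unfolding AMs_ops comult_gens ..

lemma Hom_M_sub_1: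
  assumes "\<phi> \<in> hopf_homs (AMs 1) AM"
  obtains \<mu> a where "a \<in> tuples r" "\<phi> tau_A = scal \<mu> tau_A" "\<phi> theta_A = add_poly a"
    "\<phi> = restrict (psi 1 \<mu> a 0) (carrier_of (AMs 1))"
proof -
  interpret hopf_M_hom \<iota> p r "AMs 1" 1 \<phi>
    using assms M_like_AMs[of 1] by unfold_locales simp_all
  obtain a where a: "a \<in> tuples r" "\<phi> theta_A = add_poly a" using phi_theta AMs_comult_theta by blast
  have "\<phi> = restrict (psi 1 \<mu> a 0) (carrier_of (AMs 1))"
  proof (rule hom_ext[OF X'(1) assms])
    show "restrict (psi 1 \<mu> a 0) (carrier_of (AMs 1)) \<in> hopf_homs (AMs 1) AM"
      by (rule psi_in_Hom) simp_all
  qed (use phi_tau a psi_gens[of 1 0] AMs_gens_closed(1)[of 1] AMs_gens_closed(2)[of 1] in \<open>simp_all del: AMs_simps\<close>)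
  then show ?thesis using that a phi_tau by blast
qed

lemma classification_M_1:
  assumes t: "1 \<le> t"
  shows "bij_betw (precomp \<iota> (M_sub p r 1) (incl_M \<iota> p r 1))
        (Hom \<iota> (M_sub p r 1) (M_sub p r 1)) (Hom \<iota> (M_sub p r t) (M_sub p r 1))"
    and "bij_betw (precomp \<iota> (M_sub p r 1) (incl_M \<iota> p r t))
        (Hom \<iota> (M_sub p r t) (M_sub p r 1)) (Hom \<iota> (M p r) (M_sub p r 1))"
    and "parametrized_by (Hom \<iota> (M p r) (M_sub p r 1)) (UNIV \<times> tuples r)
        (\<lambda>(\<mu>, a) \<phi>. \<phi> (tauA \<iota> p r) = scal \<mu> (tauA \<iota> p r) \<and> \<phi> (thetaA \<iota> p r) = additive_poly \<iota> p r a)"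
proof -
  let ?spec = "\<lambda>(\<mu>, a) (\<phi> :: (idx \<Rightarrow>\<^sub>0 'a) \<Rightarrow> (idx \<Rightarrow>\<^sub>0 'a)). \<phi> tau_A = scal \<mu> tau_A \<and> \<phi> theta_A = add_poly a"
  have im: "\<phi> z \<in> carrier_of (AMs 1)" if ph: "\<phi> \<in> Hom \<iota> (M p r) (M_sub p r 1)" and zc: "z \<in> carrier_of (AMs 1)" for \<phi> z
  proof -
    obtain \<mu> a where "\<phi> = restrict (psi 1 \<mu> a 0) (carrier_of (AMs 1))"
      using ph unfolding Hom_eq by (elim Hom_M_sub_1) blast
    then show ?thesis using psi_image[of 1 z \<mu> a 0] AMs_carrier[OF zc] zc by (simp del: AMs_simps)
  qed
  show "bij_betw (precomp \<iota> (M_sub p r 1) (incl_M \<iota> p r 1))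
        (Hom \<iota> (M_sub p r 1) (M_sub p r 1)) (Hom \<iota> (M_sub p r t) (M_sub p r 1))"
    "bij_betw (precomp \<iota> (M_sub p r 1) (incl_M \<iota> p r t))
        (Hom \<iota> (M_sub p r t) (M_sub p r 1)) (Hom \<iota> (M p r) (M_sub p r 1))"
    by (rule bij_precomp_incl_M; use im t in blast)+
  show "parametrized_by (Hom \<iota> (M p r) (M_sub p r 1)) (UNIV \<times> tuples r)
        (\<lambda>(\<mu>, a) \<phi>. \<phi> (tauA \<iota> p r) = scal \<mu> (tauA \<iota> p r) \<and> \<phi> (thetaA \<iota> p r) = additive_poly \<iota> p r a)"
    unfolding Hom_eq scalar_ext_gens
  proof (rule parametrized_byI)
    fix x :: "'a \<times> (nat \<Rightarrow> 'a)" assume "x \<in> UNIV \<times> tuples r"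
    then obtain \<mu> a where x: "x = (\<mu>, a)" by (cases x)
    show "\<exists>\<phi>\<in>hopf_homs (AMs 1) AM. ?spec x \<phi>"
      unfolding x
      using psi_in_Hom[of 1 0 \<mu> a] psi_gens[of 1 0] AMs_gens_closed(1)[of 1] AMs_gens_closed(2)[of 1]
      by (intro bexI[of _ "restrict (psi 1 \<mu> a 0) (carrier_of (AMs 1))"]) (simp_all del: AMs_simps)
  next
    fix \<phi> assume "\<phi> \<in> hopf_homs (AMs 1) AM"
    then show "\<exists>x\<in>UNIV \<times> tuples r. ?spec x \<phi>"
      by (elim Hom_M_sub_1) blast
  next
    fix x y :: "'a \<times> (nat \<Rightarrow> 'a)" and \<phi> :: "(idx \<Rightarrow>\<^sub>0 'a) \<Rightarrow> (idx \<Rightarrow>\<^sub>0 'a)"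
    assume *: "x \<in> UNIV \<times> tuples r" "y \<in> UNIV \<times> tuples r"
      "?spec x \<phi>"
      "?spec y \<phi>"
    obtain \<mu> a \<nu> a' where xy: "x = (\<mu>, a)" "y = (\<nu>, a')" by (cases x, cases y)
    have "a \<in> tuples r" "a' \<in> tuples r" "\<phi> tau_A = scal \<mu> tau_A" "\<phi> tau_A = scal \<nu> tau_A"
      "\<phi> theta_A = add_poly a" "\<phi> theta_A = add_poly a'"
      using * unfolding xy mem_Times_iff prod.case fst_conv snd_conv by blast+
    then have "\<mu> = \<nu>" "a = a'" using scal_tau_inj[of \<mu> \<nu>] add_poly_inj[of a a'] by simp_all
    then show "x = y" unfolding xy by simp
  next
    fix x :: "'a \<times> (nat \<Rightarrow> 'a)" and \<phi> \<psi> :: "(idx \<Rightarrow>\<^sub>0 'a) \<Rightarrow> (idx \<Rightarrow>\<^sub>0 'a)"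
    assume "\<phi> \<in> hopf_homs (AMs 1) AM" "\<psi> \<in> hopf_homs (AMs 1) AM"
      "?spec x \<phi>"
      "?spec x \<psi>"
    moreover obtain \<mu> a where "x = (\<mu>, a)" by (cases x)
    ultimately show "\<phi> = \<psi>" by (intro hom_ext[OF sub_like_AMs[OF order.refl]]) simp_all
  qed
qed

lemma Hom_M_sub:
  assumes red: "is_reduced TYPE('a)" and s: "2 \<le> s" and \<phi>: "\<phi> \<in> hopf_homs (AMs s) AM"
  obtains \<mu> a b where "a \<in> tuples r" "\<mu> ^ 2 = (a 0 ^ Q) ^ p" "\<phi> tau_A = scal \<mu> tau_A" "\<phi> theta_A = add_poly a"
    "\<And>u. u < p ^ (s - 1) \<Longrightarrow> \<phi> (sigma_A u) = scal ((a 0 ^ Q) ^ u) (sigma_A u)"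
    "\<phi> (sigma_A (p ^ (s - 1))) = top_image (s - 1) (a 0 ^ Q) b"
    "\<phi> = restrict (psi s \<mu> a b) (carrier_of (AMs s))"
proof -
  have s1: "1 \<le> s" using s by simp
  interpret hopf_M_hom \<iota> p r "AMs s" s \<phi>
    using \<phi> M_like_AMs[OF s1] by unfold_locales simp_all
  obtain a where a: "a \<in> tuples r" "\<phi> theta_A = add_poly a" using phi_theta AMs_comult_theta by blast
  have "\<phi> (sigma_A 1) = scal (a 0 ^ Q) (sigma_A 1)"
    using phi_sigma_1 a add_poly_pow_Q by simp
  from phi_sigma_all[OF red this s1 order.refl] obtain b where
    b: "2 \<le> s \<longrightarrow> \<mu> ^ 2 = (a 0 ^ Q) ^ p" "\<phi> (sigma_A (p ^ (s - 1))) = top_image (s - 1) (a 0 ^ Q) b"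
      "\<forall>u<p ^ (s - 1). \<phi> (sigma_A u) = scal ((a 0 ^ Q) ^ u) (sigma_A u)" by blast
  have mu: "\<mu> ^ 2 = (a 0 ^ Q) ^ p" using b(1) s by blast
  have ps: "p ^ l < p ^ s" if "l < s" for l using that p_gt by (intro power_strict_increasing) auto
  have "\<phi> = restrict (psi s \<mu> a b) (carrier_of (AMs s))"
  proof (rule hom_ext[OF X'(1) \<phi>])
    show "restrict (psi s \<mu> a b) (carrier_of (AMs s)) \<in> hopf_homs (AMs s) AM"
      by (rule psi_in_Hom[OF s1]) (simp_all add: s mu)
    fix l assume l: "1 \<le> l" "l < s"
    have "\<phi> (sigma_A (p ^ l)) = psi s \<mu> a b (sigma_A (p ^ l))"
    proof (cases "l = s - 1")
      case True
      then show ?thesis using b(2) psi_sigma(2)[OF s1] s by simp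
    next
      case False
      then have "p ^ l < p ^ (s - 1)" using l p_gt by (intro power_strict_increasing) auto
      then show ?thesis using b(3) psi_sigma(1)[OF s1] s by simp
    qed
    then show "\<phi> (sigma_A (p ^ l)) = restrict (psi s \<mu> a b) (carrier_of (AMs s)) (sigma_A (p ^ l))"
      using AMs_gens_closed(3)[OF ps[OF l(2)]] by (simp del: AMs_simps)
  qed (use phi_tau a psi_gens[OF s1, of b] s AMs_gens_closed(1)[OF s1] AMs_gens_closed(2)[of s] in \<open>simp_all del: AMs_simps\<close>)
  then show ?thesis using that[OF a(1) mu phi_tau a(2) _ b(2)] b(3) by blast
qed

lemma top_image_inj: "1 \<le> l \<Longrightarrow> top_image l c b = top_image l c b' \<Longrightarrow> b = b'"
proof -
  assume "1 \<le> l" "top_image l c b = top_image l c b'"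
  moreover have "p ^ l \<noteq> 1" using p_power_ge[OF \<open>1 \<le> l\<close>] p_gt by linarith
  ultimately have "Poly_Mapping.lookup (scal b (sigma_A 1)) (0, 0, 1) = Poly_Mapping.lookup (scal b' (sigma_A 1)) (0, 0, 1)"
    unfolding top_image_def by simp
  then show "b = b'" by (simp add: sigma_A_def)
qed

lemma classification_M_sub:
  assumes red: "is_reduced TYPE('a)" and s: "2 \<le> s" "s \<le> t"
  shows "bij_betw (precomp \<iota> (M_sub p r s) (incl_M \<iota> p r s))
        (Hom \<iota> (M_sub p r s) (M_sub p r s)) (Hom \<iota> (M_sub p r t) (M_sub p r s))"
    and "bij_betw (precomp \<iota> (M_sub p r s) (incl_M \<iota> p r t))
        (Hom \<iota> (M_sub p r t) (M_sub p r s)) (Hom \<iota> (M p r) (M_sub p r s))"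
    and "parametrized_by (Hom \<iota> (M p r) (M_sub p r s))
        {(\<mu>, a, b). a \<in> tuples r \<and> \<mu> ^ 2 = a 0 ^ (p ^ r)}
        (\<lambda>(\<mu>, a, b) \<phi>. \<phi> (tauA \<iota> p r) = scal \<mu> (tauA \<iota> p r) \<and>
                     \<phi> (thetaA \<iota> p r) = additive_poly \<iota> p r a \<and>
                     (\<forall>i<p ^ (s - 1). \<phi> (sigmaA \<iota> p r i) =
                        scal (a 0 ^ (i * p ^ (r - 1))) (sigmaA \<iota> p r i)) \<and>
                     \<phi> (sigmaA \<iota> p r (p ^ (s - 1))) =
                        scal (a 0 ^ (p ^ (r + s - 2))) (sigmaA \<iota> p r (p ^ (s - 1))) +
                        scal b (sigmaA \<iota> p r 1))"
proof -
  have s1: "1 \<le> s" using s by simp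
  have im: "\<phi> z \<in> carrier_of (AMs s)" if ph: "\<phi> \<in> Hom \<iota> (M p r) (M_sub p r s)" and zc: "z \<in> carrier_of (AMs s)" for \<phi> z
  proof -
    obtain \<mu> a b where "\<phi> = restrict (psi s \<mu> a b) (carrier_of (AMs s))"
      using ph unfolding Hom_eq by (elim Hom_M_sub[OF red s(1)]) blast
    then show ?thesis using psi_image[OF s1 AMs_carrier[OF zc], of \<mu> a b] zc by (simp del: AMs_simps)
  qed
  show "bij_betw (precomp \<iota> (M_sub p r s) (incl_M \<iota> p r s))
        (Hom \<iota> (M_sub p r s) (M_sub p r s)) (Hom \<iota> (M_sub p r t) (M_sub p r s))"
    "bij_betw (precomp \<iota> (M_sub p r s) (incl_M \<iota> p r t))
        (Hom \<iota> (M_sub p r t) (M_sub p r s)) (Hom \<iota> (M p r) (M_sub p r s))"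
    by (rule bij_precomp_incl_M; use im s(2) in blast)+
  let ?P = "{(\<mu>, a, b). a \<in> tuples r \<and> \<mu> ^ 2 = (a 0 ^ Q) ^ p}"
  let ?spec = "\<lambda>(\<mu>, a, b) \<phi>. \<phi> tau_A = scal \<mu> tau_A \<and> \<phi> theta_A = add_poly a \<and>
      (\<forall>i<p ^ (s - 1). \<phi> (sigma_A i) = scal ((a 0 ^ Q) ^ i) (sigma_A i)) \<and>
      \<phi> (sigma_A (p ^ (s - 1))) = top_image (s - 1) (a 0 ^ Q) b"
  have ps: "p ^ l < p ^ s" if "l < s" for l using that p_gt by (intro power_strict_increasing) auto
  have "parametrized_by (hopf_homs (AMs s) AM) ?P ?spec"
  proof (rule parametrized_byI)
    fix x :: "'a \<times> (nat \<Rightarrow> 'a) \<times> 'a" assume "x \<in> ?P"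
    then obtain \<mu> a b where x: "x = (\<mu>, a, b)" and a: "a \<in> tuples r" "\<mu> ^ 2 = (a 0 ^ Q) ^ p" by blast
    show "\<exists>\<phi>\<in>hopf_homs (AMs s) AM. ?spec x \<phi>" unfolding x
    proof (rule bexI[of _ "restrict (psi s \<mu> a b) (carrier_of (AMs s))"])
      show "restrict (psi s \<mu> a b) (carrier_of (AMs s)) \<in> hopf_homs (AMs s) AM"
        by (rule psi_in_Hom[OF s1]) (simp_all add: s a)
      have ps': "p ^ (s - 1) < p ^ s" using s1 by (intro ps) simp
      have "sigma_A i \<in> carrier_of (AMs s)" if "i \<le> p ^ (s - 1)" for i
        using that ps' by (intro AMs_gens_closed) linarith
      then show "?spec (\<mu>, a, b) (restrict (psi s \<mu> a b) (carrier_of (AMs s)))"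
        using psi_gens[OF s1, of b] psi_sigma[OF s1, of b] s AMs_gens_closed(1)[OF s1] AMs_gens_closed(2)[of s]
        by (simp del: AMs_simps)
    qed
  next
    fix \<phi> assume "\<phi> \<in> hopf_homs (AMs s) AM"
    then obtain \<mu> a b where ab: "a \<in> tuples r" "\<mu> ^ 2 = (a 0 ^ Q) ^ p" "\<phi> tau_A = scal \<mu> tau_A" "\<phi> theta_A = add_poly a"
      "\<And>u. u < p ^ (s - 1) \<Longrightarrow> \<phi> (sigma_A u) = scal ((a 0 ^ Q) ^ u) (sigma_A u)"
      "\<phi> (sigma_A (p ^ (s - 1))) = top_image (s - 1) (a 0 ^ Q) b"
      by (elim Hom_M_sub[OF red s(1)]) blast
    then have "(\<mu>, a, b) \<in> ?P" "?spec (\<mu>, a, b) \<phi>" by blast+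
    then show "\<exists>x\<in>?P. ?spec x \<phi>" by (rule bexI[rotated])
  next
    fix x y :: "'a \<times> (nat \<Rightarrow> 'a) \<times> 'a" and \<phi> :: "(idx \<Rightarrow>\<^sub>0 'a) \<Rightarrow> (idx \<Rightarrow>\<^sub>0 'a)"
    assume xy: "x \<in> ?P" "y \<in> ?P" "?spec x \<phi>" "?spec y \<phi>"
    obtain \<mu> a b \<nu> a' b' where eq: "x = (\<mu>, a, b)" "y = (\<nu>, a', b')" by (metis prod_cases3)
    have *: "a \<in> tuples r" "a' \<in> tuples r" "\<phi> tau_A = scal \<mu> tau_A" "\<phi> tau_A = scal \<nu> tau_A"
      "\<phi> theta_A = add_poly a" "\<phi> theta_A = add_poly a'"
      "\<phi> (sigma_A (p ^ (s - 1))) = top_image (s - 1) (a 0 ^ Q) b"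
      "\<phi> (sigma_A (p ^ (s - 1))) = top_image (s - 1) (a' 0 ^ Q) b'"
      using xy unfolding eq by simp_all
    then have e: "\<mu> = \<nu>" "a = a'" using scal_tau_inj[of \<mu> \<nu>] add_poly_inj[of a a'] by simp_all
    have "1 \<le> s - 1" using s by simp
    then have "b = b'" using top_image_inj[of "s - 1" "a 0 ^ Q" b b'] *(7,8) e by simp
    then show "x = y" using e unfolding eq by simp
  next
    fix x :: "'a \<times> (nat \<Rightarrow> 'a) \<times> 'a" and \<phi> \<psi> :: "(idx \<Rightarrow>\<^sub>0 'a) \<Rightarrow> (idx \<Rightarrow>\<^sub>0 'a)"
    assume xs: "\<phi> \<in> hopf_homs (AMs s) AM" "\<psi> \<in> hopf_homs (AMs s) AM" "?spec x \<phi>" "?spec x \<psi>"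
    obtain \<mu> a b where x: "x = (\<mu>, a, b)" by (metis prod_cases3)
    have *: "\<phi> \<in> hopf_homs (AMs s) AM" "\<psi> \<in> hopf_homs (AMs s) AM"
      "\<phi> tau_A = scal \<mu> tau_A" "\<psi> tau_A = scal \<mu> tau_A" "\<phi> theta_A = add_poly a" "\<psi> theta_A = add_poly a"
      "\<forall>i<p ^ (s - 1). \<phi> (sigma_A i) = scal ((a 0 ^ Q) ^ i) (sigma_A i)"
      "\<forall>i<p ^ (s - 1). \<psi> (sigma_A i) = scal ((a 0 ^ Q) ^ i) (sigma_A i)"
      "\<phi> (sigma_A (p ^ (s - 1))) = top_image (s - 1) (a 0 ^ Q) b"
      "\<psi> (sigma_A (p ^ (s - 1))) = top_image (s - 1) (a 0 ^ Q) b"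
      using xs unfolding x prod.case by blast+
    show "\<phi> = \<psi>"
    proof (rule hom_ext[OF sub_like_AMs[OF s1] *(1,2)])
      fix l assume l: "1 \<le> l" "l < s"
      then have "l < s - 1 \<or> l = s - 1" by linarith
      then show "\<phi> (sigma_A (p ^ l)) = \<psi> (sigma_A (p ^ l))"
      proof
        assume "l < s - 1"
        then have "p ^ l < p ^ (s - 1)" using p_gt by (intro power_strict_increasing) auto
        then show ?thesis using * by metis
      qed (use * in metis)
    qed (use * in metis)+
  qed
  then show "parametrized_by (Hom \<iota> (M p r) (M_sub p r s))
        {(\<mu>, a, b). a \<in> tuples r \<and> \<mu> ^ 2 = a 0 ^ (p ^ r)}
        (\<lambda>(\<mu>, a, b) \<phi>. \<phi> (tauA \<iota> p r) = scal \<mu> (tauA \<iota> p r) \<and>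
                     \<phi> (thetaA \<iota> p r) = additive_poly \<iota> p r a \<and>
                     (\<forall>i<p ^ (s - 1). \<phi> (sigmaA \<iota> p r i) =
                        scal (a 0 ^ (i * p ^ (r - 1))) (sigmaA \<iota> p r i)) \<and>
                     \<phi> (sigmaA \<iota> p r (p ^ (s - 1))) =
                        scal (a 0 ^ (p ^ (r + s - 2))) (sigmaA \<iota> p r (p ^ (s - 1))) +
                        scal b (sigmaA \<iota> p r 1))"
    unfolding Hom_eq scalar_ext_gens c_powers(1,4) c_powers(2)[OF s1] top_image_def .
qed

end

section \<open>Homomorphisms to M_(r;s,eta)\<close>

context eta_setting begin

lemma E_theta_AMs: "theta_A - scal (\<iota> \<eta>) (sigma_A (p ^ s)) \<in> carrier_of (AMs (s + 1))"
  using p_gt s1 by (intro carrier_closed(3) carrier_scal AMs_gens_closed) (simp_all add: power_strict_increasing)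

text \<open>The image of theta involves sigma_(p^s), which first occurs in A[M_(r;s+1)]; hence
  M_(r;s+1) in part (3).\<close>

lemma E_image: "z \<in> carrier_of AM \<Longrightarrow> E z \<in> carrier_of (AMs (s + 1))"
proof -
  have "p ^ s < p ^ (s + 1)" using p_gt by (intro power_strict_increasing) auto
  then have "j < p ^ s \<Longrightarrow> sigma_A j \<in> carrier_of (AMs (s + 1))" for j
    by (intro AMs_gens_closed) linarith
  then have "cut_sigma s j \<in> carrier_of (AMs (s + 1))" for j
    by (auto simp: cut_sigma_def carrier_closed(1) simp del: AMs_simps)
  then show "z \<in> carrier_of AM \<Longrightarrow> E z \<in> carrier_of (AMs (s + 1))"
    unfolding eta_map_def by (intro gens_map_image E_theta_AMs AMs_gens_closed) simp_all
qed

lemma psi_E_hom: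
  assumes \<mu>: "\<mu> ^ 2 = (a 0 ^ Q) ^ p"
  shows "restrict (\<lambda>z. psi (s + 1) \<mu> a 0 (E z)) (carrier_of ME_A) \<in> hopf_homs ME_A AM"
proof -
  let ?\<psi> = "psi (s + 1) \<mu> a 0"
  have sl: "sub_like ME_A s" using M_like_ME by (simp add: M_like_def)
  have c: "carrier_of ME_A = carrier_of (AMs s)" by (rule sub_like_carrier[OF sl])
  note ops = sl[unfolded sub_like_def] sub_like_homogeneous[OF sl]
  have s': "1 \<le> s + 1" "2 \<le> s + 1 \<or> (0 :: 'a) = 0" by simp_all
  have psi: "restrict ?\<psi> (carrier_of (AMs (s + 1))) \<in> hopf_homs (AMs (s + 1)) AM"
    by (rule psi_in_Hom[OF s']) (rule \<mu>)
  have psiD: "u \<in> carrier_of (AMs (s + 1)) \<Longrightarrow> homogeneous AM e u \<Longrightarrow> homogeneous AM e (?\<psi> u)"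
    "u \<in> carrier_of (AMs (s + 1)) \<Longrightarrow> comult AM (?\<psi> u) = tensor_map ?\<psi> (comult AM u)"
    "u \<in> carrier_of (AMs (s + 1)) \<Longrightarrow> counit AM (?\<psi> u) = counit AM u"
    "u \<in> carrier_of (AMs (s + 1)) \<Longrightarrow> antipode AM (?\<psi> u) = ?\<psi> (antipode AM u)" for u e
    using hopf_homsD(4,7,8,9)[OF psi, of u] AMs_antipode_closed[of u "s + 1"]
      tensor_map_restrict[of "comult AM u" "AMs (s + 1)" ?\<psi>] AMs_comult_closed[of u "s + 1"]
    unfolding AMs_ops by (simp_all del: AMs_simps)
  have ED: "u \<in> carrier_of ME_A \<Longrightarrow> homogeneous AM e u \<Longrightarrow> homogeneous AM e (E u)"
    "u \<in> carrier_of ME_A \<Longrightarrow> comult AM (E u) = tensor_map E (comult ME_A u)"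
    "u \<in> carrier_of ME_A \<Longrightarrow> counit AM (E u) = counit AM u"
    "u \<in> carrier_of ME_A \<Longrightarrow> antipode AM (E u) = E (antipode AM u)" for u e
    using hopf_homsD(4,7,8,9)[OF E_hom, of u] AMs_antipode_closed[of u s] comult_ME_keys[of u]
      tensor_map_restrict[of "comult ME_A u" "AMs s" E] ops
    unfolding c by (simp_all del: AMs_simps)
  have cl: "E u \<in> carrier_of (AMs (s + 1))" if "u \<in> carrier_of ME_A" for u
    using that unfolding c by (intro E_image AMs_carrier)
  show ?thesis
  proof (rule hopf_hom_restrictI[OF sl])
    show "linear_on UNIV (\<lambda>z. ?\<psi> (E z))"
      by (auto simp: linear_on_def eta_map_linear psi_def gens_map_add gens_map_scal)
    show "?\<psi> (E (mono 0 0 0)) = mono 0 0 0" by (simp only: E_gens psi_gens[OF s'])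
    show "?\<psi> (E (mul AM x y)) = mul AM (?\<psi> (E x)) (?\<psi> (E y))" for x y
      unfolding eta_map_mul[OF s1 eta_conditions(1)] psi_def by (rule gens_map_mul[OF R.assoc_superalgebra_axioms psi_relations[OF s']])
    fix x assume x: "x \<in> carrier_of ME_A"
    show "?\<psi> (E x) \<in> carrier_of AM" by (rule AMs_carrier[OF psi_image[OF s'(1) AMs_carrier[OF cl[OF x]]]])
    show "homogeneous AM e x \<Longrightarrow> homogeneous AM e (?\<psi> (E x))" for e by (rule psiD(1)[OF cl[OF x] ED(1)[OF x]])
    show "counit AM (?\<psi> (E x)) = counit AM x" by (simp only: psiD(3)[OF cl[OF x]] ED(3)[OF x])
    show "antipode AM (?\<psi> (E x)) = ?\<psi> (E (antipode AM x))" by (simp only: psiD(4)[OF cl[OF x]] ED(4)[OF x])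
    show "comult AM (?\<psi> (E x)) = tensor_map (\<lambda>z. ?\<psi> (E z)) (comult ME_A x)"
      unfolding psiD(2)[OF cl[OF x]] ED(2)[OF x] unfolding psi_def gens_map_def by (rule tensor_map_compose)
  qed
qed

lemma psi_E_gens:
  "psi (s + 1) \<mu> a 0 (E tau_A) = scal \<mu> tau_A"
  "psi (s + 1) \<mu> a 0 (E theta_A) = add_poly a - scal (\<iota> \<eta> * (a 0 ^ Q) ^ p ^ s) (sigma_A (p ^ s))"
  "j < p ^ s \<Longrightarrow> psi (s + 1) \<mu> a 0 (E (sigma_A j)) = scal ((a 0 ^ Q) ^ j) (sigma_A j)"
proof -
  have s': "1 \<le> s + 1" "2 \<le> s + 1 \<or> (0 :: 'a) = 0" by simp_all
  show "psi (s + 1) \<mu> a 0 (E tau_A) = scal \<mu> tau_A" by (simp only: E_gens psi_gens[OF s'])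
  show "psi (s + 1) \<mu> a 0 (E (sigma_A j)) = scal ((a 0 ^ Q) ^ j) (sigma_A j)" if "j < p ^ s"
    using psi_sigma(1)[OF s', of j \<mu> a] that by (simp add: E_gens cut_sigma_def)
  have "psi (s + 1) \<mu> a 0 (theta_A - scal (\<iota> \<eta>) (sigma_A (p ^ s))) =
      psi (s + 1) \<mu> a 0 theta_A - scal (\<iota> \<eta>) (psi (s + 1) \<mu> a 0 (sigma_A (p ^ s)))"
    by (simp add: psi_def gens_map_diff gens_map_scal)
  then show "psi (s + 1) \<mu> a 0 (E theta_A) = add_poly a - scal (\<iota> \<eta> * (a 0 ^ Q) ^ p ^ s) (sigma_A (p ^ s))"
    using psi_gens[OF s'] psi_sigma(2)[OF s', of \<mu> a] by (simp add: E_gens top_image_def)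
qed

text \<open>As theta is not primitive here, phi(theta) is found last. First phi(sigma_1), primitive
  with p-th power 0, is c sigma_1 for some c; the induction gives the sigma_j with j < p^s up to b;
  then a multiple of phi(theta) takes the place of phi(sigma_(p^s)), and theta^Q = sigma_1 returns c
  = a_0^Q.\<close>

lemma Hom_M_eta:
  assumes red: "is_reduced TYPE('a)" and \<eta>: "\<eta> \<noteq> 0" and \<phi>: "\<phi> \<in> hopf_homs ME_A AM"
  obtains \<mu> a where "a \<in> tuples r" "\<mu> ^ 2 = (a 0 ^ Q) ^ p" "\<phi> tau_A = scal \<mu> tau_A"
    "\<phi> theta_A = add_poly a - scal (\<iota> \<eta> * (a 0 ^ Q) ^ p ^ s) (sigma_A (p ^ s))"
    "\<And>u. u < p ^ s \<Longrightarrow> \<phi> (sigma_A u) = scal ((a 0 ^ Q) ^ u) (sigma_A u)"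
    "\<phi> = restrict (\<lambda>z. psi (s + 1) \<mu> a 0 (E z)) (carrier_of ME_A)"
proof -
  interpret hopf_M_hom \<iota> p r ME_A s \<phi>
    using \<phi> M_like_ME by unfold_locales
  note tc = AMs_gens_closed(1)[OF s1]
  have ps: "1 < p ^ s" using p_power_ge[OF s1] p_gt by linarith
  have "comult AM (\<phi> (sigma_A 1)) = prim (\<phi> (sigma_A 1))"
    using homD(7)[OF AMs_gens_closed(3)[OF ps]] tensor_map_phi_prim[OF AMs_gens_closed(3)[OF ps]]
      comult_ME_gens(2)[OF ps] comult_sigma_1 by simp
  then obtain d where d: "\<phi> (sigma_A 1) = add_poly d"
    using even_primitive_tuple[OF phi_sigma(1)[OF ps]] phi_sigma(2)[OF ps] by blast
  have "pow AM (add_poly d) p = 0"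
    using phi_pow[OF AMs_gens_closed(3)[OF ps], of p] sigma_pow_p[of 0] phi_zero d by simp
  then obtain c where c: "\<phi> (sigma_A 1) = scal c (sigma_A 1)"
    using add_poly_nilpotent[OF red] d by metis
  obtain b where b: "s = 1 \<longrightarrow> b = 0" "\<forall>u<p ^ s. \<phi> (sigma_A u) = sigma_image (s - 1) c b u" "2 \<le> s \<longrightarrow> \<mu> ^ 2 = c ^ p"
    using phi_sigma_all[OF red c s1 order.refl] by blast
  define g where "g = \<iota> (inverse \<eta>)"
  have g: "g * \<iota> \<eta> = 1" using \<eta> by (simp add: g_def flip: map_mult)
  \<comment> \<open>The factor -1/\<eta> turns the coproduct formula of phi(theta) into the equation
    of phi(sigma_(p^s)), so \<open>phi_extension\<close> applies with l = s. Unlike a value at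
    sigma_(p^l), z need not have p-th power 0, so its primitive part keeps r free coefficients,
    which become the a_i.\<close>
  define z where "z = scal (- g) (\<phi> theta_A)"
  have xz: "\<phi> theta_A = scal (- \<iota> \<eta>) z" using g by (simp add: z_def mult.commute)
  let ?y = "\<lambda>u. \<phi> (cut_sigma s u)"
  have "comult AM (\<phi> theta_A) = prim (\<phi> theta_A) - scal (\<iota> \<eta>) (conv (scal \<mu> tau_A) ?y (p ^ s))"
  proof -
    have "tensor_map \<phi> cut_comult = conv (scal \<mu> tau_A) ?y (p ^ s)"
      unfolding cut_comult_def
      by (rule tensor_map_phi_conv)
        (auto simp: cut_sigma_def carrier_closed(1) simp del: AMs_simps intro: AMs_gens_closed)
    then show ?thesis
      using homD(7)[OF tc] tensor_map_phi_prim[OF tc] by (simp add: comult_ME_gens tensor_map_linear)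
  qed
  then have "comult AM z = scal (- g) (prim (\<phi> theta_A) - scal (\<iota> \<eta>) (conv (scal \<mu> tau_A) ?y (p ^ s)))"
    by (simp only: z_def comult_linear)
  also have "\<dots> = scal (- g) (prim (\<phi> theta_A)) + scal (g * \<iota> \<eta>) (conv (scal \<mu> tau_A) ?y (p ^ s))"
    by (simp add: scal_diff_right scal_minus_left)
  also have "\<dots> = prim z + conv (scal \<mu> tau_A) ?y (p ^ s)"
    by (simp only: g scal_one z_def prim_linear)
  also have "\<dots> = conv (scal \<mu> tau_A) (\<lambda>u. ?y u + (if u = p ^ s then z else 0)) (p ^ s)"
  proof -
    have "?y 0 = mono 0 0 0" using p_gt phi_unit by (simp add: cut_sigma_def sigma_A_def)
    moreover have "0 < p ^ s" using ps by linarith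
    ultimately show ?thesis using conv_perturb[of "p ^ s" ?y "scal \<mu> tau_A" z] by (simp only: add.commute)
  qed
  also have "\<dots> = conv (scal \<mu> tau_A) (\<lambda>u. if u < p ^ s then \<phi> (sigma_A u) else if u = p ^ s then z else 0) (p ^ s)"
    by (rule conv_cong) (auto simp: cut_sigma_def phi_zero)
  finally have comult_z: "comult AM z = \<dots>" .
  have z: "z \<in> carrier_of AM" "homogeneous AM 0 z" "Poly_Mapping.lookup z (0, 0, 0) = 0"
    using homD(3)[OF tc] homD(4)[OF tc, of 0] homD(8)[OF tc] counit_gens(2)
    by (simp_all add: z_def carrier_scal homogeneous_closed counit_AM del: AM_simps)
  note ab = phi_extension[OF red s1 order.refl b(1)[rule_format] b(2)[rule_format] b(3)[rule_format] z comult_z]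
  have ab1: "\<phi> (sigma_A u) = scal (c ^ u) (sigma_A u)" if "u < p ^ s" for u
    by (rule ab(1)) (use that in simp_all)
  have ab2: "\<mu> ^ 2 = c ^ p" by (rule ab(2)) simp_all
  have "\<exists>a. z = scal (c ^ p ^ s) (sigma_A (p ^ s)) + add_poly a" by (rule ab(3)) simp_all
  then obtain a' where a': "z = scal (c ^ p ^ s) (sigma_A (p ^ s)) + add_poly a'" by blast
  define a where "a = restrict (\<lambda>i. - \<iota> \<eta> * a' i) {..<r}"
  have at: "a \<in> tuples r" by (simp add: a_def)
  have "add_poly a = scal (- \<iota> \<eta>) (add_poly a')"
    unfolding a_def add_poly_restrict unfolding add_poly_eq by (simp add: scal_sum_right)
  then have x: "\<phi> theta_A = add_poly a - scal (\<iota> \<eta> * c ^ p ^ s) (sigma_A (p ^ s))"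
    unfolding xz a' by (simp add: scal_add_right scal_minus_left)
  \<comment> \<open>As p divides Q, the Q-th power of the correction term is 0, so phi(theta)^Q is
    that of the additive polynomial.\<close>
  have cQ: "c = a 0 ^ Q"
  proof -
    have "p ^ 1 \<le> Q" using r2 p_gt unfolding Q_def by (intro power_increasing) auto
    then have "pow AM (sigma_A (p ^ s)) Q = 0"
      using prime_p by (simp add: sigma_pow nu_zero prime_dvd_fact_iff)
    then have s0: "pow AM (scal (- (\<iota> \<eta> * c ^ p ^ s)) (sigma_A (p ^ s))) (p ^ (r - 1)) = 0"
      by (simp only: R.pow_scal Q_def scal_simps)
    have x': "\<phi> theta_A = add_poly a + scal (- (\<iota> \<eta> * c ^ p ^ s)) (sigma_A (p ^ s))"
      unfolding x by (simp add: scal_minus_left)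
    have "pow AM (\<phi> theta_A) (p ^ (r - 1)) = pow AM (add_poly a) (p ^ (r - 1))"
      unfolding x' frobenius_AM[OF add_poly_closed carrier_scal[OF gens_closed(2)]] s0 by simp
    then have "scal c (sigma_A 1) = scal (a 0 ^ Q) (sigma_A 1)"
      using phi_sigma_1 c add_poly_pow_Q[of a] by (simp add: Q_def)
    then have "Poly_Mapping.lookup (scal c (sigma_A 1)) (0, 0, 1) = Poly_Mapping.lookup (scal (a 0 ^ Q) (sigma_A 1)) (0, 0, 1)"
      by simp
    then show ?thesis by (simp add: sigma_A_def)
  qed
  have "\<phi> = restrict (\<lambda>z. psi (s + 1) \<mu> a 0 (E z)) (carrier_of ME_A)"
  proof (rule hom_ext[OF X'(1) \<phi>])
    show "restrict (\<lambda>z. psi (s + 1) \<mu> a 0 (E z)) (carrier_of ME_A) \<in> hopf_homs ME_A AM"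
      by (rule psi_E_hom) (use ab2 cQ in simp)
    show "\<phi> tau_A = restrict (\<lambda>z. psi (s + 1) \<mu> a 0 (E z)) (carrier_of ME_A) tau_A"
      using AMs_gens_closed(2)[of s] phi_tau psi_E_gens(1) X'(3) by simp
    show "\<phi> theta_A = restrict (\<lambda>z. psi (s + 1) \<mu> a 0 (E z)) (carrier_of ME_A) theta_A"
      using tc x cQ psi_E_gens(2)[of \<mu> a] X'(3) by simp
    fix l assume "l < s"
    then have pl: "p ^ l < p ^ s" using p_gt by (intro power_strict_increasing) auto
    then show "\<phi> (sigma_A (p ^ l)) = restrict (\<lambda>z. psi (s + 1) \<mu> a 0 (E z)) (carrier_of ME_A) (sigma_A (p ^ l))"
      using AMs_gens_closed(3)[OF pl] ab1[OF pl] cQ psi_E_gens(3)[OF pl, of \<mu> a] X'(3) by simp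
  qed
  then show ?thesis
    using that[OF at _ phi_tau] ab1 ab2 x unfolding cQ by blast
qed

lemma classification_M_eta:
  assumes red: "is_reduced TYPE('a)" and st: "s < t" and \<eta>: "\<eta> \<noteq> 0"
  shows "bij_betw (precomp \<iota> (M_eta p r s \<eta>) (incl_M \<iota> p r (s + 1)))
        (Hom \<iota> (M_sub p r (s + 1)) (M_eta p r s \<eta>)) (Hom \<iota> (M_sub p r t) (M_eta p r s \<eta>))"
    and "bij_betw (precomp \<iota> (M_eta p r s \<eta>) (incl_M \<iota> p r t))
        (Hom \<iota> (M_sub p r t) (M_eta p r s \<eta>)) (Hom \<iota> (M p r) (M_eta p r s \<eta>))"
    and "parametrized_by (Hom \<iota> (M p r) (M_eta p r s \<eta>))
        {(\<mu>, a). a \<in> tuples r \<and> \<mu> ^ 2 = a 0 ^ (p ^ r)}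
        (\<lambda>(\<mu>, a) \<phi>. \<phi> (tauA \<iota> p r) = scal \<mu> (tauA \<iota> p r) \<and>
                     \<phi> (thetaA \<iota> p r) = additive_poly \<iota> p r a -
                        scal (\<iota> \<eta> * a 0 ^ (p ^ (r + s - 1))) (sigmaA \<iota> p r (p ^ s)) \<and>
                     (\<forall>i<p ^ s. \<phi> (sigmaA \<iota> p r i) =
                        scal (a 0 ^ (i * p ^ (r - 1))) (sigmaA \<iota> p r i)))"
proof -
  have c: "carrier_of ME_A = carrier_of (AMs s)" using M_like_ME sub_like_carrier by (simp add: M_like_def)
  have sl: "sub_like ME_A s" using M_like_ME by (simp add: M_like_def)
  have im: "\<phi> z \<in> carrier_of (AMs (s + 1))" if ph: "\<phi> \<in> Hom \<iota> (M p r) ME" and zc: "z \<in> carrier_of ME_A" for \<phi> z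
  proof -
    obtain \<mu> a where "\<phi> = restrict (\<lambda>z. psi (s + 1) \<mu> a 0 (E z)) (carrier_of ME_A)"
      using ph unfolding Hom_eq by (elim Hom_M_eta[OF red \<eta>]) blast
    moreover have "z \<in> carrier_of AM" using zc AMs_carrier unfolding c by blast
    ultimately show ?thesis using psi_image[of "s + 1" "E z" \<mu> a 0] E_closed zc by (simp del: AMs_simps)
  qed
  have st': "s + 1 \<le> t" using st by simp
  show "bij_betw (precomp \<iota> (M_eta p r s \<eta>) (incl_M \<iota> p r (s + 1)))
        (Hom \<iota> (M_sub p r (s + 1)) (M_eta p r s \<eta>)) (Hom \<iota> (M_sub p r t) (M_eta p r s \<eta>))"
    "bij_betw (precomp \<iota> (M_eta p r s \<eta>) (incl_M \<iota> p r t))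
        (Hom \<iota> (M_sub p r t) (M_eta p r s \<eta>)) (Hom \<iota> (M p r) (M_eta p r s \<eta>))"
    by (rule bij_precomp_incl_M; use im st' in blast)+
  let ?P = "{(\<mu>, a). a \<in> tuples r \<and> \<mu> ^ 2 = (a 0 ^ Q) ^ p}"
  let ?spec = "\<lambda>(\<mu>, a) \<phi>. \<phi> tau_A = scal \<mu> tau_A \<and>
      \<phi> theta_A = add_poly a - scal (\<iota> \<eta> * (a 0 ^ Q) ^ p ^ s) (sigma_A (p ^ s)) \<and>
      (\<forall>i<p ^ s. \<phi> (sigma_A i) = scal ((a 0 ^ Q) ^ i) (sigma_A i))"
  have "parametrized_by (hopf_homs ME_A AM) ?P ?spec"
  proof (rule parametrized_byI)
    fix x :: "'a \<times> (nat \<Rightarrow> 'a)" assume "x \<in> ?P"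
    then obtain \<mu> a where x: "x = (\<mu>, a)" and a: "a \<in> tuples r" "\<mu> ^ 2 = (a 0 ^ Q) ^ p" by blast
    show "\<exists>\<phi>\<in>hopf_homs ME_A AM. ?spec x \<phi>" unfolding x
      using psi_E_hom[where \<mu> = \<mu> and a = a, OF a(2)] psi_E_gens(1,2)[of \<mu> a] psi_E_gens(3)[of _ \<mu> a] AMs_gens_closed(1)[OF s1] AMs_gens_closed(2)[of s] AMs_gens_closed(3)[of _ s]
      by (intro bexI[of _ "restrict (\<lambda>z. psi (s + 1) \<mu> a 0 (E z)) (carrier_of ME_A)"]) (simp_all add: c del: AMs_simps)
  next
    fix \<phi> assume "\<phi> \<in> hopf_homs ME_A AM"
    then obtain \<mu> a where "a \<in> tuples r" "\<mu> ^ 2 = (a 0 ^ Q) ^ p" "\<phi> tau_A = scal \<mu> tau_A"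
      "\<phi> theta_A = add_poly a - scal (\<iota> \<eta> * (a 0 ^ Q) ^ p ^ s) (sigma_A (p ^ s))"
      "\<And>u. u < p ^ s \<Longrightarrow> \<phi> (sigma_A u) = scal ((a 0 ^ Q) ^ u) (sigma_A u)"
      by (elim Hom_M_eta[OF red \<eta>]) blast
    then have "(\<mu>, a) \<in> ?P" "?spec (\<mu>, a) \<phi>" by blast+
    then show "\<exists>x\<in>?P. ?spec x \<phi>" by (rule bexI[rotated])
  next
    fix x y :: "'a \<times> (nat \<Rightarrow> 'a)" and \<phi> :: "(idx \<Rightarrow>\<^sub>0 'a) \<Rightarrow> (idx \<Rightarrow>\<^sub>0 'a)"
    assume xy: "x \<in> ?P" "y \<in> ?P" "?spec x \<phi>" "?spec y \<phi>"
    obtain \<mu> a \<nu> a' where eq: "x = (\<mu>, a)" "y = (\<nu>, a')" by (metis surj_pair)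
    have *: "a \<in> tuples r" "a' \<in> tuples r" "\<phi> tau_A = scal \<mu> tau_A" "\<phi> tau_A = scal \<nu> tau_A"
      "\<phi> theta_A = add_poly a - scal (\<iota> \<eta> * (a 0 ^ Q) ^ p ^ s) (sigma_A (p ^ s))"
      "\<phi> theta_A = add_poly a' - scal (\<iota> \<eta> * (a' 0 ^ Q) ^ p ^ s) (sigma_A (p ^ s))"
      using xy unfolding eq by simp_all
    \<comment> \<open>For s >= 1 the element sigma_(p^s) is none of the theta^(p^l) with l < r, so
      the correction term leaves the coefficients a_l visible.\<close>
    have look: "Poly_Mapping.lookup (add_poly a'' - scal v (sigma_A (p ^ s))) (gidx l) = a'' l" if "l < r" for a'' v l
    proof -
      have "p ^ s \<noteq> 1" using p_power_ge[OF s1] p_gt by linarith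
      moreover have "l < r - 1 \<or> l = r - 1" using that by linarith
      ultimately have "gidx l \<noteq> (0, 0, p ^ s)" using gidx_low[of l] gidx_top p_gt by auto
      then show ?thesis using lookup_add_poly[OF that] by (auto simp: lookup_minus sigma_A_def lookup_single when_def)
    qed
    have "a = a'"
    proof (rule PiE_ext[OF *(1,2)])
      fix l assume "l \<in> {..<r}"
      then show "a l = a' l" using look[of l a] look[of l a'] *(5,6) by (metis lessThan_iff)
    qed
    moreover have "\<mu> = \<nu>" using scal_tau_inj[of \<mu> \<nu>] *(3,4) by simp
    ultimately show "x = y" unfolding eq by simp
  next
    fix x :: "'a \<times> (nat \<Rightarrow> 'a)" and \<phi> \<psi> :: "(idx \<Rightarrow>\<^sub>0 'a) \<Rightarrow> (idx \<Rightarrow>\<^sub>0 'a)"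
    assume xs: "\<phi> \<in> hopf_homs ME_A AM" "\<psi> \<in> hopf_homs ME_A AM" "?spec x \<phi>" "?spec x \<psi>"
    obtain \<mu> a where x: "x = (\<mu>, a)" by (metis surj_pair)
    have *: "\<phi> \<in> hopf_homs ME_A AM" "\<psi> \<in> hopf_homs ME_A AM"
      "\<phi> tau_A = scal \<mu> tau_A" "\<psi> tau_A = scal \<mu> tau_A"
      "\<phi> theta_A = add_poly a - scal (\<iota> \<eta> * (a 0 ^ Q) ^ p ^ s) (sigma_A (p ^ s))"
      "\<psi> theta_A = add_poly a - scal (\<iota> \<eta> * (a 0 ^ Q) ^ p ^ s) (sigma_A (p ^ s))"
      "\<forall>i<p ^ s. \<phi> (sigma_A i) = scal ((a 0 ^ Q) ^ i) (sigma_A i)"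
      "\<forall>i<p ^ s. \<psi> (sigma_A i) = scal ((a 0 ^ Q) ^ i) (sigma_A i)"
      using xs unfolding x prod.case by blast+
    show "\<phi> = \<psi>"
    proof (rule hom_ext[OF sl *(1,2)])
      fix l assume "l < s"
      then have "p ^ l < p ^ s" using p_gt by (intro power_strict_increasing) auto
      then show "\<phi> (sigma_A (p ^ l)) = \<psi> (sigma_A (p ^ l))" using * by metis
    qed (use * in metis)+
  qed
  then show "parametrized_by (Hom \<iota> (M p r) (M_eta p r s \<eta>))
        {(\<mu>, a). a \<in> tuples r \<and> \<mu> ^ 2 = a 0 ^ (p ^ r)}
        (\<lambda>(\<mu>, a) \<phi>. \<phi> (tauA \<iota> p r) = scal \<mu> (tauA \<iota> p r) \<and>
                     \<phi> (thetaA \<iota> p r) = additive_poly \<iota> p r a -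
                        scal (\<iota> \<eta> * a 0 ^ (p ^ (r + s - 1))) (sigmaA \<iota> p r (p ^ s)) \<and>
                     (\<forall>i<p ^ s. \<phi> (sigmaA \<iota> p r i) =
                        scal (a 0 ^ (i * p ^ (r - 1))) (sigmaA \<iota> p r i)))"
    unfolding Hom_eq scalar_ext_gens c_powers(1,3,4) .
qed

end

context hopf_M begin

definition primitives :: "nat \<Rightarrow> (idx \<Rightarrow>\<^sub>0 'a) set" where
  "primitives d = {x \<in> carrier_of AM. homogeneous AM d x \<and> comult AM x = prim x}"

end

section \<open>The classification for \<open>G\<^sub>a\<^sub>(\<^sub>r\<^sub>)\<close> and \<open>G\<^sub>a\<^sup>-\<close>\<close>

text \<open>A common frame for G_a(r), with N = p^r, d = 0, g = theta, and G_a^-, with N = 2, d = 1,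
  g = tau. A homomorphism amounts to a primitive image x of the generator with x^N = 0, which is
  assumed of all primitive elements of parity d. The two algebras have different index types, so the
  quotient map is handled through a left inverse \<open>l_tab\<close> of its comorphism.\<close>

locale truncated_polynomials = hopf_M \<iota> p r
  for \<iota> :: "'k::field \<Rightarrow> 'a::{comm_ring,comm_monoid_mult}" and p r :: nat +
  fixes H :: "(nat, 'k) hopf_superalgebra" and N d :: nat
    and g :: "idx \<Rightarrow>\<^sub>0 'a" and l_tab :: "idx \<Rightarrow> (nat \<Rightarrow>\<^sub>0 'a)"
  assumes N: "2 \<le> N"
    and basis_H: "basis H = {..<N}" and parity_H: "parity H = (\<lambda>n. d * n)"
    and unit_H: "unit_el H = Poly_Mapping.single 0 1"
    and mult_H: "mult_tab H m n = (if m + n < N then Poly_Mapping.single (m + n) 1 else 0)"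
    and comult_H: "comult_tab H n = pow (tensor_square H)
      (tensor (Poly_Mapping.single 1 1) (unit_el H) + tensor (unit_el H) (Poly_Mapping.single 1 1)) n"
    and counit_H: "counit_tab H n = (if n = 0 then 1 else 0)"
    and antipode_H: "antipode_tab H n = Poly_Mapping.single n ((- 1) ^ n)"
    and prim_nilpotent: "x \<in> primitives d \<Longrightarrow> pow AM x N = 0"
    and prim_antipode: "x \<in> primitives d \<Longrightarrow> antipode_sign x = - x"
    and prim_range: "x \<in> primitives d \<Longrightarrow> \<exists>y. Poly_Mapping.keys y \<subseteq> {..<N} \<and> x = lin_ext (pow AM g) y"
    and g: "g \<in> primitives d" "g \<in> carrier_of (AMs 1)"
    and l_tab: "n < N \<Longrightarrow> lin_ext l_tab (pow AM g n) = Poly_Mapping.single n 1"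
    and l_tab_parity: "n \<in> Poly_Mapping.keys (l_tab b) \<Longrightarrow> d * n = fst b"
begin

abbreviation HA :: "(nat, 'a) hopf_superalgebra" where "HA \<equiv> base_change \<iota> H"

lemma HA_simps [simp]: "basis HA = {..<N}" "parity HA = (\<lambda>n. d * n)" "unit_el HA = Poly_Mapping.single 0 1"
  by (simp_all add: base_change_def basis_H parity_H unit_H scalar_ext_simps del: single_one)

lemma mult_HA: "mult_tab HA m n = Poly_Mapping.single (m + n) (if m + n < N then 1 else 0)"
  by (simp add: base_change_def mult_H scalar_ext_simps)

sublocale G: graded_monomial_superalgebra HA "(+)" "\<lambda>m n. if m + n < N then 1 else 0" 0
  using N by unfold_locales (auto simp: mult_HA add.assoc distrib_left)

definition prim_H :: "nat \<times> nat \<Rightarrow>\<^sub>0 'a" where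
  "prim_H = tensor (Poly_Mapping.single 1 1) (Poly_Mapping.single 0 1) + tensor (Poly_Mapping.single 0 1) (Poly_Mapping.single 1 1)"

lemma comult_HA: "comult HA (Poly_Mapping.single n 1) = pow (tensor_square HA) prim_H n"
proof -
  have 1: "mult_tab HA b c = scalar_ext \<iota> (mult_tab H b c)" "unit_el HA = scalar_ext \<iota> (unit_el H)" "parity HA = parity H" for b c
    by (simp_all add: base_change_def del: HA_simps)
  have "comult HA (Poly_Mapping.single n 1) = scalar_ext \<iota> (comult_tab H n)"
    by (simp add: comult_def base_change_def)
  also have "\<dots> = pow (tensor_square HA) prim_H n"
    unfolding comult_H scalar_ext_pow[OF tensor_square_scalar_ext[OF 1]]
    by (simp add: prim_H_def unit_H scalar_ext_simps scalar_ext_tensor del: single_one tensor_single)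
  finally show ?thesis .
qed

lemma prim_H_closed: "prim_H \<in> carrier_of (tensor_square HA)"
  using N unfolding prim_H_def by (intro carrier_closed(2)) (auto simp: tensor_square_def carrier_of_iff)

lemma X_closed: "n < N \<Longrightarrow> Poly_Mapping.single n a \<in> carrier_of HA"
  by (auto simp: carrier_of_iff)

lemma comult_HA_keys:
  assumes "z \<in> carrier_of HA" shows "Poly_Mapping.keys (comult HA z) \<subseteq> basis HA \<times> basis HA"
proof -
  have "comult HA z = lin_ext (\<lambda>n. comult HA (Poly_Mapping.single n 1)) z"
    by (simp add: comult_def)
  also have "\<dots> \<in> carrier_of (tensor_square HA)"
    using assms unfolding comult_HA by (rule carrier_lin_ext) (intro G.T.pow_closed prim_H_closed)
  finally show ?thesis by (simp add: carrier_of_iff tensor_square_def)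
qed

lemma counit_HA: "counit HA z = Poly_Mapping.lookup z 0"
proof -
  have "counit_tab HA n = (if n = 0 then 1 else 0)" for n by (simp add: base_change_def counit_H)
  then show ?thesis by (simp add: counit_def if_distrib[of "(*) _"] sum.delta in_keys_iff cong: if_cong)
qed

lemma antipode_HA: "antipode HA (Poly_Mapping.single n a) = Poly_Mapping.single n (a * (- 1) ^ n)"
  by (simp add: antipode_def base_change_def antipode_H scalar_ext_simps map_uminus_power)

lemma antipode_HA_closed: "z \<in> carrier_of HA \<Longrightarrow> antipode HA z \<in> carrier_of HA"
proof -
  assume "z \<in> carrier_of HA"
  then have "lin_ext (\<lambda>n. antipode HA (Poly_Mapping.single n 1)) z \<in> carrier_of HA"
    unfolding antipode_HA by (rule carrier_lin_ext) (simp add: X_closed)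
  then show ?thesis by (simp add: antipode_def)
qed

definition power_map :: "(idx \<Rightarrow>\<^sub>0 'a) \<Rightarrow> (nat \<Rightarrow>\<^sub>0 'a) \<Rightarrow> (idx \<Rightarrow>\<^sub>0 'a)" where "power_map x = lin_ext (pow AM x)"

lemma power_map_mul:
  assumes x: "x \<in> primitives d"
  shows "power_map x (mul HA u v) = mul AM (power_map x u) (power_map x v)"
proof (induction u rule: poly_mapping_linear_induct[OF subset_UNIV, case_names zero add single])
  case (single m a)
  have xc: "x \<in> carrier_of AM" using x by (simp add: primitives_def)
  show ?case
  proof (induction v rule: poly_mapping_linear_induct[OF subset_UNIV, case_names zero add single])
    case (single n b)
    have "pow AM x (m + n) = 0" if "\<not> m + n < N"
      using R.pow_eq_zero_ge[OF xc prim_nilpotent[OF x]] that by simp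
    then show ?case
      by (simp add: power_map_def G.mul_singles mul_linear R.pow_add[OF xc] mult_ac del: mul_single)
  qed (simp_all add: power_map_def mul_linear lin_ext_linear)
qed (simp_all add: power_map_def mul_linear lin_ext_linear)

lemma power_map_X: "x \<in> carrier_of AM \<Longrightarrow> power_map x (Poly_Mapping.single 1 1) = x" "power_map x (Poly_Mapping.single 0 1) = mono 0 0 0"
  by (simp_all add: power_map_def R.pow_1 R.pow_0)

lemma power_map_hom:
  assumes x: "x \<in> primitives d"
  shows "restrict (power_map x) (carrier_of HA) \<in> hopf_homs HA AM"
proof -
  have xc: "x \<in> carrier_of AM" and xp: "comult AM x = prim x" and xh: "homogeneous AM d x"
    using x by (simp_all add: primitives_def)
  have x0: "counit AM x = 0" using primitive_counit[OF xc xp] by (simp add: counit_AM)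
  have closed: "power_map x z \<in> carrier_of AM" if "z \<in> carrier_of HA" for z
    unfolding power_map_def using that by (rule carrier_lin_ext) (rule R.pow_closed[OF xc])
  have tm: "tensor_map (power_map x) (pow (tensor_square HA) prim_H n) = pow T (prim x) n" for n
  proof (induction n)
    case 0
    show ?case unfolding G.T.pow_0 R.T.pow_0 G.T.unit R.T.unit using power_map_X(2)[of x] by (simp add: tensor_map_single del: single_one)
  next
    case (Suc n)
    have "tensor_map (power_map x) prim_H = prim x"
      using power_map_X(1)[OF xc] power_map_X(2)[of x] unfolding power_map_def
      by (simp add: prim_H_def prim_def tensor_map_linear tensor_map_lin_ext_tensor del: tensor_single lin_ext_single single_one)
    moreover have "tensor_map (power_map x) (mul (tensor_square HA) u v) = mul T (tensor_map (power_map x) u) (tensor_map (power_map x) v)" for u v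
      unfolding power_map_def
      by (rule tensor_map_mul[OF G.graded_monomial_superalgebra_axioms R.graded_monomial_superalgebra_axioms])
        (use power_map_mul[OF x] R.pow_homogeneous[OF xh] in \<open>simp_all add: power_map_def mult.commute\<close>)
    ultimately show ?case by (simp add: G.T.pow_Suc R.T.pow_Suc Suc)
  qed
  have comult: "comult AM (power_map x z) = tensor_map (power_map x) (comult HA z)" for z
  proof (induction z rule: poly_mapping_linear_induct[OF subset_UNIV, case_names zero add single])
    case (single n a)
    have "Poly_Mapping.single n a = scal a (Poly_Mapping.single n 1)" by simp
    then have "comult HA (Poly_Mapping.single n a) = scal a (comult HA (Poly_Mapping.single n 1))"
      by (simp only: comult_def lin_ext_linear)
    then show ?case using tm[of n] comult_pow[of x n] xp
      by (simp add: power_map_def comult_HA tensor_map_linear comult_linear)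
  qed (simp_all add: power_map_def lin_ext_linear comult_def tensor_map_linear tensor_map_def)
  have counit: "counit AM (power_map x z) = counit HA z" for z
  proof (induction z rule: poly_mapping_linear_induct[OF subset_UNIV, case_names zero add single])
    case (single n a)
    then show ?case using counit_pow[OF xc x0, of n]
      by (simp add: power_map_def counit_linear counit_HA lookup_single when_def)
  qed (simp_all add: power_map_def lin_ext_linear counit_linear counit_HA lookup_add, simp add: counit_AM)
  have antipode: "antipode_sign (power_map x z) = power_map x (antipode HA z)" for z
  proof (induction z rule: poly_mapping_linear_induct[OF subset_UNIV, case_names zero add single])
    case (single n a)
    have "antipode_sign (pow AM x n) = scal ((- 1) ^ n) (pow AM x n)"
      using R.pow_scal[of "- 1" x n] prim_antipode[OF x] by (simp add: antipode_sign_pow scal_minus_one)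
    then show ?case by (simp add: power_map_def antipode_HA antipode_sign_linear)
  qed (simp_all add: power_map_def lin_ext_linear antipode_sign_linear antipode_def, simp add: antipode_sign_def gens_map_def)
  have par: "homogeneous AM e (power_map x z)" if "homogeneous HA e z" for e z
    unfolding power_map_def using that
    by (rule homogeneous_lin_ext) (use R.pow_homogeneous[OF xh] in \<open>auto simp: mult.commute\<close>)
  have lin: "power_map x (u + v) = power_map x u + power_map x v" "power_map x (scal c u) = scal c (power_map x u)" for u v c
    by (simp_all add: power_map_def lin_ext_linear)
  have mulc: "mul HA u v \<in> carrier_of HA" if "u \<in> carrier_of HA" "v \<in> carrier_of HA" for u v
    using that by (rule G.mul_closed)
  have tmr: "tensor_map (restrict (power_map x) (carrier_of HA)) (comult HA z) = tensor_map (power_map x) (comult HA z)"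
    if "z \<in> carrier_of HA" for z using tensor_map_restrict[OF comult_HA_keys[OF that]] .
  have one: "Poly_Mapping.single 0 1 \<in> carrier_of HA" using N by (intro X_closed) simp
  show ?thesis unfolding hopf_homs_def
    using closed par mulc tmr one power_map_X(2)[of x] power_map_mul[OF x] comult counit antipode antipode_HA_closed
      antipode_AM[OF closed] lin
    by (simp add: carrier_closed carrier_scal del: single_one)
qed

lemma hom_power_map:
  assumes \<phi>: "\<phi> \<in> hopf_homs HA AM"
  shows "\<phi> (Poly_Mapping.single 1 1) \<in> primitives d"
    and "\<phi> = restrict (power_map (\<phi> (Poly_Mapping.single 1 1))) (carrier_of HA)"
proof -
  let ?x = "\<phi> (Poly_Mapping.single 1 1)"
  note D = hopf_homsD[OF \<phi>]
  have X: "Poly_Mapping.single 1 1 \<in> carrier_of HA" using N by (intro X_closed) simp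
  have "comult HA (Poly_Mapping.single 1 1) = prim_H"
    using G.T.pow_1[OF prim_H_closed] by (simp add: comult_HA)
  then have "comult AM ?x = prim ?x"
    using D(5) unfolding D(7)[OF X] prim_H_def prim_def
    by (simp add: tensor_map_linear tensor_map_single)
  then show "?x \<in> primitives d"
    using D(3)[OF X] D(4)[OF X, of d] by (simp add: primitives_def homogeneous_closed)
  have pow: "\<phi> (Poly_Mapping.single n 1) = pow AM ?x n" if "n < N" for n
    using that
  proof (induction n)
    case 0
    show ?case using D(5) by (simp add: R.pow_0)
  next
    case (Suc n)
    have "\<phi> (mul HA (Poly_Mapping.single 1 1) (Poly_Mapping.single n 1)) = mul AM ?x (pow AM ?x n)"
      using Suc D(6)[OF X X_closed[of n 1]] by (simp del: mul_single)
    then show ?case using Suc.prems by (simp add: R.pow_Suc G.mul_singles del: mul_single)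
  qed
  show "\<phi> = restrict (power_map ?x) (carrier_of HA)"
  proof
    fix z show "\<phi> z = restrict (power_map ?x) (carrier_of HA) z"
    proof (cases "z \<in> carrier_of HA")
      case True
      have "\<phi> z = power_map ?x z" unfolding power_map_def
        by (rule linear_on_eq[OF D(2) linear_on_lin_ext True]) (simp add: pow)
      then show ?thesis using True by simp
    qed (use D(1) in \<open>auto simp: PiE_iff extensional_def\<close>)
  qed
qed

lemma power_map_inj: "x \<in> carrier_of AM \<Longrightarrow> restrict (power_map x) (carrier_of HA) (Poly_Mapping.single 1 1) = x"
  using N X_closed[of 1 1] power_map_X(1)[of x] by simp

lemma parametrized_H:
  assumes G: "bij_betw G P (primitives d)"
  shows "parametrized_by (Hom \<iota> (M p r) H) P (\<lambda>x \<phi>. \<phi> (Poly_Mapping.single 1 1) = G x)"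
  unfolding Hom_eq
proof (rule parametrized_byI)
  fix x assume "x \<in> P"
  then have "G x \<in> primitives d" using G by (auto simp: bij_betw_def)
  then show "\<exists>\<phi>\<in>hopf_homs HA AM. \<phi> (Poly_Mapping.single 1 1) = G x"
    using power_map_hom power_map_inj by (auto simp: primitives_def intro!: bexI[of _ "restrict (power_map (G x)) (carrier_of HA)"])
next
  fix \<phi> assume "\<phi> \<in> hopf_homs HA AM"
  then show "\<exists>x\<in>P. \<phi> (Poly_Mapping.single 1 1) = G x" using hom_power_map(1) G by (auto simp: bij_betw_def)
next
  fix x y and \<phi> :: "(nat \<Rightarrow>\<^sub>0 'a) \<Rightarrow> (idx \<Rightarrow>\<^sub>0 'a)"
  assume "x \<in> P" "y \<in> P" "\<phi> (Poly_Mapping.single 1 1) = G x" "\<phi> (Poly_Mapping.single 1 1) = G y"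
  then show "x = y" using G by (auto simp: bij_betw_def inj_on_def)
next
  fix x and \<phi> \<psi> :: "(nat \<Rightarrow>\<^sub>0 'a) \<Rightarrow> (idx \<Rightarrow>\<^sub>0 'a)"
  assume "\<phi> \<in> hopf_homs HA AM" "\<psi> \<in> hopf_homs HA AM"
    "\<phi> (Poly_Mapping.single 1 1) = G x" "\<psi> (Poly_Mapping.single 1 1) = G x"
  then show "\<phi> = \<psi>" using hom_power_map(2)[of \<phi>] hom_power_map(2)[of \<psi>] by metis
qed

definition q :: "(nat \<Rightarrow>\<^sub>0 'a) \<Rightarrow> (idx \<Rightarrow>\<^sub>0 'a)" where "q = restrict (power_map g) (carrier_of HA)"

lemma q_hom: "q \<in> hopf_homs HA AM"
  unfolding q_def by (rule power_map_hom[OF g(1)])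

lemma l_q: "z \<in> carrier_of HA \<Longrightarrow> lin_ext l_tab (q z) = z"
proof -
  assume z: "z \<in> carrier_of HA"
  have "lin_ext l_tab (power_map g z) = lin_ext (\<lambda>n. Poly_Mapping.single n 1) z"
    using z unfolding power_map_def lin_ext_compose by (intro lin_ext_cong l_tab) (auto simp: carrier_of_iff)
  then show ?thesis using z by (simp add: q_def lin_ext_id)
qed

text \<open>The image of the generator is primitive, hence in the span of the powers of g and so of
  the form \<open>q y\<close>. As \<open>q\<close> is multiplicative, the images of all powers lie
  in its range too.\<close>

lemma hom_range:
  assumes \<phi>: "\<phi> \<in> hopf_homs HA AM" and z: "z \<in> carrier_of HA"
  shows "\<exists>w\<in>carrier_of HA. \<phi> z = q w"
proof -
  let ?x = "\<phi> (Poly_Mapping.single 1 1)"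
  note Q = hopf_homsD[OF q_hom]
  obtain y where y: "y \<in> carrier_of HA" "?x = q y"
    using prim_range[OF hom_power_map(1)[OF \<phi>]] by (auto simp: carrier_of_iff q_def power_map_def)
  have pow: "pow AM ?x = (\<lambda>n. q (pow HA y n))"
  proof
    fix n show "pow AM ?x n = q (pow HA y n)"
    using Q(5,6) y G.pow_closed[OF y(1)] by (induction n) (simp_all add: R.pow_0 G.pow_0 R.pow_Suc G.pow_Suc)
  qed
  have "\<phi> z = lin_ext (\<lambda>n. q (pow HA y n)) z"
    unfolding pow[symmetric] using fun_cong[OF hom_power_map(2)[OF \<phi>], of z] z by (simp add: power_map_def)
  also have "\<dots> = power_map g (lin_ext (pow HA y) z)"
    using G.pow_closed[OF y(1)] by (simp add: q_def power_map_def lin_ext_compose)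
  also have "\<dots> = q (lin_ext (pow HA y) z)"
    using carrier_lin_ext[OF z, of "pow HA y" HA] G.pow_closed[OF y(1)] by (simp add: q_def)
  finally show ?thesis using carrier_lin_ext[OF z, of "pow HA y" HA] G.pow_closed[OF y(1)] by blast
qed

lemma q_AMs: "w \<in> carrier_of HA \<Longrightarrow> q w \<in> carrier_of (AMs 1)"
  unfolding q_def power_map_def using g(2) by (simp, intro carrier_lin_ext AMs_pow_closed) simp_all

lemma Hom_H_AMs:
  assumes "\<phi> \<in> Hom \<iota> (M p r) H" "z \<in> carrier_of HA"
  shows "\<phi> z \<in> carrier_of (AMs 1)"
  using hom_range[OF assms[unfolded Hom_eq]] q_AMs by auto

lemma hom_compose_q:
  assumes \<psi>: "\<psi> \<in> hopf_homs HA HA"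
  shows "compose (carrier_of HA) q \<psi> \<in> hopf_homs HA AM"
proof -
  note Q = hopf_homsD[OF q_hom] and P = hopf_homsD[OF \<psi>]
  have comult: "comult AM (q (\<psi> z)) = tensor_map (compose (carrier_of HA) q \<psi>) (comult HA z)"
    if z: "z \<in> carrier_of HA" for z
  proof -
    have "comult AM (q (\<psi> z)) = tensor_map (power_map g) (comult HA (\<psi> z))"
      using Q(7)[OF P(3)[OF z]] tensor_map_restrict[OF comult_HA_keys[OF P(3)[OF z]]] by (simp add: q_def)
    also have "\<dots> = tensor_map (\<lambda>z. power_map g (\<psi> z)) (comult HA z)"
      unfolding P(7)[OF z] power_map_def by (rule tensor_map_compose)
    also have "\<dots> = tensor_map (compose (carrier_of HA) q \<psi>) (comult HA z)"
      using comult_HA_keys[OF z]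
    proof (rule tensor_map_cong)
      fix n assume "n \<in> basis HA"
      then have "Poly_Mapping.single n 1 \<in> carrier_of HA" by (intro X_closed) simp
      then show "power_map g (\<psi> (Poly_Mapping.single n 1)) = compose (carrier_of HA) q \<psi> (Poly_Mapping.single n 1)"
        using P(3) by (simp add: q_def compose_def)
    qed
    finally show ?thesis .
  qed
  have lin: "\<psi> (u + v) = \<psi> u + \<psi> v" "\<psi> (scal c u) = scal c (\<psi> u)" if "u \<in> carrier_of HA" "v \<in> carrier_of HA" for u v c
    using P(2) that by (simp_all add: linear_on_def)
  have qlin: "q (u + v) = q u + q v" "q (scal c u) = scal c (q u)" if "u \<in> carrier_of HA" "v \<in> carrier_of HA" for u v c
    using Q(2) that by (simp_all add: linear_on_def)
  have one: "Poly_Mapping.single 0 1 \<in> carrier_of HA" using N by (intro X_closed) simp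
  have "compose (carrier_of HA) q \<psi> \<in> carrier_of HA \<rightarrow>\<^sub>E carrier_of AM"
    using P(3) Q(3) by (auto simp: compose_def)
  then show ?thesis unfolding hopf_homs_def
    using comult one P(3-6,8,9) Q(3-6,8,9) lin qlin G.mul_closed antipode_HA_closed
    by (simp add: compose_def carrier_closed carrier_scal)
qed

text \<open>Values of \<phi> lie in the range of \<open>q\<close>, on which the left inverse undoes
  \<open>q\<close>. The structure maps transfer because \<open>q\<close> is an injective
  homomorphism.\<close>

lemma hom_factor:
  assumes \<phi>: "\<phi> \<in> hopf_homs HA AM"
  shows "restrict (\<lambda>z. lin_ext l_tab (\<phi> z)) (carrier_of HA) \<in> hopf_homs HA HA" (is "?\<psi> \<in> _")
    and "compose (carrier_of HA) q (restrict (\<lambda>z. lin_ext l_tab (\<phi> z)) (carrier_of HA)) = \<phi>"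
proof -
  note Q = hopf_homsD[OF q_hom] and P = hopf_homsD[OF \<phi>]
  let ?l = "lin_ext l_tab"
  have l: "?l (\<phi> z) \<in> carrier_of HA" "q (?l (\<phi> z)) = \<phi> z" if "z \<in> carrier_of HA" for z
    using hom_range[OF \<phi> that] l_q by auto
  show "compose (carrier_of HA) q ?\<psi> = \<phi>"
  proof
    fix z show "compose (carrier_of HA) q ?\<psi> z = \<phi> z"
      using l P(1) by (cases "z \<in> carrier_of HA") (auto simp: compose_def PiE_iff extensional_def)
  qed
  have comult: "comult HA (?l (\<phi> z)) = tensor_map ?\<psi> (comult HA z)" if z: "z \<in> carrier_of HA" for z
  proof -
    \<comment> \<open>The identity is inserted as the left inverse after \<open>q\<close>, so that
      compatibility with the coproduct is used for \<open>q\<close> and \<phi> alone.\<close>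
    have "comult HA (?l (\<phi> z)) = tensor_map (\<lambda>z. ?l (q z)) (comult HA (?l (\<phi> z)))"
      by (rule tensor_map_id[OF comult_HA_keys[OF l(1)[OF z]], symmetric]) (simp add: l_q X_closed)
    also have "\<dots> = tensor_map ?l (tensor_map q (comult HA (?l (\<phi> z))))"
      by (rule tensor_map_compose[symmetric])
    also have "tensor_map q (comult HA (?l (\<phi> z))) = tensor_map \<phi> (comult HA z)"
      using Q(7)[OF l(1)[OF z]] l(2)[OF z] P(7)[OF z] by simp
    also have "tensor_map ?l (tensor_map \<phi> (comult HA z)) = tensor_map (\<lambda>z. ?l (\<phi> z)) (comult HA z)"
      by (rule tensor_map_compose)
    also have "\<dots> = tensor_map ?\<psi> (comult HA z)"
      by (rule tensor_map_restrict[OF comult_HA_keys[OF z], symmetric])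
    finally show ?thesis .
  qed
  have par: "homogeneous HA e (?l y)" if "homogeneous AM e y" for e y
    using that by (rule homogeneous_lin_ext) (use l_tab_parity in \<open>auto simp: homogeneous_def\<close>)
  have parl: "homogeneous HA e (?l (\<phi> z))" if "z \<in> carrier_of HA" "homogeneous HA e z" for e z
    by (rule par) (rule P(4)[OF that])
  have lin: "\<phi> (u + v) = \<phi> u + \<phi> v" "\<phi> (scal c u) = scal c (\<phi> u)" if "u \<in> carrier_of HA" "v \<in> carrier_of HA" for u v c
    using P(2) that by (simp_all add: linear_on_def)
  have one: "Poly_Mapping.single 0 1 \<in> carrier_of HA" using N by (intro X_closed) simp
  have unit: "?l (\<phi> (Poly_Mapping.single 0 1)) = Poly_Mapping.single 0 1"
    using P(5) Q(5) l_q[OF one] by simp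
  have mult: "?l (\<phi> (mul HA u v)) = mul HA (?l (\<phi> u)) (?l (\<phi> v))" if "u \<in> carrier_of HA" "v \<in> carrier_of HA" for u v
    using Q(6)[OF l(1)[OF that(1)] l(1)[OF that(2)]] l(2)[OF that(1)] l(2)[OF that(2)] P(6)[OF that]
      l_q[OF G.mul_closed[OF l(1)[OF that(1)] l(1)[OF that(2)]]] by simp
  have counit: "counit HA (?l (\<phi> z)) = counit HA z" if z: "z \<in> carrier_of HA" for z
    using Q(8)[OF l(1)[OF z]] l(2)[OF z] P(8)[OF z] by simp
  have antipode: "antipode HA (?l (\<phi> z)) = ?l (\<phi> (antipode HA z))" if z: "z \<in> carrier_of HA" for z
    using Q(9)[OF l(1)[OF z]] l(2)[OF z] P(9)[OF z] l_q[OF antipode_HA_closed[OF l(1)[OF z]]] by simp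
  show "?\<psi> \<in> hopf_homs HA HA" unfolding hopf_homs_def
    using l(1) comult parl lin one unit mult counit antipode G.mul_closed antipode_HA_closed
    by (simp add: carrier_closed carrier_scal lin_ext_linear del: single_one)
qed

lemma bij_precomp_q:
  assumes t: "1 \<le> t"
  shows "bij_betw (precomp \<iota> H q) (Hom \<iota> H H) (Hom \<iota> (M_sub p r t) H)"
proof -
  have eq: "Hom \<iota> (M_sub p r t) H = hopf_homs HA AM"
    using Hom_H_AMs AMs_carrier_mono[OF t] unfolding Hom_def hopf_homs_AMs by blast
  show ?thesis unfolding eq
  proof (rule bij_betw_imageI)
    show "inj_on (precomp \<iota> H q) (Hom \<iota> H H)"
    proof (rule inj_onI)
      fix \<phi> \<psi> assume *: "\<phi> \<in> Hom \<iota> H H" "\<psi> \<in> Hom \<iota> H H" "precomp \<iota> H q \<phi> = precomp \<iota> H q \<psi>"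
      note P = hopf_homsD[OF *(1)[unfolded Hom_def]] hopf_homsD[OF *(2)[unfolded Hom_def]]
      show "\<phi> = \<psi>"
      proof (rule PiE_ext[OF P(1,10)])
        fix z assume z: "z \<in> carrier_of HA"
        then have "q (\<phi> z) = q (\<psi> z)" using fun_cong[OF *(3), of z] by (simp add: precomp_def compose_def)
        then show "\<phi> z = \<psi> z" using l_q[OF P(3)[OF z]] l_q[OF P(12)[OF z]] by metis
      qed
    qed
    show "precomp \<iota> H q ` Hom \<iota> H H = hopf_homs HA AM"
    proof (intro equalityI subsetI)
      fix \<phi> assume "\<phi> \<in> precomp \<iota> H q ` Hom \<iota> H H"
      then show "\<phi> \<in> hopf_homs HA AM" using hom_compose_q by (auto simp: precomp_def Hom_def)
    next
      fix \<phi> assume \<phi>: "\<phi> \<in> hopf_homs HA AM"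
      show "\<phi> \<in> precomp \<iota> H q ` Hom \<iota> H H"
        unfolding precomp_def Hom_def by (rule image_eqI[where f = "compose (carrier_of HA) q", OF hom_factor(2)[OF \<phi>, symmetric] hom_factor(1)[OF \<phi>]])
    qed
  qed
qed

end

section \<open>The two instances G_a(r) and G_a^-\<close>

context hopf_M begin

lemma primitives_even: "bij_betw add_poly (tuples r) (primitives 0)"
proof (rule bij_betw_imageI)
  show "inj_on add_poly (tuples r)" using add_poly_inj by (auto simp: inj_on_def)
  show "add_poly ` tuples r = primitives 0"
    using even_primitive_tuple add_poly_closed add_poly_even comult_add_poly
    by (auto simp: primitives_def) 
qed

lemma primitives_odd: "bij_betw (\<lambda>\<mu>. scal \<mu> tau_A) UNIV (primitives 1)"
proof (rule bij_betw_imageI)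
  show "inj (\<lambda>\<mu>. scal \<mu> tau_A)" using scal_tau_inj by (rule injI)
  show "range (\<lambda>\<mu>. scal \<mu> tau_A) = primitives 1"
    using odd_primitive
    by (auto simp: primitives_def carrier_scal homogeneous_closed comult_linear comult_gens prim_linear)
qed

lemma scalar_ext_pow_M: "scalar_ext \<iota> (pow (M p r) x n) = pow AM (scalar_ext \<iota> x) n"
  by (rule scalar_ext_pow) (simp_all add: base_change_def del: AM_simps)

text \<open>Left inverse of \<open>\<theta>^n \<mapsto> \<theta>^n\<close>, where \<open>\<theta>^(i + Qj) = j! \<theta>^i \<sigma>\<^sub>j\<close> in \<open>A[M\<^sub>r]\<close>.\<close>

definition even_retraction :: "idx \<Rightarrow> (nat \<Rightarrow>\<^sub>0 'a)" where
  "even_retraction = (\<lambda>(e, i, j). if e = 0 then Poly_Mapping.single (i + Q * j) (\<iota> (inverse (of_nat (fact j)))) else 0)"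

lemma truncated_Ga: "truncated_polynomials \<iota> p r (Ga p r) (p ^ r) 0 theta_A even_retraction"
proof
  show "2 \<le> p ^ r" using p_power_ge[OF r1] p3 by linarith
  show "basis (Ga p r) = {..<p ^ r}" "parity (Ga p r) = (\<lambda>n. 0 * n)" "unit_el (Ga p r) = Poly_Mapping.single 0 1"
    "counit_tab (Ga p r) n = (if n = 0 then 1 else 0)"
    "antipode_tab (Ga p r) n = Poly_Mapping.single n ((- 1) ^ n)"
    "mult_tab (Ga p r) m n = (if m + n < p ^ r then Poly_Mapping.single (m + n) 1 else 0)" for m n
    by (simp_all add: Ga_def Ga_superalgebra_def superalgebra.defs Let_def)
  show "comult_tab (Ga p r) n = pow (tensor_square (Ga p r))
      (tensor (Poly_Mapping.single 1 1) (unit_el (Ga p r)) + tensor (unit_el (Ga p r)) (Poly_Mapping.single 1 1)) n" for n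
    by (simp add: Ga_def Ga_superalgebra_def superalgebra.defs Let_def tensor_square_def primitive_comult_def)
  show "theta_A \<in> primitives 0" by (simp add: primitives_def comult_gens)
  show "theta_A \<in> carrier_of (AMs 1)" by (rule AMs_gens_closed) simp
  fix x assume "x \<in> primitives 0"
  then obtain a where x: "x = add_poly a" using primitives_even by (auto simp: bij_betw_def)
  show "pow AM x (p ^ r) = 0" unfolding x by (rule add_poly_pow_r)
  show "antipode_sign x = - x" unfolding x by (rule antipode_sign_add_poly)
  show "\<exists>y. Poly_Mapping.keys y \<subseteq> {..<p ^ r} \<and> x = lin_ext (pow AM theta_A) y"
  proof (intro exI conjI)
    let ?y = "\<Sum>i<r. scal (a i) (Poly_Mapping.single (p ^ i) 1)"
    have "p ^ i < p ^ r" if "i < r" for i using that p_gt by (intro power_strict_increasing) auto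
    then have "Poly_Mapping.lookup ?y n = 0" if "n \<notin> {..<p ^ r}" for n
      using that by (auto simp: lookup_sum lookup_single when_def intro!: sum.neutral)
    then show "Poly_Mapping.keys ?y \<subseteq> {..<p ^ r}" by (auto simp: in_keys_iff)
    show "x = lin_ext (pow AM theta_A) ?y" by (simp add: x add_poly_eq lin_ext_linear)
  qed
next
  fix n assume "n < p ^ r"
  moreover have "p ^ r = p * Q" using r1 by (simp add: Q_def flip: power_Suc)
  \<comment> \<open>theta^n is (n div Q)! times a basis monomial, and n < p Q makes this factorial
    invertible in k; the retraction divides by it.\<close>
  ultimately have "n div Q < p" by (intro less_mult_imp_div_less) simp
  then have "\<iota> (inverse (of_nat (fact (n div Q)))) * nu (fact (n div Q)) = 1"
    using prime_dvd_fact_iff[OF prime_p] char_p by (intro nu_inverse) simp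
  then show "lin_ext even_retraction (pow AM theta_A n) = Poly_Mapping.single n 1"
    by (simp add: pow_theta scalar_ext_normal_monomial even_retraction_def mult.commute)
next
  fix n and b :: idx assume "n \<in> Poly_Mapping.keys (even_retraction b)"
  then show "0 * n = fst b" by (auto simp: even_retraction_def split: prod.splits if_splits)
qed

definition odd_retraction :: "idx \<Rightarrow> (nat \<Rightarrow>\<^sub>0 'a)" where
  "odd_retraction = (\<lambda>(e, i, j). if i = 0 \<and> j = 0 then Poly_Mapping.single e 1 else 0)"

lemma truncated_Ga_odd: "truncated_polynomials \<iota> p r Ga_odd 2 1 tau_A odd_retraction"
proof
  show "basis (Ga_odd :: (nat, 'k) hopf_superalgebra) = {..<2}" "parity (Ga_odd :: (nat, 'k) hopf_superalgebra) = (\<lambda>n. 1 * n)"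
    "unit_el (Ga_odd :: (nat, 'k) hopf_superalgebra) = Poly_Mapping.single 0 1"
    "counit_tab (Ga_odd :: (nat, 'k) hopf_superalgebra) n = (if n = 0 then 1 else 0)"
    "antipode_tab (Ga_odd :: (nat, 'k) hopf_superalgebra) n = Poly_Mapping.single n ((- 1) ^ n)"
    "mult_tab (Ga_odd :: (nat, 'k) hopf_superalgebra) m n = (if m + n < 2 then Poly_Mapping.single (m + n) 1 else 0)" for m n
    by (simp_all add: Ga_odd_def Ga_odd_superalgebra_def superalgebra.defs Let_def)
  show "comult_tab (Ga_odd :: (nat, 'k) hopf_superalgebra) n = pow (tensor_square Ga_odd)
      (tensor (Poly_Mapping.single 1 1) (unit_el Ga_odd) + tensor (unit_el Ga_odd) (Poly_Mapping.single 1 1)) n" for n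
    by (simp add: Ga_odd_def Ga_odd_superalgebra_def superalgebra.defs Let_def tensor_square_def primitive_comult_def)
  show "tau_A \<in> primitives 1" by (simp add: primitives_def comult_gens)
  show "tau_A \<in> carrier_of (AMs 1)" by (rule AMs_gens_closed)
  have tau2: "pow AM tau_A 2 = 0"
    by (simp add: numeral_2_eq_2 R.pow_Suc R.pow_0 tau_A_def R.mul_singles kappa_M_def op_M_def del: mul_single)
  fix x assume "x \<in> primitives 1"
  then obtain a where x: "x = scal a tau_A" using primitives_odd by (auto simp: bij_betw_def)
  show "pow AM x 2 = 0" by (simp add: x R.pow_scal tau2)
  show "antipode_sign x = - x" by (simp add: x antipode_sign_linear antipode_sign_gens scal_minus_right)
  show "\<exists>y. Poly_Mapping.keys y \<subseteq> {..<2} \<and> x = lin_ext (pow AM tau_A) y"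
    by (rule exI[of _ "Poly_Mapping.single 1 a"]) (simp add: x R.pow_1)
next
  fix n :: nat assume "n < 2"
  then have "n = 0 \<or> n = 1" by linarith
  then show "lin_ext odd_retraction (pow AM tau_A n) = Poly_Mapping.single n 1"
    by (auto simp: R.pow_0 R.pow_1) (simp_all add: tau_A_def odd_retraction_def)
next
  fix n and b :: idx assume "n \<in> Poly_Mapping.keys (odd_retraction b)"
  then show "1 * n = fst b" by (auto simp: odd_retraction_def split: prod.splits if_splits)
qed simp

lemma classification_Ga:
  assumes t: "1 \<le> t"
  shows "bij_betw (precomp \<iota> (Ga p r) (incl_Ga \<iota> p r))
        (Hom \<iota> (Ga p r) (Ga p r)) (Hom \<iota> (M_sub p r t) (Ga p r))"
    and "bij_betw (precomp \<iota> (Ga p r) (incl_M \<iota> p r t))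
        (Hom \<iota> (M_sub p r t) (Ga p r)) (Hom \<iota> (M p r) (Ga p r))"
    and "parametrized_by (Hom \<iota> (M p r) (Ga p r)) (tuples r)
        (\<lambda>a \<phi>. \<phi> (Poly_Mapping.single 1 1) = additive_poly \<iota> p r a)"
proof -
  interpret truncated_polynomials \<iota> p r "Ga p r" "p ^ r" 0 theta_A even_retraction by (rule truncated_Ga)
  have "incl_Ga \<iota> p r = q" by (simp only: incl_Ga_def q_def power_map_def scalar_ext_pow_M scalar_ext_gens)
  then show "bij_betw (precomp \<iota> (Ga p r) (incl_Ga \<iota> p r)) (Hom \<iota> (Ga p r) (Ga p r)) (Hom \<iota> (M_sub p r t) (Ga p r))"
    using bij_precomp_q[OF t] by simp
  show "bij_betw (precomp \<iota> (Ga p r) (incl_M \<iota> p r t)) (Hom \<iota> (M_sub p r t) (Ga p r)) (Hom \<iota> (M p r) (Ga p r))"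
    using Hom_H_AMs t by (intro bij_precomp_incl_M(2)[of _ 1]) blast+
  show "parametrized_by (Hom \<iota> (M p r) (Ga p r)) (tuples r)
      (\<lambda>a \<phi>. \<phi> (Poly_Mapping.single 1 1) = additive_poly \<iota> p r a)"
    by (rule parametrized_H[OF primitives_even])
qed

lemma classification_Ga_odd:
  assumes t: "1 \<le> t"
  shows "bij_betw (precomp \<iota> Ga_odd (incl_Ga_odd \<iota> p r))
        (Hom \<iota> Ga_odd Ga_odd) (Hom \<iota> (M_sub p r t) Ga_odd)"
    and "bij_betw (precomp \<iota> Ga_odd (incl_M \<iota> p r t))
        (Hom \<iota> (M_sub p r t) Ga_odd) (Hom \<iota> (M p r) Ga_odd)"
    and "parametrized_by (Hom \<iota> (M p r) Ga_odd) UNIV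
        (\<lambda>\<mu> \<phi>. \<phi> (Poly_Mapping.single 1 1) = scal \<mu> (tauA \<iota> p r))"
proof -
  interpret truncated_polynomials \<iota> p r Ga_odd 2 1 tau_A odd_retraction by (rule truncated_Ga_odd)
  have "incl_Ga_odd \<iota> p r = q" by (simp only: incl_Ga_odd_def q_def power_map_def scalar_ext_pow_M scalar_ext_gens)
  then show "bij_betw (precomp \<iota> Ga_odd (incl_Ga_odd \<iota> p r)) (Hom \<iota> Ga_odd Ga_odd) (Hom \<iota> (M_sub p r t) Ga_odd)"
    using bij_precomp_q[OF t] by simp
  show "bij_betw (precomp \<iota> Ga_odd (incl_M \<iota> p r t)) (Hom \<iota> (M_sub p r t) Ga_odd) (Hom \<iota> (M p r) Ga_odd)"
    using Hom_H_AMs t by (intro bij_precomp_incl_M(2)[of _ 1]) blast+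
  show "parametrized_by (Hom \<iota> (M p r) Ga_odd) UNIV
      (\<lambda>\<mu> \<phi>. \<phi> (Poly_Mapping.single 1 1) = scal \<mu> (tauA \<iota> p r))"
    unfolding scalar_ext_gens by (rule parametrized_H[OF primitives_odd])
qed

end

theorem proposition2p2p2:
  fixes \<iota> :: "'k::field \<Rightarrow> 'a::{comm_ring,comm_monoid_mult}"
    and p r :: nat
  assumes char_p: "CHAR('k) = p" and p3: "p \<ge> 3" and r1: "r \<ge> 1"
    and algebra: "algebra_map \<iota>"
  shows
    "(\<forall>t\<ge>1.
      bij_betw (precomp \<iota> (M_sub p r 1) (incl_M \<iota> p r 1))
        (Hom \<iota> (M_sub p r 1) (M_sub p r 1)) (Hom \<iota> (M_sub p r t) (M_sub p r 1)) \<and>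
      bij_betw (precomp \<iota> (M_sub p r 1) (incl_M \<iota> p r t))
        (Hom \<iota> (M_sub p r t) (M_sub p r 1)) (Hom \<iota> (M p r) (M_sub p r 1)) \<and>
      parametrized_by (Hom \<iota> (M p r) (M_sub p r 1))
        (UNIV \<times> tuples r)
        (\<lambda>(\<mu>, a) \<phi>. \<phi> (tauA \<iota> p r) = scal \<mu> (tauA \<iota> p r) \<and>
                     \<phi> (thetaA \<iota> p r) = additive_poly \<iota> p r a)) \<and>
     (is_reduced TYPE('a) \<longrightarrow> (\<forall>s t. 2 \<le> s \<and> s \<le> t \<longrightarrow>
      bij_betw (precomp \<iota> (M_sub p r s) (incl_M \<iota> p r s))
        (Hom \<iota> (M_sub p r s) (M_sub p r s)) (Hom \<iota> (M_sub p r t) (M_sub p r s)) \<and>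
      bij_betw (precomp \<iota> (M_sub p r s) (incl_M \<iota> p r t))
        (Hom \<iota> (M_sub p r t) (M_sub p r s)) (Hom \<iota> (M p r) (M_sub p r s)) \<and>
      parametrized_by (Hom \<iota> (M p r) (M_sub p r s))
        {(\<mu>, a, b). a \<in> tuples r \<and> \<mu> ^ 2 = a 0 ^ (p ^ r)}
        (\<lambda>(\<mu>, a, b) \<phi>. \<phi> (tauA \<iota> p r) = scal \<mu> (tauA \<iota> p r) \<and>
                     \<phi> (thetaA \<iota> p r) = additive_poly \<iota> p r a \<and>
                     (\<forall>i<p ^ (s - 1). \<phi> (sigmaA \<iota> p r i) =
                        scal (a 0 ^ (i * p ^ (r - 1))) (sigmaA \<iota> p r i)) \<and>
                     \<phi> (sigmaA \<iota> p r (p ^ (s - 1))) =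
                        scal (a 0 ^ (p ^ (r + s - 2))) (sigmaA \<iota> p r (p ^ (s - 1))) +
                        scal b (sigmaA \<iota> p r 1)))) \<and>
     (r \<ge> 2 \<and> is_reduced TYPE('a) \<longrightarrow> (\<forall>s t. \<forall>\<eta>. 1 \<le> s \<and> s < t \<and> \<eta> \<noteq> 0 \<longrightarrow>
      bij_betw (precomp \<iota> (M_eta p r s \<eta>) (incl_M \<iota> p r (s + 1)))
        (Hom \<iota> (M_sub p r (s + 1)) (M_eta p r s \<eta>)) (Hom \<iota> (M_sub p r t) (M_eta p r s \<eta>)) \<and>
      bij_betw (precomp \<iota> (M_eta p r s \<eta>) (incl_M \<iota> p r t))
        (Hom \<iota> (M_sub p r t) (M_eta p r s \<eta>)) (Hom \<iota> (M p r) (M_eta p r s \<eta>)) \<and>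
      parametrized_by (Hom \<iota> (M p r) (M_eta p r s \<eta>))
        {(\<mu>, a). a \<in> tuples r \<and> \<mu> ^ 2 = a 0 ^ (p ^ r)}
        (\<lambda>(\<mu>, a) \<phi>. \<phi> (tauA \<iota> p r) = scal \<mu> (tauA \<iota> p r) \<and>
                     \<phi> (thetaA \<iota> p r) = additive_poly \<iota> p r a -
                        scal (\<iota> \<eta> * a 0 ^ (p ^ (r + s - 1))) (sigmaA \<iota> p r (p ^ s)) \<and>
                     (\<forall>i<p ^ s. \<phi> (sigmaA \<iota> p r i) =
                        scal (a 0 ^ (i * p ^ (r - 1))) (sigmaA \<iota> p r i))))) \<and>
     (\<forall>t\<ge>1.
      bij_betw (precomp \<iota> (Ga p r) (incl_Ga \<iota> p r))
        (Hom \<iota> (Ga p r) (Ga p r)) (Hom \<iota> (M_sub p r t) (Ga p r)) \<and>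
      bij_betw (precomp \<iota> (Ga p r) (incl_M \<iota> p r t))
        (Hom \<iota> (M_sub p r t) (Ga p r)) (Hom \<iota> (M p r) (Ga p r)) \<and>
      parametrized_by (Hom \<iota> (M p r) (Ga p r))
        (tuples r)
        (\<lambda>a \<phi>. \<phi> (Poly_Mapping.single 1 1) = additive_poly \<iota> p r a)) \<and>
     (\<forall>t\<ge>1.
      bij_betw (precomp \<iota> Ga_odd (incl_Ga_odd \<iota> p r))
        (Hom \<iota> Ga_odd Ga_odd) (Hom \<iota> (M_sub p r t) Ga_odd) \<and>
      bij_betw (precomp \<iota> Ga_odd (incl_M \<iota> p r t))
        (Hom \<iota> (M_sub p r t) Ga_odd) (Hom \<iota> (M p r) Ga_odd) \<and>
      parametrized_by (Hom \<iota> (M p r) Ga_odd)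
        UNIV
        (\<lambda>\<mu> \<phi>. \<phi> (Poly_Mapping.single 1 1) = scal \<mu> (tauA \<iota> p r)))"
proof -
  interpret hopf_M \<iota> p r using assms by unfold_locales
  have eta: "eta_setting \<iota> p r s" if "2 \<le> r" "1 \<le> s" for s
    using that by unfold_locales
  show ?thesis
    apply (intro conjI allI impI; (elim conjE)?)
    subgoal by (rule classification_M_1)
    subgoal by (rule classification_M_1)
    subgoal by (rule classification_M_1(3)[of 1]) simp
    subgoal by (rule classification_M_sub)
    subgoal by (rule classification_M_sub)
    subgoal by (rule classification_M_sub(3))
    subgoal for s t \<eta> by (rule eta_setting.classification_M_eta(1)[OF eta])
    subgoal for s t \<eta> by (rule eta_setting.classification_M_eta(2)[OF eta])
    subgoal for s t \<eta> by (rule eta_setting.classification_M_eta(3)[OF eta])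
    subgoal by (rule classification_Ga)
    subgoal by (rule classification_Ga)
    subgoal by (rule classification_Ga)
    subgoal by (rule classification_Ga_odd)
    subgoal by (rule classification_Ga_odd)
    subgoal by (rule classification_Ga_odd)
    done
qed

end
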